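(* Let $N\geq 2$. For $\mathcal{L}_{4N}$-almost every $\mathcal{A}=(A_1,\dots,A_N)\in\mathfrak{N}^N\cup\mathfrak{O}_N$ the following holds: whenever $(t_1,\dots,t_N)\in(\mathbb{R}^2)^N=\mathbb{R}^{2N}$ is chosen such that the iterated function system $\Phi=\{f_i:x\mapsto A_ix+t_i\}_{i=1}^N$ on $\mathbb{R}^2$ satisfies the strong separation condition, there exists a (Borel probability) measure $\nu^K$ supported on the attractor $\Lambda$ of $\Phi$ such that $$\dim_H\nu^K=\dim_H\Lambda=\dim_B\Lambda=s_0(\mathcal{A}).$$
   Context: $\mathcal{L}_{4N}$ is Lebesgue measure on $(\mathbb{R}^{2\times 2})^N\cong\mathbb{R}^{4N}$. $\|\cdot\|$ is the Euclidean norm on $\mathbb{R}^2$ and the induced operator norm on $2\times2$ matrices. $\mathbb{R}_+^{2\times2}$ (resp. $\mathbb{R}_-^{2\times2}$) is the set of real $2\times 2$ matrices with all entries strictly positive (resp. strictly negative). For $A=\begin{pmatrix}a&b\\c&d\end{pmatrix}$ put $|||A|||=\min\{|a|+|b|,|c|+|d|\}$. Define $$\mathfrak{M}=\Big\{A\in\mathbb{R}_+^{2\times2}\cup\mathbb{R}_-^{2\times2}:0<\frac{|\det A|}{|||A|||^2}<\frac12\ \text{and}\ \|A\|<1\Big\},$$ $$\mathfrak{N}=\{A\in\mathfrak{M}:\|A^{-1}\|\,\|A\|^2\leq1\},\qquad \mathfrak{O}_N=\{\mathcal{A}\in\mathfrak{M}^N:s_0(\mathcal{A})>5/3\}.$$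 Singular values: $\alpha_1(A)\ge\alpha_2(A)$ are the singular values of $A$. Singular value function: $\phi^s(A)=\alpha_1(A)^s$ for $0\le s\le1$, $\phi^s(A)=\alpha_1(A)\alpha_2(A)^{s-1}$ for $1<s\le2$, $\phi^s(A)=(\alpha_1(A)\alpha_2(A))^{s/2}$ for $s>2$. For $\mathcal{A}=(A_1,\dots,A_N)$ non-singular with $\|A_i\|<1$, the subadditive pressure is $$P_{\mathcal{A}}(s)=\lim_{n\to\infty}\frac1n\log\sum_{i_1,\dots,i_n=1}^N\phi^s(A_{i_1}\cdots A_{i_n}),\quad s\ge0;$$ it is continuous and strictly decreasing with a unique root, denoted $s_0(\mathcal{A})$ (the affinity dimension). The attractor $\Lambda$ of $\Phi$ is the unique non-empty compact set with $\Lambda=\bigcup_{i=1}^Nf_i(\Lambda)$. The strong separation condition means $f_i(\Lambda)\cap f_j(\Lambda)=\emptyset$ for all $i\ne j$. $\dim_H$ of a set is Hausdorff dimension; $\dim_B$ is box dimension (the equality includes the assertion that lower and upper box dimensions coincide). For a Borel probability measure $\nu$, $\dim_H\nu=\inf\{\dim_HE:E\text{ Borel},\ \nu(E)=1\}$. *)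

theory Defs
  imports "HOL-Analysis.Analysis" "HOL-Probability.Probability"
begin

text \<open>
  The weight \<open>(diam U)\<^sup>s\<close> with the usual conventions for \<open>s = 0\<close>: the empty set has weight 0 and
  every other set has weight 1. (In the library \<open>0 powr 0 = 0\<close>, so singletons need the case split.)
\<close>

definition diam_weight :: "real \<Rightarrow> 'a::metric_space set \<Rightarrow> ennreal" where
  "diam_weight s U =
     (if U = {} then 0 else if s = 0 then 1 else ennreal (diameter U powr s))"

text \<open>Boundedness is required explicitly because \<open>diameter\<close> is meaningless on unbounded sets.\<close>

definition delta_covers :: "real \<Rightarrow> 'a::metric_space set \<Rightarrow> (nat \<Rightarrow> 'a set) set" where
  "delta_covers \<delta> E =
     {U. E \<subseteq> (\<Union>i. U i) \<and> (\<forall>i. bounded (U i) \<and> diameter (U i) \<le> \<delta>)}"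

definition hausdorff_premeasure :: "real \<Rightarrow> real \<Rightarrow> 'a::metric_space set \<Rightarrow> ennreal" where
  "hausdorff_premeasure \<delta> s E = (INF U\<in>delta_covers \<delta> E. \<Sum>i. diam_weight s (U i))"

definition hausdorff_measure :: "real \<Rightarrow> 'a::metric_space set \<Rightarrow> ennreal" where
  "hausdorff_measure s E = (SUP \<delta>\<in>{0<..}. hausdorff_premeasure \<delta> s E)"

definition hausdorff_dim :: "'a::metric_space set \<Rightarrow> ereal" where
  "hausdorff_dim E = Inf {ereal s | s. 0 \<le> s \<and> hausdorff_measure s E = 0}"

text \<open>Intended for Borel probability measures.\<close>

definition hausdorff_dim_measure :: "'a::metric_space measure \<Rightarrow> ereal" where
  "hausdorff_dim_measure \<nu> = Inf {hausdorff_dim E | E. E \<in> sets borel \<and> emeasure \<nu> E = 1}"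

text \<open>
  The least number of sets of diameter at most \<open>\<delta>\<close> needed to cover \<open>E\<close>. Only meaningful for
  totally bounded \<open>E\<close>; otherwise the infimum is over the empty set and equals 0.
\<close>

definition covering_number :: "real \<Rightarrow> 'a::metric_space set \<Rightarrow> nat" where
  "covering_number \<delta> E =
     Inf {card C | C. finite C \<and> E \<subseteq> \<Union>C \<and> (\<forall>U\<in>C. bounded U \<and> diameter U \<le> \<delta>)}"

definition lower_box_dim :: "'a::metric_space set \<Rightarrow> ereal" where
  "lower_box_dim E =
     Liminf (at_right 0) (\<lambda>\<delta>. ereal (ln (real (covering_number \<delta> E)) / (- ln \<delta>)))"

definition upper_box_dim :: "'a::metric_space set \<Rightarrow> ereal" where
  "upper_box_dim E =
     Limsup (at_right 0) (\<lambda>\<delta>. ereal (ln (real (covering_number \<delta> E)) / (- ln \<delta>)))"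

definition has_box_dim :: "'a::metric_space set \<Rightarrow> ereal \<Rightarrow> bool" where
  "has_box_dim E d \<longleftrightarrow> lower_box_dim E = d \<and> upper_box_dim E = d"

definition op_norm :: "real^2^2 \<Rightarrow> real" where
  "op_norm A = onorm ((*v) A)"

definition singular_values :: "real^2^2 \<Rightarrow> real set" where
  "singular_values A =
     {\<sigma>. 0 \<le> \<sigma> \<and> (\<exists>v. v \<noteq> 0 \<and> (transpose A ** A) *v v = \<sigma>\<^sup>2 *\<^sub>R v)}"

text \<open>
  A \<open>2 \<times> 2\<close> matrix has exactly two singular values counted with multiplicity, so the larger and
  the smaller one are the maximum and the minimum of the set (which coincide iff it is a singleton).
\<close>

definition sv1 :: "real^2^2 \<Rightarrow> real" where
  "sv1 A = Max (singular_values A)"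

definition sv2 :: "real^2^2 \<Rightarrow> real" where
  "sv2 A = Min (singular_values A)"

text \<open>Intended for \<open>s \<ge> 0\<close> and non-singular \<open>A\<close>, where all bases of \<open>powr\<close> are positive.\<close>

definition svf :: "real \<Rightarrow> real^2^2 \<Rightarrow> real" where
  "svf s A =
     (if s \<le> 1 then sv1 A powr s
      else if s \<le> 2 then sv1 A * sv2 A powr (s - 1)
      else (sv1 A * sv2 A) powr (s / 2))"

text \<open>
  A tuple \<open>(A\<^sub>1, \<dots>, A\<^sub>N)\<close> is an element of \<open>real^2^2^'n\<close> with \<open>N = CARD('n)\<close>; words over the
  alphabet are lists over \<open>'n\<close>, and \<open>word_product A [i\<^sub>1, \<dots>, i\<^sub>n] = A\<^sub>i\<^sub>1 \<cdots> A\<^sub>i\<^sub>n\<close>.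
\<close>

definition word_product :: "real^2^2^'n::finite \<Rightarrow> 'n list \<Rightarrow> real^2^2" where
  "word_product A w = foldr (\<lambda>i B. A $ i ** B) w (mat 1)"

definition pressure :: "real^2^2^'n::finite \<Rightarrow> real \<Rightarrow> real" where
  "pressure A s =
     lim (\<lambda>n. 1 / real n * ln (\<Sum>w\<in>{w :: 'n list. length w = n}. svf s (word_product A w)))"

definition affinity_dim :: "real^2^2^'n::finite \<Rightarrow> real" where
  "affinity_dim A = (THE s. 0 \<le> s \<and> pressure A s = 0)"

definition pos_matrices :: "(real^2^2) set" where
  "pos_matrices = {A. \<forall>i j. 0 < A $ i $ j}"

definition neg_matrices :: "(real^2^2) set" where
  "neg_matrices = {A. \<forall>i j. A $ i $ j < 0}"

definition min_row_sum :: "real^2^2 \<Rightarrow> real" where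
  "min_row_sum A = min (\<bar>A $ 1 $ 1\<bar> + \<bar>A $ 1 $ 2\<bar>) (\<bar>A $ 2 $ 1\<bar> + \<bar>A $ 2 $ 2\<bar>)"

definition set_M :: "(real^2^2) set" where
  "set_M = {A \<in> pos_matrices \<union> neg_matrices.
     0 < \<bar>det A\<bar> / (min_row_sum A)\<^sup>2 \<and> \<bar>det A\<bar> / (min_row_sum A)\<^sup>2 < 1 / 2 \<and> op_norm A < 1}"

definition set_N :: "(real^2^2) set" where
  "set_N = {A \<in> set_M. op_norm (matrix_inv A) * (op_norm A)\<^sup>2 \<le> 1}"

definition tuples :: "(real^2^2) set \<Rightarrow> (real^2^2^'n::finite) set" where
  "tuples S = {A. \<forall>i. A $ i \<in> S}"

definition set_O :: "(real^2^2^'n::finite) set" where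
  "set_O = {A \<in> tuples set_M. affinity_dim A > 5 / 3}"

definition affine_ifs :: "real^2^2^'n::finite \<Rightarrow> real^2^'n \<Rightarrow> 'n \<Rightarrow> real^2 \<Rightarrow> real^2" where
  "affine_ifs A t i x = A $ i *v x + t $ i"

definition attractor :: "('n \<Rightarrow> 'a::topological_space \<Rightarrow> 'a) \<Rightarrow> 'a set" where
  "attractor f = (THE K. K \<noteq> {} \<and> compact K \<and> K = (\<Union>i. f i ` K))"

definition strong_separation :: "('n \<Rightarrow> 'a::topological_space \<Rightarrow> 'a) \<Rightarrow> bool" where
  "strong_separation f \<longleftrightarrow>
     (\<forall>i j. i \<noteq> j \<longrightarrow> f i ` attractor f \<inter> f j ` attractor f = {})"

text \<open>For closed \<open>K\<close>, full measure of \<open>K\<close> is the same as the topological support lying in \<open>K\<close>.\<close>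

definition borel_prob_on :: "'a::topological_space set \<Rightarrow> 'a measure \<Rightarrow> bool" where
  "borel_prob_on K \<nu> \<longleftrightarrow> prob_space \<nu> \<and> sets \<nu> = sets borel \<and> emeasure \<nu> K = 1"

end

theory Submission imports Defs begin

text \<open>
  The upper bound is the usual covering argument: cut the attractor into the cylinders whose smaller
  singular value (or, below dimension 1, whose larger one) is about \<open>\<delta>\<close>.

  For the lower bound fix \<open>s\<close> below the affinity dimension and sort the words of a large length by
  their singular values. By the pigeonhole principle some class \<open>\<Gamma>\<close>, with singular values about
  \<open>\<alpha>\<close> and \<open>\<beta>\<close>, satisfies \<open>card \<Gamma> * \<phi>\<^sup>s(\<alpha>, \<beta>) \<ge> 1\<close>. The first rows of the products over
  words in \<open>\<Gamma>\<^sup>m\<close>, as directions, are iterates of projective maps which contract by a factor below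
  \<open>1/2\<close>, since \<open>\<bar>det A\<bar> < 1/2 * (min_row_sum A)\<^sup>2\<close>. This yields transversality under
  perturbation of the matrices, so for almost every tuple half of the words in \<open>\<Gamma>\<^sup>m\<close> have directions
  that are as well separated as their number permits.

  The self-affine measure \<open>\<nu>\<close> of the subsystem given by these words is studied through its
  correlations \<open>\<phi>(r) = (\<nu> \<times> \<nu>) {(x, y). dist x y \<le> r}\<close>. On the scale \<open>\<beta>\<^sup>k\<close> they are
  controlled by the average, over the directions of level \<open>k\<close>, of the measure of a strip of width
  \<open>(\<beta> / \<alpha>)\<^sup>k\<close>. Since the directions satisfy a Frostman condition of exponent \<open>d\<close>, a bound
  \<open>\<phi>(r) \<le> C * r powr D\<close> with \<open>D < d\<close> carries over to the average (Kaufman's argument), and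
  for \<open>d + D > 2\<close> a Fourier estimate with Gaussian test functions makes the average linear in the
  width. In \<open>\<NN>\<close> the inequality \<open>\<alpha>\<^sup>2 \<le> \<beta>\<close> makes \<open>d\<close> so large that Kaufman's argument alone reaches
  every exponent below \<open>s\<close>; in \<open>\<OO>\<^sub>N\<close> the assumption \<open>s > 5/3\<close> is what the Fourier estimate needs after
  one Kaufman step. Mixing the measures obtained for \<open>s\<close> tending to the affinity dimension gives
  a single measure of full dimension.
\<close>

section \<open>Singular values and projective action of 2 by 2 matrices\<close>

text \<open>The null set must be chosen before the translations. Transversality therefore concerns
  the linear parts alone, and strong separation enters only through one fact: points closer than
  about \<open>q ^ k\<close> share a cylinder of level \<open>k\<close>, and undoing the cylinder
  map leaves a strip normal to the first row of a matrix product. Words with nearly equal singular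
  values make one pair of scales serve a whole level.

  With M \<approx> 1/\<phi>^s(\<alpha>,\<beta>) directions to be separated at resolution
  \<beta>/\<alpha>, the exponent d can be taken close to min(1, log M / log(\<alpha>/\<beta>)). If
  \<alpha>^2 \<le> \<beta>, this is at least min(1, s), the correlations bootstrap to an exponent D
  near min(1, s), and a Kaufman step, which for s > 1 raises D to at least s - 1 + D, reaches s.
  Without \<alpha>^2 \<le> \<beta>, and for 1 < s \<le> 2, only d near s - 1 is guaranteed.
  Bootstrapping gives D near s - 1, the Kaufman step 2(s - 1), and the Fourier estimate asks for d +
  D > 2, that is 3(s - 1) > 2: hence 5/3.\<close>

lemma matrix_mul_entry: "((A::real^2^2) ** B) $ i $ j = A$i$1 * B$1$j + A$i$2 * B$2$j"
  by (simp add: matrix_matrix_mult_def sum_2)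

lemma matrix_vec_entry: "((A::real^2^2) *v z) $ i = A$i$1 * z$1 + A$i$2 * z$2"
  by (simp add: matrix_vector_mult_def sum_2)

lemma vec2_eq_iff: "(x::'a^2) = y \<longleftrightarrow> x$1 = y$1 \<and> x$2 = y$2"
  by (simp add: vec_eq_iff forall_2)

lemma norm_vec2_sq: "(norm (z::real^2))\<^sup>2 = (z$1)\<^sup>2 + (z$2)\<^sup>2"
  by (simp add: norm_vec_def L2_set_def sum_2)

lemma vec2_zero_iff: "(z::real^2) = 0 \<longleftrightarrow> z$1 = 0 \<and> z$2 = 0"
  by (simp add: vec2_eq_iff)

text \<open>The squared Frobenius norm, which is the trace of the Gram matrix; together with the
  determinant it fixes both singular values.\<close>

definition frob2 :: "real^2^2 \<Rightarrow> real" where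
  "frob2 A = (A$1$1)\<^sup>2 + (A$1$2)\<^sup>2 + (A$2$1)\<^sup>2 + (A$2$2)\<^sup>2"

lemma frob2_plus_det: "frob2 A + 2 * det A = (A$1$1 + A$2$2)\<^sup>2 + (A$1$2 - A$2$1)\<^sup>2"
  and frob2_minus_det: "frob2 A - 2 * det A = (A$1$1 - A$2$2)\<^sup>2 + (A$1$2 + A$2$1)\<^sup>2"
  by (simp_all add: frob2_def det_2 power2_eq_square algebra_simps)

text \<open>The square roots of frob2 A + 2 det A and frob2 A - 2 det A have to be u + v and u - v,
  in an order decided by the sign of det A; both radicands are sums of two squares.\<close>

lemma singular_pair_exists:
  "\<exists>u v. 0 \<le> v \<and> v \<le> u \<and> u\<^sup>2 + v\<^sup>2 = frob2 A \<and> u * v = \<bar>det A\<bar>"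
proof -
  define p where "p = sqrt (frob2 A + 2 * det A)"
  define m where "m = sqrt (frob2 A - 2 * det A)"
  have p: "p \<ge> 0" "p\<^sup>2 = frob2 A + 2 * det A" unfolding p_def frob2_plus_det by auto
  have m: "m \<ge> 0" "m\<^sup>2 = frob2 A - 2 * det A" unfolding m_def frob2_minus_det by auto
  have pm: "(p + m) * (p - m) = 4 * det A"
    using p m by (simp add: power2_eq_square algebra_simps)
  have prod: "((p + m)/2) * (\<bar>p - m\<bar>/2) = \<bar>det A\<bar>"
  proof -
    have "((p + m)/2) * (\<bar>p - m\<bar>/2) = \<bar>(p + m) * (p - m)\<bar> / 4"
      using p m by (simp add: abs_mult)
    then show ?thesis by (simp add: pm)
  qed
  have sq: "((p + m)/2)\<^sup>2 + (\<bar>p - m\<bar>/2)\<^sup>2 = frob2 A"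
    using p m by (simp add: power_divide power2_eq_square field_simps)
  show ?thesis
    by (rule exI[of _ "(p+m)/2"], rule exI[of _ "\<bar>p-m\<bar>/2"]) (use sq prod p m in auto)
qed

lemma eigen_2x2_iff:
  fixes x y z l :: real
  shows "(\<exists>v::real^2. v \<noteq> 0 \<and> x * v$1 + y * v$2 = l * v$1 \<and> y * v$1 + z * v$2 = l * v$2)
     \<longleftrightarrow> (x - l) * (z - l) = y\<^sup>2" (is "?L \<longleftrightarrow> ?R")
proof
  assume ?L
  then obtain v :: "real^2" where v: "v \<noteq> 0" "(x - l) * v$1 = - y * v$2" "(z - l) * v$2 = - y * v$1"
    by (auto simp: algebra_simps)
  have "((x - l) * (z - l) - y\<^sup>2) * v$1 = (z - l) * ((x - l) * v$1) - y * (y * v$1)"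
    by (simp add: power2_eq_square algebra_simps)
  also have "\<dots> = - y * ((z - l) * v$2) - y * (y * v$1)" unfolding v(2) by simp
  also have "\<dots> = 0" unfolding v(3) by simp
  finally have 1: "((x - l) * (z - l) - y\<^sup>2) * v$1 = 0" .
  have "((x - l) * (z - l) - y\<^sup>2) * v$2 = (x - l) * ((z - l) * v$2) - y * (y * v$2)"
    by (simp add: power2_eq_square algebra_simps)
  also have "\<dots> = - y * ((x - l) * v$1) - y * (y * v$2)" unfolding v(3) by simp
  also have "\<dots> = 0" unfolding v(2) by simp
  finally have 2: "((x - l) * (z - l) - y\<^sup>2) * v$2 = 0" .
  from 1 2 v(1) show ?R by (auto simp: vec2_zero_iff)
next
  assume R: ?R
  show ?L
  proof (cases "y = 0 \<and> x = l")
    case True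
    then show ?thesis by (intro exI[of _ "vector [1,0]"]) (simp add: vec2_zero_iff)
  next
    case False
    then show ?thesis using R
      by (intro exI[of _ "vector [y, l - x]"]) (auto simp: vec2_zero_iff algebra_simps power2_eq_square)
  qed
qed

lemma gram_entries:
  fixes A :: "real^2^2"
  shows "(transpose A ** A) $ 1 $ 1 = (A$1$1)\<^sup>2 + (A$2$1)\<^sup>2"
    "(transpose A ** A) $ 1 $ 2 = A$1$1 * A$1$2 + A$2$1 * A$2$2"
    "(transpose A ** A) $ 2 $ 1 = A$1$1 * A$1$2 + A$2$1 * A$2$2"
    "(transpose A ** A) $ 2 $ 2 = (A$1$2)\<^sup>2 + (A$2$2)\<^sup>2"
  by (simp_all add: matrix_mul_entry transpose_def power2_eq_square algebra_simps)

text \<open>The polynomial is the characteristic polynomial of the Gram matrix at \<sigma>^2: its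
  trace is \<open>frob2 A\<close> and its determinant is (det A)^2.\<close>

lemma singular_values_iff:
  "\<sigma> \<in> singular_values A \<longleftrightarrow> 0 \<le> \<sigma> \<and> (\<sigma>\<^sup>2)\<^sup>2 - frob2 A * \<sigma>\<^sup>2 + (det A)\<^sup>2 = 0"
proof -
  let ?x = "(A$1$1)\<^sup>2 + (A$2$1)\<^sup>2" and ?y = "A$1$1 * A$1$2 + A$2$1 * A$2$2" and ?z = "(A$1$2)\<^sup>2 + (A$2$2)\<^sup>2"
  have "(\<exists>v. v \<noteq> 0 \<and> (transpose A ** A) *v v = \<sigma>\<^sup>2 *\<^sub>R v) \<longleftrightarrow> (?x - \<sigma>\<^sup>2) * (?z - \<sigma>\<^sup>2) = ?y\<^sup>2"
    unfolding eigen_2x2_iff[symmetric]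
    by (simp add: vec2_eq_iff[of "_ *v _"] matrix_vec_entry gram_entries)
  also have "\<dots> \<longleftrightarrow> (\<sigma>\<^sup>2)\<^sup>2 - frob2 A * \<sigma>\<^sup>2 + (det A)\<^sup>2 = 0"
    by (auto simp: frob2_def det_2 power2_eq_square algebra_simps)
  finally show ?thesis by (simp add: singular_values_def)
qed

lemma singular_values_eq:
  assumes "0 \<le> v" "v \<le> u" "u\<^sup>2 + v\<^sup>2 = frob2 A" "u * v = \<bar>det A\<bar>"
  shows "singular_values A = {u, v}"
proof -
  have d: "(det A)\<^sup>2 = u\<^sup>2 * v\<^sup>2" using assms(4) by (metis power2_abs power_mult_distrib)
  have "(s\<^sup>2)\<^sup>2 - frob2 A * s\<^sup>2 + (det A)\<^sup>2 = (s\<^sup>2 - u\<^sup>2) * (s\<^sup>2 - v\<^sup>2)" for s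
    unfolding d assms(3)[symmetric] by (simp add: algebra_simps power2_eq_square)
  then show ?thesis
    using assms by (auto simp: singular_values_iff)
qed

lemma sv_basic:
  shows sv2_nonneg: "0 \<le> sv2 A" and sv2_le_sv1: "sv2 A \<le> sv1 A"
    and sv_sq_sum: "(sv1 A)\<^sup>2 + (sv2 A)\<^sup>2 = frob2 A" and sv_prod: "sv1 A * sv2 A = \<bar>det A\<bar>"
proof -
  obtain u v where uv: "0 \<le> v" "v \<le> u" "u\<^sup>2 + v\<^sup>2 = frob2 A" "u * v = \<bar>det A\<bar>"
    using singular_pair_exists by blast
  have "singular_values A = {u, v}" by (rule singular_values_eq[OF uv])
  then have "sv1 A = u" "sv2 A = v" using uv by (auto simp: sv1_def sv2_def)
  then show "0 \<le> sv2 A" "sv2 A \<le> sv1 A" "(sv1 A)\<^sup>2 + (sv2 A)\<^sup>2 = frob2 A" "sv1 A * sv2 A = \<bar>det A\<bar>"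
    using uv by auto
qed

lemma sv1_nonneg: "0 \<le> sv1 A" using sv2_nonneg sv2_le_sv1 order_trans by blast

lemma sv_in_singular_values: "sv1 A \<in> singular_values A" "sv2 A \<in> singular_values A"
  using singular_values_eq[OF sv2_nonneg sv2_le_sv1 sv_sq_sum sv_prod] by auto

lemma psd_2x2:
  fixes P y R u v :: real
  assumes "P \<ge> 0" "R \<ge> 0" "P * R = y\<^sup>2"
  shows "0 \<le> P * u\<^sup>2 - 2 * y * u * v + R * v\<^sup>2"
proof (cases "P = 0")
  case True
  then show ?thesis using assms by auto
next
  case False
  have "P * (P * u\<^sup>2 - 2 * y * u * v + R * v\<^sup>2) = (P * u)\<^sup>2 - 2 * (P * u) * (y * v) + (P * R) * v\<^sup>2"
    by (simp add: power2_eq_square algebra_simps)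
  also have "\<dots> = (P * u - y * v)\<^sup>2" unfolding assms(3) by (simp add: power2_eq_square algebra_simps)
  finally show ?thesis using False assms(1) by (metis zero_le_mult_iff zero_le_power2 less_le not_le)
qed

lemma norm_matrix_vec_sq:
  "(norm ((A::real^2^2) *v z))\<^sup>2 = ((A$1$1)\<^sup>2 + (A$2$1)\<^sup>2) * (z$1)\<^sup>2
     + 2 * (A$1$1 * A$1$2 + A$2$1 * A$2$2) * z$1 * z$2 + ((A$1$2)\<^sup>2 + (A$2$2)\<^sup>2) * (z$2)\<^sup>2"
  unfolding norm_vec2_sq matrix_vec_entry by (simp add: power2_eq_square algebra_simps)

lemma nonneg_if_sum_prod: "\<lbrakk>(P::real) + R \<ge> 0; P * R \<ge> 0\<rbrakk> \<Longrightarrow> P \<ge> 0 \<and> R \<ge> 0"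
  by (smt (verit) mult_neg_pos mult_pos_neg mult_neg_neg mult_nonneg_nonpos mult_nonneg_nonpos2 zero_le_mult_iff)

text \<open>The quadratic forms sv1^2 |z|^2 - |Az|^2 and |Az|^2 - sv2^2 |z|^2 are degenerate,
  because the squared singular values are eigenvalues, and both have trace sv1^2 - sv2^2 \<ge> 0;
  hence they are positive semidefinite.\<close>

lemma norm_matrix_vec_bounds:
  fixes A :: "real^2^2"
  shows norm_le_sv1: "norm (A *v z) \<le> sv1 A * norm z"
    and norm_ge_sv2: "sv2 A * norm z \<le> norm (A *v z)"
proof -
  let ?x = "(A$1$1)\<^sup>2 + (A$2$1)\<^sup>2" and ?y = "A$1$1 * A$1$2 + A$2$1 * A$2$2" and ?z = "(A$1$2)\<^sup>2 + (A$2$2)\<^sup>2"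
  have xz: "?x + ?z = (sv1 A)\<^sup>2 + (sv2 A)\<^sup>2" by (simp add: sv_sq_sum frob2_def)
  have eq: "(?x - s\<^sup>2) * (?z - s\<^sup>2) = ?y\<^sup>2" if "s \<in> singular_values A" for s
    using that unfolding singular_values_iff
    by (simp add: frob2_def det_2 power2_eq_square algebra_simps)
  have le: "(sv2 A)\<^sup>2 \<le> (sv1 A)\<^sup>2" using sv2_nonneg sv2_le_sv1 by (intro power_mono)
  have "((sv1 A)\<^sup>2 - ?x) * ((sv1 A)\<^sup>2 - ?z) = ?y\<^sup>2"
    using eq[OF sv_in_singular_values(1)] by (simp add: algebra_simps)
  moreover from this have "(sv1 A)\<^sup>2 - ?x \<ge> 0 \<and> (sv1 A)\<^sup>2 - ?z \<ge> 0"
    by (intro nonneg_if_sum_prod) (use xz le in auto)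
  ultimately have "0 \<le> ((sv1 A)\<^sup>2 - ?x) * (z$1)\<^sup>2 - 2 * ?y * z$1 * z$2 + ((sv1 A)\<^sup>2 - ?z) * (z$2)\<^sup>2"
    by (intro psd_2x2) auto
  then have "(norm (A *v z))\<^sup>2 \<le> (sv1 A * norm z)\<^sup>2"
    unfolding norm_matrix_vec_sq power_mult_distrib norm_vec2_sq[of z] by (simp add: algebra_simps)
  then show "norm (A *v z) \<le> sv1 A * norm z"
    by (rule power2_le_imp_le) (simp add: sv1_nonneg)
  have 2: "(?x - (sv2 A)\<^sup>2) * (?z - (sv2 A)\<^sup>2) = (-?y)\<^sup>2"
    using eq[OF sv_in_singular_values(2)] unfolding power2_minus .
  moreover from this have "?x - (sv2 A)\<^sup>2 \<ge> 0 \<and> ?z - (sv2 A)\<^sup>2 \<ge> 0"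
    by (intro nonneg_if_sum_prod) (use xz le in auto)
  ultimately have "0 \<le> (?x - (sv2 A)\<^sup>2) * (z$1)\<^sup>2 - 2 * (-?y) * z$1 * z$2 + (?z - (sv2 A)\<^sup>2) * (z$2)\<^sup>2"
    by (intro psd_2x2) auto
  then have "(sv2 A * norm z)\<^sup>2 \<le> (norm (A *v z))\<^sup>2"
    unfolding norm_matrix_vec_sq power_mult_distrib norm_vec2_sq[of z] by (simp add: algebra_simps)
  then show "sv2 A * norm z \<le> norm (A *v z)"
    by (rule power2_le_imp_le) simp
qed

lemma singular_vector:
  assumes "\<sigma> \<in> singular_values A"
  obtains v where "v \<noteq> 0" "norm (A *v v) = \<sigma> * norm v"
proof -
  obtain v where v: "v \<noteq> 0" "(transpose A ** A) *v v = \<sigma>\<^sup>2 *\<^sub>R v" and "0 \<le> \<sigma>"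
    using assms by (auto simp: singular_values_def)
  have "(norm (A *v v))\<^sup>2 = (A *v v) \<bullet> (A *v v)" by (simp add: power2_norm_eq_inner)
  also have "\<dots> = v \<bullet> ((transpose A ** A) *v v)"
    by (metis dot_lmul_matrix matrix_vector_mul_assoc vector_transpose_matrix inner_commute)
  also have "\<dots> = \<sigma>\<^sup>2 * (norm v)\<^sup>2" by (simp add: v power2_norm_eq_inner)
  also have "\<dots> = (\<sigma> * norm v)\<^sup>2" by (simp add: power_mult_distrib)
  finally have "norm (A *v v) = \<sigma> * norm v"
    using \<open>0 \<le> \<sigma>\<close> by (simp add: power2_eq_iff_nonneg)
  with v(1) show thesis by (rule that)
qed

lemma op_norm_eq_sv1: "op_norm A = sv1 A"
proof (rule antisym)
  show "op_norm A \<le> sv1 A" unfolding op_norm_def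
    by (rule onorm_bound) (use norm_le_sv1 sv1_nonneg in auto)
  obtain v where v: "v \<noteq> 0" "norm (A *v v) = sv1 A * norm v"
    using singular_vector[OF sv_in_singular_values(1)] .
  have "norm (A *v v) \<le> op_norm A * norm v" unfolding op_norm_def
    by (rule onorm) (simp add: matrix_vector_mul_bounded_linear)
  with v show "sv1 A \<le> op_norm A" by simp
qed

lemma sv1_le_if: "(\<And>z. norm ((A::real^2^2) *v z) \<le> c * norm z) \<Longrightarrow> sv1 A \<le> c"
  by (metis singular_vector sv_in_singular_values(1) mult_le_cancel_right norm_le_zero_iff not_le zero_less_norm_iff)

lemma sv2_ge_if: "(\<And>z. c * norm z \<le> norm ((A::real^2^2) *v z)) \<Longrightarrow> c \<le> sv2 A"
  by (metis singular_vector sv_in_singular_values(2) mult_le_cancel_right norm_le_zero_iff not_le zero_less_norm_iff)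

lemma sv1_mult: "sv1 (A ** B) \<le> sv1 A * sv1 B"
proof (rule sv1_le_if)
  fix z
  have "norm ((A ** B) *v z) \<le> sv1 A * norm (B *v z)"
    by (metis matrix_vector_mul_assoc norm_le_sv1)
  also have "\<dots> \<le> sv1 A * (sv1 B * norm z)" by (intro mult_left_mono norm_le_sv1 sv1_nonneg)
  finally show "norm ((A ** B) *v z) \<le> sv1 A * sv1 B * norm z" by (simp add: mult.assoc)
qed

lemma sv2_mult: "sv2 A * sv2 B \<le> sv2 (A ** B)"
proof (rule sv2_ge_if)
  fix z
  have "sv2 A * (sv2 B * norm z) \<le> sv2 A * norm (B *v z)" by (intro mult_left_mono norm_ge_sv2 sv2_nonneg)
  also have "\<dots> \<le> norm ((A ** B) *v z)"
    by (metis matrix_vector_mul_assoc norm_ge_sv2)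
  finally show "sv2 A * sv2 B * norm z \<le> norm ((A ** B) *v z)" by (simp add: mult.assoc)
qed

lemma sv_mat1: "sv1 (mat 1) = 1" "sv2 (mat 1) = 1"
proof -
  have "1 \<le> sv2 (mat 1)" by (rule sv2_ge_if) simp
  moreover have "sv1 (mat 1) \<le> 1" by (rule sv1_le_if) simp
  ultimately show "sv1 (mat 1) = 1" "sv2 (mat 1) = 1" using sv2_le_sv1[of "mat 1"] by auto
qed

lemma sv2_pos: "det A \<noteq> 0 \<Longrightarrow> 0 < sv2 A"
  using sv_prod[of A] sv2_nonneg[of A] by (metis abs_eq_0 less_eq_real_def mult_zero_right)

lemma sv1_pos: "det A \<noteq> 0 \<Longrightarrow> 0 < sv1 A"
  using sv2_pos sv2_le_sv1 less_le_trans by blast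

lemma row_sum_le_sv1: "\<bar>A$i$1\<bar> + \<bar>A$i$2\<bar> \<le> 2 * sv1 A"
proof -
  have "\<bar>(A *v axis j 1) $ i\<bar> \<le> sv1 A" for j
    using component_le_norm_cart[of "A *v axis j 1" i] norm_le_sv1[of A "axis j 1"] by (simp add: norm_axis_1)
  from this[of 1] this[of 2] show ?thesis by (simp add: matrix_vec_entry axis_def)
qed

lemma sv1_le_row_sums: "sv1 A \<le> (\<bar>A$1$1\<bar> + \<bar>A$1$2\<bar>) + (\<bar>A$2$1\<bar> + \<bar>A$2$2\<bar>)"
proof (rule power2_le_imp_le)
  have "(sv1 A)\<^sup>2 \<le> frob2 A" using sv_sq_sum[of A] by (metis le_add_same_cancel1 zero_le_power2)
  also have "\<dots> \<le> ((\<bar>A$1$1\<bar> + \<bar>A$1$2\<bar>) + (\<bar>A$2$1\<bar> + \<bar>A$2$2\<bar>))\<^sup>2"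
    by (simp add: frob2_def power2_eq_square algebra_simps)
  finally show "(sv1 A)\<^sup>2 \<le> ((\<bar>A$1$1\<bar> + \<bar>A$1$2\<bar>) + (\<bar>A$2$1\<bar> + \<bar>A$2$2\<bar>))\<^sup>2" .
qed simp


section \<open>Matrices with entries of one sign: row sums and the action on directions\<close>

definition psgn :: "(real^2^2) set" where "psgn = pos_matrices \<union> neg_matrices"

definition rsum :: "real^2^2 \<Rightarrow> 2 \<Rightarrow> real" where "rsum A i = \<bar>A$i$1\<bar> + \<bar>A$i$2\<bar>"

definition max_row_sum :: "real^2^2 \<Rightarrow> real" where "max_row_sum A = max (rsum A 1) (rsum A 2)"

lemma min_row_sum_rsum: "min_row_sum A = min (rsum A 1) (rsum A 2)"
  by (simp add: min_row_sum_def rsum_def)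

lemma psgn_iff: "A \<in> psgn \<longleftrightarrow> (0 < A$1$1 \<and> 0 < A$1$2 \<and> 0 < A$2$1 \<and> 0 < A$2$2)
    \<or> (A$1$1 < 0 \<and> A$1$2 < 0 \<and> A$2$1 < 0 \<and> A$2$2 < 0)"
  by (auto simp: psgn_def pos_matrices_def neg_matrices_def forall_2)

lemma psgn_mult: "A \<in> psgn \<Longrightarrow> B \<in> psgn \<Longrightarrow> A ** B \<in> psgn"
  unfolding psgn_iff matrix_mul_entry
  by (auto simp: add_pos_pos mult_neg_neg add_neg_neg mult_pos_neg mult_neg_pos)

lemma psgn_nonzero: "A \<in> psgn \<Longrightarrow> A$i$j \<noteq> 0"
  by (auto simp: psgn_def pos_matrices_def neg_matrices_def) (metis less_irrefl)+

lemma rsum_psgn: "A \<in> psgn \<Longrightarrow> rsum A i = \<bar>A$i$1 + A$i$2\<bar>"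
  using exhaust_2[of i] by (auto simp: psgn_iff rsum_def)

lemma rsum_pos: "A \<in> psgn \<Longrightarrow> 0 < rsum A i"
  using psgn_nonzero by (simp add: rsum_def add_pos_pos)

lemma min_row_sum_pos: "A \<in> psgn \<Longrightarrow> 0 < min_row_sum A"
  by (simp add: min_row_sum_rsum rsum_pos)

lemma min_row_sum_le: "min_row_sum A \<le> rsum A i" and rsum_le_max: "rsum A i \<le> max_row_sum A"
  using exhaust_2[of i] by (auto simp: min_row_sum_rsum max_row_sum_def)

lemma max_row_sum_pos: "A \<in> psgn \<Longrightarrow> 0 < max_row_sum A"
  using rsum_le_max rsum_pos less_le_trans by blast

lemma rsum_mult:
  assumes "A \<in> psgn" "B \<in> psgn"
  shows "rsum (A ** B) i = \<bar>A$i$1\<bar> * rsum B 1 + \<bar>A$i$2\<bar> * rsum B 2"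
proof -
  have "rsum (A ** B) i = \<bar>A$i$1 * (B$1$1 + B$1$2) + A$i$2 * (B$2$1 + B$2$2)\<bar>"
    unfolding rsum_psgn[OF psgn_mult[OF assms]] matrix_mul_entry by (simp add: algebra_simps)
  also have "\<dots> = \<bar>A$i$1\<bar> * \<bar>B$1$1 + B$1$2\<bar> + \<bar>A$i$2\<bar> * \<bar>B$2$1 + B$2$2\<bar>"
  proof -
    have *: "\<bar>a * x + b * y\<bar> = \<bar>a\<bar> * \<bar>x\<bar> + \<bar>b\<bar> * \<bar>y\<bar>"
      if "(0 < a \<and> 0 < b) \<or> (a < 0 \<and> b < 0)" "(0 < x \<and> 0 < y) \<or> (x < 0 \<and> y < 0)" for a b x y :: real
    proof -
      have "0 \<le> a * x \<and> 0 \<le> b * y \<or> a * x \<le> 0 \<and> b * y \<le> 0"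
        using that by (auto simp: zero_le_mult_iff mult_le_0_iff)
      then have "\<bar>a * x + b * y\<bar> = \<bar>a * x\<bar> + \<bar>b * y\<bar>" by linarith
      then show ?thesis by (simp add: abs_mult)
    qed
    show ?thesis by (rule *) (use assms exhaust_2[of i] in \<open>auto simp: psgn_iff\<close>)
  qed
  finally show ?thesis by (simp add: rsum_psgn assms)
qed

text \<open>Entries of one sign never cancel in a product. Row sums thus behave
  supermultiplicatively, which supplies the lower bounds that norms, being submultiplicative, cannot
  give.\<close>

lemma rsum_mult_ge:
  assumes "A \<in> psgn" "B \<in> psgn"
  shows "rsum A i * min_row_sum B \<le> rsum (A ** B) i"
proof -
  have "rsum A i * min_row_sum B = \<bar>A$i$1\<bar> * min_row_sum B + \<bar>A$i$2\<bar> * min_row_sum B"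
    by (simp add: rsum_def algebra_simps)
  also have "\<dots> \<le> \<bar>A$i$1\<bar> * rsum B 1 + \<bar>A$i$2\<bar> * rsum B 2"
    by (intro add_mono mult_left_mono min_row_sum_le) auto
  finally show ?thesis by (simp add: rsum_mult assms)
qed

lemma min_row_sum_mult:
  assumes "A \<in> psgn" "B \<in> psgn"
  shows "min_row_sum A * min_row_sum B \<le> min_row_sum (A ** B)"
proof -
  have "min_row_sum A * min_row_sum B \<le> rsum (A ** B) i" for i
    by (rule order_trans[OF mult_right_mono[OF min_row_sum_le] rsum_mult_ge])
      (use assms min_row_sum_pos in \<open>auto intro: less_imp_le\<close>)
  then show ?thesis by (simp add: min_row_sum_rsum[of "A ** B"])
qed

text \<open>\<open>rowmix A x\<close> and \<open>gm A\<close> describe the action of the transpose of \<open>A\<close> on the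
  projective line: the direction \<open>(x, 1 - x)\<close> is mapped to the direction \<open>(gm A x, 1 - gm A x)\<close>.\<close>

definition rowmix :: "real^2^2 \<Rightarrow> real \<Rightarrow> real" where
  "rowmix A x = (A$1$1 + A$1$2) * x + (A$2$1 + A$2$2) * (1 - x)"

definition gm :: "real^2^2 \<Rightarrow> real \<Rightarrow> real" where
  "gm A x = (A$1$1 * x + A$2$1 * (1 - x)) / rowmix A x"

lemma abs_rowmix:
  assumes "A \<in> psgn" "0 \<le> x" "x \<le> 1"
  shows "\<bar>rowmix A x\<bar> = rsum A 1 * x + rsum A 2 * (1 - x)"
proof -
  have "(0 \<le> (A$1$1 + A$1$2) \<and> 0 \<le> (A$2$1 + A$2$2)) \<or> ((A$1$1 + A$1$2) \<le> 0 \<and> (A$2$1 + A$2$2) \<le> 0)"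
    using assms(1) by (auto simp: psgn_iff)
  then have "\<bar>rowmix A x\<bar> = \<bar>A$1$1 + A$1$2\<bar> * x + \<bar>A$2$1 + A$2$2\<bar> * (1 - x)"
  proof
    assume "0 \<le> (A$1$1 + A$1$2) \<and> 0 \<le> (A$2$1 + A$2$2)"
    then show ?thesis using assms by (simp add: rowmix_def)
  next
    assume *: "(A$1$1 + A$1$2) \<le> 0 \<and> (A$2$1 + A$2$2) \<le> 0"
    then have "rowmix A x \<le> 0" using assms unfolding rowmix_def
      by (intro add_nonpos_nonpos) (simp_all add: mult_nonpos_nonneg)
    then have "\<bar>rowmix A x\<bar> = - rowmix A x" by (rule abs_of_nonpos)
    then show ?thesis using * by (simp add: rowmix_def abs_of_nonpos algebra_simps)
  qed
  then show ?thesis by (simp add: rsum_psgn assms(1))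
qed

lemma rowmix_bounds:
  assumes "A \<in> psgn" "0 \<le> x" "x \<le> 1"
  shows "min_row_sum A \<le> \<bar>rowmix A x\<bar>" "\<bar>rowmix A x\<bar> \<le> max_row_sum A"
proof -
  have "min_row_sum A = min_row_sum A * x + min_row_sum A * (1 - x)" by (simp add: algebra_simps)
  also have "\<dots> \<le> rsum A 1 * x + rsum A 2 * (1 - x)"
    using assms by (intro add_mono mult_right_mono min_row_sum_le) auto
  finally show "min_row_sum A \<le> \<bar>rowmix A x\<bar>" by (simp add: abs_rowmix assms)
  have "rsum A 1 * x + rsum A 2 * (1 - x) \<le> max_row_sum A * x + max_row_sum A * (1 - x)"
    using assms by (intro add_mono mult_right_mono rsum_le_max) auto
  also have "\<dots> = max_row_sum A" by (simp add: algebra_simps)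
  finally show "\<bar>rowmix A x\<bar> \<le> max_row_sum A" by (simp add: abs_rowmix assms)
qed

lemma rowmix_nonzero: "A \<in> psgn \<Longrightarrow> 0 \<le> x \<Longrightarrow> x \<le> 1 \<Longrightarrow> rowmix A x \<noteq> 0"
  using rowmix_bounds(1) min_row_sum_pos by fastforce

text \<open>The difference formula for Moebius maps. With the denominators confined between the two
  row sums it puts every contraction ratio of \<open>gm A\<close> between |det A| / max^2 and |det
  A| / min^2.\<close>

lemma gm_diff:
  assumes "rowmix A x \<noteq> 0" "rowmix A y \<noteq> 0"
  shows "gm A x - gm A y = det A * (x - y) / (rowmix A x * rowmix A y)"
proof -
  have "(A$1$1 * x + A$2$1 * (1 - x)) * rowmix A y - (A$1$1 * y + A$2$1 * (1 - y)) * rowmix A x = det A * (x - y)"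
    by (simp add: rowmix_def det_2 algebra_simps)
  then show ?thesis using assms by (simp add: gm_def diff_frac_eq)
qed

lemma gm_lipschitz:
  assumes A: "A \<in> psgn" and "0 \<le> x" "x \<le> 1" "0 \<le> y" "y \<le> 1"
  shows gm_upper: "\<bar>gm A x - gm A y\<bar> \<le> \<bar>det A\<bar> / (min_row_sum A)\<^sup>2 * \<bar>x - y\<bar>"
    and gm_lower: "\<bar>det A\<bar> / (max_row_sum A)\<^sup>2 * \<bar>x - y\<bar> \<le> \<bar>gm A x - gm A y\<bar>"
proof -
  have nz: "rowmix A x \<noteq> 0" "rowmix A y \<noteq> 0" using assms rowmix_nonzero by auto
  have eq: "\<bar>gm A x - gm A y\<bar> = \<bar>det A\<bar> * \<bar>x - y\<bar> / (\<bar>rowmix A x\<bar> * \<bar>rowmix A y\<bar>)"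
    by (simp add: gm_diff nz abs_mult)
  have 1: "(min_row_sum A)\<^sup>2 \<le> \<bar>rowmix A x\<bar> * \<bar>rowmix A y\<bar>"
    unfolding power2_eq_square using assms min_row_sum_pos[OF A] by (intro mult_mono rowmix_bounds) auto
  have 2: "\<bar>rowmix A x\<bar> * \<bar>rowmix A y\<bar> \<le> (max_row_sum A)\<^sup>2"
    unfolding power2_eq_square using assms max_row_sum_pos[OF A] by (intro mult_mono rowmix_bounds) auto
  have "\<bar>det A\<bar> * \<bar>x - y\<bar> / (\<bar>rowmix A x\<bar> * \<bar>rowmix A y\<bar>) \<le> \<bar>det A\<bar> * \<bar>x - y\<bar> / (min_row_sum A)\<^sup>2"
    using 1 min_row_sum_pos[OF A] nz by (intro divide_left_mono mult_pos_pos) auto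
  then show "\<bar>gm A x - gm A y\<bar> \<le> \<bar>det A\<bar> / (min_row_sum A)\<^sup>2 * \<bar>x - y\<bar>"
    unfolding eq by simp
  have "\<bar>det A\<bar> * \<bar>x - y\<bar> / (max_row_sum A)\<^sup>2 \<le> \<bar>det A\<bar> * \<bar>x - y\<bar> / (\<bar>rowmix A x\<bar> * \<bar>rowmix A y\<bar>)"
    using 2 nz max_row_sum_pos[OF A] by (intro divide_left_mono mult_pos_pos) auto
  then show "\<bar>det A\<bar> / (max_row_sum A)\<^sup>2 * \<bar>x - y\<bar> \<le> \<bar>gm A x - gm A y\<bar>"
    unfolding eq by simp
qed

lemma gm_mem:
  assumes A: "A \<in> psgn" and x: "0 \<le> x" "x \<le> 1"
  shows "0 \<le> gm A x" "gm A x \<le> 1"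
proof -
  have nz: "rowmix A x \<noteq> 0" using rowmix_nonzero assms by auto
  have sum: "rowmix A x = (A$1$1 * x + A$2$1 * (1 - x)) + (A$1$2 * x + A$2$2 * (1 - x))"
    by (simp add: rowmix_def algebra_simps)
  have frac: "0 \<le> p / r \<and> p / r \<le> 1" if "r \<noteq> 0" "r = p + q" "(0 \<le> p \<and> 0 \<le> q) \<or> (p \<le> 0 \<and> q \<le> 0)" for p q r :: real
    using that by (auto simp: divide_simps zero_le_mult_iff)
  have "0 \<le> gm A x \<and> gm A x \<le> 1"
    unfolding gm_def
  proof (rule frac[OF nz sum])
    show "(0 \<le> A$1$1 * x + A$2$1 * (1 - x) \<and> 0 \<le> A$1$2 * x + A$2$2 * (1 - x)) \<or>
      (A$1$1 * x + A$2$1 * (1 - x) \<le> 0 \<and> A$1$2 * x + A$2$2 * (1 - x) \<le> 0)"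
      using A x unfolding psgn_iff
      by (auto intro!: add_nonneg_nonneg add_nonpos_nonpos mult_nonneg_nonneg mult_nonpos_nonneg)
  qed
  then show "0 \<le> gm A x" "gm A x \<le> 1" by auto
qed

text \<open>\<open>gm\<close> is the action of the transpose, and transposition reverses products;
  so the leftmost factor acts first. This is the origin of the reversed words later on.\<close>

lemma gm_mult:
  assumes A: "A \<in> psgn" and B: "B \<in> psgn" and x: "0 \<le> x" "x \<le> 1"
  shows "gm (A ** B) x = gm B (gm A x)"
proof -
  define r where "r = rowmix A x"
  define g where "g = gm A x"
  have r: "r \<noteq> 0" using rowmix_nonzero[OF A x] by (simp add: r_def)
  have 1: "A$1$1 * x + A$2$1 * (1 - x) = g * r" using r by (simp add: g_def gm_def r_def)
  have 2: "A$1$2 * x + A$2$2 * (1 - x) = (1 - g) * r"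
  proof -
    have "A$1$2 * x + A$2$2 * (1 - x) = r - (A$1$1 * x + A$2$1 * (1 - x))" by (simp add: r_def rowmix_def algebra_simps)
    then show ?thesis unfolding 1 by (simp add: algebra_simps)
  qed
  have num: "(A**B)$1$j * x + (A**B)$2$j * (1 - x) = r * (B$1$j * g + B$2$j * (1 - g))" for j
  proof -
    have "(A**B)$1$j * x + (A**B)$2$j * (1 - x)
      = B$1$j * (A$1$1 * x + A$2$1 * (1 - x)) + B$2$j * (A$1$2 * x + A$2$2 * (1 - x))"
      by (simp add: matrix_mul_entry algebra_simps)
    then show ?thesis unfolding 1 2 by (simp add: algebra_simps)
  qed
  have den: "rowmix (A**B) x = r * rowmix B g"
  proof -
    have "rowmix (A**B) x = ((A**B)$1$1 * x + (A**B)$2$1 * (1 - x)) + ((A**B)$1$2 * x + (A**B)$2$2 * (1 - x))"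
      by (simp add: rowmix_def algebra_simps)
    then show ?thesis unfolding num by (simp add: rowmix_def algebra_simps)
  qed
  show ?thesis unfolding gm_def[of "A ** B"] num den using r by (simp add: gm_def[of B] flip: g_def)
qed

text \<open>The first row of \<open>A\<close> is, up to sign, \<open>rsum A 1\<close> times the
  vector (gm A 1, 1 - gm A 1), and the first coordinate of the image pairs \<open>z\<close> with it.
  This is the only link between distances in the plane and directions: a small image forces
  \<open>z\<close> into a strip.\<close>

lemma gm_one_direction:
  assumes "A \<in> psgn"
  shows "rsum A 1 * \<bar>gm A 1 * z$1 + (1 - gm A 1) * z$2\<bar> \<le> norm (A *v z)"
proof -
  have nz: "A$1$1 + A$1$2 \<noteq> 0" using assms by (auto simp: psgn_iff)
  have g: "gm A 1 = A$1$1 / (A$1$1 + A$1$2)" by (simp add: gm_def rowmix_def)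
  have 1: "(A$1$1 + A$1$2) * gm A 1 = A$1$1" using nz unfolding g by simp
  have "(A$1$1 + A$1$2) * (gm A 1 * z$1 + (1 - gm A 1) * z$2)
      = ((A$1$1 + A$1$2) * gm A 1) * z$1 + ((A$1$1 + A$1$2) - (A$1$1 + A$1$2) * gm A 1) * z$2"
    by (simp add: algebra_simps)
  also have "\<dots> = (A *v z)$1" unfolding 1 by (simp add: matrix_vec_entry)
  finally have "rsum A 1 * \<bar>gm A 1 * z$1 + (1 - gm A 1) * z$2\<bar> = \<bar>(A *v z)$1\<bar>"
    by (simp add: rsum_psgn assms flip: abs_mult)
  then show ?thesis using component_le_norm_cart[of "A *v z" 1] by simp
qed

section \<open>Words and pressure\<close>

definition words :: "'a set \<Rightarrow> nat \<Rightarrow> 'a list set" where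
  "words I k = {w. set w \<subseteq> I \<and> length w = k}"

lemma words_UNIV: "words UNIV k = {w. length w = k}"
  by (simp add: words_def)

lemma finite_words: "finite I \<Longrightarrow> finite (words I k)"
  by (simp add: words_def finite_lists_length_eq)

lemma card_words: "finite I \<Longrightarrow> card (words I k) = card I ^ k"
  by (simp add: words_def card_lists_length_eq)

lemma words_0 [simp]: "words I 0 = {[]}"
  by (auto simp: words_def)

lemma bij_betw_words_append:
  "bij_betw (\<lambda>(u, v). u @ v) (words I m \<times> words I n) (words I (m + n))"
proof (rule bij_betwI[where g = "\<lambda>w. (take m w, drop m w)"])
  show "(\<lambda>w. (take m w, drop m w)) \<in> words I (m + n) \<rightarrow> words I m \<times> words I n"
    by (auto simp: words_def dest: in_set_takeD in_set_dropD)
qed (auto simp: words_def)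

lemma sum_words_add:
  "(\<Sum>w\<in>words I (m + n). F w) = (\<Sum>u\<in>words I m. \<Sum>v\<in>words I n. F (u @ v))"
proof -
  have "(\<Sum>w\<in>words I (m + n). F w) = (\<Sum>p\<in>words I m \<times> words I n. F (case p of (u, v) \<Rightarrow> u @ v))"
    by (rule sum.reindex_bij_betw[OF bij_betw_words_append, symmetric])
  then show ?thesis by (simp add: sum.cartesian_product case_prod_beta)
qed

lemma word_product_append: "word_product A (u @ v) = word_product A u ** word_product A v"
  by (induction u) (simp_all add: word_product_def matrix_mul_assoc)

lemma word_product_Nil [simp]: "word_product A [] = mat 1"
  and word_product_Cons [simp]: "word_product A (i # w) = A $ i ** word_product A w"
  by (simp_all add: word_product_def)

text \<open>Exponents that merge the three ranges in the definition of \<open>svf\<close> into the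
  single monomial sv1^expo1 * sv2^expo2. Both are monotone in \<open>s\<close> and add up to
  \<open>s\<close>, so a comparison of two parameters needs no case distinction.\<close>

definition expo1 :: "real \<Rightarrow> real" where "expo1 s = (if s \<le> 1 then s else if s \<le> 2 then 1 else s / 2)"
definition expo2 :: "real \<Rightarrow> real" where "expo2 s = (if s \<le> 1 then 0 else if s \<le> 2 then s - 1 else s / 2)"

lemma expo_sum: "expo1 s + expo2 s = s" by (simp add: expo1_def expo2_def)
lemma expo_mono: "s \<le> t \<Longrightarrow> expo1 s \<le> expo1 t" "s \<le> t \<Longrightarrow> expo2 s \<le> expo2 t"
  by (auto simp: expo1_def expo2_def)
lemma expo2_le: "0 \<le> s \<Longrightarrow> expo2 s \<le> expo1 s" by (simp add: expo1_def expo2_def)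
lemma expo_nonneg: "0 \<le> s \<Longrightarrow> 0 \<le> expo1 s" "0 \<le> expo2 s" by (simp_all add: expo1_def expo2_def)

lemma svf_eq:
  assumes "det A \<noteq> 0"
  shows "svf s A = sv1 A powr expo1 s * sv2 A powr expo2 s"
  using sv1_pos[OF assms] sv2_pos[OF assms] by (simp add: svf_def expo1_def expo2_def powr_mult)

lemma svf_eq_det:
  assumes "det A \<noteq> 0"
  shows "svf s A = sv1 A powr (expo1 s - expo2 s) * \<bar>det A\<bar> powr expo2 s"
  using sv1_pos[OF assms] sv2_pos[OF assms]
  by (simp add: svf_eq[OF assms] powr_mult powr_diff flip: sv_prod)

lemma svf_pos: "det A \<noteq> 0 \<Longrightarrow> 0 < svf s A"
  by (simp add: svf_eq) (metis mult_pos_pos powr_gt_zero sv1_pos sv2_pos less_irrefl)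

lemma svf_0: "det A \<noteq> 0 \<Longrightarrow> svf 0 A = 1"
  using sv1_pos[of A] by (simp add: svf_def)

text \<open>Written as a nonnegative power of \<open>sv1\<close> times a power of the determinant,
  the function is a product of a submultiplicative and a multiplicative factor;
  \<open>expo2_le\<close> makes the first exponent nonnegative.\<close>

lemma svf_mult:
  assumes "det A \<noteq> 0" "det B \<noteq> 0" "0 \<le> s"
  shows "svf s (A ** B) \<le> svf s A * svf s B"
proof -
  have nz: "det (A ** B) \<noteq> 0" using assms by (simp add: det_mul)
  have "sv1 (A ** B) powr (expo1 s - expo2 s) \<le> (sv1 A * sv1 B) powr (expo1 s - expo2 s)"
    using expo2_le[OF assms(3)] by (intro powr_mono2 sv1_nonneg sv1_mult) auto
  then have "svf s (A ** B) \<le> (sv1 A * sv1 B) powr (expo1 s - expo2 s) * (\<bar>det A\<bar> * \<bar>det B\<bar>) powr expo2 s"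
    unfolding svf_eq_det[OF nz] by (simp add: det_mul abs_mult mult_right_mono)
  also have "\<dots> = svf s A * svf s B"
    by (simp add: svf_eq_det assms powr_mult sv1_nonneg)
  finally show ?thesis .
qed

lemma svf_compare:
  assumes "det A \<noteq> 0" "s \<le> t"
  shows "svf t A \<le> svf s A * sv1 A powr (t - s)" "svf s A * sv2 A powr (t - s) \<le> svf t A"
proof -
  note p = sv1_pos[OF assms(1)] sv2_pos[OF assms(1)]
  have eq: "svf t A = svf s A * (sv1 A powr (expo1 t - expo1 s) * sv2 A powr (expo2 t - expo2 s))"
    using p by (simp add: svf_eq assms powr_diff)
  have sp: "x powr (t - s) = x powr (expo1 t - expo1 s) * x powr (expo2 t - expo2 s)" for x :: real
    by (metis add_diff_add expo_sum powr_add)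
  have "sv1 A powr (expo1 t - expo1 s) * sv2 A powr (expo2 t - expo2 s) \<le> sv1 A powr (t - s)"
    unfolding sp using p sv2_le_sv1[of A] expo_mono[OF assms(2)] by (intro mult_left_mono powr_mono2) auto
  then show "svf t A \<le> svf s A * sv1 A powr (t - s)"
    unfolding eq using svf_pos[OF assms(1), of s] by (intro mult_left_mono) auto
  have "sv2 A powr (t - s) \<le> sv1 A powr (expo1 t - expo1 s) * sv2 A powr (expo2 t - expo2 s)"
    unfolding sp using p sv2_le_sv1[of A] expo_mono[OF assms(2)] by (intro mult_right_mono powr_mono2) auto
  then show "svf s A * sv2 A powr (t - s) \<le> svf t A"
    unfolding eq using svf_pos[OF assms(1), of s] by (intro mult_left_mono) auto
qed

text \<open>Fekete's lemma: the limit is the infimum of a n / n, which the linear lower bound keeps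
  finite.\<close>

lemma fekete:
  fixes a :: "nat \<Rightarrow> real"
  assumes sub: "\<And>m n. a (m + n) \<le> a m + a n" and bdd: "\<And>n. - C * real n \<le> a n"
  shows "convergent (\<lambda>n. a n / real n)"
proof -
  define L where "L = (INF n\<in>{1..}. a n / real n)"
  have bb: "bdd_below ((\<lambda>n. a n / real n) ` {1..})"
    by (rule bdd_belowI2[where m = "- C"]) (use bdd in \<open>auto simp: field_simps\<close>)
  have Lle: "L \<le> a n / real n" if "n \<ge> 1" for n
    unfolding L_def using bb that by (intro cINF_lower) auto
  have mult: "a (q * m + r) \<le> real q * a m + a r" for q m r
  proof (induction q)
    case (Suc q)
    have "a (Suc q * m + r) = a (m + (q * m + r))" by (simp add: algebra_simps)
    also have "\<dots> \<le> a m + a (q * m + r)" by (rule sub)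
    finally show ?case using Suc by (simp add: algebra_simps)
  qed simp
  have "(\<lambda>n. a n / real n) \<longlonglongrightarrow> L"
  proof (rule LIMSEQ_I)
    fix e :: real assume e: "e > 0"
    have "\<exists>n\<in>{1..}. a n / real n < L + e/2"
      unfolding L_def using e bb by (subst cINF_less_iff[symmetric]) auto
    then obtain m where m: "m \<ge> 1" "a m / real m < L + e/2" by auto
    \<comment> \<open>Covers both errors of division with remainder: the value at the remainder, and
      the replacement of the quotient by n / m.\<close>
    define K where "K = (\<Sum>r<m. \<bar>a r\<bar>) + \<bar>a m\<bar>"
    have up: "a n / real n \<le> a m / real m + K / real n" if n: "n \<ge> 1" for n
    proof -
      define q where "q = n div m" define r where "r = n mod m"
      have nq: "n = q * m + r" and rm: "r < m" using m by (auto simp: q_def r_def)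
      have 1: "a n \<le> real q * a m + a r" unfolding nq by (rule mult)
      have 2: "a r \<le> (\<Sum>r<m. \<bar>a r\<bar>)"
        using rm by (intro order_trans[OF abs_ge_self[of "a r"]] member_le_sum[of r "{..<m}" "\<lambda>r. \<bar>a r\<bar>"]) auto
      have 3: "real q * a m = real n * (a m / real m) - (real r / real m) * a m"
        using m unfolding nq by (simp add: field_simps)
      have 4: "- (real r / real m) * a m \<le> 1 * \<bar>a m\<bar>"
      proof -
        have "- (real r / real m) * a m \<le> \<bar>(real r / real m) * a m\<bar>"
          by (metis abs_ge_minus_self mult_minus_left)
        also have "\<dots> = (real r / real m) * \<bar>a m\<bar>" by (simp add: abs_mult)
        also have "\<dots> \<le> 1 * \<bar>a m\<bar>" using rm m by (intro mult_right_mono) auto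
        finally show ?thesis .
      qed
      have "a n \<le> real n * (a m / real m) + K" unfolding K_def using 1 2 3 4 by linarith
      then show ?thesis using n by (simp add: field_simps)
    qed
    obtain N where N: "real N > 2 * K / e" using reals_Archimedean2 by blast
    have "norm (a n / real n - L) < e" if "n \<ge> max 1 N" for n
    proof -
      have n: "n \<ge> 1" "real n > 2 * K / e" using that N by (auto intro: less_le_trans)
      then have "K / real n < e/2" using e by (simp add: field_simps)
      with up[OF n(1)] m(2) Lle[OF n(1)] show ?thesis unfolding real_norm_def by linarith
    qed
    then show "\<exists>no. \<forall>n\<ge>no. norm (a n / real n - L) < e" by blast
  qed
  then show ?thesis by (auto simp: convergent_def)
qed

definition svsum :: "real^2^2^'n::finite \<Rightarrow> real \<Rightarrow> nat \<Rightarrow> real" where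
  "svsum A s n = (\<Sum>w\<in>words UNIV n. svf s (word_product A w))"

lemma det_word_product: "(\<And>i. det (A $ i) \<noteq> 0) \<Longrightarrow> det (word_product A w) \<noteq> 0"
  by (induction w) (simp_all add: det_mul)

lemma sv1_word_product_le:
  assumes "\<And>i. sv1 (A $ i) \<le> l" "0 \<le> l"
  shows "sv1 (word_product A w) \<le> l ^ length w"
proof (induction w)
  case (Cons i w)
  have "sv1 (word_product A (i # w)) \<le> sv1 (A $ i) * sv1 (word_product A w)" by (simp add: sv1_mult)
  also have "\<dots> \<le> l * l ^ length w" using assms Cons by (intro mult_mono sv1_nonneg)
  finally show ?case by simp
qed (simp add: sv_mat1)

lemma sv2_word_product_ge:
  assumes "\<And>i. l \<le> sv2 (A $ i)" "0 \<le> l"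
  shows "l ^ length w \<le> sv2 (word_product A w)"
proof (induction w)
  case (Cons i w)
  have "l * l ^ length w \<le> sv2 (A $ i) * sv2 (word_product A w)" using assms Cons by (intro mult_mono sv2_nonneg) auto
  also have "\<dots> \<le> sv2 (word_product A (i # w))" by (simp add: sv2_mult)
  finally show ?case by simp
qed (simp add: sv_mat1)

context
  fixes A :: "real^2^2^'n::finite"
  assumes nonsing: "\<And>i. det (A $ i) \<noteq> 0" and contr: "\<And>i. sv1 (A $ i) < 1"
begin

lemma sv1_uniform: "\<exists>l. 0 < l \<and> l < 1 \<and> (\<forall>w. sv1 (word_product A w) \<le> l ^ length w)"
proof -
  define l where "l = Max (range (\<lambda>i. sv1 (A $ i)))"
  have le: "sv1 (A $ i) \<le> l" for i unfolding l_def by (rule Max_ge) auto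
  have "l \<in> range (\<lambda>i. sv1 (A $ i))" unfolding l_def by (rule Max_in) auto
  then have "0 < l" "l < 1" using contr sv1_pos nonsing by auto
  then show ?thesis using sv1_word_product_le[OF le] by auto
qed

lemma sv2_uniform: "\<exists>l. 0 < l \<and> l < 1 \<and> (\<forall>w. l ^ length w \<le> sv2 (word_product A w))"
proof -
  define l where "l = Min (range (\<lambda>i. sv2 (A $ i)))"
  have le: "l \<le> sv2 (A $ i)" for i unfolding l_def by (rule Min_le) auto
  have "l \<in> range (\<lambda>i. sv2 (A $ i))" unfolding l_def by (rule Min_in) auto
  then have "0 < l" "l < 1" using contr sv2_pos[OF nonsing] sv2_le_sv1 by (auto intro: le_less_trans)
  then show ?thesis using sv2_word_product_ge[OF le] by auto
qed

lemma svsum_pos: "0 < svsum A s n"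
proof -
  have "words UNIV n \<noteq> ({} :: 'n list set)"
    using card_words[of "UNIV :: 'n set" n] by (metis card.empty finite_class.finite_UNIV power_not_zero zero_less_card_finite less_irrefl)
  then show ?thesis unfolding svsum_def
    by (intro sum_pos finite_words svf_pos det_word_product nonsing) auto
qed

lemma svsum_add_le:
  assumes "0 \<le> s"
  shows "svsum A s (m + n) \<le> svsum A s m * svsum A s n"
  unfolding svsum_def sum_words_add sum_product word_product_append
  by (intro sum_mono svf_mult det_word_product nonsing assms)

lemma svsum_0: "svsum A 0 n = real CARD('n) ^ n"
  by (simp add: svsum_def svf_0 det_word_product nonsing card_words)

lemma svsum_compare_upper:
  assumes "\<And>w. sv1 (word_product A w) \<le> l ^ length w" "0 < l" "s \<le> t"
  shows "svsum A t n \<le> svsum A s n * (l powr (t - s)) ^ n"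
  unfolding svsum_def sum_distrib_right
proof (rule sum_mono)
  fix w :: "'n list" assume w: "w \<in> words UNIV n"
  have "svf t (word_product A w) \<le> svf s (word_product A w) * sv1 (word_product A w) powr (t - s)"
    by (rule svf_compare(1)[OF det_word_product[OF nonsing] assms(3)])
  also have "sv1 (word_product A w) powr (t - s) \<le> (l ^ n) powr (t - s)"
    using assms w by (intro powr_mono2 sv1_nonneg) (auto simp: words_def)
  also have "(l ^ n) powr (t - s) = (l powr (t - s)) ^ n"
    using assms(2) by (simp add: powr_powr mult.commute flip: powr_realpow)
  finally show "svf t (word_product A w) \<le> svf s (word_product A w) * (l powr (t - s)) ^ n"
    using svf_pos[OF det_word_product[OF nonsing], of s w] by (simp add: mult_left_mono)
qed

lemma svsum_compare_lower:
  assumes "\<And>w. l ^ length w \<le> sv2 (word_product A w)" "0 < l" "s \<le> t"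
  shows "svsum A s n * (l powr (t - s)) ^ n \<le> svsum A t n"
  unfolding svsum_def sum_distrib_right
proof (rule sum_mono)
  fix w :: "'n list" assume w: "w \<in> words UNIV n"
  have "(l powr (t - s)) ^ n = (l ^ n) powr (t - s)"
    using assms(2) by (simp add: powr_powr mult.commute flip: powr_realpow)
  also have "\<dots> \<le> sv2 (word_product A w) powr (t - s)"
    using assms w by (intro powr_mono2) (auto simp: words_def)
  finally have "svf s (word_product A w) * (l powr (t - s)) ^ n
      \<le> svf s (word_product A w) * sv2 (word_product A w) powr (t - s)"
    using svf_pos[OF det_word_product[OF nonsing], of s w] by (simp add: mult_left_mono)
  also have "\<dots> \<le> svf t (word_product A w)"
    by (rule svf_compare(2)[OF det_word_product[OF nonsing] assms(3)])
  finally show "svf s (word_product A w) * (l powr (t - s)) ^ n \<le> svf t (word_product A w)" .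
qed

text \<open>Submultiplicativity of the sums makes their logarithms subadditive; comparison with s =
  0, where the sum is the number of words, gives the linear lower bound. Only from here on does the
  \<open>lim\<close> in \<open>pressure\<close> have its intended value.\<close>

lemma pressure_limit:
  assumes "0 \<le> s"
  shows "(\<lambda>n. ln (svsum A s n) / real n) \<longlonglongrightarrow> pressure A s"
proof -
  obtain l where l: "0 < l" "l < 1" "\<And>w. l ^ length w \<le> sv2 (word_product A w)" using sv2_uniform by auto
  have "convergent (\<lambda>n. ln (svsum A s n) / real n)"
  proof (rule fekete)
    fix m n
    show "ln (svsum A s (m + n)) \<le> ln (svsum A s m) + ln (svsum A s n)"
      using svsum_add_le[OF assms, of m n] svsum_pos[of s m] svsum_pos[of s n] svsum_pos[of s "m + n"]
      by (simp flip: ln_mult_pos)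
    have "1 * (l powr s) ^ n \<le> real CARD('n) ^ n * (l powr s) ^ n" by (intro mult_right_mono) auto
    also have "\<dots> \<le> svsum A s n" using svsum_compare_lower[OF l(3,1) assms, of n] by (simp add: svsum_0)
    finally have "ln ((l powr s) ^ n) \<le> ln (svsum A s n)" using l svsum_pos by (subst ln_le_cancel_iff) auto
    moreover have "ln ((l powr s) ^ n) = - (- ln (l powr s)) * real n" using l by (subst ln_realpow) auto
    ultimately show "- (- ln (l powr s)) * real n \<le> ln (svsum A s n)" by simp
  qed
  then show ?thesis
    by (simp add: convergent_LIMSEQ_iff pressure_def svsum_def words_UNIV)
qed

lemma pressure_0: "pressure A 0 = ln (real CARD('n))"
proof -
  have "(\<lambda>n. ln (svsum A 0 n) / real n) \<longlonglongrightarrow> ln (real CARD('n))"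
  proof (rule tendsto_eventually)
    show "eventually (\<lambda>n. ln (svsum A 0 n) / real n = ln (real CARD('n))) sequentially"
      using eventually_gt_at_top[of 0] by eventually_elim (simp add: svsum_0 ln_realpow)
  qed
  with pressure_limit[of 0] show ?thesis using LIMSEQ_unique by auto
qed

text \<open>The slopes are the logarithms of uniform bounds for the singular values of the
  generators. The positive lower slope makes the zero unique, the upper one gives continuity, hence
  existence.\<close>

lemma pressure_compare:
  "\<exists>a b. 0 < a \<and> (\<forall>s t. 0 \<le> s \<longrightarrow> s \<le> t \<longrightarrow> pressure A t \<le> pressure A s - a * (t - s) \<and> pressure A s - b * (t - s) \<le> pressure A t)"
proof -
  obtain u where u: "0 < u" "u < 1" "\<And>w. sv1 (word_product A w) \<le> u ^ length w" using sv1_uniform by auto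
  obtain l where l: "0 < l" "l < 1" "\<And>w. l ^ length w \<le> sv2 (word_product A w)" using sv2_uniform by auto
  have 1: "pressure A t \<le> pressure A s - (- ln u) * (t - s)" if st: "0 \<le> s" "s \<le> t" for s t
  proof (rule LIMSEQ_le[OF pressure_limit tendsto_diff[OF pressure_limit tendsto_const]])
    show "\<exists>N. \<forall>n\<ge>N. ln (svsum A t n) / real n \<le> ln (svsum A s n) / real n - (- ln u) * (t - s)"
    proof (intro exI[of _ 1] allI impI)
      fix n :: nat assume n: "1 \<le> n"
      have "ln (svsum A t n) \<le> ln (svsum A s n * (u powr (t - s)) ^ n)"
        using svsum_compare_upper[OF u(3,1) st(2)] svsum_pos u by (subst ln_le_cancel_iff) auto
      also have "\<dots> = ln (svsum A s n) + real n * ((t - s) * ln u)"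
        using svsum_pos[of s n] u by (simp add: ln_mult ln_realpow ln_powr)
      finally show "ln (svsum A t n) / real n \<le> ln (svsum A s n) / real n - (- ln u) * (t - s)"
        using n by (simp add: field_simps)
    qed
  qed (use st in auto)
  have 2: "pressure A s - (- ln l) * (t - s) \<le> pressure A t" if st: "0 \<le> s" "s \<le> t" for s t
  proof (rule LIMSEQ_le[OF tendsto_diff[OF pressure_limit tendsto_const] pressure_limit])
    show "\<exists>N. \<forall>n\<ge>N. ln (svsum A s n) / real n - (- ln l) * (t - s) \<le> ln (svsum A t n) / real n"
    proof (intro exI[of _ 1] allI impI)
      fix n :: nat assume n: "1 \<le> n"
      have "ln (svsum A s n) + real n * ((t - s) * ln l) = ln (svsum A s n * (l powr (t - s)) ^ n)"
        using svsum_pos[of s n] l by (simp add: ln_mult ln_realpow ln_powr)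
      also have "\<dots> \<le> ln (svsum A t n)"
        using svsum_compare_lower[OF l(3,1) st(2)] svsum_pos l by (subst ln_le_cancel_iff) auto
      finally have "(ln (svsum A s n) + real n * ((t - s) * ln l)) / real n \<le> ln (svsum A t n) / real n"
        by (rule divide_right_mono) simp
      then show "ln (svsum A s n) / real n - (- ln l) * (t - s) \<le> ln (svsum A t n) / real n"
        using n by (simp add: add_divide_distrib mult.commute)
    qed
  qed (use st in auto)
  show ?thesis
    by (rule exI[of _ "- ln u"], rule exI[of _ "- ln l"]) (use 1 2 u in auto)
qed

lemma affinity_dim_props:
  assumes "CARD('n) \<ge> 2"
  shows "0 < affinity_dim A" "pressure A (affinity_dim A) = 0"
    "\<And>s. 0 \<le> s \<Longrightarrow> s < affinity_dim A \<Longrightarrow> 0 < pressure A s"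
    "\<And>s. affinity_dim A < s \<Longrightarrow> pressure A s < 0"
proof -
  obtain a b where a: "0 < a" and up: "\<And>s t. 0 \<le> s \<Longrightarrow> s \<le> t \<Longrightarrow> pressure A t \<le> pressure A s - a * (t - s)"
    and lo: "\<And>s t. 0 \<le> s \<Longrightarrow> s \<le> t \<Longrightarrow> pressure A s - b * (t - s) \<le> pressure A t"
    using pressure_compare by blast
  have p0: "pressure A 0 > 0" using assms by (simp add: pressure_0)
  \<comment> \<open>By the slope bound the pressure is nonpositive at this point, so it brackets the
    zero.\<close>
  define T where "T = pressure A 0 / a"
  have T: "T \<ge> 0" using a p0 by (simp add: T_def)
  have pT: "pressure A T \<le> 0" using up[of 0 T] T a by (simp add: T_def)
  have b: "b \<ge> 0" using up[of 0 1] lo[of 0 1] a by simp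
  have "continuous_on {0..T} (pressure A)"
  proof (rule lipschitz_on_continuous_on, rule lipschitz_onI[OF _ b])
    fix x y assume xy: "x \<in> {0..T}" "y \<in> {0..T}"
    have "\<bar>pressure A x - pressure A y\<bar> \<le> b * \<bar>x - y\<bar>" 
    proof (cases "x \<le> y")
      case True
      have "a * (y - x) \<ge> 0" using a True by simp
      then show ?thesis using up[of x y] lo[of x y] xy True by (simp add: algebra_simps)
    next
      case False
      then have "a * (x - y) \<ge> 0" using a by simp
      then show ?thesis using up[of y x] lo[of y x] xy False by (simp add: algebra_simps)
    qed
    then show "dist (pressure A x) (pressure A y) \<le> b * dist x y" by (simp add: dist_real_def)
  qed
  then obtain z where z: "0 \<le> z" "z \<le> T" "pressure A z = 0"
    using IVT2'[of "pressure A" T 0 0] pT p0 T by auto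
  have neg: "pressure A s < 0" if "z < s" for s
  proof -
    have "a * (s - z) > 0" using a that by simp
    then show ?thesis using up[of z s] z that by simp
  qed
  have pos: "0 < pressure A s" if "0 \<le> s" "s < z" for s
  proof -
    have "a * (z - s) > 0" using a that by simp
    then show ?thesis using up[of s z] z that by simp
  qed
  have "affinity_dim A = z"
    unfolding affinity_dim_def
    by (rule the_equality) (use z neg pos in \<open>metis less_irrefl linorder_neqE_linordered_idom\<close>)+
  then show "0 < affinity_dim A" "pressure A (affinity_dim A) = 0"
    "\<And>s. 0 \<le> s \<Longrightarrow> s < affinity_dim A \<Longrightarrow> 0 < pressure A s"
    "\<And>s. affinity_dim A < s \<Longrightarrow> pressure A s < 0"
    using z neg pos p0 by (auto simp: less_le)
qed

lemma svsum_growth: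
  assumes "CARD('n) \<ge> 2" "0 \<le> s" "s < affinity_dim A"
  shows "\<exists>\<eta>>0. eventually (\<lambda>n. exp (\<eta> * real n) \<le> svsum A s n) sequentially"
proof -
  define \<eta> where "\<eta> = pressure A s / 2"
  have pos: "0 < pressure A s" using affinity_dim_props(3) assms by auto
  then have "eventually (\<lambda>n. \<eta> < ln (svsum A s n) / real n) sequentially"
    using pressure_limit[OF assms(2)] by (intro order_tendstoD) (auto simp: \<eta>_def)
  then have "eventually (\<lambda>n. exp (\<eta> * real n) \<le> svsum A s n) sequentially"
    using eventually_gt_at_top[of 0]
  proof eventually_elim
    case (elim n)
    then have "\<eta> * real n < ln (svsum A s n)" by (simp add: field_simps)
    then have "exp (\<eta> * real n) < exp (ln (svsum A s n))" by simp
    then show ?case using svsum_pos by simp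
  qed
  then show ?thesis using pos by (intro exI[of _ \<eta>]) (auto simp: \<eta>_def)
qed

lemma svsum_decay:
  assumes "CARD('n) \<ge> 2" "affinity_dim A < s"
  shows "summable (\<lambda>n. svsum A s n)"
proof -
  define \<eta> where "\<eta> = pressure A s / 2"
  have neg: "pressure A s < 0" using affinity_dim_props(4) assms by auto
  have "0 \<le> s" using affinity_dim_props(1) assms by fastforce
  have "eventually (\<lambda>n. ln (svsum A s n) / real n < \<eta>) sequentially"
    using pressure_limit[OF \<open>0 \<le> s\<close>] neg by (intro order_tendstoD) (auto simp: \<eta>_def)
  then have ev: "eventually (\<lambda>n. norm (svsum A s n) \<le> exp \<eta> ^ n) sequentially"
    using eventually_gt_at_top[of 0]
  proof eventually_elim
    case (elim n)
    then have "ln (svsum A s n) < real n * \<eta>" by (simp add: field_simps)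
    then have "exp (ln (svsum A s n)) < exp (real n * \<eta>)" by simp
    then show ?case using svsum_pos[of s n] by (simp add: exp_of_nat_mult)
  qed
  show ?thesis
    by (rule summable_comparison_test_ev[OF ev summable_geometric]) (use neg in \<open>simp add: \<eta>_def\<close>)
qed

end

section \<open>Affine iterated function systems\<close>

definition word_map :: "real^2^2^'n::finite \<Rightarrow> real^2^'n \<Rightarrow> 'n list \<Rightarrow> real^2 \<Rightarrow> real^2" where
  "word_map A t w x = foldr (affine_ifs A t) w x"

lemma word_map_Nil [simp]: "word_map A t [] x = x"
  and word_map_Cons [simp]: "word_map A t (i # w) x = affine_ifs A t i (word_map A t w x)"
  and word_map_append: "word_map A t (u @ w) x = word_map A t u (word_map A t w x)"
  by (simp_all add: word_map_def)

lemma affine_ifs_diff: "affine_ifs A t i x - affine_ifs A t i y = A $ i *v (x - y)"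
  by (simp add: affine_ifs_def matrix_vector_mult_diff_distrib)

lemma word_map_diff: "word_map A t w x - word_map A t w y = word_product A w *v (x - y)"
  by (induction w arbitrary: x y) (simp_all add: affine_ifs_diff matrix_vector_mul_assoc)

lemma dist_word_map: "dist (word_map A t w x) (word_map A t w y) = norm (word_product A w *v (x - y))"
  by (simp add: dist_norm word_map_diff)

lemma continuous_affine_ifs: "continuous_on S (affine_ifs A t i)"
  unfolding affine_ifs_def
  by (intro continuous_intros linear_continuous_on) (simp add: matrix_vector_mul_bounded_linear)

context
  fixes A :: "real^2^2^'n::finite" and t :: "real^2^'n"
  assumes nonsing: "\<And>i. det (A $ i) \<noteq> 0" and contr: "\<And>i. sv1 (A $ i) < 1"
begin

lemma affine_ifs_inj: "affine_ifs A t i x = affine_ifs A t i y \<Longrightarrow> x = y"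
  using affine_ifs_diff[of A t i x y] norm_ge_sv2[of "A $ i" "x - y"] sv2_pos[OF nonsing, of i]
  by (simp add: mult_le_0_iff)

lemma affine_ifs_lipschitz_uniform:
  "\<exists>l. 0 < l \<and> l < 1 \<and> (\<forall>i x y. dist (affine_ifs A t i x) (affine_ifs A t i y) \<le> l * dist x y)"
proof -
  obtain l where l: "0 < l" "l < 1" "\<And>w. sv1 (word_product A w) \<le> l ^ length w"
    using sv1_uniform[OF nonsing contr] by auto
  have "dist (affine_ifs A t i x) (affine_ifs A t i y) \<le> l * dist x y" for i x y
  proof -
    have "dist (affine_ifs A t i x) (affine_ifs A t i y) \<le> sv1 (A $ i) * dist x y"
      by (simp add: dist_norm affine_ifs_diff norm_le_sv1)
    also have "\<dots> \<le> l * dist x y" using l(3)[of "[i]"] by (intro mult_right_mono) auto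
    finally show ?thesis .
  qed
  with l show ?thesis by blast
qed

text \<open>The invariant set is the decreasing intersection of the iterated images of a ball that
  is mapped into itself.\<close>

lemma invariant_compact_exists:
  "\<exists>K. K \<noteq> {} \<and> compact K \<and> K = (\<Union>i. affine_ifs A t i ` K)"
proof -
  let ?f = "affine_ifs A t"
  obtain l where l: "0 < l" "l < 1" "\<And>i x y. dist (?f i x) (?f i y) \<le> l * dist x y"
    using affine_ifs_lipschitz_uniform by blast
  define T where "T = (\<Sum>i\<in>UNIV. norm (t $ i))"
  \<comment> \<open>The solution of l R + T = R, so every map sends the ball of this radius into
    itself.\<close>
  define R where "R = T / (1 - l)"
  have T: "norm (t $ i) \<le> T" for i unfolding T_def by (rule member_le_sum) auto
  have R: "R \<ge> 0" using l by (simp add: R_def T_def sum_nonneg)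
  define F where "F E = (\<Union>i. ?f i ` E)" for E
  define K where "K n = (F ^^ n) (cball 0 R)" for n
  have F_mono: "F E \<subseteq> F E'" if "E \<subseteq> E'" for E E' using that by (auto simp: F_def)
  have K_Suc: "K (Suc n) = F (K n)" for n by (simp add: K_def)
  have K0: "F (K 0) \<subseteq> K 0"
  proof -
    have "norm (?f i x) \<le> R" if "norm x \<le> R" for i x
    proof -
      have "norm (?f i x) \<le> dist (?f i x) (?f i 0) + norm (?f i 0)"
        by (metis dist_norm norm_triangle_sub add.commute)
      also have "\<dots> \<le> l * norm x + T" using l(3)[of i x 0] T[of i] by (simp add: affine_ifs_def)
      also have "\<dots> \<le> l * R + T" using that l by (intro add_mono mult_left_mono) auto
      also have "\<dots> = R" using l by (simp add: R_def field_simps)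
      finally show ?thesis .
    qed
    then show ?thesis by (auto simp: K_def F_def)
  qed
  have dec1: "K (Suc n) \<subseteq> K n" for n
    by (induction n) (use K0 F_mono in \<open>auto simp: K_Suc\<close>)
  have dec: "K n \<subseteq> K m" if "m \<le> n" for m n
    using lift_Suc_antimono_le[of K, OF dec1 that] .
  have cpt: "compact (K n)" for n
  proof (induction n)
    case (Suc n)
    then show ?case unfolding K_Suc F_def
      by (intro compact_UN compact_continuous_image continuous_affine_ifs) auto
  qed (simp add: K_def)
  have ne: "K n \<noteq> {}" for n
    by (induction n) (use R in \<open>auto simp: K_Suc F_def, simp add: K_def\<close>)
  define L where "L = (\<Inter>n. K n)"
  have "L \<noteq> {}" unfolding L_def by (rule compact_nest[OF cpt ne dec])
  moreover have "compact L" unfolding L_def using cpt by (intro compact_Inter) auto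
  moreover have "F L \<subseteq> L"
  proof -
    have "F L \<subseteq> K n" for n
      using F_mono[of L "K n"] dec1[of n] by (auto simp: L_def K_Suc)
    then show ?thesis by (auto simp: L_def)
  qed
  moreover have "L \<subseteq> F L"
  proof
    fix y assume y: "y \<in> L"
    \<comment> \<open>One index serves all \<open>n\<close>, because the maps are finitely many and
      the sets \<open>K n\<close> decrease. Injectivity of that map then gives a single preimage
      lying in every \<open>K n\<close>.\<close>
    have "\<exists>i. \<forall>n. y \<in> ?f i ` K n"
    proof (rule ccontr)
      assume "\<not> ?thesis"
      then obtain n where n: "\<And>i. y \<notin> ?f i ` K (n i)" by metis
      define N where "N = Max (range n)"
      have "n i \<le> N" for i unfolding N_def by (rule Max_ge) auto
      then have "y \<notin> F (K N)" using n dec by (force simp: F_def)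
      then show False using y by (auto simp: L_def K_Suc[symmetric])
    qed
    then obtain i where i: "\<And>n. y \<in> ?f i ` K n" by blast
    then obtain x where x: "y = ?f i x" "x \<in> K 0" by blast
    have "x \<in> K n" for n using i[of n] x affine_ifs_inj by auto
    then show "y \<in> F L" using x by (auto simp: F_def L_def)
  qed
  ultimately show ?thesis unfolding F_def by blast
qed

text \<open>Take the point of \<open>K\<close> farthest from \<open>L\<close>. It is the image of a
  point of \<open>K\<close>, so its distance to \<open>L\<close> is at most \<open>l\<close> times
  the maximal distance, which must vanish.\<close>

lemma invariant_compact_subset:
  assumes K: "K \<noteq> {}" "compact K" "K = (\<Union>i. affine_ifs A t i ` K)"
    and L: "L \<noteq> {}" "compact L" "L = (\<Union>i. affine_ifs A t i ` L)"
  shows "K \<subseteq> L"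
proof -
  let ?f = "affine_ifs A t"
  obtain l where l: "0 < l" "l < 1" "\<And>i x y. dist (?f i x) (?f i y) \<le> l * dist x y"
    using affine_ifs_lipschitz_uniform by blast
  have "continuous_on K (\<lambda>x. infdist x L)" by (intro continuous_intros)
  then obtain x where x: "x \<in> K" "\<And>y. y \<in> K \<Longrightarrow> infdist y L \<le> infdist x L"
    using continuous_attains_sup[OF K(2,1)] by blast
  obtain i z where z: "z \<in> K" "x = ?f i z" using x(1) K(3) by blast
  have "infdist x L \<le> l * infdist z L"
  proof -
    obtain u where u: "u \<in> L" "infdist z L = dist z u"
      using infdist_attains_inf[OF compact_imp_closed[OF L(2)] L(1)] by metis
    have "infdist x L \<le> dist x (?f i u)" by (rule infdist_le) (use u L(3) in blast)
    also have "\<dots> \<le> l * dist z u" using l(3) z by simp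
    finally show ?thesis using u by simp
  qed
  also have "\<dots> \<le> l * infdist x L" using x z l by (intro mult_left_mono) auto
  finally have "infdist x L * (1 - l) \<le> 0" by (simp add: algebra_simps)
  then have "infdist x L \<le> 0" using l by (simp add: mult_le_0_iff)
  then have "infdist y L = 0" if "y \<in> K" for y using x(2)[OF that] infdist_nonneg[of y L] by linarith
  then show ?thesis using in_closed_iff_infdist_zero[OF compact_imp_closed[OF L(2)] L(1)] by auto
qed

lemma attractor_props:
  "attractor (affine_ifs A t) \<noteq> {}" "compact (attractor (affine_ifs A t))"
  "attractor (affine_ifs A t) = (\<Union>i. affine_ifs A t i ` attractor (affine_ifs A t))"
proof -
  have "\<exists>!K. K \<noteq> {} \<and> compact K \<and> K = (\<Union>i. affine_ifs A t i ` K)"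
  proof (rule ex_ex1I[OF invariant_compact_exists])
    fix K L
    assume "K \<noteq> {} \<and> compact K \<and> K = (\<Union>i. affine_ifs A t i ` K)"
      "L \<noteq> {} \<and> compact L \<and> L = (\<Union>i. affine_ifs A t i ` L)"
    then show "K = L" using invariant_compact_subset[of K L] invariant_compact_subset[of L K] by blast
  qed
  from theI'[OF this, folded attractor_def]
  show "attractor (affine_ifs A t) \<noteq> {}" "compact (attractor (affine_ifs A t))"
    "attractor (affine_ifs A t) = (\<Union>i. affine_ifs A t i ` attractor (affine_ifs A t))"
    by blast+
qed

lemma affine_ifs_attractor: "x \<in> attractor (affine_ifs A t) \<Longrightarrow> affine_ifs A t i x \<in> attractor (affine_ifs A t)"
  using attractor_props(3) by blast

lemma word_map_attractor: "x \<in> attractor (affine_ifs A t) \<Longrightarrow> word_map A t w x \<in> attractor (affine_ifs A t)"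
  by (induction w) (simp_all add: affine_ifs_attractor)

lemma strong_separation_dist:
  assumes "strong_separation (affine_ifs A t)"
  shows "\<exists>e>0. \<forall>i j. \<forall>x\<in>attractor (affine_ifs A t). \<forall>y\<in>attractor (affine_ifs A t). i \<noteq> j \<longrightarrow>
     e \<le> dist (affine_ifs A t i x) (affine_ifs A t j y)"
proof -
  let ?f = "affine_ifs A t" and ?K = "attractor (affine_ifs A t)"
  have "\<exists>e>0. \<forall>x\<in>?K. \<forall>y\<in>?K. i \<noteq> j \<longrightarrow> e \<le> dist (?f i x) (?f j y)" for i j
  proof (cases "i = j")
    case False
    have c: "compact (?f i ` ?K)" "compact (?f j ` ?K)"
      by (intro compact_continuous_image continuous_affine_ifs attractor_props)+
    have "?f i ` ?K \<inter> ?f j ` ?K = {}" using assms False by (auto simp: strong_separation_def)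
    from separate_compact_closed[OF c(1) compact_imp_closed[OF c(2)] this]
    show ?thesis by auto
  qed (auto intro: exI[of _ 1])
  then obtain e where e: "\<And>i j. e i j > 0"
    "\<And>i j x y. x \<in> ?K \<Longrightarrow> y \<in> ?K \<Longrightarrow> i \<noteq> j \<Longrightarrow> e i j \<le> dist (?f i x) (?f j y)" by metis
  define m where "m = Min (range (\<lambda>(i, j). e i j))"
  have le: "m \<le> e i j" for i j
  proof -
    have "e i j \<in> range (\<lambda>(i, j). e i j)" by (auto intro!: image_eqI[of _ _ "(i, j)"])
    then show ?thesis unfolding m_def by (intro Min_le) auto
  qed
  have "m \<in> range (\<lambda>(i, j). e i j)" unfolding m_def by (rule Min_in) auto
  then have "m > 0" using e(1) by auto
  then show ?thesis using e(2) le by (intro exI[of _ m]) (meson order_trans)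
qed

text \<open>A volume comparison: the neighbourhood of the attractor of half the separation gap is
  open, is mapped into itself by every map, and has pairwise disjoint images.\<close>

lemma sum_det_le_1:
  assumes "strong_separation (affine_ifs A t)"
  shows "(\<Sum>i\<in>UNIV. \<bar>det (A $ i)\<bar>) \<le> 1"
proof -
  let ?f = "affine_ifs A t" and ?K = "attractor (affine_ifs A t)"
  obtain e where e: "e > 0" "\<And>i j x y. x \<in> ?K \<Longrightarrow> y \<in> ?K \<Longrightarrow> i \<noteq> j \<Longrightarrow> e \<le> dist (?f i x) (?f j y)"
    using strong_separation_dist[OF assms] by metis
  define U where "U = (\<Union>x\<in>?K. ball x (e/2))"
  have U: "open U" "U \<noteq> {}" using attractor_props(1) e by (auto simp: U_def)
  have bU: "bounded U"
  proof -
    obtain B where B: "\<And>x. x \<in> ?K \<Longrightarrow> norm x \<le> B"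
      using compact_imp_bounded[OF attractor_props(2)] by (auto simp: bounded_iff)
    have "norm y \<le> B + e/2" if y: "y \<in> U" for y
    proof -
      obtain x where x: "x \<in> ?K" "dist x y < e/2" using y unfolding U_def UN_iff mem_ball by blast
      have "norm y \<le> norm x + dist x y" by (metis dist_norm norm_triangle_sub dist_commute)
      then show ?thesis using B[OF x(1)] x by simp
    qed
    then show ?thesis by (auto simp: bounded_iff)
  qed
  have near: "\<exists>z\<in>?K. dist (?f i z) y < e/2" if y: "y \<in> ?f i ` U" for i y
  proof -
    obtain x z where "z \<in> ?K" "dist z x < e/2" "y = ?f i x" using y unfolding U_def image_iff Bex_def UN_iff mem_ball by blast
    moreover have "dist (?f i z) (?f i x) \<le> dist z x"
    proof -
      have "dist (?f i z) (?f i x) \<le> sv1 (A $ i) * dist z x" by (simp add: dist_norm affine_ifs_diff norm_le_sv1)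
      also have "\<dots> \<le> 1 * dist z x" using contr[of i] by (intro mult_right_mono) auto
      finally show ?thesis by simp
    qed
    ultimately show ?thesis by (intro bexI[of _ z]) auto
  qed
  have sub: "?f i ` U \<subseteq> U" for i
  proof
    fix y assume "y \<in> ?f i ` U"
    then obtain z where "z \<in> ?K" "dist (?f i z) y < e/2" using near by meson
    then show "y \<in> U" unfolding U_def UN_iff mem_ball using affine_ifs_attractor by blast
  qed
  have disj: "?f i ` U \<inter> ?f j ` U = {}" if "i \<noteq> j" for i j
  proof (rule ccontr)
    assume "\<not> ?thesis"
    then obtain y where "y \<in> ?f i ` U" "y \<in> ?f j ` U" by blast
    then obtain z z' where "z \<in> ?K" "z' \<in> ?K" "dist (?f i z) y < e/2" "dist (?f j z') y < e/2" using near by meson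
    then show False using e(2)[of z z' i j] that dist_triangle2[of "?f i z" "?f j z'" y] by simp
  qed
  have mU: "U \<in> lmeasurable" using U bU by (simp add: lmeasurable_open)
  have img: "?f i ` U = (\<lambda>x. t $ i + x) ` ((*v) (A $ i) ` U)" for i
    by (auto simp: affine_ifs_def image_image add.commute)
  have mi: "?f i ` U \<in> lmeasurable \<and> measure lebesgue (?f i ` U) = \<bar>det (A $ i)\<bar> * measure lebesgue U" for i
  proof -
    have lin: "linear ((*v) (A $ i))" by (rule matrix_vector_mul_linear)
    have "(*v) (A $ i) ` U \<in> lmeasurable" "measure lebesgue ((*v) (A $ i) ` U) = \<bar>det (A $ i)\<bar> * measure lebesgue U"
      using measurable_linear_image[OF lin mU] measure_linear_image[OF lin mU] by (simp_all add: matrix_of_matrix_vector_mul)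
    then show ?thesis unfolding img by (simp add: measurable_translation measure_translation)
  qed
  have "(\<Sum>i\<in>UNIV. \<bar>det (A $ i)\<bar>) * measure lebesgue U = (\<Sum>i\<in>UNIV. measure lebesgue (?f i ` U))"
    using mi by (simp add: sum_distrib_right)
  also have "\<dots> = measure lebesgue (\<Union>i. ?f i ` U)"
    using mi disj by (intro measure_UNION'[symmetric]) (auto simp: pairwise_def disjnt_def)
  also have "\<dots> \<le> measure lebesgue U"
    using mi sub mU by (intro measure_mono_fmeasurable) (auto intro!: fmeasurableD fmeasurable.finite_UN)
  finally have le: "(\<Sum>i\<in>UNIV. \<bar>det (A $ i)\<bar>) * measure lebesgue U \<le> 1 * measure lebesgue U" by simp
  have "measure lebesgue U > 0"
    using U mU by (metis negligible_iff_measure open_not_negligible zero_less_measure_iff)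
  with le show ?thesis by simp
qed

text \<open>At s = 2 the singular value function is |det|, which is multiplicative, so the sums are
  powers of the quantity bounded in \<open>sum_det_le_1\<close>. The bound keeps all exponents used
  below the dimension in the range where \<open>svf\<close> has its first two forms.\<close>

lemma affinity_dim_le_2:
  assumes "strong_separation (affine_ifs A t)" "CARD('n) \<ge> 2"
  shows "affinity_dim A \<le> 2"
proof -
  have "svsum A 2 n \<le> 1" for n
  proof -
    have sv: "svf 2 B = \<bar>det B\<bar>" if "det B \<noteq> 0" for B
      using that sv1_pos[OF that] sv2_pos[OF that] by (simp add: svf_def sv_prod)
    have "svsum A 2 n = (\<Sum>i\<in>UNIV. \<bar>det (A $ i)\<bar>) ^ n"
    proof (induction n)
      case 0
      then show ?case by (simp add: svsum_def sv)
    next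
      case (Suc n)
      have w1: "words UNIV 1 = (\<lambda>i. [i]) ` (UNIV :: 'n set)" by (auto simp: words_def length_Suc_conv)
      have "svsum A 2 (1 + n) = (\<Sum>i\<in>UNIV. \<Sum>w\<in>words UNIV n. \<bar>det (A $ i)\<bar> * \<bar>det (word_product A w)\<bar>)"
        unfolding svsum_def sum_words_add w1
        by (subst sum.reindex) (auto simp: inj_on_def sv det_word_product nonsing det_mul abs_mult)
      also have "\<dots> = (\<Sum>i\<in>UNIV. \<bar>det (A $ i)\<bar>) * svsum A 2 n"
        by (simp add: svsum_def sv det_word_product nonsing sum_product)
      finally show ?case using Suc by simp
    qed
    then show ?thesis using sum_det_le_1[OF assms(1)] by (simp add: power_le_one sum_nonneg)
  qed
  then have "ln (svsum A 2 n) / real n \<le> 0" for n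
    using svsum_pos[OF nonsing contr, of 2 n] by (auto intro!: divide_nonpos_nonneg)
  then have "pressure A 2 \<le> 0"
    by (intro LIMSEQ_le_const2[OF pressure_limit[OF nonsing contr]]) auto
  then show ?thesis using affinity_dim_props(3)[OF nonsing contr assms(2), of 2] by force
qed

end

section \<open>Box dimension, correlations and Hausdorff dimension\<close>

lemma covering_number_le:
  assumes "finite C" "E \<subseteq> \<Union>C" "\<And>U. U \<in> C \<Longrightarrow> bounded U \<and> diameter U \<le> \<delta>"
  shows "covering_number \<delta> E \<le> card C"
  unfolding covering_number_def by (rule cInf_lower) (use assms in auto)

lemma diameter_le_dist:
  assumes "0 \<le> d" "\<And>x y. x \<in> S \<Longrightarrow> y \<in> S \<Longrightarrow> dist x y \<le> d"
  shows "diameter S \<le> d"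
  using assms by (auto simp: diameter_def intro!: cSUP_least)

lemma covering_number_attained:
  fixes E :: "'a::metric_space set"
  assumes "compact E" "\<delta> > 0"
  obtains C where "finite C" "E \<subseteq> \<Union>C" "\<And>U. U \<in> C \<Longrightarrow> bounded U \<and> diameter U \<le> \<delta>"
    "card C = covering_number \<delta> E"
proof -
  let ?S = "{card C | C. finite C \<and> E \<subseteq> \<Union>C \<and> (\<forall>U\<in>C. bounded U \<and> diameter U \<le> \<delta>)}"
  have "E \<subseteq> (\<Union>x\<in>E. ball x (\<delta>/2))" using assms(2) by auto
  then obtain k where k: "finite k" "k \<subseteq> E" "E \<subseteq> (\<Union>x\<in>k. ball x (\<delta>/2))"
    using compactE_image[OF assms(1), of E "\<lambda>x. ball x (\<delta>/2)"] by (metis open_ball)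
  have d: "bounded (ball x (\<delta>/2)) \<and> diameter (ball x (\<delta>/2)) \<le> \<delta>" for x :: 'a
  proof
    show "diameter (ball x (\<delta>/2)) \<le> \<delta>"
    proof (rule diameter_le_dist)
      fix y z assume "y \<in> ball x (\<delta>/2)" "z \<in> ball x (\<delta>/2)"
      then show "dist y z \<le> \<delta>" using dist_triangle3[of y z x] by simp
    qed (use assms in auto)
  qed simp
  have "card ((\<lambda>x. ball x (\<delta>/2)) ` k) \<in> ?S" using k d by blast
  then have "covering_number \<delta> E \<in> ?S" unfolding covering_number_def by (intro Inf_nat_def1) blast
  then show thesis using that by force
qed

lemma covering_number_pos:
  assumes "compact (E::'a::metric_space set)" "\<delta> > 0" "E \<noteq> {}"
  shows "0 < covering_number \<delta> E"
proof -
  obtain C where C: "finite C" "E \<subseteq> \<Union>C" "card C = covering_number \<delta> E"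
    using covering_number_attained[OF assms(1,2)] by metis
  then have "C \<noteq> {}" using assms(3) by auto
  then show ?thesis using C by (metis card_gt_0_iff)
qed

lemma hausdorff_premeasure_le_covering:
  fixes E :: "'a::metric_space set"
  assumes "compact E" "0 < \<delta>" "\<delta> \<le> \<delta>'" "0 < t"
  shows "hausdorff_premeasure \<delta>' t E \<le> ennreal (real (covering_number \<delta> E) * \<delta> powr t)"
proof -
  obtain C where C: "finite C" "E \<subseteq> \<Union>C" "\<And>U. U \<in> C \<Longrightarrow> bounded U \<and> diameter U \<le> \<delta>"
    "card C = covering_number \<delta> E" using covering_number_attained[OF assms(1,2)] by metis
  obtain h where h: "bij_betw h {..<card C} C"
    using ex_bij_betw_nat_finite[OF C(1)] by (auto simp: atLeast0LessThan)
  \<comment> \<open>Padding by empty sets is free, since they have \<open>diam_weight\<close>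
    0.\<close>
  define U where "U i = (if i < card C then h i else {})" for i
  have hC: "h i \<in> C" if "i < card C" for i using h that by (auto simp: bij_betw_def)
  have "C = h ` {..<card C}" using h by (simp add: bij_betw_def)
  then have "\<Union>C \<subseteq> (\<Union>i. U i)" by (force simp: U_def)
  moreover have "bounded (U i) \<and> diameter (U i) \<le> \<delta>'" for i
    using C(3)[OF hC, of i] assms(2,3) by (auto simp: U_def)
  ultimately have "U \<in> delta_covers \<delta>' E" using C(2) by (auto simp: delta_covers_def)
  then have "hausdorff_premeasure \<delta>' t E \<le> (\<Sum>i. diam_weight t (U i))"
    unfolding hausdorff_premeasure_def by (rule INF_lower)
  also have "\<dots> = (\<Sum>i<card C. diam_weight t (U i))"
    by (rule suminf_finite) (auto simp: U_def diam_weight_def)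
  also have "\<dots> \<le> (\<Sum>i<card C. ennreal (\<delta> powr t))"
  proof (rule sum_mono)
    fix i assume "i \<in> {..<card C}"
    then have "h i \<in> C" using hC by simp
    then have "diameter (U i) powr t \<le> \<delta> powr t"
      using C(3) \<open>i \<in> _\<close> assms by (intro powr_mono2) (auto simp: U_def diameter_ge_0)
    then show "diam_weight t (U i) \<le> ennreal (\<delta> powr t)"
      using assms by (auto simp: diam_weight_def intro: ennreal_leI)
  qed
  also have "\<dots> = ennreal (real (covering_number \<delta> E) * \<delta> powr t)"
    by (simp add: C(4) ennreal_mult ennreal_of_nat_eq_real_of_nat)
  finally show ?thesis .
qed

lemma hausdorff_dim_le:
  assumes "0 \<le> s" "\<And>t. s < t \<Longrightarrow> hausdorff_measure t E = 0"
  shows "hausdorff_dim E \<le> ereal s"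
proof (rule ereal_le_epsilon2)
  fix e :: real assume "0 < e"
  then have "hausdorff_dim E \<le> ereal (s + e)"
    unfolding hausdorff_dim_def using assms by (intro Inf_lower) auto
  then show "hausdorff_dim E \<le> ereal s + ereal e" by simp
qed

text \<open>If s lay strictly between the two dimensions, arbitrarily fine covers by at most
  \<delta>^(-s) sets would annihilate the t-dimensional measure for every t > s. That s is
  nonnegative follows because a covering number is at least 1.\<close>

lemma hausdorff_dim_le_lower_box_dim:
  fixes E :: "'a::metric_space set"
  assumes "compact E" "E \<noteq> {}"
  shows "hausdorff_dim E \<le> lower_box_dim E"
proof (rule ccontr)
  let ?q = "\<lambda>\<delta>. ln (real (covering_number \<delta> E)) / (- ln \<delta>)"
  assume "\<not> ?thesis"
  then have "lower_box_dim E < hausdorff_dim E" by simp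
  then obtain s where s: "lower_box_dim E < ereal s" "ereal s < hausdorff_dim E"
    using ereal_dense2 by blast
  have freq: "frequently (\<lambda>\<delta>. ereal (?q \<delta>) < ereal s) (at_right 0)"
  proof (rule ccontr)
    assume "\<not> ?thesis"
    then have "eventually (\<lambda>\<delta>. ereal s \<le> ereal (?q \<delta>)) (at_right 0)"
      by (simp add: not_frequently not_less)
    then have "ereal s \<le> lower_box_dim E" unfolding lower_box_dim_def by (rule Liminf_bounded)
    with s(1) show False by simp
  qed
  have small: "\<exists>\<delta>. 0 < \<delta> \<and> \<delta> < e \<and> \<delta> < 1 \<and> ?q \<delta> < s" if "e > 0" for e :: real
  proof -
    have "eventually (\<lambda>\<delta>. 0 < \<delta> \<and> \<delta> < e \<and> \<delta> < 1) (at_right (0::real))"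
      using that by (auto simp: eventually_at_right_field intro!: exI[of _ "min e 1"])
    from frequently_eventually_frequently[OF freq this] show ?thesis
      using frequently_ex by (force dest: frequently_ex)
  qed
  have N: "real (covering_number \<delta> E) \<le> \<delta> powr (- s) \<and> 0 \<le> s" if "0 < \<delta>" "\<delta> < 1" "?q \<delta> < s" for \<delta>
  proof -
    have N1: "1 \<le> real (covering_number \<delta> E)" using covering_number_pos[OF assms(1) that(1) assms(2)] by simp
    have l: "- ln \<delta> > 0" using that by simp
    then have "ln (real (covering_number \<delta> E)) < s * (- ln \<delta>)" using that(3) by (simp only: pos_divide_less_eq[OF l])
    also have "\<dots> = ln (\<delta> powr (- s))" using that by (simp add: ln_powr)
    finally have "real (covering_number \<delta> E) < \<delta> powr (- s)" using N1 that by (subst (asm) ln_less_cancel_iff) auto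
    moreover have "0 \<le> ?q \<delta>" using N1 l by (intro divide_nonneg_pos) auto
    ultimately show ?thesis using that by auto
  qed
  have "0 \<le> s" using small[of 1] N by auto
  have "hausdorff_measure t E = 0" if t: "s < t" for t
  proof -
    have "hausdorff_premeasure \<delta>' t E = 0" if "\<delta>' > 0" for \<delta>'
    proof -
      have le: "hausdorff_premeasure \<delta>' t E \<le> ennreal e" if e: "e > 0" for e
      proof -
        obtain \<delta> where \<delta>: "0 < \<delta>" "\<delta> < min \<delta>' (e powr (1 / (t - s)))" "\<delta> < 1" "?q \<delta> < s"
          using small[of "min \<delta>' (e powr (1 / (t - s)))"] \<open>\<delta>' > 0\<close> e by auto
        have "hausdorff_premeasure \<delta>' t E \<le> ennreal (real (covering_number \<delta> E) * \<delta> powr t)"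
          using \<delta> t \<open>0 \<le> s\<close> by (intro hausdorff_premeasure_le_covering assms) auto
        also have "real (covering_number \<delta> E) * \<delta> powr t \<le> \<delta> powr (- s) * \<delta> powr t"
          using N[OF \<delta>(1,3,4)] by (intro mult_right_mono) auto
        also have "\<dots> = \<delta> powr (t - s)" by (simp flip: powr_add)
        also have "\<dots> \<le> (e powr (1 / (t - s))) powr (t - s)" using \<delta> t by (intro powr_mono2) auto
        also have "\<dots> = e" using e t by (simp add: powr_powr)
        finally show ?thesis by (simp add: ennreal_leI)
      qed
      have "hausdorff_premeasure \<delta>' t E \<le> 0"
      proof (rule ennreal_le_epsilon)
        fix e :: real assume "0 < e"
        then show "hausdorff_premeasure \<delta>' t E \<le> 0 + ennreal e" using le by simp
      qed
      then show ?thesis by simp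
    qed
    then have "hausdorff_measure t E \<le> 0"
      unfolding hausdorff_measure_def by (intro SUP_least) simp
    then show ?thesis by simp
  qed
  then have "hausdorff_dim E \<le> ereal s" using \<open>0 \<le> s\<close> by (intro hausdorff_dim_le)
  with s(2) show False by simp
qed

lemma upper_box_dim_le:
  fixes E :: "'a::metric_space set"
  assumes "compact E" "E \<noteq> {}" "0 < C" "0 < \<delta>0"
    and le: "\<And>\<delta>. 0 < \<delta> \<Longrightarrow> \<delta> < \<delta>0 \<Longrightarrow> real (covering_number \<delta> E) \<le> C * \<delta> powr (- s)"
  shows "upper_box_dim E \<le> ereal s"
proof -
  let ?q = "\<lambda>\<delta>. ln (real (covering_number \<delta> E)) / (- ln \<delta>)"
  have "eventually (\<lambda>\<delta>. ereal (?q \<delta>) \<le> ereal (ln C / (- ln \<delta>) + s)) (at_right 0)"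
    unfolding eventually_at_right_field
  proof (intro exI[of _ "min \<delta>0 1"] conjI allI impI)
    fix \<delta> assume \<delta>: "0 < \<delta>" "\<delta> < min \<delta>0 1"
    have N1: "0 < real (covering_number \<delta> E)" using covering_number_pos[OF assms(1) \<delta>(1) assms(2)] by simp
    have "ln (real (covering_number \<delta> E)) \<le> ln (C * \<delta> powr (- s))"
      using le[of \<delta>] \<delta> N1 assms by (subst ln_le_cancel_iff) auto
    also have "\<dots> = ln C + s * (- ln \<delta>)" using assms \<delta> by (simp add: ln_mult_pos ln_powr)
    finally have "?q \<delta> \<le> (ln C + s * (- ln \<delta>)) / (- ln \<delta>)" using \<delta> by (intro divide_right_mono) auto
    also have "\<dots> = ln C / (- ln \<delta>) + s" using \<delta> by (simp add: field_simps)
    finally show "ereal (?q \<delta>) \<le> ereal (ln C / (- ln \<delta>) + s)" by simp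
  qed (use assms in auto)
  then have "upper_box_dim E \<le> Limsup (at_right 0) (\<lambda>\<delta>. ereal (ln C / (- ln \<delta>) + s))"
    unfolding upper_box_dim_def by (rule Limsup_mono)
  also have "\<dots> = ereal s"
  proof (rule lim_imp_Limsup)
    have "((\<lambda>\<delta>. ln C / (- ln \<delta>)) \<longlongrightarrow> 0) (at_right (0::real))"
    proof (rule tendsto_divide_0[OF tendsto_const])
      show "filterlim (\<lambda>\<delta>. - ln \<delta>) at_infinity (at_right (0::real))"
        using ln_at_0 by (intro filterlim_at_top_imp_at_infinity) (simp add: filterlim_uminus_at_top)
    qed
    then have "((\<lambda>\<delta>. ln C / (- ln \<delta>) + s) \<longlongrightarrow> 0 + s) (at_right (0::real))"
      by (intro tendsto_intros)
    then show "((\<lambda>\<delta>. ereal (ln C / (- ln \<delta>) + s)) \<longlongrightarrow> ereal s) (at_right (0::real))" by simp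
  qed simp
  finally show ?thesis .
qed

section \<open>Correlation decay and Hausdorff dimension\<close>

definition pairs_within :: "real \<Rightarrow> ('a::metric_space \<times> 'a) set" where
  "pairs_within r = {p. dist (fst p) (snd p) \<le> r}"

lemma pairs_within_measurable [measurable]:
  "pairs_within r \<in> sets (borel \<Otimes>\<^sub>M (borel :: 'a::{second_countable_topology,metric_space} measure))"
  unfolding pairs_within_def borel_prod
  by (intro borel_closed closed_Collect_le continuous_intros)

text \<open>Every nonempty set has weight 1 for s = 0, so a cover of total weight below 1 consists
  of empty sets. This disposes of s = 0 in the lower bound for the dimension.\<close>

lemma hausdorff_measure_0_imp_empty:
  assumes "hausdorff_measure 0 E = 0"
  shows "E = {}"
proof -
  have "hausdorff_premeasure 1 0 E \<le> hausdorff_measure 0 E"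
    unfolding hausdorff_measure_def by (rule SUP_upper) simp
  then have "hausdorff_premeasure 1 0 E < 1" using assms by (simp add: zero_less_one)
  then obtain U where U: "U \<in> delta_covers 1 E" "(\<Sum>i. diam_weight 0 (U i)) < 1"
    unfolding hausdorff_premeasure_def INF_less_iff by blast
  have "U i = {}" for i
  proof (rule ccontr)
    assume "U i \<noteq> {}"
    then have "1 = (\<Sum>j\<in>{i}. diam_weight 0 (U j))" by (simp add: diam_weight_def)
    also have "\<dots> \<le> (\<Sum>i. diam_weight 0 (U i))" by (intro sum_le_suminf) auto
    finally show False using U(2) by simp
  qed
  then show ?thesis using U(1) by (auto simp: delta_covers_def)
qed

text \<open>The integral of the measure of balls of radius r is the correlation at r. Markov's
  inequality bounds the set \<open>B k\<close> of points with too heavy a ball at scale 2^(-k) by C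
  * \<theta>^k with \<theta> = 2^(s - D) < 1, and a tail of this series is below 1.\<close>

lemma regular_points_positive:
  fixes \<nu> :: "'a::{second_countable_topology,metric_space} measure"
  assumes "prob_space \<nu>" and sets[measurable_cong]: "sets \<nu> = sets borel" and "s < D"
    and corr: "\<And>r. 0 < r \<Longrightarrow> r \<le> 1 \<Longrightarrow> measure (\<nu> \<Otimes>\<^sub>M \<nu>) (pairs_within r) \<le> C * r powr D"
  obtains k0 where "{x. \<forall>k\<ge>k0. emeasure \<nu> (cball x (1/2^k)) \<le> ennreal ((1/2^k) powr s)} \<in> sets borel"
    "0 < emeasure \<nu> {x. \<forall>k\<ge>k0. emeasure \<nu> (cball x (1/2^k)) \<le> ennreal ((1/2^k) powr s)}"
proof -
  interpret prob_space \<nu> by fact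
  interpret P: pair_prob_space \<nu> \<nu> ..
  have sp: "space \<nu> = UNIV" using sets_eq_imp_space_eq[OF sets] by simp
  define f where "f k x = emeasure \<nu> (cball x (1/2^k))" for k x
  have fP: "f k x = emeasure \<nu> (Pair x -` pairs_within (1/2^k))" for k x
    by (auto simp: f_def pairs_within_def intro!: arg_cong[where f = "emeasure \<nu>"])
  have f_meas[measurable]: "f k \<in> borel_measurable \<nu>" for k
    unfolding fP by (rule measurable_emeasure_Pair) measurable
  have f_int: "(\<integral>\<^sup>+x. f k x \<partial>\<nu>) \<le> ennreal (C * (1/2^k) powr D)" for k
  proof -
    have "(\<integral>\<^sup>+x. f k x \<partial>\<nu>) = emeasure (\<nu> \<Otimes>\<^sub>M \<nu>) (pairs_within (1/2^k))"
      unfolding fP by (rule emeasure_pair_measure_alt[symmetric]) measurable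
    also have "\<dots> \<le> ennreal (C * (1/2^k) powr D)"
      unfolding P.emeasure_eq_measure by (intro ennreal_leI corr) auto
    finally show ?thesis .
  qed
  define B where "B k = {x. \<not> f k x \<le> ennreal ((1/2^k) powr s)}" for k
  have B_meas[measurable]: "B k \<in> sets \<nu>" for k
  proof -
    have "{x\<in>space \<nu>. \<not> f k x \<le> ennreal ((1/2^k) powr s)} \<in> sets \<nu>" by measurable
    then show ?thesis by (simp add: B_def sp)
  qed
  define \<theta> where "\<theta> = (1/2) powr (D - s)"
  have \<theta>: "0 < \<theta>" "\<theta> < 1" using assms(3) by (auto simp: \<theta>_def powr_def ln_div mult_pos_pos)
  have C0: "0 \<le> C"
  proof -
    have "0 \<le> measure (\<nu> \<Otimes>\<^sub>M \<nu>) (pairs_within 1)" by simp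
    also have "\<dots> \<le> C" using corr[of 1] by simp
    finally show ?thesis .
  qed
  have B_le: "emeasure \<nu> (B k) \<le> ennreal (C * \<theta> ^ k)" for k
  proof -
    define a where "a = (1/2^k) powr s"
    have a: "a > 0" by (simp add: a_def)
    have "emeasure \<nu> (B k) \<le> emeasure \<nu> {x\<in>space \<nu>. 1 \<le> ennreal (1/a) * f k x}"
    proof (rule emeasure_mono)
      have "1 \<le> ennreal (1/a) * y" if "\<not> y \<le> ennreal a" for y
      proof -
        have "ennreal (1/a) * ennreal a \<le> ennreal (1/a) * y" using that by (intro mult_left_mono) auto
        then show ?thesis using a by (simp flip: ennreal_mult)
      qed
      then show "B k \<subseteq> {x\<in>space \<nu>. 1 \<le> ennreal (1/a) * f k x}" by (auto simp: B_def a_def[symmetric] sp)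
    qed measurable
    also have "\<dots> \<le> ennreal (1/a) * (\<integral>\<^sup>+x. f k x \<partial>\<nu>)"
      using nn_integral_Markov_inequality[of "f k" "space \<nu>" \<nu> "ennreal (1/a)"] 
      by (simp add: sp)
    also have "\<dots> \<le> ennreal (1/a) * ennreal (C * (1/2^k) powr D)" by (intro mult_left_mono f_int) simp
    also have "\<dots> = ennreal (1/a * (C * (1/2^k) powr D))" using a C0 by (intro ennreal_mult[symmetric]) auto
    also have "1/a * (C * (1/2^k) powr D) = C * ((1/2^k) powr D / (1/2^k) powr s)" by (simp add: a_def)
    also have "(1/2^k) powr D / (1/2^k) powr s = (1/2^k) powr (D - s)" by (simp add: powr_diff)
    also have "\<dots> = \<theta> ^ k"
    proof -
      have "(1/2^k::real) = (1/2) powr k" by (simp add: powr_realpow power_one_over)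
      then show ?thesis by (simp add: \<theta>_def powr_powr mult.commute flip: powr_realpow)
    qed
    finally show ?thesis .
  qed
  obtain k0 where k0: "C * \<theta> ^ k0 / (1 - \<theta>) < 1"
  proof -
    have "(\<lambda>k. C * \<theta> ^ k / (1 - \<theta>)) \<longlonglongrightarrow> C * 0 / (1 - \<theta>)"
      using \<theta> by (intro tendsto_intros LIMSEQ_realpow_zero) auto
    then have "eventually (\<lambda>k. C * \<theta> ^ k / (1 - \<theta>) < 1) sequentially" by (intro order_tendstoD) auto
    then show thesis using that by (auto simp: eventually_sequentially)
  qed
  let ?G = "{x. \<forall>k\<ge>k0. f k x \<le> ennreal ((1/2^k) powr s)}"
  have Gc: "space \<nu> - ?G = (\<Union>j. B (j + k0))" 
    by (auto simp: sp B_def) (metis le_add_diff_inverse2)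
  have G_meas: "?G \<in> sets \<nu>"
  proof -
    have "{x\<in>space \<nu>. \<forall>k\<ge>k0. f k x \<le> ennreal ((1/2^k) powr s)} \<in> sets \<nu>" by measurable
    then show ?thesis by (simp add: sp)
  qed
  have "emeasure \<nu> (space \<nu> - ?G) \<le> (\<Sum>j. emeasure \<nu> (B (j + k0)))"
    unfolding Gc by (intro emeasure_subadditive_countably) auto
  also have "\<dots> \<le> (\<Sum>j. ennreal (C * \<theta> ^ k0 * \<theta> ^ j))"
    by (intro suminf_le order_trans[OF B_le]) (auto simp: power_add algebra_simps)
  also have "\<dots> = ennreal (C * \<theta> ^ k0 * (1 / (1 - \<theta>)))"
    using \<theta> C0 by (intro suminf_ennreal_eq sums_mult geometric_sums) auto
  also have "\<dots> < 1" using k0 by (simp add: ennreal_lessI flip: ennreal_1)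
  finally have "emeasure \<nu> (space \<nu> - ?G) < 1" .
  moreover have "emeasure \<nu> ?G + emeasure \<nu> (space \<nu> - ?G) = 1"
    using G_meas by (subst plus_emeasure) (auto simp: sp emeasure_space_1[unfolded sp] Un_absorb1)
  ultimately have "emeasure \<nu> ?G \<noteq> 0" by auto
  then have "0 < emeasure \<nu> ?G" by (simp add: zero_less_iff_neq_zero)
  moreover have "?G \<in> sets borel" using G_meas sets by simp
  ultimately show thesis unfolding f_def by (intro that[of k0])
qed

lemma dyadic_scale:
  fixes d :: real
  assumes "0 < d" "d \<le> 1 / 2 ^ k0"
  obtains k :: nat where "k \<ge> k0" "d \<le> 1 / 2 ^ k" "1 / 2 ^ k < 2 * d"
proof -
  obtain m :: nat where m: "(1/2::real) ^ m < d" using real_arch_pow_inv[OF assms(1), of "1/2"] by auto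
  define k where "k = (GREATEST k. d \<le> 1 / 2 ^ k)"
  have bound: "j \<le> m" if "d \<le> 1 / 2 ^ j" for j :: nat
  proof (rule ccontr)
    assume "\<not> j \<le> m"
    then have "(1/2::real) ^ j \<le> (1/2) ^ m" by (intro power_decreasing) auto
    then show False using m that by (simp add: power_one_over)
  qed
  have "d \<le> 1 / 2 ^ k" unfolding k_def
    by (rule GreatestI_nat[where P = "\<lambda>k. d \<le> 1 / 2 ^ k", OF assms(2) bound])
  moreover have "k0 \<le> k" unfolding k_def
    by (rule Greatest_le_nat[where P = "\<lambda>k. d \<le> 1 / 2 ^ k", OF assms(2) bound])
  moreover have "\<not> d \<le> 1 / 2 ^ Suc k"
    using Greatest_le_nat[of "\<lambda>k. d \<le> 1 / 2 ^ k" "Suc k" m] bound by (auto simp: k_def)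
  ultimately show thesis using that[of k] by (auto simp: field_simps)
qed

text \<open>The mass distribution principle, applied to the part of \<open>E\<close> inside the set
  of regular points: each covering set is enclosed in a ball around one of its regular points, whose
  measure is comparable with the weight of the set.\<close>

lemma correlation_imp_hausdorff_dim_ge:
  fixes \<nu> :: "'a::{second_countable_topology,metric_space} measure"
  assumes \<nu>: "prob_space \<nu>" "sets \<nu> = sets borel"
    and corr: "\<And>r. 0 < r \<Longrightarrow> r \<le> 1 \<Longrightarrow> measure (\<nu> \<Otimes>\<^sub>M \<nu>) (pairs_within r) \<le> C * r powr D"
    and E: "E \<in> sets borel" "emeasure \<nu> E = 1"
  shows "ereal D \<le> hausdorff_dim E"
  unfolding hausdorff_dim_def
proof (rule Inf_greatest, safe)
  fix s :: real assume s: "0 \<le> s" "hausdorff_measure s E = 0"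
  interpret prob_space \<nu> by fact
  show "ereal D \<le> ereal s"
  proof (rule ccontr)
    assume "\<not> ?thesis"
    then have "s < D" by simp
    have "s > 0" using s hausdorff_measure_0_imp_empty[of E] E(2)
      by (metis emeasure_empty less_eq_real_def zero_neq_one)
    obtain k0 where k00: "{x. \<forall>k\<ge>k0. emeasure \<nu> (cball x (1/2^k)) \<le> ennreal ((1/2^k) powr s)} \<in> sets borel"
      "0 < emeasure \<nu> {x. \<forall>k\<ge>k0. emeasure \<nu> (cball x (1/2^k)) \<le> ennreal ((1/2^k) powr s)}"
      by (rule regular_points_positive[OF \<nu> \<open>s < D\<close> corr])
    define G where "G = {x. \<forall>k\<ge>k0. emeasure \<nu> (cball x (1/2^k)) \<le> ennreal ((1/2^k) powr s)}"
    have k0: "G \<in> sets borel" "0 < emeasure \<nu> G" using k00 unfolding G_def .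
    have G: "emeasure \<nu> (cball x (1/2^k)) \<le> ennreal ((1/2^k) powr s)" if "x \<in> G" "k0 \<le> k" for x k
      using that by (simp add: G_def)
    have ball: "emeasure \<nu> (cball x d) \<le> ennreal (2 powr s * d powr s)"
      if x: "x \<in> G" and d: "0 \<le> d" "d \<le> 1 / 2 ^ k0" for x d
    proof (cases "d = 0")
      \<comment> \<open>A covering set may be a single point. Its weight is 0 since s > 0, so
        regular points must be shown to carry no mass.\<close>
      case True
      have small: "emeasure \<nu> (cball x d) \<le> ennreal e" if "e > 0" for e
      proof -
        obtain m where m: "(1/2::real) ^ m < e powr (1/s)" using real_arch_pow_inv[of "e powr (1/s)" "1/2"] \<open>e > 0\<close> by auto
        define k where "k = max k0 m"
        have "emeasure \<nu> (cball x d) \<le> emeasure \<nu> (cball x (1/2^k))"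
          using True by (intro emeasure_mono subset_cball) (auto simp: \<nu>)
        also have "\<dots> \<le> ennreal ((1/2^k) powr s)" by (rule G[OF x]) (simp add: k_def)
        also have "(1/2^k) powr s \<le> (e powr (1/s)) powr s"
        proof (intro powr_mono2)
          have "(1/2::real)^k \<le> (1/2)^m" by (intro power_decreasing) (auto simp: k_def)
          then show "1/2^k \<le> e powr (1/s)" using m by (simp add: power_one_over)
        qed (use \<open>s > 0\<close> in auto)
        also have "\<dots> = e" using \<open>s > 0\<close> that by (simp add: powr_powr)
        finally show ?thesis by (simp add: ennreal_leI)
      qed
      have "emeasure \<nu> (cball x d) \<le> 0"
      proof (rule ennreal_le_epsilon)
        fix e :: real assume "0 < e"
        then show "emeasure \<nu> (cball x d) \<le> 0 + ennreal e" using small by simp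
      qed
      then show ?thesis by simp
    next
      case False
      then have "0 < d" using d by simp
      then obtain k where k: "k \<ge> k0" "d \<le> 1 / 2 ^ k" "1 / 2 ^ k < 2 * d"
        by (rule dyadic_scale[OF _ d(2)])
      have "emeasure \<nu> (cball x d) \<le> emeasure \<nu> (cball x (1/2^k))"
        using k by (intro emeasure_mono subset_cball) (auto simp: \<nu>)
      also have "\<dots> \<le> ennreal ((1/2^k) powr s)" by (rule G[OF x k(1)])
      also have "(1/2^k) powr s \<le> (2 * d) powr s" using k \<open>s > 0\<close> by (intro powr_mono2) auto
      also have "\<dots> = 2 powr s * d powr s" using d by (simp add: powr_mult)
      finally show ?thesis by (simp add: ennreal_leI)
    qed
    have le: "emeasure \<nu> G \<le> ennreal (2 powr s) * (\<Sum>i. diam_weight s (U i))"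
      if U: "U \<in> delta_covers (1 / 2 ^ k0) E" for U
    proof -
      have "\<forall>i. \<exists>x. U i \<inter> G \<noteq> {} \<longrightarrow> x \<in> U i \<inter> G" by blast
      then obtain c where pick: "\<And>i. U i \<inter> G \<noteq> {} \<Longrightarrow> c i \<in> U i \<inter> G" by metis
      define V where "V i = (if U i \<inter> G = {} then {} else cball (c i) (diameter (U i)))" for i
      have Vm: "V i \<in> sets \<nu>" for i by (simp add: V_def \<nu>)
      have sub: "G \<inter> E \<subseteq> (\<Union>i. V i)"
      proof
        fix x assume x: "x \<in> G \<inter> E"
        then obtain i where i: "x \<in> U i" using U by (auto simp: delta_covers_def)
        then have ne: "U i \<inter> G \<noteq> {}" using x by blast
        have "dist (c i) x \<le> diameter (U i)"
          using pick[OF ne] i U by (intro diameter_bounded_bound) (auto simp: delta_covers_def)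
        then show "x \<in> (\<Union>i. V i)" using ne by (auto simp: V_def intro!: exI[of _ i])
      qed
      have "emeasure \<nu> G = emeasure \<nu> (G \<inter> E)"
      proof -
        have "AE x in \<nu>. x \<in> E" using E(2) by (subst AE_in_set_eq_1) (simp_all add: \<nu> E(1) measure_def)
        then show ?thesis using k0(1) E(1) by (intro emeasure_eq_AE) (auto simp: \<nu>)
      qed
      also have "\<dots> \<le> emeasure \<nu> (\<Union>i. V i)" using sub Vm by (intro emeasure_mono) auto
      also have "\<dots> \<le> (\<Sum>i. emeasure \<nu> (V i))" using Vm by (intro emeasure_subadditive_countably) auto
      also have "\<dots> \<le> (\<Sum>i. ennreal (2 powr s) * diam_weight s (U i))"
      proof (intro suminf_le allI)
        fix i
        show "emeasure \<nu> (V i) \<le> ennreal (2 powr s) * diam_weight s (U i)"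
        proof (cases "U i \<inter> G = {}")
          case False
          have "emeasure \<nu> (V i) \<le> ennreal (2 powr s * diameter (U i) powr s)"
            using pick[OF False] False U ball[of "c i" "diameter (U i)"]
            by (auto simp: V_def delta_covers_def diameter_ge_0)
          also have "\<dots> = ennreal (2 powr s) * diam_weight s (U i)"
            using False \<open>s > 0\<close> by (auto simp: diam_weight_def ennreal_mult)
          finally show ?thesis .
        qed (simp add: V_def)
      qed auto
      finally show ?thesis by (simp add: ennreal_suminf_cmult)
    qed
    have "hausdorff_premeasure (1 / 2 ^ k0) s E \<le> hausdorff_measure s E"
      unfolding hausdorff_measure_def by (rule SUP_upper) simp
    then have pm: "hausdorff_premeasure (1 / 2 ^ k0) s E = 0" using s by simp
    have "\<exists>e>0. ennreal (2 powr s) * ennreal e < emeasure \<nu> G"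
    proof -
      define g where "g = measure \<nu> G"
      have g: "emeasure \<nu> G = ennreal g" by (simp add: g_def emeasure_eq_measure)
      then have "g > 0" using k0(2) by simp
      then have "ennreal (2 powr s) * ennreal (g / (2 * 2 powr s)) < emeasure \<nu> G"
        unfolding g by (simp add: ennreal_lessI flip: ennreal_mult)
      then show ?thesis using \<open>g > 0\<close> by (intro exI[of _ "g / (2 * 2 powr s)"]) auto
    qed
    then obtain e where e: "e > 0" "ennreal (2 powr s) * ennreal e < emeasure \<nu> G" by blast
    have "hausdorff_premeasure (1 / 2 ^ k0) s E < ennreal e" using pm e by simp
    then obtain U where U: "U \<in> delta_covers (1 / 2 ^ k0) E" "(\<Sum>i. diam_weight s (U i)) < ennreal e"
      unfolding hausdorff_premeasure_def INF_less_iff by blast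
    have "emeasure \<nu> G \<le> ennreal (2 powr s) * ennreal e"
      using le[OF U(1)] U(2) by (meson mult_left_mono less_imp_le order_trans zero_le)
    with e(2) show False by simp
  qed
qed

text \<open>Geometric weights are positive at every index, so a set that is full for the mixture is
  full for each component.\<close>

lemma mixture_exists:
  fixes \<nu> :: "nat \<Rightarrow> 'a::topological_space measure"
  assumes "\<And>n. borel_prob_on K (\<nu> n)" "K \<in> sets borel"
  shows "\<exists>\<mu>. borel_prob_on K \<mu> \<and> (\<forall>E\<in>sets borel. emeasure \<mu> E = 1 \<longrightarrow> (\<forall>n. emeasure (\<nu> n) E = 1))"
proof -
  define g where "g = measure_pmf (geometric_pmf (1/2))"
  define \<mu> where "\<mu> = g \<bind> \<nu>"
  have p: "prob_space (\<nu> n)" and s: "sets (\<nu> n) = sets borel" and K: "emeasure (\<nu> n) K = 1" for n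
    using assms(1) by (auto simp: borel_prob_on_def)
  have k: "\<nu> \<in> g \<rightarrow>\<^sub>M prob_algebra borel"
    using p s by (auto simp: g_def space_prob_algebra measurable_def)
  have g: "g \<in> space (prob_algebra g)" by (simp add: space_prob_algebra g_def prob_space_measure_pmf)
  have em: "emeasure \<mu> E = (\<integral>\<^sup>+n. emeasure (\<nu> n) E \<partial>g)" if "E \<in> sets borel" for E
    unfolding \<mu>_def by (rule emeasure_bind_prob_algebra[OF g k that])
  have "prob_space \<mu>" unfolding \<mu>_def by (rule prob_space_bind'[OF g k])
  moreover have "sets \<mu> = sets borel" unfolding \<mu>_def by (rule sets_bind'[OF g k])
  moreover have "emeasure \<mu> K = 1"
    using em[OF assms(2)] by (simp add: K g_def measure_pmf.emeasure_space_1)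
  moreover have "emeasure (\<nu> n) E = 1" if E: "E \<in> sets borel" "emeasure \<mu> E = 1" for E n
  proof -
    have le: "emeasure (\<nu> n) E \<le> 1" for n
      using p s by (metis prob_space.emeasure_le_1)
    have "(\<integral>\<^sup>+n. 1 - emeasure (\<nu> n) E \<partial>g) = (\<integral>\<^sup>+n. 1 \<partial>g) - (\<integral>\<^sup>+n. emeasure (\<nu> n) E \<partial>g)"
      using em[OF E(1)] E(2) le by (intro nn_integral_diff) (auto simp: g_def)
    also have "\<dots> = 0" using em[OF E(1)] E(2) by (simp add: g_def measure_pmf.emeasure_space_1)
    finally have "AE n in g. 1 - emeasure (\<nu> n) E = 0"
      by (subst (asm) nn_integral_0_iff_AE) (auto simp: g_def)
    moreover have "set_pmf (geometric_pmf (1/2)) = UNIV" by (rule set_pmf_geometric) auto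
    ultimately have "1 - emeasure (\<nu> n) E = 0" unfolding g_def AE_measure_pmf_iff by blast
    then have "1 \<le> emeasure (\<nu> n) E" by (rule ennreal_minus_eq_0)
    then show ?thesis using le[of n] by (rule antisym[rotated])
  qed
  ultimately show ?thesis by (auto simp: borel_prob_on_def)
qed

text \<open>\<open>hausdorff_dim_measure\<close> is an infimum over sets of full measure, so one
  measure has to exclude every exponent below \<open>s0\<close> at once; this is why a mixture is
  formed. The chain from the dimension of the measure up to the upper box dimension then closes on
  itself.\<close>

lemma dimensions_coincide:
  fixes K :: "'a::{second_countable_topology,metric_space} set"
  assumes K: "compact K" "K \<noteq> {}" and s0: "0 < s0" and up: "upper_box_dim K \<le> ereal s0"
    and lo: "\<And>s. 0 < s \<Longrightarrow> s < s0 \<Longrightarrow> \<exists>\<nu> C. borel_prob_on K \<nu> \<and>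
      (\<forall>r. 0 < r \<longrightarrow> r \<le> 1 \<longrightarrow> measure (\<nu> \<Otimes>\<^sub>M \<nu>) (pairs_within r) \<le> C * r powr s)"
  shows "\<exists>\<nu>. borel_prob_on K \<nu> \<and> hausdorff_dim_measure \<nu> = hausdorff_dim K \<and>
    hausdorff_dim K = ereal s0 \<and> has_box_dim K (ereal s0)"
proof -
  define s where "s n = s0 * (1 - 1 / real (n + 2))" for n
  have s: "0 < s n" "s n < s0" for n using s0 by (auto simp: s_def field_simps intro: add_pos_nonneg)
  have slim: "s \<longlonglongrightarrow> s0"
  proof -
    have "(\<lambda>n. s0 * (1 - 1 / real (n + 2))) \<longlonglongrightarrow> s0 * (1 - 0)"
      by (intro tendsto_intros LIMSEQ_ignore_initial_segment[OF lim_1_over_n])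
    then show ?thesis by (simp add: s_def[abs_def])
  qed
  have "\<forall>n. \<exists>\<nu> C. borel_prob_on K \<nu> \<and>
      (\<forall>r. 0 < r \<longrightarrow> r \<le> 1 \<longrightarrow> measure (\<nu> \<Otimes>\<^sub>M \<nu>) (pairs_within r) \<le> C * r powr s n)"
    using lo s by blast
  then obtain \<nu> C where \<nu>: "\<And>n. borel_prob_on K (\<nu> n)"
    "\<And>n r. 0 < r \<Longrightarrow> r \<le> 1 \<Longrightarrow> measure (\<nu> n \<Otimes>\<^sub>M \<nu> n) (pairs_within r) \<le> C n * r powr s n"
    by metis
  have Kb: "K \<in> sets borel" using K(1) by (simp add: borel_compact)
  obtain \<mu> where \<mu>: "borel_prob_on K \<mu>" "\<And>E n. E \<in> sets borel \<Longrightarrow> emeasure \<mu> E = 1 \<Longrightarrow> emeasure (\<nu> n) E = 1"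
    using mixture_exists[of K \<nu>, OF \<nu>(1) Kb] by blast
  have dimE: "ereal s0 \<le> hausdorff_dim E" if E: "E \<in> sets borel" "emeasure \<mu> E = 1" for E
  proof (rule LIMSEQ_le_const2)
    show "(\<lambda>n. ereal (s n)) \<longlonglongrightarrow> ereal s0" using slim by simp
    have "ereal (s n) \<le> hausdorff_dim E" for n
    proof (rule correlation_imp_hausdorff_dim_ge)
      show "prob_space (\<nu> n)" "sets (\<nu> n) = sets borel" using \<nu>(1)[of n] by (simp_all add: borel_prob_on_def)
      show "emeasure (\<nu> n) E = 1" by (rule \<mu>(2)[OF E])
    qed (fact E(1) \<nu>(2))+
    then show "\<exists>N. \<forall>n\<ge>N. ereal (s n) \<le> hausdorff_dim E" by blast
  qed
  have 1: "ereal s0 \<le> hausdorff_dim_measure \<mu>"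
    unfolding hausdorff_dim_measure_def by (rule Inf_greatest) (use dimE in auto)
  have 2: "hausdorff_dim_measure \<mu> \<le> hausdorff_dim K"
    unfolding hausdorff_dim_measure_def by (rule Inf_lower) (use Kb \<mu>(1) in \<open>auto simp: borel_prob_on_def\<close>)
  have 3: "hausdorff_dim K \<le> lower_box_dim K" by (rule hausdorff_dim_le_lower_box_dim[OF K])
  have 4: "lower_box_dim K \<le> upper_box_dim K"
    unfolding lower_box_dim_def upper_box_dim_def by (rule Liminf_le_Limsup) simp
  note le = order_trans[OF 2 order_trans[OF 3 order_trans[OF 4 up]]]
    order_trans[OF 3 order_trans[OF 4 up]] order_trans[OF 4 up]
    order_trans[OF 1 2] order_trans[OF order_trans[OF 1 2] 3] order_trans[OF order_trans[OF order_trans[OF 1 2] 3] 4]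
  have "hausdorff_dim_measure \<mu> = ereal s0" "hausdorff_dim K = ereal s0"
    "lower_box_dim K = ereal s0" "upper_box_dim K = ereal s0"
    by (rule antisym[OF le(1) 1], rule antisym[OF le(2,4)], rule antisym[OF le(3,5)], rule antisym[OF up le(6)])
  with \<mu>(1) show ?thesis by (intro exI[of _ \<mu>]) (simp add: has_box_dim_def)
qed

section \<open>Transversality of directions\<close>

definition row_fun :: "real^2^2 \<Rightarrow> 2 \<Rightarrow> real" where "row_fun A i = A$i$1 + A$i$2"

text \<open>The perturbation direction of the transversality argument: it does not change the
  denominator of \<open>gm\<close>, so along it \<open>gm\<close> is merely translated.\<close>

definition shear :: "real^2^2 \<Rightarrow> real^2^2" where
  "shear B = (\<chi> i j. if j = 1 then row_fun B i else - row_fun B i)"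

lemma rowmix_row_fun: "rowmix A x = row_fun A 1 * x + row_fun A 2 * (1 - x)"
  by (simp add: rowmix_def row_fun_def)

lemma rowmix_shear: "rowmix (A + c *\<^sub>R shear B) x = rowmix A x"
  by (simp add: rowmix_def shear_def algebra_simps)

lemma gm_shear:
  "gm (A + c *\<^sub>R shear B) x = gm A x + c * (rowmix B x / rowmix A x)"
proof -
  have "(A + c *\<^sub>R shear B)$1$1 * x + (A + c *\<^sub>R shear B)$2$1 * (1 - x)
      = (A$1$1 * x + A$2$1 * (1 - x)) + c * rowmix B x"
    by (simp add: shear_def rowmix_row_fun algebra_simps)
  then show ?thesis unfolding gm_def rowmix_shear by (simp add: add_divide_distrib)
qed

text \<open>The first letter acts last. Words are read in the opposite order to
  \<open>word_product\<close>, so that two words with different first letters differ in their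
  outermost map, where a perturbation is felt without contraction.\<close>

definition dir :: "real^2^2^'n::finite \<Rightarrow> 'n list \<Rightarrow> real \<Rightarrow> real" where
  "dir A l x = foldr (\<lambda>i y. gm (A $ i) y) l x"

lemma dir_Nil [simp]: "dir A [] x = x"
  and dir_Cons [simp]: "dir A (i # l) x = gm (A $ i) (dir A l x)"
  and dir_append: "dir A (u @ l) x = dir A u (dir A l x)"
  by (simp_all add: dir_def)

lemma dir_mem:
  assumes "\<And>i. A $ i \<in> psgn" "x \<in> {0..1}"
  shows "dir A l x \<in> {0..1}"
  by (induction l) (use assms gm_mem in auto)

lemma word_product_psgn:
  assumes "\<And>i. A $ i \<in> psgn"
  shows "w \<noteq> [] \<Longrightarrow> word_product A w \<in> psgn"
proof (induction w)
  case (Cons i w)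
  then show ?case using assms by (cases "w = []") (auto intro: psgn_mult)
qed simp

lemma gm_mat1: "gm (mat 1) x = x"
  by (simp add: gm_def rowmix_def mat_def)

lemma gm_word_product:
  assumes "\<And>i. A $ i \<in> psgn" "x \<in> {0..1}"
  shows "gm (word_product A w) x = dir A (rev w) x"
proof (induction w rule: rev_induct)
  case (snoc i w)
  show ?case
  proof (cases "w = []")
    case False
    have "gm (word_product A (w @ [i])) x = gm (word_product A w ** A $ i) x"
      by (simp add: word_product_append)
    also have "\<dots> = gm (A $ i) (gm (word_product A w) x)"
      using assms word_product_psgn[of A, OF assms(1) False] by (intro gm_mult) auto
    finally show ?thesis using snoc by simp
  qed (simp)
qed (simp add: gm_mat1)

lemma dir_measurable [measurable]: "(\<lambda>A. dir A l x) \<in> borel_measurable borel"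
proof (induction l)
  case (Cons i l)
  have [measurable]: "(\<lambda>A::real^2^2^'a. A $ i $ a $ b) \<in> borel_measurable borel" for a b
    by (intro borel_measurable_continuous_onI continuous_intros)
  note Cons[measurable]
  show ?case unfolding dir_Cons gm_def rowmix_def by measurable
qed simp

text \<open>Shifts the maps of the two letters in opposite senses. It is built from the base tuple
  and not from the moving one, so all perturbations run along parallel straight lines, as a
  translation argument for Lebesgue measure requires.\<close>

definition bump :: "real^2^2^'n::finite \<Rightarrow> 'n \<Rightarrow> 'n \<Rightarrow> real^2^2^'n" where
  "bump A0 i0 j0 = (\<chi> k. if k = i0 then shear (A0 $ i0) else if k = j0 then - shear (A0 $ j0) else 0)"

definition bump_sign :: "'n \<Rightarrow> 'n \<Rightarrow> 'n \<Rightarrow> real" where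
  "bump_sign i0 j0 k = (if k = i0 then 1 else if k = j0 then -1 else 0)"

lemma bump_eq: "(A + c *\<^sub>R bump A0 i0 j0) $ k = A $ k + (bump_sign i0 j0 k * c) *\<^sub>R shear (A0 $ k)"
  by (simp add: bump_def bump_sign_def)

text \<open>A neighbourhood of \<open>A0\<close> on which one perturbation direction works for all
  pairs of words starting with two given letters. By \<open>Q_near\<close> the shear of
  \<open>A0\<close> shifts the maps of a nearby \<open>A\<close> with speed 1 up to
  \<open>eps\<close>.\<close>

locale transversal_nbhd =
  fixes A0 :: "real^2^2^'n::finite" and Q :: "(real^2^2^'n) set" and lam eps :: real
  assumes lam: "0 \<le> lam" "lam < 1" and eps: "0 < eps" "eps < 1 - 2 * lam"
    and Q_psgn: "\<And>A i. A \<in> Q \<Longrightarrow> A $ i \<in> psgn"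
    and Q_contr: "\<And>A i. A \<in> Q \<Longrightarrow> \<bar>det (A $ i)\<bar> / (min_row_sum (A $ i))\<^sup>2 \<le> lam"
    and Q_near: "\<And>A i j. A \<in> Q \<Longrightarrow> \<bar>row_fun (A0 $ i) j - row_fun (A $ i) j\<bar> \<le> eps * min_row_sum (A $ i)"
begin

lemma ratio_near_1:
  assumes A: "A \<in> Q" and x: "x \<in> {0..1}"
  shows "\<bar>rowmix (A0 $ i) x / rowmix (A $ i) x - 1\<bar> \<le> eps"
proof -
  have nz: "rowmix (A $ i) x \<noteq> 0" using rowmix_nonzero[OF Q_psgn[OF A]] x by auto
  have "\<bar>rowmix (A0 $ i) x - rowmix (A $ i) x\<bar>
     = \<bar>(row_fun (A0 $ i) 1 - row_fun (A $ i) 1) * x + (row_fun (A0 $ i) 2 - row_fun (A $ i) 2) * (1 - x)\<bar>"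
    by (simp add: rowmix_row_fun algebra_simps)
  also have "\<dots> \<le> \<bar>row_fun (A0 $ i) 1 - row_fun (A $ i) 1\<bar> * x + \<bar>row_fun (A0 $ i) 2 - row_fun (A $ i) 2\<bar> * (1 - x)"
    using x by (intro order_trans[OF abs_triangle_ineq]) (simp add: abs_mult)
  also have "\<dots> \<le> (eps * min_row_sum (A $ i)) * x + (eps * min_row_sum (A $ i)) * (1 - x)"
    using x by (intro add_mono mult_right_mono Q_near[OF A]) auto
  also have "\<dots> = eps * min_row_sum (A $ i)" by (simp add: algebra_simps)
  also have "\<dots> \<le> eps * \<bar>rowmix (A $ i) x\<bar>"
    using rowmix_bounds(1)[OF Q_psgn[OF A]] x eps by (intro mult_left_mono) auto
  finally have "\<bar>rowmix (A0 $ i) x - rowmix (A $ i) x\<bar> / \<bar>rowmix (A $ i) x\<bar> \<le> eps"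
    using nz by (simp add: divide_le_eq)
  then show ?thesis using nz by (simp add: diff_divide_distrib flip: abs_divide)
qed

text \<open>Direct effect of the perturbation on the outermost map, minus the largest effect
  inherited from the inner maps. It is positive exactly when eps < 1 - 2 * lam, which is possible
  because the contraction ratios are below 1/2.\<close>

definition "growth_const = (1 - eps) - lam * ((1 + eps) / (1 - lam))"

lemma growth_const_pos: "growth_const > 0"
proof -
  have "lam * (1 + eps) < (1 - eps) * (1 - lam)" using eps lam by (simp add: algebra_simps)
  then show ?thesis using lam by (simp add: growth_const_def field_simps)
qed

text \<open>The change splits into moving the outermost map at a fixed point, which is an exact
  shift by \<open>gm_shear\<close>, and moving the point under the perturbed map, which is damped by
  \<open>lam\<close>.\<close>

lemma dir_step:
  assumes A: "A \<in> Q" and A': "A + c *\<^sub>R bump A0 i0 j0 \<in> Q" and c: "c \<ge> 0"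
    and bnd: "\<bar>dir (A + c *\<^sub>R bump A0 i0 j0) l 1 - dir A l 1\<bar> \<le> c * ((1 + eps) / (1 - lam))"
  shows "\<bar>(dir (A + c *\<^sub>R bump A0 i0 j0) (k # l) 1 - dir A (k # l) 1)
      - bump_sign i0 j0 k * c * (rowmix (A0 $ k) (dir A l 1) / rowmix (A $ k) (dir A l 1))\<bar>
    \<le> c * (lam * ((1 + eps) / (1 - lam)))"
proof -
  let ?A' = "A + c *\<^sub>R bump A0 i0 j0"
  define y where "y = dir A l 1" define y' where "y' = dir ?A' l 1"
  have y: "0 \<le> y" "y \<le> 1" "0 \<le> y'" "y' \<le> 1"
    using dir_mem[of A 1 l] dir_mem[of ?A' 1 l] Q_psgn[OF A] Q_psgn[OF A'] by (auto simp: y_def y'_def)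
  have eq: "gm (?A' $ k) y = gm (A $ k) y + bump_sign i0 j0 k * c * (rowmix (A0 $ k) y / rowmix (A $ k) y)"
    unfolding bump_eq gm_shear ..
  have "\<bar>gm (?A' $ k) y' - gm (?A' $ k) y\<bar> \<le> \<bar>det (?A' $ k)\<bar> / (min_row_sum (?A' $ k))\<^sup>2 * \<bar>y' - y\<bar>"
    by (rule gm_upper[OF Q_psgn[OF A'] y(3,4,1,2)])
  also have "\<dots> \<le> lam * (c * ((1 + eps) / (1 - lam)))"
    using bnd lam by (intro mult_mono Q_contr[OF A']) (auto simp: y_def y'_def)
  finally show ?thesis unfolding dir_Cons y_def[symmetric] y'_def[symmetric] eq
    by (simp add: algebra_simps)
qed

text \<open>(1 + eps) / (1 - lam) is the fixed point of x \<mapsto> (1 + eps) + lam * x: each letter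
  adds at most 1 + eps and damps what was there before.\<close>

lemma dir_bump_bound:
  assumes A: "A \<in> Q" and A': "A + c *\<^sub>R bump A0 i0 j0 \<in> Q" and c: "c \<ge> 0"
  shows "\<bar>dir (A + c *\<^sub>R bump A0 i0 j0) l 1 - dir A l 1\<bar> \<le> c * ((1 + eps) / (1 - lam))"
proof (induction l)
  case Nil
  then show ?case using c eps lam by simp
next
  case (Cons k l)
  define q where "q = rowmix (A0 $ k) (dir A l 1) / rowmix (A $ k) (dir A l 1)"
  have q: "\<bar>q - 1\<bar> \<le> eps" unfolding q_def
    using ratio_near_1[OF A] dir_mem[of A 1 l] Q_psgn[OF A] by auto
  define D where "D = dir (A + c *\<^sub>R bump A0 i0 j0) (k # l) 1 - dir A (k # l) 1"
  have 1: "\<bar>D - bump_sign i0 j0 k * c * q\<bar> \<le> c * (lam * ((1 + eps) / (1 - lam)))"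
    unfolding D_def q_def by (rule dir_step[OF assms Cons])
  have "\<bar>bump_sign i0 j0 k * c * q\<bar> = (\<bar>bump_sign i0 j0 k\<bar> * \<bar>q\<bar>) * c" using c by (simp add: abs_mult)
  also have "\<dots> \<le> (1 * (1 + eps)) * c"
    using q c eps by (intro mult_right_mono mult_mono) (auto simp: bump_sign_def)
  finally have "\<bar>D\<bar> \<le> c * (lam * ((1 + eps) / (1 - lam))) + (1 + eps) * c" using 1 by linarith
  also have "\<dots> = c * ((1 + eps) / (1 - lam))" using lam by (simp add: field_simps)
  finally show ?case by (simp add: D_def)
qed

text \<open>The two outermost maps are shifted with opposite signs, so the direct effects add up;
  whatever happens further inside costs at most the inherited error for each word. No cancellation
  between the two words is possible.\<close>

lemma dir_bump_growth:
  assumes A: "A \<in> Q" and A': "A + c *\<^sub>R bump A0 i0 j0 \<in> Q" and c: "c \<ge> 0" and ij: "i0 \<noteq> j0"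
  shows "2 * growth_const * c \<le> (dir (A + c *\<^sub>R bump A0 i0 j0) (i0 # l) 1 - dir (A + c *\<^sub>R bump A0 i0 j0) (j0 # l') 1)
     - (dir A (i0 # l) 1 - dir A (j0 # l') 1)"
proof -
  let ?A' = "A + c *\<^sub>R bump A0 i0 j0"
  define q where "q k l = rowmix (A0 $ k) (dir A l 1) / rowmix (A $ k) (dir A l 1)" for k l
  have q: "\<bar>q k l - 1\<bar> \<le> eps" for k l unfolding q_def
    using ratio_near_1[OF A] dir_mem[of A 1 l] Q_psgn[OF A] by auto
  note st = dir_step[OF A A' c dir_bump_bound[OF A A' c], folded q_def]
  have 1: "\<bar>(dir ?A' (i0 # l) 1 - dir A (i0 # l) 1) - c * q i0 l\<bar> \<le> c * (lam * ((1 + eps) / (1 - lam)))"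
    using st[of i0 l] by (simp add: bump_sign_def)
  have 2: "\<bar>(dir ?A' (j0 # l') 1 - dir A (j0 # l') 1) + c * q j0 l'\<bar> \<le> c * (lam * ((1 + eps) / (1 - lam)))"
    using st[of j0 l'] ij by (simp add: bump_sign_def)
  have 3: "c * (1 - eps) \<le> c * q i0 l" "c * (1 - eps) \<le> c * q j0 l'"
    using c q[of i0 l] q[of j0 l'] by (auto intro!: mult_left_mono)
  have "2 * growth_const * c = 2 * (c * (1 - eps)) - 2 * (c * (lam * ((1 + eps) / (1 - lam))))"
    by (simp add: growth_const_def algebra_simps)
  then show ?thesis using 1 2 3 by linarith
qed

end

text \<open>About \<open>c / (2 * r)\<close> translates of \<open>B\<close> along \<open>v\<close> are pairwise disjoint.\<close>

lemma thin_strip_measure: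
  fixes B Q :: "'a::euclidean_space set" and F :: "'a \<Rightarrow> real"
  assumes B: "B \<in> sets borel" "B \<subseteq> Q" "Q \<subseteq> cball z e" and c: "0 < c" and r: "0 < r"
    and F: "\<And>x. x \<in> B \<Longrightarrow> \<bar>F x\<bar> \<le> r"
    and grow: "\<And>x t. x \<in> Q \<Longrightarrow> x + t *\<^sub>R v \<in> Q \<Longrightarrow> 0 \<le> t \<Longrightarrow> 2 * c * t \<le> F (x + t *\<^sub>R v) - F x"
  shows "measure lebesgue B \<le> (2 * measure lebesgue (cball z (e + norm v)) / c) * r"
proof -
  define \<mu> where "\<mu> = measure lebesgue (cball z (e + norm v))"
  \<comment> \<open>A shift by \<open>d\<close> or more raises \<open>F\<close> by at least 4 * r,
    while \<open>F\<close> varies by at most 2 * r on \<open>B\<close>; so the translates by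
    different multiples of \<open>d\<close> are disjoint.\<close>
  define d where "d = 2 * r / c"
  have d: "d > 0" using c r by (simp add: d_def)
  define J where "J = nat \<lfloor>1 / d\<rfloor>"
  have J: "real J \<le> 1 / d" "1 / d < real J + 1" using d by (auto simp: J_def)
  have "bounded B" using B by (meson bounded_cball bounded_subset)
  then have Bm: "B \<in> lmeasurable" using B(1) by (intro bounded_set_imp_lmeasurable) auto
  define T where "T j = (\<lambda>x. (real j * d) *\<^sub>R v + x) ` B" for j
  have Tm: "T j \<in> lmeasurable" "measure lebesgue (T j) = measure lebesgue B" for j
    unfolding T_def using Bm by (auto simp: measurable_translation measure_translation)
  have no: False if "x \<in> B" "y \<in> B" "(real j * d) *\<^sub>R v + x = (real k * d) *\<^sub>R v + y" "k < j" for x y j k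
  proof -
    have y: "y = x + (real (j - k) * d) *\<^sub>R v"
      using that(3,4) by (simp add: of_nat_diff algebra_simps)
    have "2 * c * (real (j - k) * d) \<le> F y - F x"
      unfolding y using that(1,2) B(2) d y by (intro grow) auto
    also have "\<dots> \<le> 2 * r" using F[OF that(1)] F[OF that(2)] by linarith
    finally have "2 * c * (real (j - k) * d) \<le> 2 * r" .
    moreover have "c * d \<le> c * (real (j - k) * d)" using that(4) c d by simp
    ultimately show False using c r by (simp add: d_def)
  qed
  have disj: "pairwise (\<lambda>i j. disjnt (T i) (T j)) {..J}"
  proof (rule pairwiseI)
    fix i j :: nat assume "i \<noteq> j"
    show "disjnt (T i) (T j)"
    proof (rule ccontr)
      assume "\<not> disjnt (T i) (T j)"
      then obtain x y where "x \<in> B" "y \<in> B" "(real i * d) *\<^sub>R v + x = (real j * d) *\<^sub>R v + y"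
        by (auto simp: disjnt_def T_def)
      with \<open>i \<noteq> j\<close> show False using no[of x y i j] no[of y x j i] by (metis linorder_neqE_nat)
    qed
  qed
  have sub: "(\<Union>j\<le>J. T j) \<subseteq> cball z (e + norm v)"
  proof (safe)
    fix j y assume "j \<le> J" "y \<in> T j"
    then obtain x where x: "x \<in> B" "y = (real j * d) *\<^sub>R v + x" by (auto simp: T_def)
    have "real j * d \<le> real J * d" using \<open>j \<le> J\<close> d by simp
    also have "\<dots> \<le> 1" using J d by (simp add: field_simps)
    finally have "(real j * d) * norm v \<le> 1 * norm v" by (intro mult_right_mono) auto
    then have "norm ((real j * d) *\<^sub>R v) \<le> 1 * norm v" using d by simp
    moreover have "dist z y \<le> dist z x + norm ((real j * d) *\<^sub>R v)"
      unfolding x(2) using dist_triangle[of z "(real j * d) *\<^sub>R v + x" x] by (simp add: dist_norm)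
    moreover have "dist z x \<le> e" using x(1) B by auto
    ultimately show "y \<in> cball z (e + norm v)" by simp
  qed
  have "(real J + 1) * measure lebesgue B = (\<Sum>j\<le>J. measure lebesgue (T j))" by (simp add: Tm)
  also have "\<dots> = measure lebesgue (\<Union>j\<le>J. T j)"
    by (intro measure_UNION'[symmetric] disj) (auto simp: Tm)
  also have "\<dots> \<le> \<mu>" unfolding \<mu>_def
    using sub Tm by (intro measure_mono_fmeasurable) (auto intro!: fmeasurableD fmeasurable.finite_UN)
  finally have "(real J + 1) * measure lebesgue B \<le> \<mu>" .
  moreover have "1 / d * measure lebesgue B \<le> (real J + 1) * measure lebesgue B"
    using J by (intro mult_right_mono) auto
  ultimately have "1 / d * measure lebesgue B \<le> \<mu>" by linarith
  then have "measure lebesgue B \<le> \<mu> * d" using d by (simp add: field_simps)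
  then show ?thesis by (simp add: d_def \<mu>_def mult_ac)
qed


section \<open>Counting pairs of close directions\<close>

lemma words_1: "words I (Suc 0) = (\<lambda>i. [i]) ` I"
  by (auto simp: words_def length_Suc_conv)

lemma sum_words_Suc: "(\<Sum>w\<in>words I (Suc m). F w) = (\<Sum>i\<in>I. \<Sum>w\<in>words I m. F (i # w))"
proof -
  have "(\<Sum>w\<in>words I (1 + m). F w) = (\<Sum>i\<in>I. \<Sum>w\<in>words I m. F (i # w))"
    unfolding sum_words_add by (simp add: words_1 sum.reindex inj_on_def)
  then show ?thesis by simp
qed

text \<open>The bound \<open>\<kappa>\<close> for whole blocks enters the count with the power
  \<open>m\<close>, so it has to be sharp. The bound \<open>\<kappa>1\<close> for letters is only
  used inside one block of length \<open>n\<close> and merely affects constants.\<close>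

locale transversal_family = transversal_nbhd A0 Q lam eps
  for A0 :: "real^2^2^'n::finite" and Q lam eps +
  fixes \<Gamma> :: "'n list set" and n :: nat and \<kappa> \<kappa>1 :: real
  assumes Q_borel: "Q \<in> sets borel" and Q_bounded: "bounded Q"
    and \<Gamma>: "finite \<Gamma>" "\<Gamma> \<noteq> {}" "\<And>\<gamma>. \<gamma> \<in> \<Gamma> \<Longrightarrow> length \<gamma> = n"
    and \<kappa>: "0 < \<kappa>" "\<And>A \<gamma> x y. A \<in> Q \<Longrightarrow> \<gamma> \<in> \<Gamma> \<Longrightarrow> x \<in> {0..1} \<Longrightarrow> y \<in> {0..1} \<Longrightarrow>
      \<kappa> * \<bar>x - y\<bar> \<le> \<bar>dir A \<gamma> x - dir A \<gamma> y\<bar>"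
    and \<kappa>1: "0 < \<kappa>1" "\<kappa>1 \<le> 1" "\<And>A i x y. A \<in> Q \<Longrightarrow> x \<in> {0..1} \<Longrightarrow> y \<in> {0..1} \<Longrightarrow>
      \<kappa>1 * \<bar>x - y\<bar> \<le> \<bar>gm (A $ i) x - gm (A $ i) y\<bar>"
begin

definition "near_set l l' r = {A\<in>Q. \<bar>dir A l 1 - dir A l' 1\<bar> \<le> r}"

lemma near_set_borel [measurable]: "near_set l l' r \<in> sets borel"
proof -
  have "{A\<in>space borel. A \<in> Q \<and> \<bar>dir A l 1 - dir A l' 1\<bar> \<le> r} \<in> sets borel"
    using Q_borel by measurable
  then show ?thesis by (simp add: near_set_def)
qed

lemma near_set_lmeasurable: "near_set l l' r \<in> lmeasurable"
  by (intro bounded_set_imp_lmeasurable bounded_subset[OF Q_bounded])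
    (auto simp: near_set_def[of l l' r] near_set_borel[unfolded near_set_def])

lemma Q_lmeasurable: "Q \<in> lmeasurable"
  using Q_bounded Q_borel by (intro bounded_set_imp_lmeasurable) auto

lemma measure_near_set_mono:
  assumes "near_set l l' r \<subseteq> near_set k k' s"
  shows "measure lebesgue (near_set l l' r) \<le> measure lebesgue (near_set k k' s)"
  by (intro measure_mono_fmeasurable assms fmeasurableD near_set_lmeasurable)

lemma dir_mem_Q: "A \<in> Q \<Longrightarrow> dir A l 1 \<in> {0..1}"
  using dir_mem[of A 1 l] Q_psgn by auto

lemma strip_letters:
  "\<exists>K>0. \<forall>i j l l' r. i \<noteq> j \<longrightarrow> 0 < r \<longrightarrow> measure lebesgue (near_set (i # l) (j # l') r) \<le> K * r"
proof -
  obtain z e where ze: "Q \<subseteq> cball z e" using Q_bounded bounded_subset_cball by blast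
  define c where "c i j = 2 * measure lebesgue (cball z (e + norm (bump A0 i j))) / growth_const" for i j
  have c0: "0 \<le> c i j" for i j using growth_const_pos by (simp add: c_def)
  define K where "K = 1 + (\<Sum>i\<in>UNIV. \<Sum>j\<in>UNIV. c i j)"
  have cK: "c i j \<le> K" for i j
  proof -
    have "c i j \<le> (\<Sum>j\<in>UNIV. c i j)" by (rule member_le_sum) (auto simp: c0)
    also have "\<dots> \<le> (\<Sum>i\<in>UNIV. \<Sum>j\<in>UNIV. c i j)"
      by (rule member_le_sum[where f = "\<lambda>i. \<Sum>j\<in>UNIV. c i j"]) (auto simp: c0 sum_nonneg)
    finally show ?thesis by (simp add: K_def)
  qed
  have "measure lebesgue (near_set (i # l) (j # l') r) \<le> K * r" if "i \<noteq> j" "0 < r" for i j l l' r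
  proof -
    have "measure lebesgue (near_set (i # l) (j # l') r) \<le> c i j * r"
      unfolding c_def
    proof (rule thin_strip_measure[where Q = Q and F = "\<lambda>A. dir A (i # l) 1 - dir A (j # l') 1"])
      fix x :: "real^2^2^'n" and t :: real
      assume "x \<in> Q" "x + t *\<^sub>R bump A0 i j \<in> Q" "0 \<le> t"
      from dir_bump_growth[OF this that(1), of l l']
      show "2 * growth_const * t \<le> dir (x + t *\<^sub>R bump A0 i j) (i # l) 1 - dir (x + t *\<^sub>R bump A0 i j) (j # l') 1
          - (dir x (i # l) 1 - dir x (j # l') 1)" .
    next
      show "near_set (i # l) (j # l') r \<in> sets borel" by (rule near_set_borel)
      show "near_set (i # l) (j # l') r \<subseteq> Q" unfolding near_set_def by blast
      show "\<bar>dir A (i # l) 1 - dir A (j # l') 1\<bar> \<le> r" if "A \<in> near_set (i # l) (j # l') r" for A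
        using that unfolding near_set_def by blast
    qed (fact ze growth_const_pos that(2))+
    also have "\<dots> \<le> K * r" using cK that by (intro mult_right_mono) auto
    finally show ?thesis .
  qed
  moreover have "K > 0" unfolding K_def using c0 by (intro add_pos_nonneg sum_nonneg) auto
  ultimately show ?thesis by blast
qed

lemma dir_lower_letters:
  assumes "A \<in> Q" "x \<in> {0..1}" "y \<in> {0..1}"
  shows "\<kappa>1 ^ length u * \<bar>x - y\<bar> \<le> \<bar>dir A u x - dir A u y\<bar>"
proof (induction u)
  case (Cons i u)
  have m: "dir A u x \<in> {0..1}" "dir A u y \<in> {0..1}"
    using assms dir_mem[of A _ u] Q_psgn by blast+
  have "\<kappa>1 ^ length (i # u) * \<bar>x - y\<bar> = \<kappa>1 * (\<kappa>1 ^ length u * \<bar>x - y\<bar>)" by simp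
  also have "\<dots> \<le> \<kappa>1 * \<bar>dir A u x - dir A u y\<bar>" using Cons \<kappa>1 by (intro mult_left_mono) auto
  also have "\<dots> \<le> \<bar>dir A (i # u) x - dir A (i # u) y\<bar>"
    unfolding dir_Cons by (rule \<kappa>1(3)[OF assms(1) m])
  finally show ?case .
qed simp

text \<open>Two different blocks share a prefix of at most \<open>n\<close> letters. Removing it
  costs a factor \<open>\<kappa>1 ^ n\<close>, and then the first letters differ.\<close>

lemma strip_words:
  "\<exists>K>0. \<forall>\<gamma>\<in>\<Gamma>. \<forall>\<gamma>'\<in>\<Gamma>. \<forall>l l' r. \<gamma> \<noteq> \<gamma>' \<longrightarrow> 0 < r \<longrightarrow>
    measure lebesgue (near_set (\<gamma> @ l) (\<gamma>' @ l') r) \<le> K * r"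
proof -
  obtain K where K: "K > 0" "\<And>i j l l' r. i \<noteq> j \<Longrightarrow> 0 < r \<Longrightarrow> measure lebesgue (near_set (i # l) (j # l') r) \<le> K * r"
    using strip_letters by blast
  have "measure lebesgue (near_set (\<gamma> @ l) (\<gamma>' @ l') r) \<le> (K / \<kappa>1 ^ n) * r"
    if g: "\<gamma> \<in> \<Gamma>" "\<gamma>' \<in> \<Gamma>" "\<gamma> \<noteq> \<gamma>'" "0 < r" for \<gamma> \<gamma>' l l' r
  proof -
    obtain u i v j v' where u: "i \<noteq> j" "\<gamma> = u @ [i] @ v" "\<gamma>' = u @ [j] @ v'"
      using same_length_different[OF g(3)] \<Gamma>(3)[OF g(1)] \<Gamma>(3)[OF g(2)] by metis
    have "length u \<le> n" using \<Gamma>(3)[OF g(1)] u by simp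
    then have pw: "\<kappa>1 ^ n \<le> \<kappa>1 ^ length u" using \<kappa>1 by (intro power_decreasing) auto
    have "near_set (\<gamma> @ l) (\<gamma>' @ l') r \<subseteq> near_set (i # v @ l) (j # v' @ l') (r / \<kappa>1 ^ n)"
    proof
      fix A assume A: "A \<in> near_set (\<gamma> @ l) (\<gamma>' @ l') r"
      then have AQ: "A \<in> Q" by (simp add: near_set_def)
      define x y where "x = dir A (i # v @ l) 1" and "y = dir A (j # v' @ l') 1"
      have "\<kappa>1 ^ n * \<bar>x - y\<bar> \<le> \<kappa>1 ^ length u * \<bar>x - y\<bar>" using pw by (intro mult_right_mono) auto
      also have "\<dots> \<le> \<bar>dir A u x - dir A u y\<bar>"
        unfolding x_def y_def by (intro dir_lower_letters AQ dir_mem_Q)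
      also have "\<dots> \<le> r" using A by (simp add: near_set_def u x_def y_def dir_append)
      finally have "\<bar>x - y\<bar> \<le> r / \<kappa>1 ^ n" using \<kappa>1 by (simp add: field_simps)
      then show "A \<in> near_set (i # v @ l) (j # v' @ l') (r / \<kappa>1 ^ n)"
        using AQ by (simp add: near_set_def x_def y_def)
    qed
    then have "measure lebesgue (near_set (\<gamma> @ l) (\<gamma>' @ l') r) \<le> measure lebesgue (near_set (i # v @ l) (j # v' @ l') (r / \<kappa>1 ^ n))"
      by (rule measure_near_set_mono)
    also have "\<dots> \<le> K * (r / \<kappa>1 ^ n)" using u g \<kappa>1 by (intro K) auto
    finally show ?thesis by simp
  qed
  then show ?thesis using K(1) \<kappa>1(1) by (intro exI[of _ "K / \<kappa>1 ^ n"]) auto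
qed

lemma near_set_same_prefix:
  assumes "\<gamma> \<in> \<Gamma>"
  shows "near_set (\<gamma> @ l) (\<gamma> @ l') r \<subseteq> near_set l l' (r / \<kappa>)"
proof
  fix A assume A: "A \<in> near_set (\<gamma> @ l) (\<gamma> @ l') r"
  then have AQ: "A \<in> Q" by (simp add: near_set_def)
  have "\<kappa> * \<bar>dir A l 1 - dir A l' 1\<bar> \<le> \<bar>dir A \<gamma> (dir A l 1) - dir A \<gamma> (dir A l' 1)\<bar>"
    by (intro \<kappa>(2) AQ assms dir_mem_Q)
  also have "\<dots> \<le> r" using A by (simp add: near_set_def dir_append)
  finally show "A \<in> near_set l l' (r / \<kappa>)" using AQ \<kappa>(1) by (simp add: near_set_def field_simps)
qed

text \<open>The integral over \<open>Q\<close> of the number of pairs of words of level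
  \<open>m\<close> whose directions differ by at most \<open>r\<close>.\<close>

definition "pair_mass m r = (\<Sum>w\<in>words \<Gamma> m. \<Sum>w'\<in>words \<Gamma> m. measure lebesgue (near_set (concat w) (concat w') r))"

abbreviation "M \<equiv> real (card \<Gamma>)"
text \<open>The inevitable number of neighbours per level: intervals of length
  \<open>\<kappa> ^ m\<close> in [0, 1] cannot separate M ^ m points better than to about (M *
  \<kappa>) ^ m per interval, and each word is its own neighbour.\<close>

definition "X = max 1 (M * \<kappa>)"

lemma M_ge_1: "1 \<le> M"
  using \<Gamma> by (simp add: Suc_leI card_gt_0_iff)

lemma X_ge_1: "1 \<le> X" by (simp add: X_def)

text \<open>Pairs with a common first block are pairs of the previous level at a radius enlarged by
  1 / \<kappa>; for all other pairs transversality bounds the measure by a multiple of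
  \<open>r\<close>.\<close>

lemma pair_mass_Suc:
  assumes K: "0 \<le> K" "\<And>\<gamma> \<gamma>' l l' r. \<gamma> \<in> \<Gamma> \<Longrightarrow> \<gamma>' \<in> \<Gamma> \<Longrightarrow> \<gamma> \<noteq> \<gamma>' \<Longrightarrow> 0 < r \<Longrightarrow>
    measure lebesgue (near_set (\<gamma> @ l) (\<gamma>' @ l') r) \<le> K * r" and r: "0 < r"
  shows "pair_mass (Suc m) r \<le> M * pair_mass m (r / \<kappa>) + M ^ (2 * Suc m) * (K * r)"
proof -
  define f where "f w w' = measure lebesgue (near_set (concat w) (concat w') (r / \<kappa>))" for w w'
  have f0: "0 \<le> f w w'" for w w' by (simp add: f_def)
  have "pair_mass (Suc m) r = (\<Sum>\<gamma>\<in>\<Gamma>. \<Sum>w\<in>words \<Gamma> m. \<Sum>\<gamma>'\<in>\<Gamma>. \<Sum>w'\<in>words \<Gamma> m.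
      measure lebesgue (near_set (\<gamma> @ concat w) (\<gamma>' @ concat w') r))"
    by (simp add: pair_mass_def sum_words_Suc)
  also have "\<dots> \<le> (\<Sum>\<gamma>\<in>\<Gamma>. \<Sum>w\<in>words \<Gamma> m. \<Sum>\<gamma>'\<in>\<Gamma>. \<Sum>w'\<in>words \<Gamma> m. (if \<gamma>' = \<gamma> then f w w' else 0) + K * r)"
  proof (intro sum_mono)
    fix \<gamma> w \<gamma>' w' assume g: "\<gamma> \<in> \<Gamma>" "\<gamma>' \<in> \<Gamma>"
    show "measure lebesgue (near_set (\<gamma> @ concat w) (\<gamma>' @ concat w') r) \<le> (if \<gamma>' = \<gamma> then f w w' else 0) + K * r"
    proof (cases "\<gamma>' = \<gamma>")
      case True
      have "measure lebesgue (near_set (\<gamma> @ concat w) (\<gamma> @ concat w') r) \<le> f w w'"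
        unfolding f_def by (intro measure_near_set_mono near_set_same_prefix g)
      moreover have "0 \<le> K * r" using K r by simp
      ultimately show ?thesis using True by simp
    next
      case False
      then show ?thesis using K(2)[OF g _ r] by auto
    qed
  qed
  also have "\<dots> = (\<Sum>\<gamma>\<in>\<Gamma>. \<Sum>w\<in>words \<Gamma> m. \<Sum>\<gamma>'\<in>\<Gamma>. (if \<gamma>' = \<gamma> then \<Sum>w'\<in>words \<Gamma> m. f w w' else 0)) + M ^ (2 * Suc m) * (K * r)"
  proof -
    have *: "(\<Sum>w'\<in>words \<Gamma> m. if b then f w w' else 0) = (if b then \<Sum>w'\<in>words \<Gamma> m. f w w' else 0)" for b w by simp
    show ?thesis
      by (simp add: sum.distrib card_words[OF \<Gamma>(1)] * power2_eq_square power_mult algebra_simps flip: power_mult_distrib)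
  qed
  also have "(\<Sum>\<gamma>\<in>\<Gamma>. \<Sum>w\<in>words \<Gamma> m. \<Sum>\<gamma>'\<in>\<Gamma>. (if \<gamma>' = \<gamma> then \<Sum>w'\<in>words \<Gamma> m. f w w' else 0)) = M * pair_mass m (r / \<kappa>)"
    using \<Gamma>(1) by (simp add: pair_mass_def f_def)
  finally show ?thesis .
qed

text \<open>Unrolling the recursion, the diagonal leaves M ^ m times the measure of
  \<open>Q\<close>, and each of the \<open>m\<close> levels at which the words may branch
  contributes a term of the same size; hence the factor \<open>m\<close>.\<close>

lemma pair_mass_bound:
  "\<exists>K>0. \<forall>m r. 0 < r \<longrightarrow> pair_mass m r \<le> M ^ m * (measure lebesgue Q + K * real m * r * (X / \<kappa>) ^ m)"
proof -
  obtain K where K: "K > 0" "\<And>\<gamma> \<gamma>' l l' r. \<gamma> \<in> \<Gamma> \<Longrightarrow> \<gamma>' \<in> \<Gamma> \<Longrightarrow> \<gamma> \<noteq> \<gamma>' \<Longrightarrow> 0 < r \<Longrightarrow>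
    measure lebesgue (near_set (\<gamma> @ l) (\<gamma>' @ l') r) \<le> K * r"
    using strip_words by meson
  have "pair_mass m r \<le> M ^ m * (measure lebesgue Q + K * real m * r * (X / \<kappa>) ^ m)" if "0 < r" for m r
    using that
  proof (induction m arbitrary: r)
    case 0
    have "measure lebesgue (near_set [] [] r) \<le> measure lebesgue Q"
      by (intro measure_mono_fmeasurable Q_lmeasurable fmeasurableD near_set_lmeasurable) (auto simp: near_set_def)
    then show ?case by (simp add: pair_mass_def)
  next
    case (Suc m)
    define q where "q = measure lebesgue Q"
    have "pair_mass (Suc m) r \<le> M * pair_mass m (r / \<kappa>) + M ^ (2 * Suc m) * (K * r)"
      using K Suc.prems by (intro pair_mass_Suc) auto
    also have "M * pair_mass m (r / \<kappa>) \<le> M * (M ^ m * (q + K * real m * (r / \<kappa>) * (X / \<kappa>) ^ m))"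
      unfolding q_def using Suc \<kappa> by (intro mult_left_mono Suc.IH) auto
    also have "\<dots> = M ^ Suc m * (q + (K * real m * r) * (X ^ m / \<kappa> ^ Suc m))"
      by (simp add: power_divide algebra_simps)
    also have "\<dots> \<le> M ^ Suc m * (q + (K * real m * r) * (X ^ Suc m / \<kappa> ^ Suc m))"
      using K Suc.prems X_ge_1 \<kappa>
      by (intro mult_left_mono add_mono order_refl divide_right_mono power_increasing) auto
    also have "M ^ (2 * Suc m) * (K * r) \<le> M ^ Suc m * ((K * r) * (X ^ Suc m / \<kappa> ^ Suc m))"
    proof -
      have "(M * \<kappa>) ^ Suc m \<le> X ^ Suc m" using \<kappa> by (intro power_mono) (auto simp: X_def)
      then have "M ^ Suc m \<le> X ^ Suc m / \<kappa> ^ Suc m" using \<kappa> by (simp add: power_mult_distrib field_simps)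
      then have "M ^ Suc m * ((K * r) * M ^ Suc m) \<le> M ^ Suc m * ((K * r) * (X ^ Suc m / \<kappa> ^ Suc m))"
        using K Suc.prems by (intro mult_left_mono) auto
      moreover have "M ^ (2 * Suc m) * (K * r) = M ^ Suc m * ((K * r) * M ^ Suc m)"
        unfolding mult_2 power_add by (simp only: mult_ac)
      ultimately show ?thesis by (simp only:)
    qed
    finally have "pair_mass (Suc m) r \<le> M ^ Suc m * (q + (K * real m * r) * (X ^ Suc m / \<kappa> ^ Suc m))
       + M ^ Suc m * ((K * r) * (X ^ Suc m / \<kappa> ^ Suc m))" by simp
    also have "\<dots> = M ^ Suc m * (q + K * real (Suc m) * r * (X / \<kappa>) ^ Suc m)"
      by (simp add: power_divide algebra_simps add_divide_distrib)
    finally show ?case by (simp add: q_def)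
  qed
  then show ?thesis using K(1) by blast
qed

definition "close_pairs A m r = {(w, w'). w \<in> words \<Gamma> m \<and> w' \<in> words \<Gamma> m \<and>
   \<bar>dir A (concat w) 1 - dir A (concat w') 1\<bar> \<le> r}"

lemma card_close_pairs:
  assumes "A \<in> Q"
  shows "real (card (close_pairs A m r)) = (\<Sum>w\<in>words \<Gamma> m. \<Sum>w'\<in>words \<Gamma> m. indicator (near_set (concat w) (concat w') r) A)"
proof -
  have fin: "finite (words \<Gamma> m)" by (rule finite_words[OF \<Gamma>(1)])
  have "real (card (close_pairs A m r)) = (\<Sum>p\<in>words \<Gamma> m \<times> words \<Gamma> m. if p \<in> close_pairs A m r then 1 else 0)"
    using fin by (subst sum.inter_restrict[symmetric])
      (auto simp: close_pairs_def intro!: arg_cong[where f = card])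
  also have "\<dots> = (\<Sum>p\<in>words \<Gamma> m \<times> words \<Gamma> m. indicator (near_set (concat (fst p)) (concat (snd p)) r) A)"
    using assms by (intro sum.cong) (auto simp: close_pairs_def near_set_def indicator_def)
  finally show ?thesis by (simp add: sum.cartesian_product case_prod_beta)
qed

text \<open>Markov's inequality and Borel-Cantelli. Of the two factors (\<zeta> / \<kappa>) ^ m, one
  is due to the radius \<open>3 * \<zeta> ^ m\<close> in place of \<open>\<kappa> ^ m\<close>; the
  other makes the exceptional measures summable in spite of the linear factor.\<close>

lemma close_pairs_ae:
  assumes \<zeta>: "\<kappa> < \<zeta>"
  shows "AE A in lebesgue. A \<in> Q \<longrightarrow>
    eventually (\<lambda>m. real (card (close_pairs A m (3 * \<zeta> ^ m))) \<le> M ^ m * (X ^ m * (\<zeta> / \<kappa>) ^ (2 * m))) sequentially"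
proof -
  obtain K where K: "K > 0" "\<And>m r. 0 < r \<Longrightarrow> pair_mass m r \<le> M ^ m * (measure lebesgue Q + K * real m * r * (X / \<kappa>) ^ m)"
    using pair_mass_bound by blast
  define Y where "Y m = M ^ m * (X ^ m * (\<zeta> / \<kappa>) ^ (2 * m))" for m
  define c where "c m A = (\<Sum>w\<in>words \<Gamma> m. \<Sum>w'\<in>words \<Gamma> m. indicator (near_set (concat w) (concat w') (3 * \<zeta> ^ m)) A :: real)" for m A
  define Bad where "Bad m = {A\<in>Q. Y m < c m A}" for m
  define q where "q = measure lebesgue Q"
  have \<zeta>0: "0 < \<zeta>" using \<zeta> \<kappa> by simp
  have Ypos: "0 < Y m" for m using M_ge_1 X_ge_1 \<kappa> \<zeta>0 by (simp add: Y_def)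
  have c_meas[measurable]: "c m \<in> borel_measurable borel" for m unfolding c_def by measurable
  have Badb[measurable]: "Bad m \<in> sets borel" for m
  proof -
    have "{A\<in>space borel. A \<in> Q \<and> Y m < c m A} \<in> sets borel" using Q_borel by measurable
    then show ?thesis by (simp add: Bad_def)
  qed
  have Badm: "Bad m \<in> lmeasurable" for m
    using Badb by (intro bounded_set_imp_lmeasurable bounded_subset[OF Q_bounded]) (auto simp: Bad_def)
  have int_ind: "integrable lebesgue (indicat_real S)" "(\<integral>x. indicat_real S x \<partial>lebesgue) = measure lebesgue S" if "S \<in> lmeasurable" for S
    using that by (auto simp: fmeasurable_def integrable_indicator_iff)
  have bound: "measure lebesgue (Bad m) \<le> (q + 3 * K) * (real (Suc m) * (\<kappa> / \<zeta>) ^ m)" for m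
  proof -
    have "measure lebesgue (Bad m) * Y m = (\<integral>A. Y m * indicator (Bad m) A \<partial>lebesgue)"
      using int_ind[OF Badm] by simp
    also have "\<dots> \<le> (\<integral>A. c m A \<partial>lebesgue)"
    proof (rule integral_mono)
      show "integrable lebesgue (\<lambda>A. Y m * indicator (Bad m) A)" using int_ind[OF Badm] by simp
      show "integrable lebesgue (c m)" unfolding c_def
        by (intro Bochner_Integration.integrable_sum int_ind near_set_lmeasurable)
      fix A
      show "Y m * indicator (Bad m) A \<le> c m A"
        by (cases "A \<in> Bad m") (auto simp: Bad_def c_def sum_nonneg)
    qed
    also have "\<dots> = pair_mass m (3 * \<zeta> ^ m)"
      unfolding c_def pair_mass_def
      by (simp only: Bochner_Integration.integral_sum Bochner_Integration.integrable_sum int_ind near_set_lmeasurable)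
    also have "\<dots> \<le> M ^ m * (q + K * real m * (3 * \<zeta> ^ m) * (X / \<kappa>) ^ m)"
      unfolding q_def using \<zeta>0 by (intro K) auto
    finally have le: "measure lebesgue (Bad m) * Y m \<le> M ^ m * (q + K * real m * (3 * \<zeta> ^ m) * (X / \<kappa>) ^ m)" .
    define a where "a = (\<zeta> / \<kappa>) ^ m"
    have a: "1 \<le> a" using \<zeta> \<kappa> by (simp add: a_def)
    have Xm: "1 \<le> X ^ m" using X_ge_1 by simp
    have q0: "0 \<le> q" by (simp add: q_def)
    have "q + K * real m * (3 * \<zeta> ^ m) * (X / \<kappa>) ^ m = q + 3 * K * real m * (X ^ m * a)"
      by (simp add: a_def power_divide)
    also have "\<dots> \<le> q * (X ^ m * a) + 3 * K * real m * (X ^ m * a)"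
    proof -
      have "1 * 1 \<le> X ^ m * a" using Xm a by (intro mult_mono) auto
      then show ?thesis using q0 mult_left_mono[of 1 "X ^ m * a" q] by simp
    qed
    also have "\<dots> \<le> ((q + 3 * K) * real (Suc m)) * (X ^ m * a)"
    proof -
      have "q + 3 * K * real m \<le> (q + 3 * K) * real (Suc m)" using q0 K by (simp add: algebra_simps)
      then have "(q + 3 * K * real m) * (X ^ m * a) \<le> ((q + 3 * K) * real (Suc m)) * (X ^ m * a)"
        using Xm a by (intro mult_right_mono) auto
      then show ?thesis by (simp add: algebra_simps)
    qed
    finally have "M ^ m * (q + K * real m * (3 * \<zeta> ^ m) * (X / \<kappa>) ^ m) \<le> M ^ m * (((q + 3 * K) * real (Suc m)) * (X ^ m * a))"
      by (intro mult_left_mono) auto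
    also have "\<dots> = ((q + 3 * K) * (real (Suc m) / a)) * Y m"
    proof -
      have "Y m = M ^ m * (X ^ m * (a * a))" by (simp add: Y_def a_def mult_2 power_add)
      then show ?thesis using a by simp
    qed
    finally have "measure lebesgue (Bad m) * Y m \<le> ((q + 3 * K) * (real (Suc m) / a)) * Y m" using le by simp
    then have "measure lebesgue (Bad m) \<le> (q + 3 * K) * (real (Suc m) / a)"
      using Ypos[of m] by (simp only: mult_le_cancel_right_pos)
    also have "real (Suc m) / a = real (Suc m) * (\<kappa> / \<zeta>) ^ m" by (simp add: a_def power_divide)
    finally show ?thesis .
  qed
  have "summable (\<lambda>m. measure lebesgue (Bad m))"
  proof (rule summable_comparison_test'[where N = 0])
    have "norm (\<kappa> / \<zeta>) < 1" using \<kappa> \<zeta> by simp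
    from geometric_deriv_sums[OF this]
    show "summable (\<lambda>m. (q + 3 * K) * (real (Suc m) * (\<kappa> / \<zeta>) ^ m))"
      by (intro summable_mult) (auto simp: sums_iff)
    show "norm (measure lebesgue (Bad m)) \<le> (q + 3 * K) * (real (Suc m) * (\<kappa> / \<zeta>) ^ m)" for m
      using bound by simp
  qed
  then have "AE A in lebesgue. eventually (\<lambda>m. A \<in> space lebesgue - Bad m) sequentially"
    using Badm by (intro borel_cantelli_AE1) (auto simp: fmeasurable_def)
  then show ?thesis
  proof (rule AE_mp, intro AE_I2 impI)
    fix A assume A: "A \<in> Q" and ev: "eventually (\<lambda>m. A \<in> space lebesgue - Bad m) sequentially"
    from ev show "eventually (\<lambda>m. real (card (close_pairs A m (3 * \<zeta> ^ m))) \<le> M ^ m * (X ^ m * (\<zeta> / \<kappa>) ^ (2 * m))) sequentially"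
      by eventually_elim (use A in \<open>auto simp: Bad_def card_close_pairs c_def Y_def not_less\<close>)
  qed
qed

end

section \<open>From neighbourhoods to almost every tuple\<close>

lemma continuous_word_product_entry: "continuous_on UNIV (\<lambda>A::real^2^2^'n::finite. word_product A w $ i $ j)"
proof (induction w arbitrary: i j)
  case (Cons k w)
  have *: "continuous_on UNIV (\<lambda>A::real^2^2^'n. A $ k $ i $ l)" for l by (intro continuous_intros)
  show ?case unfolding word_product_Cons matrix_mul_entry
    by (intro continuous_on_add continuous_on_mult * Cons)
qed simp

text \<open>By the Lindelof property countably many of the neighbourhoods suffice.\<close>

lemma AE_local_to_global:
  fixes U :: "'a::euclidean_space set"
  assumes "\<And>x. x \<in> U \<Longrightarrow> \<exists>Q. open Q \<and> x \<in> Q \<and> (AE y in lebesgue. y \<in> Q \<longrightarrow> P y)"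
  shows "AE y in lebesgue. y \<in> U \<longrightarrow> P y"
proof -
  define F where "F = {Q. open Q \<and> (AE y in lebesgue. y \<in> Q \<longrightarrow> P y)}"
  obtain F' where F': "F' \<subseteq> F" "countable F'" "\<Union>F' = \<Union>F"
    using Lindelof[of F] by (auto simp: F_def)
  have "AE y in lebesgue. \<forall>Q\<in>F'. y \<in> Q \<longrightarrow> P y"
    using F' by (subst AE_ball_countable) (auto simp: F_def)
  then show ?thesis
  proof (rule AE_mp, intro AE_I2 impI)
    fix y assume y: "\<forall>Q\<in>F'. y \<in> Q \<longrightarrow> P y" "y \<in> U"
    have "y \<in> \<Union>F" using assms[OF y(2)] by (auto simp: F_def)
    then show "P y" using y(1) F'(3) by blast
  qed
qed

definition row1_dir :: "real^2^2 \<Rightarrow> real" where "row1_dir B = gm B 1"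

definition contracting_tuples :: "(real^2^2^'n::finite) set" where
  "contracting_tuples = {A. \<forall>i. A $ i \<in> psgn \<and> det (A $ i) \<noteq> 0 \<and> \<bar>det (A $ i)\<bar> < 1/2 * (min_row_sum (A $ i))\<^sup>2}"

lemma finite_strict_gap:
  fixes f :: "'n::finite \<Rightarrow> real"
  assumes "\<And>i. f i < c"
  shows "\<exists>d<c. \<forall>i. f i < d"
proof -
  have "Max (range f) \<in> range f" by (rule Max_in) auto
  then have lt: "Max (range f) < c" using assms by auto
  have "f i \<le> Max (range f)" for i by (rule Max_ge) auto
  then show ?thesis using dense[OF lt] by (meson le_less_trans)
qed

text \<open>The requirements of \<open>transversal_family\<close> are strict inequalities between
  continuous functions of the tuple, so they persist near every admissible tuple; for the finitely
  many letters and words there is room for uniform constants.\<close>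

lemma dir_close_pairs_ae:
  fixes xs :: "'n::finite list list"
  assumes \<kappa>: "0 < \<kappa>" "\<kappa> < \<zeta>" and xs: "xs \<noteq> []" "\<And>\<gamma>. \<gamma> \<in> set xs \<Longrightarrow> length \<gamma> = n" "0 < n"
  defines "N \<equiv> real (card (set xs))"
  shows "AE A in lebesgue. A \<in> contracting_tuples \<inter> {A. \<forall>\<gamma>\<in>set xs. \<kappa> * (max_row_sum (word_product A \<gamma>))\<^sup>2 < \<bar>det (word_product A \<gamma>)\<bar>} \<longrightarrow>
    eventually (\<lambda>m. real (card {(w, w'). w \<in> words (rev ` set xs) m \<and> w' \<in> words (rev ` set xs) m \<and>
        \<bar>dir A (concat w) 1 - dir A (concat w') 1\<bar> \<le> 3 * \<zeta> ^ m})
      \<le> N ^ m * ((max 1 (N * \<kappa>)) ^ m * (\<zeta> / \<kappa>) ^ (2 * m))) sequentially"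
proof (rule AE_local_to_global)
  fix A0 :: "real^2^2^'n"
  assume "A0 \<in> contracting_tuples \<inter> {A. \<forall>\<gamma>\<in>set xs. \<kappa> * (max_row_sum (word_product A \<gamma>))\<^sup>2 < \<bar>det (word_product A \<gamma>)\<bar>}"
  then have A0: "\<And>i. A0 $ i \<in> psgn" "\<And>i. det (A0 $ i) \<noteq> 0" "\<And>i. \<bar>det (A0 $ i)\<bar> < 1/2 * (min_row_sum (A0 $ i))\<^sup>2"
    "\<And>\<gamma>. \<gamma> \<in> set xs \<Longrightarrow> \<kappa> * (max_row_sum (word_product A0 \<gamma>))\<^sup>2 < \<bar>det (word_product A0 \<gamma>)\<bar>"
    by (auto simp: contracting_tuples_def)
  have "\<exists>lam<1/2. \<forall>i. \<bar>det (A0 $ i)\<bar> / (min_row_sum (A0 $ i))\<^sup>2 < lam"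
  proof (rule finite_strict_gap)
    fix i
    show "\<bar>det (A0 $ i)\<bar> / (min_row_sum (A0 $ i))\<^sup>2 < 1/2"
      using A0(3)[of i] min_row_sum_pos[OF A0(1), of i] by (simp add: divide_less_eq)
  qed
  then obtain lam where lam: "lam < 1/2" "\<And>i. \<bar>det (A0 $ i)\<bar> / (min_row_sum (A0 $ i))\<^sup>2 < lam" by blast
  have lam0: "0 \<le> lam" using lam(2)[of undefined] by (rule order_trans[OF _ less_imp_le, rotated]) simp
  define eps where "eps = (1 - 2 * lam) / 2"
  have eps: "0 < eps" "eps < 1 - 2 * lam" using lam(1) by (auto simp: eps_def)
  have "\<exists>k1'<0. \<forall>i. - (\<bar>det (A0 $ i)\<bar> / (max_row_sum (A0 $ i))\<^sup>2) < k1'"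
  proof (rule finite_strict_gap)
    fix i
    have "0 < \<bar>det (A0 $ i)\<bar> / (max_row_sum (A0 $ i))\<^sup>2"
      using A0(2)[of i] max_row_sum_pos[OF A0(1), of i] by (intro divide_pos_pos) auto
    then show "- (\<bar>det (A0 $ i)\<bar> / (max_row_sum (A0 $ i))\<^sup>2) < 0" by simp
  qed
  then obtain k1' where k1': "k1' < 0" "\<And>i. - (\<bar>det (A0 $ i)\<bar> / (max_row_sum (A0 $ i))\<^sup>2) < k1'" by blast
  define \<kappa>1 where "\<kappa>1 = min 1 (- k1')"
  have \<kappa>1: "0 < \<kappa>1" "\<kappa>1 \<le> 1" using k1' by (auto simp: \<kappa>1_def)
  have \<kappa>1': "\<kappa>1 * (max_row_sum (A0 $ i))\<^sup>2 < \<bar>det (A0 $ i)\<bar>" for i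
  proof -
    have "\<kappa>1 < \<bar>det (A0 $ i)\<bar> / (max_row_sum (A0 $ i))\<^sup>2" using k1'(2)[of i] by (auto simp: \<kappa>1_def)
    then show ?thesis using max_row_sum_pos[OF A0(1), of i] by (simp add: less_divide_eq)
  qed
  define O1 where "O1 i = {A::real^2^2^'n. A $ i \<in> psgn}" for i
  define O2 where "O2 i = {A::real^2^2^'n. \<bar>det (A $ i)\<bar> < lam * (min_row_sum (A $ i))\<^sup>2}" for i
  define O3 where "O3 i j = {A::real^2^2^'n. \<bar>row_fun (A0 $ i) j - row_fun (A $ i) j\<bar> < eps * min_row_sum (A $ i)}" for i j
  define O4 where "O4 i = {A::real^2^2^'n. \<kappa>1 * (max_row_sum (A $ i))\<^sup>2 < \<bar>det (A $ i)\<bar>}" for i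
  define O5 where "O5 \<gamma> = {A::real^2^2^'n. \<kappa> * (max_row_sum (word_product A \<gamma>))\<^sup>2 < \<bar>det (word_product A \<gamma>)\<bar>}" for \<gamma>
  define Q where "Q = ball A0 1 \<inter> (\<Inter>i. O1 i) \<inter> (\<Inter>i. O2 i) \<inter> (\<Inter>i. \<Inter>j. O3 i j) \<inter> (\<Inter>i. O4 i) \<inter> (\<Inter>\<gamma>\<in>set xs. O5 \<gamma>)"
  have op: "open (O1 i)" "open (O2 i)" "open (O3 i j)" "open (O4 i)" "open (O5 \<gamma>)" for i j \<gamma>
    unfolding O1_def O2_def O3_def O4_def O5_def psgn_iff min_row_sum_rsum max_row_sum_def rsum_def det_2 row_fun_def
    by (intro open_Collect_conj open_Collect_disj open_Collect_less continuous_intros continuous_word_product_entry)+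
  have opQ: "open Q" unfolding Q_def by (intro open_Int open_INT op ballI) auto
  have lam': "\<bar>det (A0 $ i)\<bar> < lam * (min_row_sum (A0 $ i))\<^sup>2" for i
    using lam(2)[of i] min_row_sum_pos[OF A0(1), of i] by (simp add: divide_less_eq)
  have A0Q: "A0 \<in> Q"
    using A0 lam' eps \<kappa>1' min_row_sum_pos[OF A0(1)]
    by (simp add: Q_def O1_def O2_def O3_def O4_def O5_def)
  have Q: "A $ i \<in> psgn" "\<bar>det (A $ i)\<bar> < lam * (min_row_sum (A $ i))\<^sup>2"
    "\<bar>row_fun (A0 $ i) j - row_fun (A $ i) j\<bar> < eps * min_row_sum (A $ i)"
    "\<kappa>1 * (max_row_sum (A $ i))\<^sup>2 < \<bar>det (A $ i)\<bar>"
    "\<gamma> \<in> set xs \<Longrightarrow> \<kappa> * (max_row_sum (word_product A \<gamma>))\<^sup>2 < \<bar>det (word_product A \<gamma>)\<bar>" if "A \<in> Q" for A i j \<gamma>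
    using that by (auto simp: Q_def O1_def O2_def O3_def O4_def O5_def)
  interpret transversal_family A0 Q lam eps "rev ` set xs" n \<kappa> \<kappa>1
  proof
    fix A i j assume A: "A \<in> Q"
    show "A $ i \<in> psgn" by (rule Q[OF A])
    show "\<bar>det (A $ i)\<bar> / (min_row_sum (A $ i))\<^sup>2 \<le> lam"
      using Q(2)[OF A, of i] min_row_sum_pos[OF Q(1)[OF A], of i] by (simp add: divide_le_eq)
    show "\<bar>row_fun (A0 $ i) j - row_fun (A $ i) j\<bar> \<le> eps * min_row_sum (A $ i)"
      using Q(3)[OF A] by (rule less_imp_le)
  next
    fix A i and x y :: real assume A: "A \<in> Q" and xy: "x \<in> {0..1}" "y \<in> {0..1}"
    have "\<kappa>1 * \<bar>x - y\<bar> \<le> \<bar>det (A $ i)\<bar> / (max_row_sum (A $ i))\<^sup>2 * \<bar>x - y\<bar>"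
      using Q(4)[OF A, of i] max_row_sum_pos[OF Q(1)[OF A], of i] by (intro mult_right_mono) (auto simp: le_divide_eq)
    also have "\<dots> \<le> \<bar>gm (A $ i) x - gm (A $ i) y\<bar>" using xy by (intro gm_lower Q(1)[OF A]) auto
    finally show "\<kappa>1 * \<bar>x - y\<bar> \<le> \<bar>gm (A $ i) x - gm (A $ i) y\<bar>" .
  next
    fix A \<gamma>' and x y :: real assume A: "A \<in> Q" and "\<gamma>' \<in> rev ` set xs" and xy: "x \<in> {0..1}" "y \<in> {0..1}"
    then obtain \<gamma> where \<gamma>: "\<gamma> \<in> set xs" "\<gamma>' = rev \<gamma>" by blast
    have "\<gamma> \<noteq> []" using xs \<gamma> by fastforce
    then have p: "word_product A \<gamma> \<in> psgn" using Q(1)[OF A] by (rule word_product_psgn[rotated])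
    have "\<kappa> * \<bar>x - y\<bar> \<le> \<bar>det (word_product A \<gamma>)\<bar> / (max_row_sum (word_product A \<gamma>))\<^sup>2 * \<bar>x - y\<bar>"
      using Q(5)[OF A \<gamma>(1)] max_row_sum_pos[OF p] by (intro mult_right_mono) (auto simp: le_divide_eq)
    also have "\<dots> \<le> \<bar>gm (word_product A \<gamma>) x - gm (word_product A \<gamma>) y\<bar>" using xy by (intro gm_lower p) auto
    also have "\<dots> = \<bar>dir A \<gamma>' x - dir A \<gamma>' y\<bar>"
      using Q(1)[OF A] xy by (simp add: gm_word_product \<gamma>)
    finally show "\<kappa> * \<bar>x - y\<bar> \<le> \<bar>dir A \<gamma>' x - dir A \<gamma>' y\<bar>" .
  next
    show "bounded Q" by (rule bounded_subset[of "ball A0 1"]) (auto simp: Q_def)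
    show "Q \<in> sets borel" using opQ by (rule borel_open)
  qed (use lam lam0 eps \<kappa> \<kappa>1 xs in auto)
  have N: "real (card (rev ` set xs)) = N" unfolding N_def by (simp add: card_image)
  show "\<exists>Q. open Q \<and> A0 \<in> Q \<and> (AE A in lebesgue. A \<in> Q \<longrightarrow>
    eventually (\<lambda>m. real (card {(w, w'). w \<in> words (rev ` set xs) m \<and> w' \<in> words (rev ` set xs) m \<and>
        \<bar>dir A (concat w) 1 - dir A (concat w') 1\<bar> \<le> 3 * \<zeta> ^ m})
      \<le> N ^ m * ((max 1 (N * \<kappa>)) ^ m * (\<zeta> / \<kappa>) ^ (2 * m))) sequentially)"
    using opQ A0Q close_pairs_ae[OF assms(2)] unfolding close_pairs_def X_def N by blast
qed

text \<open>Reversing the order of the blocks and the letters within each block matches the order of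
  \<open>word_product\<close> with that of \<open>dir\<close>.\<close>

lemma close_pairs_word_product:
  assumes "\<And>i. A $ i \<in> psgn" "finite \<Gamma>"
  shows "card {(w, w'). w \<in> words \<Gamma> m \<and> w' \<in> words \<Gamma> m \<and>
      \<bar>row1_dir (word_product A (concat w)) - row1_dir (word_product A (concat w'))\<bar> \<le> r}
    = card {(w, w'). w \<in> words (rev ` \<Gamma>) m \<and> w' \<in> words (rev ` \<Gamma>) m \<and>
      \<bar>dir A (concat w) 1 - dir A (concat w') 1\<bar> \<le> r}" (is "card ?L = card ?R")
proof -
  define h :: "'a list list \<Rightarrow> 'a list list" where "h w = map rev (rev w)" for w
  have hh: "h (h w) = w" for w by (simp add: h_def rev_map)
  have d: "row1_dir (word_product A (concat w)) = dir A (concat (h w)) 1" for w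
    using gm_word_product[of A 1 "concat w", OF assms(1)] by (simp add: row1_dir_def h_def rev_concat rev_map)
  have mem: "w \<in> words \<Gamma> m \<longleftrightarrow> h w \<in> words (rev ` \<Gamma>) m" for w
    by (auto simp: words_def h_def image_subset_iff inj_image_mem_iff)
  have "bij_betw (map_prod h h) ?L ?R"
  proof (rule bij_betwI[where g = "map_prod h h"])
    show "map_prod h h \<in> ?L \<rightarrow> ?R" by (auto simp: d simp flip: mem)
    show "map_prod h h \<in> ?R \<rightarrow> ?L" by (auto simp: d mem hh)
  qed (auto simp: hh)
  then show ?thesis by (rule bij_betw_same_card)
qed

text \<open>All quantifiers stand under one almost-everywhere statement, since the word set and the
  constants are chosen later in dependence on the tuple. Finite word sets are coded by lists and the
  constants are rational, so countably many null sets are removed.\<close>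

theorem transversality_ae:
  "AE A :: real^2^2^'n::finite in lebesgue. A \<in> contracting_tuples \<longrightarrow>
    (\<forall>\<Gamma> n (\<kappa>::real) (\<zeta>::real). finite \<Gamma> \<longrightarrow> \<Gamma> \<noteq> {} \<longrightarrow> 0 < n \<longrightarrow> (\<forall>\<gamma>\<in>\<Gamma>. length \<gamma> = n) \<longrightarrow>
      \<kappa> \<in> \<rat> \<longrightarrow> \<zeta> \<in> \<rat> \<longrightarrow> 0 < \<kappa> \<longrightarrow> \<kappa> < \<zeta> \<longrightarrow>
      (\<forall>\<gamma>\<in>\<Gamma>. \<kappa> * (max_row_sum (word_product A \<gamma>))\<^sup>2 < \<bar>det (word_product A \<gamma>)\<bar>) \<longrightarrow>
      eventually (\<lambda>m. real (card {(w, w'). w \<in> words \<Gamma> m \<and> w' \<in> words \<Gamma> m \<and>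
          \<bar>row1_dir (word_product A (concat w)) - row1_dir (word_product A (concat w'))\<bar> \<le> 3 * \<zeta> ^ m})
        \<le> real (card \<Gamma>) ^ m * ((max 1 (real (card \<Gamma>) * \<kappa>)) ^ m * (\<zeta> / \<kappa>) ^ (2 * m))) sequentially)"
proof -
  have "AE A :: real^2^2^'n in lebesgue. \<forall>xs n k z. 
    xs \<noteq> [] \<longrightarrow> (\<forall>\<gamma>\<in>set xs. length \<gamma> = n) \<longrightarrow> 0 < n \<longrightarrow> 0 < k \<longrightarrow> k < z \<longrightarrow>
    A \<in> contracting_tuples \<inter> {A. \<forall>\<gamma>\<in>set xs. real_of_rat k * (max_row_sum (word_product A \<gamma>))\<^sup>2 < \<bar>det (word_product A \<gamma>)\<bar>} \<longrightarrow>
    eventually (\<lambda>m. real (card {(w, w'). w \<in> words (rev ` set xs) m \<and> w' \<in> words (rev ` set xs) m \<and>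
        \<bar>dir A (concat w) 1 - dir A (concat w') 1\<bar> \<le> 3 * real_of_rat z ^ m})
      \<le> real (card (set xs)) ^ m * ((max 1 (real (card (set xs)) * real_of_rat k)) ^ m * (real_of_rat z / real_of_rat k) ^ (2 * m))) sequentially"
    unfolding AE_all_countable
  proof (intro allI)
    fix xs :: "'n list list" and n k z
    show "AE A :: real^2^2^'n in lebesgue.
      xs \<noteq> [] \<longrightarrow> (\<forall>\<gamma>\<in>set xs. length \<gamma> = n) \<longrightarrow> 0 < n \<longrightarrow> 0 < k \<longrightarrow> k < z \<longrightarrow>
      A \<in> contracting_tuples \<inter> {A. \<forall>\<gamma>\<in>set xs. real_of_rat k * (max_row_sum (word_product A \<gamma>))\<^sup>2 < \<bar>det (word_product A \<gamma>)\<bar>} \<longrightarrow>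
      eventually (\<lambda>m. real (card {(w, w'). w \<in> words (rev ` set xs) m \<and> w' \<in> words (rev ` set xs) m \<and>
          \<bar>dir A (concat w) 1 - dir A (concat w') 1\<bar> \<le> 3 * real_of_rat z ^ m})
        \<le> real (card (set xs)) ^ m * ((max 1 (real (card (set xs)) * real_of_rat k)) ^ m * (real_of_rat z / real_of_rat k) ^ (2 * m))) sequentially"
    proof (cases "xs \<noteq> [] \<and> (\<forall>\<gamma>\<in>set xs. length \<gamma> = n) \<and> 0 < n \<and> 0 < k \<and> k < z")
      case True
      have "AE A :: real^2^2^'n in lebesgue.
        A \<in> contracting_tuples \<inter> {A. \<forall>\<gamma>\<in>set xs. real_of_rat k * (max_row_sum (word_product A \<gamma>))\<^sup>2 < \<bar>det (word_product A \<gamma>)\<bar>} \<longrightarrow>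
        eventually (\<lambda>m. real (card {(w, w'). w \<in> words (rev ` set xs) m \<and> w' \<in> words (rev ` set xs) m \<and>
            \<bar>dir A (concat w) 1 - dir A (concat w') 1\<bar> \<le> 3 * real_of_rat z ^ m})
          \<le> real (card (set xs)) ^ m * ((max 1 (real (card (set xs)) * real_of_rat k)) ^ m * (real_of_rat z / real_of_rat k) ^ (2 * m))) sequentially"
        using True by (intro dir_close_pairs_ae[where n = n]) (auto simp: of_rat_less)
      then show ?thesis by eventually_elim blast
    next
      case False
      then show ?thesis by (intro AE_I2) blast
    qed
  qed
  then show ?thesis
  proof (rule AE_mp, intro AE_I2 impI allI)
    fix A :: "real^2^2^'n" and \<Gamma> :: "'n list set" and n :: nat and \<kappa> \<zeta> :: real
    assume *: "\<forall>xs n k z. 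
      xs \<noteq> [] \<longrightarrow> (\<forall>\<gamma>\<in>set xs. length \<gamma> = n) \<longrightarrow> 0 < n \<longrightarrow> 0 < k \<longrightarrow> k < z \<longrightarrow>
      A \<in> contracting_tuples \<inter> {A. \<forall>\<gamma>\<in>set xs. real_of_rat k * (max_row_sum (word_product A \<gamma>))\<^sup>2 < \<bar>det (word_product A \<gamma>)\<bar>} \<longrightarrow>
      eventually (\<lambda>m. real (card {(w, w'). w \<in> words (rev ` set xs) m \<and> w' \<in> words (rev ` set xs) m \<and>
          \<bar>dir A (concat w) 1 - dir A (concat w') 1\<bar> \<le> 3 * real_of_rat z ^ m})
        \<le> real (card (set xs)) ^ m * ((max 1 (real (card (set xs)) * real_of_rat k)) ^ m * (real_of_rat z / real_of_rat k) ^ (2 * m))) sequentially"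
    assume A: "A \<in> contracting_tuples" and \<Gamma>: "finite \<Gamma>" "\<Gamma> \<noteq> {}" "0 < n" "\<forall>\<gamma>\<in>\<Gamma>. length \<gamma> = n"
      and kz: "\<kappa> \<in> \<rat>" "\<zeta> \<in> \<rat>" "0 < \<kappa>" "\<kappa> < \<zeta>"
      and con: "\<forall>\<gamma>\<in>\<Gamma>. \<kappa> * (max_row_sum (word_product A \<gamma>))\<^sup>2 < \<bar>det (word_product A \<gamma>)\<bar>"
    obtain xs where xs: "set xs = \<Gamma>" using finite_list[OF \<Gamma>(1)] by blast
    obtain k z where kz': "\<kappa> = real_of_rat k" "\<zeta> = real_of_rat z" using kz by (auto elim!: Rats_cases)
    have p: "\<And>i. A $ i \<in> psgn" using A by (simp add: contracting_tuples_def)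
    show "eventually (\<lambda>m. real (card {(w, w'). w \<in> words \<Gamma> m \<and> w' \<in> words \<Gamma> m \<and>
          \<bar>row1_dir (word_product A (concat w)) - row1_dir (word_product A (concat w'))\<bar> \<le> 3 * \<zeta> ^ m})
        \<le> real (card \<Gamma>) ^ m * ((max 1 (real (card \<Gamma>) * \<kappa>)) ^ m * (\<zeta> / \<kappa>) ^ (2 * m))) sequentially"
      unfolding close_pairs_word_product[OF p \<Gamma>(1)]
      using *[rule_format, of xs n k z] xs \<Gamma> kz kz' A con by (auto simp: of_rat_less)
  qed
qed

text \<open>If more than half of the words had more than 2 * Y neighbours each, the number of close
  pairs would exceed card W * Y.\<close>

lemma half_with_few_neighbours:
  fixes f :: "'a \<Rightarrow> real"
  assumes W: "finite W" and Y: "0 < Y"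
    and le: "real (card {(w, w'). w \<in> W \<and> w' \<in> W \<and> \<bar>f w - f w'\<bar> \<le> r}) \<le> real (card W) * Y"
  obtains V where "V \<subseteq> W" "real (card W) / 2 \<le> real (card V)"
    "\<And>w. w \<in> V \<Longrightarrow> real (card {w'\<in>V. \<bar>f w - f w'\<bar> \<le> r}) \<le> 2 * Y"
proof -
  define c where "c w = real (card {w'\<in>W. \<bar>f w - f w'\<bar> \<le> r})" for w
  define V where "V = {w\<in>W. c w \<le> 2 * Y}"
  have fin: "finite V" using W by (simp add: V_def)
  have "{(w, w'). w \<in> W \<and> w' \<in> W \<and> \<bar>f w - f w'\<bar> \<le> r} = (SIGMA w:W. {w'\<in>W. \<bar>f w - f w'\<bar> \<le> r})" by auto
  then have "real (card {(w, w'). w \<in> W \<and> w' \<in> W \<and> \<bar>f w - f w'\<bar> \<le> r}) = (\<Sum>w\<in>W. c w)"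
    using W by (simp add: c_def)
  then have sum: "(\<Sum>w\<in>W. c w) \<le> real (card W) * Y" using le by simp
  have "real (card (W - V)) * (2 * Y) = (\<Sum>w\<in>W - V. 2 * Y)" by simp
  also have "\<dots> \<le> (\<Sum>w\<in>W - V. c w)" by (intro sum_mono) (auto simp: V_def)
  also have "\<dots> \<le> (\<Sum>w\<in>W. c w)" using W by (intro sum_mono2) (auto simp: c_def)
  finally have "real (card (W - V)) * (2 * Y) \<le> real (card W) * Y" using sum by simp
  then have "real (card (W - V)) * 2 \<le> real (card W)" using Y by simp
  moreover have "card (W - V) = card W - card V" "card V \<le> card W"
    using W by (auto simp: V_def intro: card_Diff_subset card_mono)
  ultimately have "real (card W) / 2 \<le> real (card V)" by (simp add: of_nat_diff)
  moreover have "real (card {w'\<in>V. \<bar>f w - f w'\<bar> \<le> r}) \<le> 2 * Y" if "w \<in> V" for w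
  proof -
    have "card {w'\<in>V. \<bar>f w - f w'\<bar> \<le> r} \<le> card {w'\<in>W. \<bar>f w - f w'\<bar> \<le> r}"
      using W by (intro card_mono) (auto simp: V_def)
    then show ?thesis using that by (simp add: V_def c_def)
  qed
  ultimately show thesis using that[of V] by (auto simp: V_def)
qed

section \<open>Self-affine measures\<close>

text \<open>The letters will be sequences of blocks, that is, long words over the original alphabet.
  \<open>K\<close> will be the attractor of the original system, of which the maps are a subsystem;
  hence forward invariance in place of equality.\<close>

locale affine_system =
  fixes I :: "'i::countable set" and B :: "'i \<Rightarrow> real^2^2" and F :: "'i \<Rightarrow> real^2 \<Rightarrow> real^2"
    and K :: "(real^2) set" and p q e0 :: real
  assumes I: "finite I" "I \<noteq> {}"
    and F_diff: "\<And>i x y. F i x - F i y = B i *v (x - y)"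
    and K: "compact K" "K \<noteq> {}" and F_K: "\<And>i x. i \<in> I \<Longrightarrow> x \<in> K \<Longrightarrow> F i x \<in> K"
    and B_psgn: "\<And>i. i \<in> I \<Longrightarrow> B i \<in> psgn"
    and B_contr: "\<And>i. i \<in> I \<Longrightarrow> sv1 (B i) < 1"
    and p: "0 < p" "p < 1" "\<And>i. i \<in> I \<Longrightarrow> p \<le> min_row_sum (B i)"
    and q: "0 < q" "q < 1" "\<And>i. i \<in> I \<Longrightarrow> q \<le> sv2 (B i)"
    and e0: "0 < e0" "\<And>i j x y. i \<in> I \<Longrightarrow> j \<in> I \<Longrightarrow> x \<in> K \<Longrightarrow> y \<in> K \<Longrightarrow> i \<noteq> j \<Longrightarrow> e0 \<le> dist (F i x) (F j y)"
begin

definition Fw :: "'i list \<Rightarrow> real^2 \<Rightarrow> real^2" where "Fw w x = foldr F w x"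
definition Bw :: "'i list \<Rightarrow> real^2^2" where "Bw w = foldr (\<lambda>i C. B i ** C) w (mat 1)"

lemma Fw_simps [simp]: "Fw [] x = x" "Fw (i # w) x = F i (Fw w x)"
  and Fw_append: "Fw (u @ w) x = Fw u (Fw w x)"
  by (simp_all add: Fw_def)

lemma Bw_simps [simp]: "Bw [] = mat 1" "Bw (i # w) = B i ** Bw w"
  by (simp_all add: Bw_def)

lemma Bw_append: "Bw (u @ w) = Bw u ** Bw w"
  by (induction u) (simp_all add: matrix_mul_assoc)

lemma Fw_diff: "Fw w x - Fw w y = Bw w *v (x - y)"
  by (induction w arbitrary: x y) (simp_all add: F_diff matrix_vector_mul_assoc)

lemma dist_Fw: "dist (Fw w x) (Fw w y) = norm (Bw w *v (x - y))"
  by (simp add: dist_norm Fw_diff)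

lemma Fw_K: "set w \<subseteq> I \<Longrightarrow> x \<in> K \<Longrightarrow> Fw w x \<in> K"
  by (induction w) (auto simp: F_K)

lemma F_continuous: "continuous_on UNIV (F i)"
proof -
  have "F i = (\<lambda>x. F i 0 + B i *v x)"
  proof
    fix x
    have "F i x - F i 0 = B i *v x" using F_diff[of i x 0] by simp
    then show "F i x = F i 0 + B i *v x" by (simp add: diff_eq_eq add.commute)
  qed
  moreover have "continuous_on UNIV (\<lambda>x. F i 0 + B i *v x)"
    by (intro continuous_intros linear_continuous_on) (simp add: matrix_vector_mul_bounded_linear)
  ultimately show ?thesis by metis
qed

lemma Fw_continuous: "continuous_on UNIV (Fw w)"
proof (induction w)
  case (Cons i w)
  have "continuous_on UNIV (\<lambda>x. F i (Fw w x))"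
    by (rule continuous_on_compose2[OF F_continuous Cons]) auto
  then show ?case by simp
qed (simp add: continuous_on_id)

lemma Fw_measurable [measurable]: "Fw w \<in> borel_measurable borel" "F i \<in> borel_measurable borel"
  by (intro borel_measurable_continuous_onI Fw_continuous F_continuous)+

lemma Fw_shrinks:
  "\<exists>c l. 0 < c \<and> 0 \<le> l \<and> l < 1 \<and> (\<forall>w x y. set w \<subseteq> I \<longrightarrow> x \<in> K \<longrightarrow> y \<in> K \<longrightarrow> dist (Fw w x) (Fw w y) \<le> c * l ^ length w)"
proof -
  define l where "l = Max ((\<lambda>i. sv1 (B i)) ` I)"
  have le: "sv1 (B i) \<le> l" if "i \<in> I" for i unfolding l_def using I that by (intro Max_ge) auto
  have "l \<in> (\<lambda>i. sv1 (B i)) ` I" unfolding l_def using I by (intro Max_in) auto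
  then have l: "0 \<le> l" "l < 1" using B_contr sv1_nonneg by auto
  have sv: "sv1 (Bw w) \<le> l ^ length w" if "set w \<subseteq> I" for w
    using that
  proof (induction w)
    case (Cons i w)
    have "sv1 (B i ** Bw w) \<le> sv1 (B i) * sv1 (Bw w)" by (rule sv1_mult)
    also have "\<dots> \<le> l * l ^ length w" using Cons le l by (intro mult_mono sv1_nonneg) auto
    finally show ?case by simp
  qed (simp add: sv_mat1)
  have "dist (Fw w x) (Fw w y) \<le> (diameter K + 1) * l ^ length w" if "set w \<subseteq> I" "x \<in> K" "y \<in> K" for w x y
  proof -
    have "dist (Fw w x) (Fw w y) \<le> sv1 (Bw w) * norm (x - y)" unfolding dist_Fw by (rule norm_le_sv1)
    also have "\<dots> \<le> l ^ length w * (diameter K + 1)"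
      using sv[OF that(1)] l diameter_bounded_bound[OF compact_imp_bounded[OF K(1)] that(2,3)]
      by (intro mult_mono) (auto simp: dist_norm)
    finally show ?thesis by (simp add: mult.commute)
  qed
  moreover have "0 < diameter K + 1" using diameter_ge_0[OF compact_imp_bounded[OF K(1)]] by simp
  ultimately show ?thesis using l by (intro exI[of _ "diameter K + 1"] exI[of _ l]) auto
qed

abbreviation "M \<equiv> real (card I)"

lemma M_ge_1: "1 \<le> M"
  using I by (simp add: Suc_leI card_gt_0_iff)

text \<open>The image of the uniform Bernoulli measure on streams under the coding map.
  Self-similarity of the stream measure under prepending a letter becomes invariance.\<close>

lemma invariant_measure_exists:
  "\<exists>\<nu>. prob_space \<nu> \<and> sets \<nu> = sets borel \<and> emeasure \<nu> K = 1 \<and>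
    (\<forall>f\<in>borel_measurable borel. (\<integral>\<^sup>+x. f x \<partial>\<nu>) = (\<Sum>i\<in>I. \<integral>\<^sup>+x. f (F i x) \<partial>\<nu>) / ennreal M)"
proof -
  obtain z where z: "z \<in> K" using K by blast
  obtain c l where cl: "0 < c" "0 \<le> l" "l < 1"
    "\<And>w x y. set w \<subseteq> I \<Longrightarrow> x \<in> K \<Longrightarrow> y \<in> K \<Longrightarrow> dist (Fw w x) (Fw w y) \<le> c * l ^ length w"
    using Fw_shrinks by metis
  define G where "G = measure_pmf (pmf_of_set I)"
  interpret G: prob_space G unfolding G_def by (rule measure_pmf.prob_space_axioms)
  define S where "S = stream_space G"
  interpret S: prob_space S unfolding S_def by (rule G.prob_space_stream_space)
  have setsG: "sets G = sets (count_space UNIV)" by (simp add: G_def)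
  have setsS[measurable_cong]: "sets S = sets (stream_space (count_space UNIV))"
    unfolding S_def by (rule sets_stream_space_cong[OF setsG])
  define \<pi>k where "\<pi>k k s = Fw (stake k s) z" for k s
  define \<pi> where "\<pi> s = lim (\<lambda>k. \<pi>k k s)" for s
  have \<pi>k_meas[measurable]: "\<pi>k k \<in> borel_measurable S" for k
  proof -
    have "(\<lambda>s. Fw (stake k s) z) \<in> borel_measurable (stream_space (count_space UNIV))"
      by (rule measurable_compose[OF measurable_stake]) simp
    then show ?thesis unfolding \<pi>k_def measurable_cong_sets[OF setsS refl] .
  qed
  have \<pi>_meas[measurable]: "\<pi> \<in> borel_measurable S"
    unfolding \<pi>_def by (rule borel_measurable_lim_metric) measurable
  have AE_I: "AE s in S. sset s \<subseteq> I"
  proof -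
    have "AE s in S. \<forall>n. s !! n \<in> I"
      unfolding AE_all_countable
    proof
      fix n
      have "AE s in S. stream_all (\<lambda>x. x \<in> I) s"
        unfolding S_def
      proof (rule G.AE_stream_all)
        show "AE x in G. x \<in> I" unfolding G_def using I by (simp add: AE_measure_pmf_iff)
      qed (simp add: G_def)
      then show "AE s in S. s !! n \<in> I" by eventually_elim (auto simp: stream_all_def)
    qed
    then show ?thesis by eventually_elim (auto simp: sset_range)
  qed
  have stk: "set (stake k s) \<subseteq> I" if "sset s \<subseteq> I" for k and s :: "'i stream"
  proof -
    have "set (stake k s) \<subseteq> sset s"
      by (induction k arbitrary: s) (auto simp: shd_sset dest: stl_sset)
    then show ?thesis using that by blast
  qed
  have conv: "(\<lambda>k. \<pi>k k s) \<longlonglongrightarrow> \<pi> s" if s: "sset s \<subseteq> I" for s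
  proof -
    have "Cauchy (\<lambda>k. \<pi>k k s)"
    proof (rule metric_CauchyI)
      fix e :: real assume e: "0 < e"
      have "(\<lambda>k. c * l ^ k) \<longlonglongrightarrow> c * 0" using cl by (intro tendsto_intros LIMSEQ_realpow_zero) auto
      then have "eventually (\<lambda>k. c * l ^ k < e) sequentially" using e by (intro order_tendstoD(2)) auto
      then obtain N where N: "\<And>k. k \<ge> N \<Longrightarrow> c * l ^ k < e" by (auto simp: eventually_sequentially)
      have *: "dist (\<pi>k m s) (\<pi>k n s) < e" if "N \<le> m" "m \<le> n" for m n
      proof -
        have se: "stake n s = stake m s @ stake (n - m) (sdrop m s)"
          using that by (metis le_add_diff_inverse stake_add)
        have "set (stake (n - m) (sdrop m s)) \<subseteq> I"
          by (rule stk) (use s in \<open>auto simp: sset_range sdrop_snth\<close>)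
        then have "dist (\<pi>k m s) (\<pi>k n s) \<le> c * l ^ m"
          unfolding \<pi>k_def se Fw_append using cl(4)[OF stk[OF s] z Fw_K[OF _ z], of "stake (n - m) (sdrop m s)" m] by simp
        also have "\<dots> < e" using N that by simp
        finally show ?thesis .
      qed
      show "\<exists>N. \<forall>m\<ge>N. \<forall>n\<ge>N. dist (\<pi>k m s) (\<pi>k n s) < e"
        by (rule exI[of _ N]) (metis * dist_commute nat_le_linear)
    qed
    then show ?thesis unfolding \<pi>_def by (simp add: Cauchy_convergent_iff convergent_LIMSEQ_iff)
  qed
  have \<pi>_K: "\<pi> s \<in> K" if s: "sset s \<subseteq> I" for s
    by (rule closed_sequentially[OF compact_imp_closed[OF K(1)] _ conv[OF s]])
      (simp add: \<pi>k_def Fw_K[OF stk[OF s] z])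
  have \<pi>_Cons: "\<pi> (i ## s) = F i (\<pi> s)" if s: "sset s \<subseteq> I" and i: "i \<in> I" for i s
  proof (rule LIMSEQ_unique)
    have "(\<lambda>k. \<pi>k k (i ## s)) \<longlonglongrightarrow> \<pi> (i ## s)" using s i by (intro conv) simp
    then show "(\<lambda>k. \<pi>k (Suc k) (i ## s)) \<longlonglongrightarrow> \<pi> (i ## s)" by (rule LIMSEQ_Suc)
    have "(\<lambda>k. F i (\<pi>k k s)) \<longlonglongrightarrow> F i (\<pi> s)"
      by (rule continuous_on_tendsto_compose[OF F_continuous conv[OF s]]) auto
    then show "(\<lambda>k. \<pi>k (Suc k) (i ## s)) \<longlonglongrightarrow> F i (\<pi> s)" by (simp add: \<pi>k_def)
  qed
  define \<nu> where "\<nu> = distr S borel \<pi>"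
  have "prob_space \<nu>" unfolding \<nu>_def by (rule S.prob_space_distr) measurable
  moreover have "sets \<nu> = sets borel" by (simp add: \<nu>_def)
  moreover have "emeasure \<nu> K = 1"
  proof -
    have "AE s in S. \<pi> s \<in> K" using AE_I by eventually_elim (rule \<pi>_K)
    then have "AE s in S. s \<in> \<pi> -` K \<inter> space S" using AE_space by eventually_elim simp
    moreover have "\<pi> -` K \<inter> space S \<in> sets S"
      by (rule measurable_sets[OF \<pi>_meas]) (use K(1) in \<open>simp add: borel_compact\<close>)
    ultimately have "emeasure S (\<pi> -` K \<inter> space S) = 1" by (intro S.emeasure_eq_1_AE)
    then show ?thesis unfolding \<nu>_def using K(1) \<pi>_meas by (simp add: emeasure_distr borel_compact)
  qed
  moreover have "(\<integral>\<^sup>+x. f x \<partial>\<nu>) = (\<Sum>i\<in>I. \<integral>\<^sup>+x. f (F i x) \<partial>\<nu>) / ennreal M"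
    if f[measurable]: "f \<in> borel_measurable borel" for f :: "real^2 \<Rightarrow> ennreal"
  proof -
    have "(\<integral>\<^sup>+x. f x \<partial>\<nu>) = (\<integral>\<^sup>+s. f (\<pi> s) \<partial>S)"
      unfolding \<nu>_def by (rule nn_integral_distr) measurable
    also have "\<dots> = (\<integral>\<^sup>+i. (\<integral>\<^sup>+s. f (\<pi> (i ## s)) \<partial>S) \<partial>G)"
      unfolding S_def by (rule G.nn_integral_stream_space) (use f \<pi>_meas in \<open>simp add: S_def[symmetric]\<close>)
    also have "\<dots> = (\<Sum>i\<in>I. \<integral>\<^sup>+s. f (\<pi> (i ## s)) \<partial>S) / ennreal M"
      unfolding G_def using I by (subst nn_integral_pmf_of_set) (auto simp: ennreal_of_nat_eq_real_of_nat)
    also have "(\<Sum>i\<in>I. \<integral>\<^sup>+s. f (\<pi> (i ## s)) \<partial>S) = (\<Sum>i\<in>I. \<integral>\<^sup>+x. f (F i x) \<partial>\<nu>)"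
    proof (rule sum.cong[OF refl])
      fix i assume i: "i \<in> I"
      have "(\<integral>\<^sup>+s. f (\<pi> (i ## s)) \<partial>S) = (\<integral>\<^sup>+s. f (F i (\<pi> s)) \<partial>S)"
        by (rule nn_integral_cong_AE) (use AE_I in eventually_elim, simp add: \<pi>_Cons i)
      also have "\<dots> = (\<integral>\<^sup>+x. f (F i x) \<partial>\<nu>)"
        unfolding \<nu>_def by (rule nn_integral_distr[symmetric]) measurable
      finally show "(\<integral>\<^sup>+s. f (\<pi> (i ## s)) \<partial>S) = (\<integral>\<^sup>+x. f (F i x) \<partial>\<nu>)" .
    qed
    finally show ?thesis .
  qed
  ultimately show ?thesis by blast
qed

end

section \<open>Correlations, strips and the Frostman condition for directions\<close>

definition strip :: "real \<Rightarrow> real \<Rightarrow> ((real^2) \<times> (real^2)) set" where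
  "strip \<theta> s = {z. \<bar>\<theta> * (fst z $ 1 - snd z $ 1) + (1 - \<theta>) * (fst z $ 2 - snd z $ 2)\<bar> \<le> s}"

lemma strip_measurable [measurable]: "strip \<theta> s \<in> sets (borel \<Otimes>\<^sub>M borel)"
  unfolding strip_def borel_prod by (intro borel_closed closed_Collect_le continuous_intros)

lemma strip_mono: "s \<le> t \<Longrightarrow> strip \<theta> s \<subseteq> strip \<theta> t"
  by (auto simp: strip_def)

text \<open>The assumption \<open>cluster\<close> is the only trace of transversality: at scale \<open>\<kappa>\<close> the directions
  of the matrices \<open>B i\<close> satisfy a Frostman condition of exponent \<open>d\<close>.\<close>

locale self_affine_measure = affine_system I B F K p q e0
  for I :: "'i::countable set" and B F K p q e0 +
  fixes \<nu> :: "(real^2) measure" and \<kappa> d :: real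
  assumes prob_\<nu>: "prob_space \<nu>" and sets_\<nu>: "sets \<nu> = sets borel" and \<nu>_K: "emeasure \<nu> K = 1"
    and inv: "\<And>f. f \<in> borel_measurable borel \<Longrightarrow> (\<integral>\<^sup>+x. f x \<partial>\<nu>) = (\<Sum>i\<in>I. \<integral>\<^sup>+x. f (F i x) \<partial>\<nu>) / ennreal M"
    and \<kappa>: "0 < \<kappa>" "\<kappa> < 1" "\<kappa> \<le> q / p"
    and \<kappa>_lower: "\<And>i x y. i \<in> I \<Longrightarrow> x \<in> {0..1} \<Longrightarrow> y \<in> {0..1} \<Longrightarrow> \<kappa> * \<bar>x - y\<bar> \<le> \<bar>gm (B i) x - gm (B i) y\<bar>"
    and d: "0 < d"
    and cluster: "\<And>S. S \<subseteq> I \<Longrightarrow> (\<And>i j. i \<in> S \<Longrightarrow> j \<in> S \<Longrightarrow> \<exists>x\<in>{0..1}. \<exists>y\<in>{0..1}. \<bar>gm (B i) x - gm (B j) y\<bar> \<le> \<kappa>)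
        \<Longrightarrow> real (card S) \<le> M * \<kappa> powr d"
begin

interpretation \<nu>: prob_space \<nu> by (rule prob_\<nu>)
interpretation P: pair_prob_space \<nu> \<nu> ..

declare sets_\<nu> [measurable_cong]

abbreviation "P \<equiv> \<nu> \<Otimes>\<^sub>M \<nu>"

lemma sets_P [measurable_cong]: "sets P = sets (borel \<Otimes>\<^sub>M borel)"
  by (rule sets_pair_measure_cong[OF sets_\<nu> sets_\<nu>])

lemma AE_K: "AE x in \<nu>. x \<in> K"
  by (subst \<nu>.AE_in_set_eq_1) (use \<nu>_K K(1) in \<open>simp_all add: sets_\<nu> borel_compact measure_def\<close>)

text \<open>The direction of the first row of the product, built up from the left; the start value 1
  encodes the row vector (1, 0).\<close>

definition \<theta> :: "'i list \<Rightarrow> real" where "\<theta> w = foldl (\<lambda>x i. gm (B i) x) 1 w"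

lemma \<theta>_simps [simp]: "\<theta> [] = 1" "\<theta> (w @ [i]) = gm (B i) (\<theta> w)"
  by (simp_all add: \<theta>_def)

lemma \<theta>_mem: "set w \<subseteq> I \<Longrightarrow> \<theta> w \<in> {0..1}"
  by (induction w rule: rev_induct) (use gm_mem B_psgn in auto)

lemma Bw_props:
  assumes "set w \<subseteq> I"
  shows "w \<noteq> [] \<Longrightarrow> Bw w \<in> psgn" "\<theta> w = gm (Bw w) 1" "p ^ length w \<le> rsum (Bw w) 1" "q ^ length w \<le> sv2 (Bw w)"
proof -
  have "(w \<noteq> [] \<longrightarrow> Bw w \<in> psgn) \<and> \<theta> w = gm (Bw w) 1 \<and> p ^ length w \<le> rsum (Bw w) 1"
    using assms
  proof (induction w rule: rev_induct)
    case Nil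
    show ?case unfolding Bw_simps gm_mat1 \<theta>_simps by (simp add: rsum_def mat_def)
  next
    case (snoc i w)
    then have IH: "w \<noteq> [] \<longrightarrow> Bw w \<in> psgn" "\<theta> w = gm (Bw w) 1" "p ^ length w \<le> rsum (Bw w) 1" and i: "i \<in> I" by auto
    have eq: "Bw (w @ [i]) = Bw w ** B i" by (simp add: Bw_append)
    show ?case
    proof (cases "w = []")
      case True
      have "p \<le> rsum (B i) 1" using p(3)[OF i] min_row_sum_le order_trans by blast
      then show ?thesis using True B_psgn[OF i] by (simp add: \<theta>_def)
    next
      case False
      have "p ^ length w * p \<le> rsum (Bw w) 1 * min_row_sum (B i)"
        using IH p(1) p(3)[OF i] by (intro mult_mono) (auto simp: rsum_def)
      also have "\<dots> \<le> rsum (Bw w ** B i) 1" using IH False by (intro rsum_mult_ge B_psgn i) auto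
      finally show ?thesis unfolding eq using IH False B_psgn[OF i] by (simp add: psgn_mult gm_mult mult.commute)
    qed
  qed
  then show "w \<noteq> [] \<Longrightarrow> Bw w \<in> psgn" "\<theta> w = gm (Bw w) 1" "p ^ length w \<le> rsum (Bw w) 1" by auto
  show "q ^ length w \<le> sv2 (Bw w)"
    using assms
  proof (induction w)
    case (Cons i w)
    have "q * q ^ length w \<le> sv2 (B i) * sv2 (Bw w)" using Cons q by (intro mult_mono sv2_nonneg) auto
    also have "\<dots> \<le> sv2 (B i ** Bw w)" by (rule sv2_mult)
    finally show ?case by simp
  qed (simp add: sv_mat1)
qed

lemma Bw_direction:
  assumes "set w \<subseteq> I"
  shows "p ^ length w * \<bar>\<theta> w * z$1 + (1 - \<theta> w) * z$2\<bar> \<le> norm (Bw w *v z)"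
proof (cases "w = []")
  case True
  then show ?thesis using component_le_norm_cart[of z 1] by simp
next
  case False
  have "p ^ length w * \<bar>\<theta> w * z$1 + (1 - \<theta> w) * z$2\<bar> \<le> rsum (Bw w) 1 * \<bar>\<theta> w * z$1 + (1 - \<theta> w) * z$2\<bar>"
    by (intro mult_right_mono Bw_props assms) auto
  also have "\<dots> \<le> norm (Bw w *v z)"
    unfolding Bw_props(2)[OF assms] by (rule gm_one_direction[OF Bw_props(1)[OF assms False]])
  finally show ?thesis .
qed

text \<open>The gap \<open>e0\<close> at the first letter where the words differ is shrunk by the
  common prefix, which contracts by no more than its smaller singular value.\<close>

lemma Fw_separated:
  assumes "w \<in> words I k" "w' \<in> words I k" "w \<noteq> w'" "x \<in> K" "y \<in> K"
  shows "e0 * q ^ k \<le> dist (Fw w x) (Fw w' y)"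
proof -
  have len: "length w = k" "length w' = k" and sub: "set w \<subseteq> I" "set w' \<subseteq> I" using assms by (auto simp: words_def)
  obtain u i v j v' where u: "i \<noteq> j" "w = u @ [i] @ v" "w' = u @ [j] @ v'"
    using same_length_different[OF assms(3)] len by metis
  have "e0 * q ^ k \<le> q ^ length u * e0"
    using q e0 len u by (subst mult.commute) (intro mult_right_mono power_decreasing, auto)
  also have "\<dots> \<le> q ^ length u * dist (F i (Fw v x)) (F j (Fw v' y))"
    using u sub q assms by (intro mult_left_mono e0(2) Fw_K) auto
  also have "\<dots> \<le> sv2 (Bw u) * dist (F i (Fw v x)) (F j (Fw v' y))"
    using u sub by (intro mult_right_mono Bw_props) auto
  also have "\<dots> \<le> dist (Fw w x) (Fw w' y)"
    using norm_ge_sv2[of "Bw u" "F i (Fw v x) - F j (Fw v' y)"] by (simp add: u Fw_append dist_Fw) (simp add: dist_norm)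
  finally show ?thesis .
qed

lemma inv_words:
  assumes [measurable]: "f \<in> borel_measurable borel"
  shows "(\<integral>\<^sup>+x. f x \<partial>\<nu>) = ennreal (1 / M ^ k) * (\<Sum>w\<in>words I k. \<integral>\<^sup>+x. f (Fw w x) \<partial>\<nu>)"
proof -
  have inv': "(\<integral>\<^sup>+x. g x \<partial>\<nu>) = ennreal (1 / M) * (\<Sum>i\<in>I. \<integral>\<^sup>+x. g (F i x) \<partial>\<nu>)"
    if "g \<in> borel_measurable borel" for g
    using inv[OF that] M_ge_1 by (simp add: divide_ennreal_def inverse_ennreal mult.commute inverse_eq_divide)
  show ?thesis using assms
  proof (induction k arbitrary: f)
    case (Suc k)
    note [measurable] = Suc.prems
    have "(\<integral>\<^sup>+x. f x \<partial>\<nu>) = ennreal (1 / M) * (\<Sum>i\<in>I. \<integral>\<^sup>+x. f (F i x) \<partial>\<nu>)"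
      by (rule inv') measurable
    also have "\<dots> = ennreal (1 / M) * (\<Sum>i\<in>I. ennreal (1 / M ^ k) * (\<Sum>w\<in>words I k. \<integral>\<^sup>+x. f (F i (Fw w x)) \<partial>\<nu>))"
      by (subst Suc.IH) measurable
    also have "\<dots> = (ennreal (1 / M) * ennreal (1 / M ^ k)) * (\<Sum>w\<in>words I (Suc k). \<integral>\<^sup>+x. f (Fw w x) \<partial>\<nu>)"
      by (simp add: sum_words_Suc sum_distrib_left mult.assoc)
    also have "ennreal (1 / M) * ennreal (1 / M ^ k) = ennreal (1 / M ^ Suc k)"
      by (subst ennreal_mult[symmetric]) auto
    finally show ?case .
  qed simp
qed

definition "\<phi> r = measure P (pairs_within r)"
definition "\<psi> k s = (\<Sum>w\<in>words I k. measure P (strip (\<theta> w) s))"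

lemma \<phi>_mono: "r \<le> s \<Longrightarrow> \<phi> r \<le> \<phi> s"
  unfolding \<phi>_def by (intro P.finite_measure_mono) (auto simp: pairs_within_def pairs_within_measurable[unfolded pairs_within_def] sets_P)

lemma \<phi>_bounds: "0 \<le> \<phi> r" "\<phi> r \<le> 1"
  by (simp_all add: \<phi>_def P.prob_le_1)

lemma \<psi>_mono: "r \<le> s \<Longrightarrow> \<psi> k r \<le> \<psi> k s"
  unfolding \<psi>_def by (intro sum_mono P.finite_measure_mono strip_mono) (auto simp: sets_P)

text \<open>Below the separation of the cylinders only pairs in a common cylinder can be close. Of
  the M ^ k * M ^ k pairs of cylinders M ^ k remain, and for each of them closeness of the images
  forces the preimages into a strip.\<close>

lemma correlation_le_strips:
  assumes r: "r < e0 * q ^ k"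
  shows "\<phi> r \<le> \<psi> k (r / p ^ k) / (M ^ k * M ^ k)"
proof -
  let ?W = "words I k"
  let ?c = "ennreal (1 / M ^ k)"
  let ?ind = "\<lambda>x y. indicator (pairs_within r) (x, y) :: ennreal"
  have "emeasure P (pairs_within r) = (\<integral>\<^sup>+x. \<integral>\<^sup>+y. ?ind x y \<partial>\<nu> \<partial>\<nu>)"
    by (rule \<nu>.emeasure_pair_measure) measurable
  also have "\<dots> = ?c * (\<Sum>w\<in>?W. \<integral>\<^sup>+x. \<integral>\<^sup>+y. ?ind (Fw w x) y \<partial>\<nu> \<partial>\<nu>)"
    by (rule inv_words) measurable
  also have "\<dots> = ?c * (\<Sum>w\<in>?W. \<integral>\<^sup>+x. ?c * (\<Sum>w'\<in>?W. \<integral>\<^sup>+y. ?ind (Fw w x) (Fw w' y) \<partial>\<nu>) \<partial>\<nu>)"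
    by (subst inv_words[where k = k, of "\<lambda>y. ?ind (Fw _ _) y"]) measurable
  also have "\<dots> \<le> ?c * (\<Sum>w\<in>?W. \<integral>\<^sup>+x. ?c * (\<integral>\<^sup>+y. indicator (strip (\<theta> w) (r / p ^ k)) (x, y) \<partial>\<nu>) \<partial>\<nu>)"
  proof (intro mult_left_mono sum_mono nn_integral_mono_AE)
    fix w assume w: "w \<in> ?W"
    then have sub: "set w \<subseteq> I" "length w = k" by (auto simp: words_def)
    show "AE x in \<nu>. ?c * (\<Sum>w'\<in>?W. \<integral>\<^sup>+y. ?ind (Fw w x) (Fw w' y) \<partial>\<nu>)
      \<le> ?c * (\<integral>\<^sup>+y. indicator (strip (\<theta> w) (r / p ^ k)) (x, y) \<partial>\<nu>)"
      using AE_K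
    proof eventually_elim
      case (elim x)
      have "(\<Sum>w'\<in>?W. \<integral>\<^sup>+y. ?ind (Fw w x) (Fw w' y) \<partial>\<nu>)
        \<le> (\<Sum>w'\<in>?W. if w' = w then \<integral>\<^sup>+y. indicator (strip (\<theta> w) (r / p ^ k)) (x, y) \<partial>\<nu> else 0)"
      proof (rule sum_mono)
        fix w' assume w': "w' \<in> ?W"
        show "(\<integral>\<^sup>+y. ?ind (Fw w x) (Fw w' y) \<partial>\<nu>) \<le> (if w' = w then \<integral>\<^sup>+y. indicator (strip (\<theta> w) (r / p ^ k)) (x, y) \<partial>\<nu> else 0)"
        proof (cases "w' = w")
          case True
          have "?ind (Fw w x) (Fw w y) \<le> indicator (strip (\<theta> w) (r / p ^ k)) (x, y)" for y
          proof (cases "dist (Fw w x) (Fw w y) \<le> r")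
            case True
            have "p ^ k * \<bar>\<theta> w * (x$1 - y$1) + (1 - \<theta> w) * (x$2 - y$2)\<bar> \<le> r"
              using Bw_direction[OF sub(1), of "x - y"] True sub by (simp add: dist_Fw)
            then have "(x, y) \<in> strip (\<theta> w) (r / p ^ k)" using p by (simp add: strip_def field_simps)
            then show ?thesis by (auto simp: indicator_def)
          qed (simp add: pairs_within_def)
          then show ?thesis using True by (auto intro: nn_integral_mono)
        next
          case False
          have "(\<integral>\<^sup>+y. ?ind (Fw w x) (Fw w' y) \<partial>\<nu>) = (\<integral>\<^sup>+y. 0 \<partial>\<nu>)"
          proof (rule nn_integral_cong_AE)
            show "AE y in \<nu>. ?ind (Fw w x) (Fw w' y) = 0"
              using AE_K
            proof eventually_elim
              case (elim y)
              have "r < dist (Fw w x) (Fw w' y)"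
                using Fw_separated[OF w w' _ \<open>x \<in> K\<close> elim] False r by force
              then show ?case by (simp add: pairs_within_def)
            qed
          qed
          then show ?thesis using False by simp
        qed
      qed
      also have "\<dots> = (\<integral>\<^sup>+y. indicator (strip (\<theta> w) (r / p ^ k)) (x, y) \<partial>\<nu>)"
        using w finite_words[OF I(1)] by simp
      finally show ?case by (intro mult_left_mono) auto
    qed
  qed auto
  also have "\<dots> = ?c * (\<Sum>w\<in>?W. ?c * emeasure P (strip (\<theta> w) (r / p ^ k)))"
  proof -
    have "(\<integral>\<^sup>+x. ?c * (\<integral>\<^sup>+y. indicator (strip (\<theta> w) (r / p ^ k)) (x, y) \<partial>\<nu>) \<partial>\<nu>)
       = ?c * emeasure P (strip (\<theta> w) (r / p ^ k))" for w
      by (subst nn_integral_cmult, measurable, subst \<nu>.emeasure_pair_measure, measurable)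
    then show ?thesis by simp
  qed
  also have "\<dots> = ennreal (1 / M ^ k * (1 / M ^ k * \<psi> k (r / p ^ k)))"
  proof -
    define c where "c = 1 / M ^ k"
    have "(\<Sum>w\<in>?W. ennreal c * emeasure P (strip (\<theta> w) (r / p ^ k))) = ennreal c * ennreal (\<psi> k (r / p ^ k))"
      unfolding \<psi>_def P.emeasure_eq_measure sum_distrib_left[symmetric] by (subst sum_ennreal) auto
    moreover have "0 \<le> \<psi> k (r / p ^ k)" "0 \<le> c" by (simp_all add: \<psi>_def sum_nonneg c_def)
    ultimately show ?thesis unfolding c_def[symmetric] by (simp add: ennreal_mult)
  qed
  finally have "\<phi> r \<le> 1 / M ^ k * (1 / M ^ k * \<psi> k (r / p ^ k))"
    unfolding \<phi>_def P.emeasure_eq_measure by (subst (asm) ennreal_le_iff) (auto simp: \<psi>_def sum_nonneg)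
  then show ?thesis by simp
qed

text \<open>Halving makes the comparison with the gap \<open>e0\<close> strict, and r0 \<le> 1 keeps
  the strip width at most \<open>\<rho> ^ k\<close>.\<close>

definition "r0 = min e0 1 / 2"
definition "\<rho> = q / p"

lemma r0: "0 < r0" "r0 \<le> 1" "r0 < e0"
  using e0(1) by (auto simp: r0_def)

lemma \<rho>: "0 < \<rho>" "\<kappa> \<le> \<rho>"
  using p q \<kappa> by (auto simp: \<rho>_def)

text \<open>At this scale only pairs in a common cylinder of level \<open>k\<close> are close; rescaled by the inverse of
  the cylinder map, such a pair lies in a strip of width \<open>\<rho> ^ k\<close>.\<close>

lemma correlation_at_scale: "\<phi> (r0 * q ^ k) \<le> \<psi> k (\<rho> ^ k) / (M ^ k * M ^ k)"
proof -
  have "\<phi> (r0 * q ^ k) \<le> \<psi> k (r0 * q ^ k / p ^ k) / (M ^ k * M ^ k)"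
    using r0 q by (intro correlation_le_strips) auto
  also have "\<dots> \<le> \<psi> k (\<rho> ^ k) / (M ^ k * M ^ k)"
    using r0 p q by (intro divide_right_mono \<psi>_mono) (auto simp: \<rho>_def power_divide divide_right_mono mult_left_le_one_le)
  finally show ?thesis .
qed

text \<open>The last letter carries the outermost map. The last letters of clustered words form a
  cluster at scale \<kappa>, which is the Frostman condition; removing a common last letter expands
  distances by at most 1 / \<kappa>, so the prefixes are clustered at scale
  \<open>\<kappa> ^ i\<close>.\<close>

lemma cluster_count:
  assumes "i \<le> j" "V \<subseteq> words I j" "\<And>w w'. w \<in> V \<Longrightarrow> w' \<in> V \<Longrightarrow> \<bar>\<theta> w - \<theta> w'\<bar> \<le> \<kappa> ^ i"
  shows "real (card V) \<le> M ^ j * (\<kappa> powr d) ^ i"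
  using assms
proof (induction i arbitrary: j V)
  case 0
  have "card V \<le> card (words I j)" using 0 finite_words[OF I(1)] by (intro card_mono)
  then show ?case using I(1) by (simp add: card_words flip: of_nat_power)
next
  case (Suc i)
  then obtain j' where j: "j = Suc j'" by (cases j) auto
  define S where "S = last ` V"
  define U where "U g = {w. w @ [g] \<in> V}" for g
  have V: "w \<noteq> [] \<and> set w \<subseteq> I \<and> length w = Suc j'" if "w \<in> V" for w
    using that Suc.prems(2) j by (auto simp: words_def)
  have dec: "butlast w @ [last w] = w" if "w \<in> V" for w using V[OF that] by simp
  have SI: "S \<subseteq> I" using V last_in_set by (fastforce simp: S_def)
  have finS: "finite S" using SI I finite_subset by blast
  have UI: "U g \<subseteq> words I j'" for g using V by (fastforce simp: U_def words_def)
  have finU: "finite (U g)" for g using UI finite_words[OF I(1)] finite_subset by blast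
  have eq: "V = (\<Union>g\<in>S. (\<lambda>w. w @ [g]) ` U g)"
  proof (intro equalityI subsetI)
    fix w assume w: "w \<in> V"
    then have "last w \<in> S" "butlast w \<in> U (last w)" using dec[OF w] by (auto simp: S_def U_def)
    then show "w \<in> (\<Union>g\<in>S. (\<lambda>w. w @ [g]) ` U g)"
      using dec[OF w] by (intro UN_I[of "last w"] image_eqI[of _ _ "butlast w"]) simp_all
  qed (auto simp: U_def)
  have "real (card S) \<le> M * \<kappa> powr d"
  proof (rule cluster[OF SI])
    fix g h assume "g \<in> S" "h \<in> S"
    then obtain w w' where w: "w \<in> V" "w' \<in> V" "g = last w" "h = last w'" by (auto simp: S_def)
    have mem: "\<theta> (butlast w) \<in> {0..1}" "\<theta> (butlast w') \<in> {0..1}"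
      using V[OF w(1)] V[OF w(2)] by (auto intro!: \<theta>_mem[unfolded atLeastAtMost_iff, THEN conjunct1] \<theta>_mem[unfolded atLeastAtMost_iff, THEN conjunct2] dest: in_set_butlastD)
    have "\<bar>gm (B g) (\<theta> (butlast w)) - gm (B h) (\<theta> (butlast w'))\<bar> = \<bar>\<theta> w - \<theta> w'\<bar>"
      unfolding w \<theta>_simps(2)[symmetric] dec[OF w(1)] dec[OF w(2)] ..
    also have "\<dots> \<le> \<kappa> ^ Suc i" by (rule Suc.prems(3)[OF w(1,2)])
    also have "\<dots> \<le> \<kappa> * 1" using \<kappa> by (simp add: power_le_one mult_left_le)
    finally show "\<exists>x\<in>{0..1}. \<exists>y\<in>{0..1}. \<bar>gm (B g) x - gm (B h) y\<bar> \<le> \<kappa>" using mem by (metis mult.right_neutral)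
  qed
  moreover have "real (card (U g)) \<le> M ^ j' * (\<kappa> powr d) ^ i" if g: "g \<in> S" for g
  proof (rule Suc.IH)
    fix w w' assume w: "w \<in> U g" "w' \<in> U g"
    then have mem: "\<theta> w \<in> {0..1}" "\<theta> w' \<in> {0..1}" using UI[of g] by (auto simp only: words_def intro!: \<theta>_mem)
    have "\<kappa> * \<bar>\<theta> w - \<theta> w'\<bar> \<le> \<bar>\<theta> (w @ [g]) - \<theta> (w' @ [g])\<bar>"
      unfolding \<theta>_simps using g SI by (intro \<kappa>_lower mem) auto
    also have "\<dots> \<le> \<kappa> ^ Suc i" using w by (intro Suc.prems(3)) (auto simp: U_def)
    finally show "\<bar>\<theta> w - \<theta> w'\<bar> \<le> \<kappa> ^ i" using \<kappa> by simp
  qed (use UI Suc.prems j in auto)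
  ultimately have "(\<Sum>g\<in>S. real (card (U g))) \<le> M * \<kappa> powr d * (M ^ j' * (\<kappa> powr d) ^ i)"
    using \<kappa> by (intro order_trans[OF sum_bounded_above[of S _ "M ^ j' * (\<kappa> powr d) ^ i"]] mult_right_mono) auto
  moreover have "real (card V) \<le> (\<Sum>g\<in>S. real (card (U g)))"
  proof -
    have "card V \<le> (\<Sum>g\<in>S. card ((\<lambda>w. w @ [g]) ` U g))" by (subst eq) (rule card_UN_le[OF finS])
    also have "\<dots> = (\<Sum>g\<in>S. card (U g))" by (intro sum.cong card_image) (auto simp: inj_on_def)
    finally show ?thesis by (simp flip: of_nat_sum)
  qed
  ultimately show ?case by (simp add: j mult_ac)
qed

text \<open>Rounding \<open>s\<close> up to a power of \<kappa> costs at most one factor 1 /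
  \<kappa>. Below the scale \<open>\<kappa> ^ k\<close> nothing is known about words of length
  \<open>k\<close>, hence the restriction on \<open>s\<close>.\<close>

lemma frostman_count:
  assumes V: "V \<subseteq> words I k" "\<And>w w'. w \<in> V \<Longrightarrow> w' \<in> V \<Longrightarrow> \<bar>\<theta> w - \<theta> w'\<bar> \<le> s" and s: "\<kappa> ^ k \<le> s"
  shows "real (card V) \<le> M ^ k * (s / \<kappa>) powr d"
proof (cases "s \<le> 1")
  case False
  have "real (card V) \<le> M ^ k * (\<kappa> powr d) ^ 0"
  proof (rule cluster_count)
    fix w w' assume "w \<in> V" "w' \<in> V"
    then have "\<theta> w \<in> {0..1}" "\<theta> w' \<in> {0..1}" using V(1) by (auto simp only: words_def intro!: \<theta>_mem)
    then show "\<bar>\<theta> w - \<theta> w'\<bar> \<le> \<kappa> ^ 0" by auto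
  qed (use V in auto)
  also have "\<dots> \<le> M ^ k * (s / \<kappa>) powr d"
    using False \<kappa> d by (intro mult_left_mono) (auto intro!: ge_one_powr_ge_zero simp: le_divide_eq)
  finally show ?thesis .
next
  case True
  define i where "i = (GREATEST i. i \<le> k \<and> s \<le> \<kappa> ^ i)"
  have ex: "0 \<le> k \<and> s \<le> \<kappa> ^ 0" using True by simp
  have i: "i \<le> k \<and> s \<le> \<kappa> ^ i"
    unfolding i_def by (rule GreatestI_nat[where P = "\<lambda>i. i \<le> k \<and> s \<le> \<kappa> ^ i" and b = k, OF ex]) simp
  have "real (card V) \<le> M ^ k * (\<kappa> powr d) ^ i"
    using i V by (intro cluster_count) (auto intro: order_trans)
  also have "(\<kappa> powr d) ^ i = (\<kappa> ^ i) powr d"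
    using \<kappa> by (simp add: powr_powr mult.commute flip: powr_realpow)
  also have "\<dots> \<le> (s / \<kappa>) powr d"
  proof (intro powr_mono2)
    show "\<kappa> ^ i \<le> s / \<kappa>"
    proof (cases "i = k")
      case True
      have "s * \<kappa> \<le> s" using \<kappa> s by (metis mult_left_le less_imp_le order_trans zero_le_power)
      then show ?thesis using True s \<kappa> by (simp add: le_divide_eq) (metis mult_right_mono less_imp_le order_trans mult_left_le zero_le_power)
    next
      case False
      have "\<not> (Suc i \<le> k \<and> s \<le> \<kappa> ^ Suc i)"
        using Greatest_le_nat[of "\<lambda>i. i \<le> k \<and> s \<le> \<kappa> ^ i" "Suc i" k] by (auto simp: i_def)
      then have "\<kappa> ^ Suc i < s" using False i by auto
      then show ?thesis using \<kappa> by (simp add: le_divide_eq mult.commute)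
    qed
  qed (use d \<kappa> in auto)
  finally show ?thesis by (simp add: mult_left_mono)
qed

end

section \<open>Kaufman's argument\<close>

lemma strip_direction_diff:
  fixes u v :: real
  assumes "0 \<le> a" "a \<le> 1" "0 \<le> b" "b \<le> 1" and N: "N \<le> \<bar>u\<bar> + \<bar>v\<bar>" "0 \<le> N"
    and s: "\<bar>a * u + (1 - a) * v\<bar> \<le> s" "\<bar>b * u + (1 - b) * v\<bar> \<le> s"
  shows "\<bar>a - b\<bar> * N \<le> 8 * s"
\<comment> \<open>The difference of the two functionals on (u, v) is (a - b) * (u - v). If u and v
  are well apart, it determines |a - b|; if they are close, both functionals nearly equal u and v,
  so \<open>s\<close> itself is at least N / 4.\<close>
proof (cases "N / 4 \<le> \<bar>u - v\<bar>")
  case True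
  have "\<bar>a - b\<bar> * (N / 4) \<le> \<bar>a - b\<bar> * \<bar>u - v\<bar>" using True by (intro mult_left_mono) auto
  also have "\<dots> = \<bar>(a * u + (1 - a) * v) - (b * u + (1 - b) * v)\<bar>"
    unfolding abs_mult[symmetric] by (simp add: algebra_simps)
  also have "\<dots> \<le> 2 * s" using s by linarith
  finally show ?thesis by simp
next
  case False
  have "\<bar>a * (u - v)\<bar> \<le> \<bar>u - v\<bar>" "\<bar>(1 - a) * (u - v)\<bar> \<le> \<bar>u - v\<bar>"
    using assms(1,2) by (auto simp: abs_mult intro!: mult_left_le_one_le)
  moreover have "a * u + (1 - a) * v = v + a * (u - v)" "a * u + (1 - a) * v = u - (1 - a) * (u - v)"
    by (simp_all add: algebra_simps)
  ultimately have "N \<le> 4 * s" using s(1) N False by linarith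
  moreover have "\<bar>a - b\<bar> * N \<le> 1 * N" using assms by (intro mult_right_mono) auto
  ultimately show ?thesis using s by linarith
qed

lemma dyadic_shell:
  fixes s t :: real
  assumes "0 < s" "s < t" "t \<le> 2 ^ J * s"
  obtains j where "j < J" "2 ^ j * s < t" "t \<le> 2 ^ (Suc j) * s"
proof -
  define j where "j = (LEAST j. t \<le> 2 ^ j * s)"
  have 1: "t \<le> 2 ^ j * s" unfolding j_def by (rule LeastI[of "\<lambda>j. t \<le> 2 ^ j * s", OF assms(3)])
  have "j \<noteq> 0" using 1 assms by (intro notI) simp
  then obtain i where i: "j = Suc i" by (cases j) auto
  have "\<not> t \<le> 2 ^ i * s" using not_less_Least[of i "\<lambda>j. t \<le> 2 ^ j * s"] i by (simp add: j_def[symmetric])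
  moreover have "j \<le> J" unfolding j_def by (rule Least_le[of "\<lambda>j. t \<le> 2 ^ j * s", OF assms(3)])
  ultimately show thesis using that[of i] 1 i by auto
qed

context self_affine_measure
begin

interpretation \<nu>: prob_space \<nu> by (rule prob_\<nu>)
interpretation P: pair_prob_space \<nu> \<nu> ..

declare sets_\<nu> [measurable_cong] sets_P [measurable_cong]

text \<open>The 8 is the constant of \<open>strip_direction_diff\<close>. As a bound for the
  diameter, \<open>Rb\<close> also keeps \<open>Rb * (s / dist x y)\<close> above \<open>s\<close>,
  hence within the range of \<open>frostman_count\<close>.\<close>

definition "Rb = max 8 (diameter K)"

lemma Rb: "8 \<le> Rb" "x \<in> K \<Longrightarrow> y \<in> K \<Longrightarrow> dist x y \<le> Rb"
  using diameter_bounded_bound[OF compact_imp_bounded[OF K(1)], of x y] by (auto simp: Rb_def)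

lemma AE_KK: "AE z in P. fst z \<in> K \<and> snd z \<in> K"
proof (rule P.AE_pair_measure)
  have [measurable]: "K \<in> sets borel" using K(1) by (rule borel_compact)
  show "{z \<in> space P. fst z \<in> K \<and> snd z \<in> K} \<in> sets P" by measurable
  show "AE x in \<nu>. AE y in \<nu>. fst (x, y) \<in> K \<and> snd (x, y) \<in> K"
    using AE_K
  proof eventually_elim
    case (elim x)
    show ?case using AE_K by eventually_elim (use elim in simp)
  qed
qed

lemma directions_near_point_count:
  assumes "\<kappa> ^ k \<le> s" "x \<in> K" "y \<in> K" "x \<noteq> y"
  shows "real (card {w\<in>words I k. (x, y) \<in> strip (\<theta> w) s}) \<le> M ^ k * ((Rb / \<kappa>) powr d * (s / dist x y) powr d)"
proof -
  have s: "0 < s" using assms(1) \<kappa>(1) by (meson less_le_trans zero_less_power)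
  have t: "0 < dist x y" using assms by simp
  define s' where "s' = Rb * (s / dist x y)"
  have "real (card {w\<in>words I k. (x, y) \<in> strip (\<theta> w) s}) \<le> M ^ k * (s' / \<kappa>) powr d"
  proof (rule frostman_count)
    fix w w' assume w: "w \<in> {w\<in>words I k. (x, y) \<in> strip (\<theta> w) s}" "w' \<in> {w\<in>words I k. (x, y) \<in> strip (\<theta> w) s}"
    have mem: "\<theta> w \<in> {0..1}" "\<theta> w' \<in> {0..1}" using w by (auto simp only: words_def intro!: \<theta>_mem)
    have "dist x y \<le> \<bar>x$1 - y$1\<bar> + \<bar>x$2 - y$2\<bar>"
      using norm_le_l1_cart[of "x - y"] by (simp add: dist_norm sum_2)
    then have "\<bar>\<theta> w - \<theta> w'\<bar> * dist x y \<le> 8 * s"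
      using w mem by (intro strip_direction_diff[where u = "x$1 - y$1" and v = "x$2 - y$2"]) (auto simp: strip_def)
    also have "\<dots> \<le> Rb * s" using Rb(1) s by (intro mult_right_mono) auto
    finally show "\<bar>\<theta> w - \<theta> w'\<bar> \<le> s'" using t by (simp add: s'_def field_simps)
  next
    have "\<kappa> ^ k * 1 \<le> s * (Rb / dist x y)"
      using assms Rb(2)[of x y] t s \<kappa> by (intro mult_mono) (auto simp: le_divide_eq)
    then show "\<kappa> ^ k \<le> s'" by (simp add: s'_def mult.commute)
  qed auto
  also have "(s' / \<kappa>) powr d = (Rb / \<kappa>) powr d * (s / dist x y) powr d"
    using Rb(1) s t \<kappa> by (simp add: s'_def mult.commute flip: powr_mult)
  finally show ?thesis .
qed

text \<open>The order of summation is exchanged: instead of the pairs in a given strip, count for a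
  given pair the directions whose strip contains it. At distance about 2^j * s this is a proportion
  of order 2^(- d j), and such pairs are counted by a correlation.\<close>

lemma strips_le_shells:
  assumes s: "\<kappa> ^ k \<le> s" and J: "Rb \<le> 2 ^ J * s"
  shows "\<psi> k s \<le> M ^ k * (\<phi> s + (\<Sum>j<J. (Rb / \<kappa>) powr d * (2 powr (- d)) ^ j * \<phi> (2 ^ Suc j * s)))"
proof -
  define c where "c = (Rb / \<kappa>) powr d"
  have c: "0 \<le> c" by (simp add: c_def)
  have s0: "0 < s" using assms(1) \<kappa>(1) by (meson less_le_trans zero_less_power)
  let ?b = "\<lambda>r z. indicat_real (pairs_within r) z"
  have int: "integrable P (indicat_real S)" "(\<integral>z. indicat_real S z \<partial>P) = measure P S" if "S \<in> sets (borel \<Otimes>\<^sub>M borel)" for S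
    using that by (simp_all add: sets_P P.emeasure_eq_measure)
  note int_s = int[OF strip_measurable] and int_p = int[OF pairs_within_measurable]
  have "\<psi> k s = (\<integral>z. (\<Sum>w\<in>words I k. indicat_real (strip (\<theta> w) s) z) \<partial>P)"
    unfolding \<psi>_def by (simp only: Bochner_Integration.integral_sum int_s)
  also have "\<dots> \<le> (\<integral>z. M ^ k * (?b s z + (\<Sum>j<J. c * (2 powr (- d)) ^ j * ?b (2 ^ Suc j * s) z)) \<partial>P)"
  proof (rule integral_mono_AE)
    show "integrable P (\<lambda>z. \<Sum>w\<in>words I k. indicat_real (strip (\<theta> w) s) z)"
      by (intro Bochner_Integration.integrable_sum int_s)
    show "integrable P (\<lambda>z. M ^ k * (?b s z + (\<Sum>j<J. c * (2 powr (- d)) ^ j * ?b (2 ^ Suc j * s) z)))"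
      by (intro integrable_mult_right Bochner_Integration.integrable_add Bochner_Integration.integrable_sum int_p)
    show "AE z in P. (\<Sum>w\<in>words I k. indicat_real (strip (\<theta> w) s) z)
      \<le> M ^ k * (?b s z + (\<Sum>j<J. c * (2 powr (- d)) ^ j * ?b (2 ^ Suc j * s) z))"
      using AE_KK
    proof eventually_elim
      case (elim z)
      obtain x y where z: "z = (x, y)" by (cases z)
      have K: "x \<in> K" "y \<in> K" using elim z by auto
      have cnt: "(\<Sum>w\<in>words I k. indicat_real (strip (\<theta> w) s) z) = real (card {w\<in>words I k. (x, y) \<in> strip (\<theta> w) s})"
        using finite_words[OF I(1)] by (simp add: indicator_def z Int_def flip: sum.inter_filter)
      have sum0: "0 \<le> (\<Sum>j<J. c * (2 powr (- d)) ^ j * ?b (2 ^ Suc j * s) z)" using c by (intro sum_nonneg) auto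
      show ?case
      proof (cases "dist x y \<le> s")
        case True
        have "card {w\<in>words I k. (x, y) \<in> strip (\<theta> w) s} \<le> card (words I k)"
          by (intro card_mono finite_words I) auto
        then have "real (card {w\<in>words I k. (x, y) \<in> strip (\<theta> w) s}) \<le> M ^ k * 1"
          by (simp add: card_words[OF I(1)] flip: of_nat_power)
        also have "\<dots> \<le> M ^ k * (?b s z + (\<Sum>j<J. c * (2 powr (- d)) ^ j * ?b (2 ^ Suc j * s) z))"
          using True sum0 by (intro mult_left_mono) (auto simp: z pairs_within_def)
        finally show ?thesis unfolding cnt .
      next
        case False
        have "dist x y \<le> 2 ^ J * s" using Rb(2)[OF K] J by simp
        then obtain j where j: "j < J" "2 ^ j * s < dist x y" "dist x y \<le> 2 ^ Suc j * s"
          using dyadic_shell[OF s0] False by (metis not_le)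
        have "real (card {w\<in>words I k. (x, y) \<in> strip (\<theta> w) s}) \<le> M ^ k * (c * (s / dist x y) powr d)"
          unfolding c_def using False s0 by (intro directions_near_point_count s K) auto
        also have "\<dots> \<le> M ^ k * (c * (2 powr (- d)) ^ j * ?b (2 ^ Suc j * s) z)"
        proof -
          have "s / dist x y \<le> 2 powr (- real j)"
          proof -
            have "0 < dist x y" using False s0 by linarith
            then show ?thesis using j(2) by (simp add: powr_minus powr_realpow field_simps)
          qed
          then have "(s / dist x y) powr d \<le> (2 powr (- real j)) powr d"
            using s0 d by (intro powr_mono2) auto
          also have "\<dots> = (2 powr (- d)) ^ j" by (simp add: powr_powr mult.commute flip: powr_realpow)
          finally have "c * (s / dist x y) powr d \<le> c * (2 powr (- d)) ^ j" using c by (rule mult_left_mono)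
          then show ?thesis using j(3) by (intro mult_left_mono) (auto simp: z pairs_within_def)
        qed
        also have "\<dots> \<le> M ^ k * (?b s z + (\<Sum>j<J. c * (2 powr (- d)) ^ j * ?b (2 ^ Suc j * s) z))"
        proof (intro mult_left_mono)
          have "c * (2 powr (- d)) ^ j * ?b (2 ^ Suc j * s) z \<le> (\<Sum>j<J. c * (2 powr (- d)) ^ j * ?b (2 ^ Suc j * s) z)"
            using j(1) c by (intro member_le_sum) auto
          then show "c * (2 powr (- d)) ^ j * ?b (2 ^ Suc j * s) z
            \<le> ?b s z + (\<Sum>j<J. c * (2 powr (- d)) ^ j * ?b (2 ^ Suc j * s) z)" by (simp add: indicator_def)
        qed auto
        finally show ?thesis unfolding cnt .
      qed
    qed
  qed
  also have "\<dots> = M ^ k * (\<phi> s + (\<Sum>j<J. c * (2 powr (- d)) ^ j * \<phi> (2 ^ Suc j * s)))"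
    by (simp only: integral_mult_right_zero Bochner_Integration.integral_add Bochner_Integration.integral_sum
        Bochner_Integration.integrable_sum integrable_mult_right int_p \<phi>_def)
  finally show ?thesis unfolding c_def .
qed

text \<open>The shells form a geometric series of ratio 2^(D - d). The constant does not depend on
  \<open>k\<close>, and the bound is linear in \<open>C\<close> and uses radii r \<ge> s only; the
  bootstrap relies on all three.\<close>

lemma kaufman:
  assumes D: "0 \<le> D" "D < d"
  shows "\<exists>C'>0. \<forall>k s C. \<kappa> ^ k \<le> s \<longrightarrow> 0 \<le> C \<longrightarrow> (\<forall>r\<ge>s. \<phi> r \<le> C * r powr D) \<longrightarrow>
    \<psi> k s \<le> M ^ k * (C' * C * s powr D)"
proof -
  define c where "c = (Rb / \<kappa>) powr d"
  define b where "b = 2 powr (D - d)"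
  have b: "0 < b" "b < 1" using D by (auto simp: b_def powr_less_one)
  define C' where "C' = 1 + c * 2 powr D * (1 / (1 - b))"
  have C': "C' > 0" unfolding C'_def using b by (intro add_pos_nonneg) (auto simp: c_def)
  have "\<psi> k s \<le> M ^ k * (C' * C * s powr D)"
    if s: "\<kappa> ^ k \<le> s" and C: "0 \<le> C" and \<phi>C: "\<And>r. s \<le> r \<Longrightarrow> \<phi> r \<le> C * r powr D" for k s C
  proof -
    have s0: "0 < s" using s \<kappa>(1) by (meson less_le_trans zero_less_power)
    obtain J where "Rb / s < 2 ^ J" using real_arch_pow[of 2 "Rb / s"] by auto
    then have J: "Rb \<le> 2 ^ J * s" using s0 by (simp add: field_simps)
    have shell: "c * (2 powr (- d)) ^ j * \<phi> (2 ^ Suc j * s) \<le> c * 2 powr D * b ^ j * (C * s powr D)" for j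
    proof -
      have s1: "1 * s \<le> 2 ^ Suc j * s" using s0 by (intro mult_right_mono one_le_power) auto
      have "\<phi> (2 ^ Suc j * s) \<le> C * (2 ^ Suc j * s) powr D" using s1 by (intro \<phi>C) simp
      also have "(2 ^ Suc j * s) powr D = 2 powr D * ((2 powr D) ^ j * s powr D)"
        using s0 by (simp add: powr_mult powr_powr mult.commute flip: powr_realpow)
      finally have "c * (2 powr (- d)) ^ j * \<phi> (2 ^ Suc j * s) \<le> c * (2 powr (- d)) ^ j * (C * (2 powr D * ((2 powr D) ^ j * s powr D)))"
        by (intro mult_left_mono) (auto simp: c_def)
      also have "\<dots> = c * 2 powr D * (2 powr (- d) * 2 powr D) ^ j * (C * s powr D)"
        by (simp add: power_mult_distrib mult_ac)
      also have "2 powr (- d) * 2 powr D = b" by (simp add: b_def flip: powr_add)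
      finally show ?thesis .
    qed
    have "\<phi> s + (\<Sum>j<J. c * (2 powr (- d)) ^ j * \<phi> (2 ^ Suc j * s))
      \<le> C * s powr D + (\<Sum>j<J. c * 2 powr D * b ^ j * (C * s powr D))"
      by (intro add_mono sum_mono shell \<phi>C) auto
    also have "\<dots> = C * s powr D + c * 2 powr D * (\<Sum>j<J. b ^ j) * (C * s powr D)"
      by (simp add: sum_distrib_left sum_distrib_right)
    also have "\<dots> \<le> C * s powr D + c * 2 powr D * (1 / (1 - b)) * (C * s powr D)"
    proof (intro add_mono mult_right_mono mult_left_mono order_refl)
      have "(\<Sum>j<J. b ^ j) \<le> (\<Sum>j. b ^ j)" using b by (intro sum_le_suminf summable_geometric) auto
      also have "\<dots> = 1 / (1 - b)" using b by (intro suminf_geometric) auto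
      finally show "(\<Sum>j<J. b ^ j) \<le> 1 / (1 - b)" .
    qed (use C in \<open>auto simp: c_def\<close>)
    also have "\<dots> = C' * C * s powr D" by (simp add: C'_def algebra_simps)
    finally have "M ^ k * (\<phi> s + (\<Sum>j<J. c * (2 powr (- d)) ^ j * \<phi> (2 ^ Suc j * s))) \<le> M ^ k * (C' * C * s powr D)"
      by (intro mult_left_mono) auto
    with strips_le_shells[OF s J] show ?thesis unfolding c_def by linarith
  qed
  then show ?thesis using C' by blast
qed

text \<open>Monotonicity carries a bound from the scales \<open>r0 * q ^ k\<close> to all radii.
  Only scales above \<open>r\<close> are consulted, so it can be used inside an induction over the
  scales.\<close>

lemma \<phi>_interpolate:
  assumes C: "1 \<le> C" and D: "0 \<le> D" and r: "0 < r"
    and le: "\<And>k. r \<le> r0 * q ^ k \<Longrightarrow> \<phi> (r0 * q ^ k) \<le> C * (q ^ k) powr D"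
  shows "\<phi> r \<le> C * (r0 * q) powr (- D) * r powr D"
proof (cases "r0 < r")
  case True
  have "\<phi> r \<le> 1" by (rule \<phi>_bounds)
  also have "\<dots> \<le> C * (1 / q) powr D" proof -
    have "1 * 1 \<le> C * (1 / q) powr D" using C q D by (intro mult_mono ge_one_powr_ge_zero) auto
    then show ?thesis by simp
  qed
  also have "\<dots> = C * (r0 * q) powr (- D) * r0 powr D"
    using r0 q by (simp add: powr_mult powr_minus powr_divide field_simps)
  also have "\<dots> \<le> C * (r0 * q) powr (- D) * r powr D"
    using True C D r0 by (intro mult_left_mono powr_mono2) auto
  finally show ?thesis .
next
  case False
  define k where "k = (GREATEST k. r \<le> r0 * q ^ k)"
  have ex: "r \<le> r0 * q ^ 0" using False by simp
  obtain m where m: "q ^ m < r / r0" using real_arch_pow_inv[of "r / r0" q] r r0 q by auto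
  have bnd: "k \<le> m" if "r \<le> r0 * q ^ k" for k
  proof (rule ccontr)
    assume "\<not> k \<le> m"
    then have "q ^ k \<le> q ^ m" using q by (intro power_decreasing) auto
    then have "r0 * q ^ k \<le> r0 * q ^ m" using r0 by (intro mult_left_mono) auto
    also have "\<dots> < r" using m r0 by (simp add: field_simps)
    finally have "r0 * q ^ k < r" .
    then show False using that by simp
  qed
  have k: "r \<le> r0 * q ^ k" unfolding k_def by (rule GreatestI_nat[where P = "\<lambda>k. r \<le> r0 * q ^ k", OF ex bnd])
  have "\<not> r \<le> r0 * q ^ Suc k"
    using Greatest_le_nat[of "\<lambda>k. r \<le> r0 * q ^ k" "Suc k" m] bnd by (auto simp: k_def)
  then have qk: "q ^ k \<le> r / (r0 * q)" using r0 q by (simp add: field_simps)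
  have "\<phi> r \<le> \<phi> (r0 * q ^ k)" by (rule \<phi>_mono[OF k])
  also have "\<dots> \<le> C * (q ^ k) powr D" by (rule le[OF k])
  also have "\<dots> \<le> C * (r / (r0 * q)) powr D" using C D q qk by (intro mult_left_mono powr_mono2) auto
  also have "\<dots> = C * (r0 * q) powr (- D) * r powr D"
    using r0 q r by (simp add: powr_divide powr_minus field_simps)
  finally show ?thesis .
qed

text \<open>A bound of order \<open>(\<rho> ^ k) powr \<tau>\<close> for the average strip gives
  (\<rho>^\<tau> / M) ^ k for the correlation at scale \<open>q ^ k\<close>, to be compared with
  (q^D) ^ k; \<open>rel\<close> is this comparison for a single level.\<close>

lemma correlation_from_strips:
  assumes C: "0 \<le> C" and D: "0 \<le> D" and rel: "\<rho> powr \<tau> \<le> M * q powr D"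
    and \<psi>: "\<And>k. \<psi> k (\<rho> ^ k) \<le> M ^ k * (C * (\<rho> ^ k) powr \<tau>)"
  shows "\<exists>C'\<ge>0. \<forall>r>0. \<phi> r \<le> C' * r powr D"
proof -
  have le: "\<phi> (r0 * q ^ k) \<le> max 1 C * (q ^ k) powr D" for k
  proof -
    have M: "0 < M ^ k" using M_ge_1 by simp
    have "\<phi> (r0 * q ^ k) \<le> \<psi> k (\<rho> ^ k) / (M ^ k * M ^ k)" by (rule correlation_at_scale)
    also have "\<dots> \<le> M ^ k * (C * (\<rho> ^ k) powr \<tau>) / (M ^ k * M ^ k)" using M by (intro divide_right_mono \<psi>) auto
    also have "\<dots> = C * ((\<rho> powr \<tau>) / M) ^ k"
      using M \<rho> by (simp add: power_divide powr_powr mult.commute flip: powr_realpow)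
    also have "\<dots> \<le> C * (q powr D) ^ k"
      using rel M_ge_1 C by (intro mult_left_mono power_mono) (auto simp: divide_le_eq mult.commute)
    also have "\<dots> \<le> max 1 C * (q ^ k) powr D"
      using q by (intro mult_mono) (auto simp: powr_powr mult.commute simp flip: powr_realpow)
    finally show ?thesis .
  qed
  have "\<phi> r \<le> max 1 C * (r0 * q) powr (- D) * r powr D" if "0 < r" for r
    by (rule \<phi>_interpolate[OF _ D that le]) simp
  then show ?thesis by (intro exI[of _ "max 1 C * (r0 * q) powr (- D)"]) auto
qed

text \<open>The bound improves itself: inserting it for \<open>r \<ge> \<rho> ^ k\<close> into Kaufman's estimate
  gives it with a smaller constant at scale \<open>q ^ k\<close>.\<close>

lemma correlation_bootstrap:
  assumes D: "0 \<le> D" "D < d" and rel: "1 < M * p powr D"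
  shows "\<exists>C\<ge>0. \<forall>r>0. \<phi> r \<le> C * r powr D"
proof -
  obtain C' where C': "C' > 0" "\<And>k s C. \<kappa> ^ k \<le> s \<Longrightarrow> 0 \<le> C \<Longrightarrow> (\<And>r. s \<le> r \<Longrightarrow> \<phi> r \<le> C * r powr D) \<Longrightarrow>
    \<psi> k s \<le> M ^ k * (C' * C * s powr D)" using kaufman[OF D] by meson
  define E where "E = (r0 * q) powr (- D)"
  have E: "0 \<le> E" by (simp add: E_def)
  \<comment> \<open>The gain per level. Beyond the level \<open>k1\<close> it outweighs the
    constants lost in Kaufman's estimate and in the interpolation.\<close>
  define b where "b = 1 / (M * p powr D)"
  have b: "0 < b" "b < 1" using rel M_ge_1 p by (auto simp: b_def)
  obtain k1 where k1: "\<And>k. k1 \<le> k \<Longrightarrow> C' * E * b ^ k \<le> 1"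
  proof -
    have "(\<lambda>k. C' * E * b ^ k) \<longlonglongrightarrow> C' * E * 0"
      using b by (intro tendsto_intros LIMSEQ_realpow_zero) auto
    then have "eventually (\<lambda>k. C' * E * b ^ k < 1) sequentially" by (intro order_tendstoD(2)) auto
    then show thesis using that by (auto simp: eventually_sequentially intro: less_imp_le)
  qed
  \<comment> \<open>Large enough to make the claim trivial below \<open>k1\<close>, because \<phi>
    \<le> 1.\<close>
  define C where "C = (q ^ k1) powr (- D)"
  have C: "1 \<le> C"
  proof -
    have "1 powr D \<le> (1 / q ^ k1) powr D" using q D by (intro powr_mono2) (auto simp: power_le_one le_divide_eq)
    then show ?thesis using q by (simp add: C_def powr_minus powr_divide inverse_eq_divide)
  qed
  have le: "\<phi> (r0 * q ^ k) \<le> C * (q ^ k) powr D" for k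
  proof (induction k rule: less_induct)
    case (less k)
    show ?case
    proof (cases "k < k1")
      case True
      have "\<phi> (r0 * q ^ k) \<le> 1" by (rule \<phi>_bounds)
      also have "1 = C * (q ^ k1) powr D" using q by (simp add: C_def flip: powr_add)
      also have "\<dots> \<le> C * (q ^ k) powr D"
        using True q C D by (intro mult_left_mono powr_mono2 power_decreasing) auto
      finally show ?thesis .
    next
      case False
      have pk: "\<rho> ^ k = q ^ k / p ^ k" by (simp add: \<rho>_def power_divide)
      have qk: "q ^ k \<le> \<rho> ^ k" unfolding pk using p q by (simp add: le_divide_eq mult_left_le power_le_one)
      have \<phi>C: "\<phi> r \<le> (C * E) * r powr D" if r: "\<rho> ^ k \<le> r" for r
        unfolding E_def
      proof (rule \<phi>_interpolate[OF C D(1)])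
        show r0': "0 < r" using r \<rho>(1) by (meson less_le_trans zero_less_power)
        fix j assume j: "r \<le> r0 * q ^ j"
        \<comment> \<open>Since r \<ge> \<rho> ^ k \<ge> q ^ k and r0 < 1, a scale of index at least
          \<open>k\<close> cannot exceed \<open>r\<close>; so the induction hypothesis covers what
          is needed.\<close>
        have "j < k \<or> j = k \<and> k = 0"
        proof (rule ccontr)
          assume n: "\<not> ?thesis"
          then have kj: "k \<le> j" by auto
          have "q ^ j \<le> q ^ k" using kj q by (intro power_decreasing) auto
          moreover have "r0 * q ^ j < 1 * q ^ j" using q by (intro mult_strict_right_mono) (auto simp: r0_def)
          ultimately show False using j r qk by simp
        qed
        then show "\<phi> (r0 * q ^ j) \<le> C * (q ^ j) powr D"
        proof
          assume "j = k \<and> k = 0"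
          then have "\<phi> (r0 * q ^ j) \<le> 1" "(q ^ j) powr D = 1" using \<phi>_bounds by auto
          then show ?thesis using C by simp
        qed (rule less)
      qed
      have "\<psi> k (\<rho> ^ k) \<le> M ^ k * (C' * (C * E) * (\<rho> ^ k) powr D)"
        using \<phi>C C E \<rho> \<kappa> by (intro C'(2) power_mono) auto
      then have "\<phi> (r0 * q ^ k) \<le> M ^ k * (C' * (C * E) * (\<rho> ^ k) powr D) / (M ^ k * M ^ k)"
        using correlation_at_scale[of k] M_ge_1 by (meson divide_right_mono order_trans zero_le_mult_iff zero_le_power le_trans of_nat_0_le_iff)
      also have "\<dots> = C * (C' * E * b ^ k) * (q ^ k) powr D"
      proof -
        have "(\<rho> ^ k) powr D = (q ^ k) powr D / (p ^ k) powr D" unfolding pk using p q by (simp add: powr_divide)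
        moreover have "(p ^ k) powr D = (p powr D) ^ k" using p by (simp add: powr_powr mult.commute flip: powr_realpow)
        ultimately show ?thesis using M_ge_1 p by (simp add: b_def power_divide power_mult_distrib field_simps)
      qed
      also have "\<dots> \<le> C * 1 * (q ^ k) powr D"
        using k1[of k] False C by (intro mult_right_mono mult_left_mono) auto
      finally show ?thesis by simp
    qed
  qed
  have "\<phi> r \<le> C * E * r powr D" if "0 < r" for r
    unfolding E_def by (rule \<phi>_interpolate[OF C D(1) that le])
  then show ?thesis using C E by (intro exI[of _ "C * E"]) auto
qed

text \<open>A single application without iteration. The strips have width \<open>\<rho> ^ k\<close>
  while the correlation lives at the smaller scale \<open>q ^ k\<close> and gains the factor 1 / M ^
  k; together these convert the exponent \<open>D\<close> into \<open>D1\<close>.\<close>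

lemma correlation_kaufman_step:
  assumes D: "0 \<le> D" "D < d" and C: "0 \<le> C" "\<And>r. 0 < r \<Longrightarrow> \<phi> r \<le> C * r powr D"
    and D1: "0 \<le> D1" and rel: "\<rho> powr D \<le> M * q powr D1"
  shows "\<exists>C\<ge>0. \<forall>r>0. \<phi> r \<le> C * r powr D1"
proof -
  obtain C' where C': "C' > 0" "\<And>k s C. \<kappa> ^ k \<le> s \<Longrightarrow> 0 \<le> C \<Longrightarrow> (\<And>r. s \<le> r \<Longrightarrow> \<phi> r \<le> C * r powr D) \<Longrightarrow>
    \<psi> k s \<le> M ^ k * (C' * C * s powr D)" using kaufman[OF D] by meson
  have "\<psi> k (\<rho> ^ k) \<le> M ^ k * ((C' * C) * (\<rho> ^ k) powr D)" for k
  proof (rule C'(2))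
    show "\<kappa> ^ k \<le> \<rho> ^ k" using \<rho> \<kappa> by (intro power_mono) auto
    fix r assume "\<rho> ^ k \<le> r"
    then show "\<phi> r \<le> C * r powr D" using \<rho>(1) by (intro C) (meson less_le_trans zero_less_power)
  qed (rule C)
  then show ?thesis using C' C by (intro correlation_from_strips[where C = "C' * C", OF _ D1 rel]) auto
qed

end

abbreviation "GG \<equiv> std_normal_distribution \<Otimes>\<^sub>M (std_normal_distribution \<Otimes>\<^sub>M std_normal_distribution)"

section \<open>Gaussian averages\<close>

lemma prob_space_std_normal: "prob_space std_normal_distribution"
  by (rule prob_space_normal_density) simp

interpretation G: prob_space std_normal_distribution by (rule prob_space_std_normal)
interpretation G2: pair_prob_space std_normal_distribution std_normal_distribution ..
interpretation G3: pair_prob_space std_normal_distribution "std_normal_distribution \<Otimes>\<^sub>M std_normal_distribution" ..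

lemma sets_GG: "sets GG = sets (borel \<Otimes>\<^sub>M (borel \<Otimes>\<^sub>M borel))"
  by (intro sets_pair_measure_cong) simp_all

lemma integral_cos_std_normal:
  "(\<integral>x. cos (a + t * x) \<partial>std_normal_distribution) = cos a * exp (- t\<^sup>2 / 2)"
proof -
  have ch: "(CLINT x|std_normal_distribution. iexp (t * x)) = complex_of_real (exp (- t\<^sup>2 / 2))"
    using fun_cong[OF char_std_normal_distribution, of t] by (simp add: char_def)
  have int: "complex_integrable std_normal_distribution (\<lambda>x. iexp (t * x))"
    by (rule G.integrable_iexp) simp_all
  have "(\<integral>x. cos (t * x) \<partial>std_normal_distribution) = Re (CLINT x|std_normal_distribution. iexp (t * x))"
    using integral_Re[OF int] by (simp add: Re_exp)
  then have c: "(\<integral>x. cos (t * x) \<partial>std_normal_distribution) = exp (- t\<^sup>2 / 2)" unfolding ch by simp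
  have "(\<integral>x. sin (t * x) \<partial>std_normal_distribution) = Im (CLINT x|std_normal_distribution. iexp (t * x))"
    using integral_Im[OF int] by (simp add: Im_exp)
  then have s: "(\<integral>x. sin (t * x) \<partial>std_normal_distribution) = 0" unfolding ch by simp
  have ic: "integrable std_normal_distribution (\<lambda>x. cos (t * x))" "integrable std_normal_distribution (\<lambda>x. sin (t * x))"
    by (rule G.integrable_const_bound[where B = 1], simp, measurable)+
  have "(\<integral>x. cos (a + t * x) \<partial>std_normal_distribution)
     = (\<integral>x. cos a * cos (t * x) - sin a * sin (t * x) \<partial>std_normal_distribution)"
    by (simp add: cos_add)
  also have "\<dots> = cos a * exp (- t\<^sup>2 / 2)"
    using ic by (simp add: c s)
  finally show ?thesis .
qed

text \<open>Here \<open>\<omega> = (r, g)\<close> with \<open>r\<close> a standard Gaussian variable and \<open>g\<close> an independent standard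
  Gaussian vector. Its characteristic function is a Gaussian elongated in one direction, the test
  function for strips.\<close>

definition gpt :: "real \<Rightarrow> real \<times> real \<Rightarrow> real \<times> real \<times> real \<Rightarrow> real \<times> real" where
  "gpt c v \<omega> = (c * fst (snd \<omega>) + fst \<omega> * fst v, c * snd (snd \<omega>) + fst \<omega> * snd v)"

lemma gpt_measurable [measurable]: "gpt c v \<in> GG \<rightarrow>\<^sub>M borel \<Otimes>\<^sub>M borel"
proof -
  have "gpt c v \<in> borel \<Otimes>\<^sub>M (borel \<Otimes>\<^sub>M borel) \<rightarrow>\<^sub>M borel \<Otimes>\<^sub>M borel"
    unfolding gpt_def[abs_def] by measurable
  then show ?thesis using measurable_cong_sets[OF sets_GG refl] by blast
qed

lemma integral_cos_gpt:
  "(\<integral>\<omega>. cos (z1 * fst (gpt c v \<omega>) + z2 * snd (gpt c v \<omega>)) \<partial>GG)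
    = exp (- (c\<^sup>2 * (z1\<^sup>2 + z2\<^sup>2) + (z1 * fst v + z2 * snd v)\<^sup>2) / 2)"
proof -
  let ?G = std_normal_distribution
  have eq: "cos (z1 * fst (gpt c v (r, x, y)) + z2 * snd (gpt c v (r, x, y)))
    = cos (((z1 * fst v + z2 * snd v) * r + (z1 * c) * x) + (z2 * c) * y)" for r x y
    by (simp add: gpt_def algebra_simps)
  have m3: "(\<lambda>(r, x, y). cos (((z1 * fst v + z2 * snd v) * r + (z1 * c) * x) + (z2 * c) * y)) \<in> borel_measurable GG"
    unfolding measurable_cong_sets[OF sets_GG refl] by measurable
  have m2: "(\<lambda>(x, y). cos ((b + (z1 * c) * x) + (z2 * c) * y)) \<in> borel_measurable (?G \<Otimes>\<^sub>M ?G)" for b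
    by measurable
  have "(\<integral>\<omega>. cos (z1 * fst (gpt c v \<omega>) + z2 * snd (gpt c v \<omega>)) \<partial>GG)
    = (\<integral>\<omega>. (case \<omega> of (r, w) \<Rightarrow> case w of (x, y) \<Rightarrow> cos (((z1 * fst v + z2 * snd v) * r + (z1 * c) * x) + (z2 * c) * y)) \<partial>GG)"
    by (intro Bochner_Integration.integral_cong refl) (auto simp: eq)
  also have "\<dots> = (\<integral>r. (\<integral>w. (case w of (x, y) \<Rightarrow> cos (((z1 * fst v + z2 * snd v) * r + (z1 * c) * x) + (z2 * c) * y)) \<partial>(?G \<Otimes>\<^sub>M ?G)) \<partial>?G)"
    by (rule G3.integral_fst[symmetric], rule G3.P.integrable_const_bound[where B = 1]) (use m3 in \<open>auto simp: split_beta'\<close>)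
  also have "\<dots> = (\<integral>r. (\<integral>x. (\<integral>y. cos (((z1 * fst v + z2 * snd v) * r + (z1 * c) * x) + (z2 * c) * y) \<partial>?G) \<partial>?G) \<partial>?G)"
    by (intro Bochner_Integration.integral_cong refl G2.integral_fst[symmetric] G2.P.integrable_const_bound[where B = 1])
      (use m2 in \<open>auto simp: split_beta'\<close>)
  also have "\<dots> = exp (- (z1 * fst v + z2 * snd v)\<^sup>2 / 2) * exp (- (z1 * c)\<^sup>2 / 2) * exp (- (z2 * c)\<^sup>2 / 2)"
    using integral_cos_std_normal[of 0 "z1 * fst v + z2 * snd v"] by (simp add: integral_cos_std_normal)
  also have "\<dots> = exp (- (c\<^sup>2 * (z1\<^sup>2 + z2\<^sup>2) + (z1 * fst v + z2 * snd v)\<^sup>2) / 2)"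
    unfolding exp_add[symmetric] by (simp add: power_mult_distrib algebra_simps add_divide_distrib[symmetric])
  finally show ?thesis .
qed

lemma nn_integral_std_normal:
  assumes [measurable]: "f \<in> borel_measurable borel"
  shows "(\<integral>\<^sup>+x. f x \<partial>std_normal_distribution) = (\<integral>\<^sup>+x. ennreal (std_normal_density x) * f x \<partial>lborel)"
  by (rule nn_integral_density) measurable

lemma nn_integral_affine_std_normal:
  assumes [measurable]: "f \<in> borel_measurable borel" and c: "0 < c"
  shows "(\<integral>\<^sup>+x. f (c * x + t) \<partial>std_normal_distribution)
    = (\<integral>\<^sup>+a. ennreal (std_normal_density ((a - t) / c) / c) * f a \<partial>lborel)"
proof -
  have "(\<integral>\<^sup>+a. ennreal (std_normal_density ((a - t) / c) / c) * f a \<partial>lborel)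
    = ennreal \<bar>c\<bar> * (\<integral>\<^sup>+x. ennreal (std_normal_density ((t + c * x - t) / c) / c) * f (t + c * x) \<partial>lborel)"
    by (rule nn_integral_real_affine) (use c in auto)
  also have "\<dots> = (\<integral>\<^sup>+x. ennreal c * (ennreal (std_normal_density x / c) * f (t + c * x)) \<partial>lborel)"
    using c by (subst nn_integral_cmult) auto
  also have "\<dots> = (\<integral>\<^sup>+x. ennreal (std_normal_density x) * f (c * x + t) \<partial>lborel)"
    using c by (intro nn_integral_cong) (simp add: ennreal_mult[symmetric] add.commute flip: mult.assoc)
  also have "\<dots> = (\<integral>\<^sup>+x. f (c * x + t) \<partial>std_normal_distribution)"
    by (rule nn_integral_std_normal[symmetric]) measurable
  finally show ?thesis by simp
qed

text \<open>The joint density of the scalar variable r and of the point \<open>gpt c v\<close>;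
  integrating out r leaves the density of \<open>gpt c v\<close>.\<close>

definition gdens :: "real \<Rightarrow> real \<times> real \<Rightarrow> real \<Rightarrow> real \<Rightarrow> real \<Rightarrow> real" where
  "gdens c v a b r = std_normal_density r * (std_normal_density ((a - r * fst v) / c) / c) * (std_normal_density ((b - r * snd v) / c) / c)"

lemma nn_integral_gpt:
  assumes f: "(\<lambda>(a, b). f a b) \<in> borel_measurable (borel \<Otimes>\<^sub>M borel)" and c: "0 < c"
  shows "(\<integral>\<^sup>+\<omega>. f (fst (gpt c v \<omega>)) (snd (gpt c v \<omega>)) \<partial>GG)
    = (\<integral>\<^sup>+a. \<integral>\<^sup>+b. f a b * (\<integral>\<^sup>+r. ennreal (gdens c v a b r) \<partial>lborel) \<partial>lborel \<partial>lborel)"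
proof -
  let ?G = std_normal_distribution
  let ?n = std_normal_density
  note [measurable] = f
  have f2: "(\<lambda>x. f (g x) (h x)) \<in> borel_measurable N"
    if "g \<in> borel_measurable N" "h \<in> borel_measurable N" for g h and N :: "(real \<times> real \<times> real) measure"
    using measurable_compose[OF measurable_Pair[OF that] f] by simp
  have f3: "(\<lambda>x. f (g x) (h x)) \<in> borel_measurable N"
    if "g \<in> borel_measurable N" "h \<in> borel_measurable N" for g h and N :: "(real \<times> real) measure"
    using measurable_compose[OF measurable_Pair[OF that] f] by simp
  have f4: "(\<lambda>x. f (g x) (h x)) \<in> borel_measurable N"
    if "g \<in> borel_measurable N" "h \<in> borel_measurable N" for g h and N :: "real measure"
    using measurable_compose[OF measurable_Pair[OF that] f] by simp
  have fa[measurable]: "f a \<in> borel_measurable borel" for a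
  proof -
    have "(\<lambda>x. f a x) \<in> borel_measurable borel"
      by (rule f4[where g = "\<lambda>_. a" and h = "\<lambda>x. x"]) simp_all
    then show ?thesis .
  qed
  have "(\<integral>\<^sup>+\<omega>. f (fst (gpt c v \<omega>)) (snd (gpt c v \<omega>)) \<partial>GG)
    = (\<integral>\<^sup>+r. \<integral>\<^sup>+w. f (c * fst w + r * fst v) (c * snd w + r * snd v) \<partial>(?G \<Otimes>\<^sub>M ?G) \<partial>?G)"
  proof (subst G2.P.nn_integral_fst[symmetric])
    show "(\<lambda>\<omega>. f (fst (gpt c v \<omega>)) (snd (gpt c v \<omega>))) \<in> borel_measurable GG"
      by (rule f2) measurable
  qed (simp add: gpt_def)
  also have "\<dots> = (\<integral>\<^sup>+r. \<integral>\<^sup>+x. \<integral>\<^sup>+y. f (c * x + r * fst v) (c * y + r * snd v) \<partial>?G \<partial>?G \<partial>?G)"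
  proof (intro nn_integral_cong, subst G.nn_integral_fst[symmetric])
    show "(\<lambda>w. f (c * fst w + r * fst v) (c * snd w + r * snd v)) \<in> borel_measurable (?G \<Otimes>\<^sub>M ?G)" for r
      by (rule f3) measurable
  qed simp
  also have "\<dots> = (\<integral>\<^sup>+r. \<integral>\<^sup>+x. \<integral>\<^sup>+b. ennreal (?n ((b - r * snd v) / c) / c) * f (c * x + r * fst v) b \<partial>lborel \<partial>?G \<partial>?G)"
    by (intro nn_integral_cong nn_integral_affine_std_normal[OF _ c] f4) measurable
  also have "\<dots> = (\<integral>\<^sup>+r. \<integral>\<^sup>+a. ennreal (?n ((a - r * fst v) / c) / c) * (\<integral>\<^sup>+b. ennreal (?n ((b - r * snd v) / c) / c) * f a b \<partial>lborel) \<partial>lborel \<partial>?G)"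
  proof (intro nn_integral_cong nn_integral_affine_std_normal[OF _ c])
    fix r
    have [measurable]: "(\<lambda>x. f (fst x) (snd x)) \<in> borel_measurable (borel \<Otimes>\<^sub>M lborel)"
      by (rule f3) measurable
    show "(\<lambda>a. \<integral>\<^sup>+b. ennreal (?n ((b - r * snd v) / c) / c) * f a b \<partial>lborel) \<in> borel_measurable borel"
      by (rule lborel.borel_measurable_nn_integral) (simp add: split_beta')
  qed
  also have "\<dots> = (\<integral>\<^sup>+r. ennreal (?n r) * (\<integral>\<^sup>+a. ennreal (?n ((a - r * fst v) / c) / c) * (\<integral>\<^sup>+b. ennreal (?n ((b - r * snd v) / c) / c) * f a b \<partial>lborel) \<partial>lborel) \<partial>lborel)"
  proof (rule nn_integral_std_normal)
    have [measurable]: "(\<lambda>x. f (snd (fst x)) (snd x)) \<in> borel_measurable ((borel \<Otimes>\<^sub>M lborel) \<Otimes>\<^sub>M lborel)"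
    proof -
      have "(\<lambda>x. (snd (fst x), snd x)) \<in> (borel \<Otimes>\<^sub>M lborel) \<Otimes>\<^sub>M lborel \<rightarrow>\<^sub>M (borel :: real measure) \<Otimes>\<^sub>M (borel :: real measure)" by measurable
      from measurable_compose[OF this f] show ?thesis by simp
    qed
    show "(\<lambda>r. \<integral>\<^sup>+a. ennreal (?n ((a - r * fst v) / c) / c) * (\<integral>\<^sup>+b. ennreal (?n ((b - r * snd v) / c) / c) * f a b \<partial>lborel) \<partial>lborel) \<in> borel_measurable borel"
      by measurable
  qed
  also have "\<dots> = (\<integral>\<^sup>+r. \<integral>\<^sup>+a. \<integral>\<^sup>+b. ennreal (gdens c v a b r) * f a b \<partial>lborel \<partial>lborel \<partial>lborel)"
  proof -
    have [measurable]: "(\<lambda>x. f (fst x) (snd x)) \<in> borel_measurable (lborel \<Otimes>\<^sub>M lborel)" by (rule f3) measurable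
    have "ennreal (?n r) * (\<integral>\<^sup>+a. ennreal (?n ((a - r * fst v) / c) / c) * (\<integral>\<^sup>+b. ennreal (?n ((b - r * snd v) / c) / c) * f a b \<partial>lborel) \<partial>lborel)
      = (\<integral>\<^sup>+a. \<integral>\<^sup>+b. ennreal (gdens c v a b r) * f a b \<partial>lborel \<partial>lborel)" for r
    proof -
      have "ennreal (?n r) * (\<integral>\<^sup>+a. ennreal (?n ((a - r * fst v) / c) / c) * (\<integral>\<^sup>+b. ennreal (?n ((b - r * snd v) / c) / c) * f a b \<partial>lborel) \<partial>lborel)
        = (\<integral>\<^sup>+a. ennreal (?n r) * (ennreal (?n ((a - r * fst v) / c) / c) * (\<integral>\<^sup>+b. ennreal (?n ((b - r * snd v) / c) / c) * f a b \<partial>lborel)) \<partial>lborel)"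
        by (rule nn_integral_cmult[symmetric]) measurable
      also have "\<dots> = (\<integral>\<^sup>+a. \<integral>\<^sup>+b. ennreal (gdens c v a b r) * f a b \<partial>lborel \<partial>lborel)"
      proof (rule nn_integral_cong)
        fix a
        have "ennreal (?n r) * (ennreal (?n ((a - r * fst v) / c) / c) * (\<integral>\<^sup>+b. ennreal (?n ((b - r * snd v) / c) / c) * f a b \<partial>lborel))
          = (\<integral>\<^sup>+b. (ennreal (?n r) * ennreal (?n ((a - r * fst v) / c) / c)) * (ennreal (?n ((b - r * snd v) / c) / c) * f a b) \<partial>lborel)"
          unfolding mult.assoc[symmetric, of "ennreal (?n r)" "ennreal (?n ((a - r * fst v) / c) / c)" "integral\<^sup>N _ _"]
          by (rule nn_integral_cmult[symmetric]) measurable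
        also have "\<dots> = (\<integral>\<^sup>+b. ennreal (gdens c v a b r) * f a b \<partial>lborel)"
        proof (rule nn_integral_cong)
          fix b
          have "ennreal (gdens c v a b r) = (ennreal (?n r) * ennreal (?n ((a - r * fst v) / c) / c)) * ennreal (?n ((b - r * snd v) / c) / c)"
            unfolding gdens_def using c by (subst ennreal_mult[symmetric], simp, simp)+ simp
          then show "(ennreal (?n r) * ennreal (?n ((a - r * fst v) / c) / c)) * (ennreal (?n ((b - r * snd v) / c) / c) * f a b)
            = ennreal (gdens c v a b r) * f a b" by (simp only: mult.assoc)
        qed
        finally show "ennreal (?n r) * (ennreal (?n ((a - r * fst v) / c) / c) * (\<integral>\<^sup>+b. ennreal (?n ((b - r * snd v) / c) / c) * f a b \<partial>lborel))
          = (\<integral>\<^sup>+b. ennreal (gdens c v a b r) * f a b \<partial>lborel)" .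
      qed
      finally show ?thesis .
    qed
    then show ?thesis by simp
  qed
  also have "\<dots> = (\<integral>\<^sup>+a. \<integral>\<^sup>+r. \<integral>\<^sup>+b. ennreal (gdens c v a b r) * f a b \<partial>lborel \<partial>lborel \<partial>lborel)"
  proof (rule lborel_pair.Fubini')
    have [measurable]: "(\<lambda>x. f (fst (fst x)) (snd x)) \<in> borel_measurable ((lborel \<Otimes>\<^sub>M lborel) \<Otimes>\<^sub>M lborel)"
    proof -
      have "(\<lambda>x. (fst (fst x), snd x)) \<in> (lborel \<Otimes>\<^sub>M lborel) \<Otimes>\<^sub>M lborel \<rightarrow>\<^sub>M (borel :: real measure) \<Otimes>\<^sub>M (borel :: real measure)" by measurable
      from measurable_compose[OF this f] show ?thesis by simp
    qed
    show "(\<lambda>(a, r). \<integral>\<^sup>+b. ennreal (gdens c v a b r) * f a b \<partial>lborel) \<in> borel_measurable (lborel \<Otimes>\<^sub>M lborel)"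
      unfolding gdens_def split_beta' by measurable
  qed
  also have "\<dots> = (\<integral>\<^sup>+a. \<integral>\<^sup>+b. \<integral>\<^sup>+r. ennreal (gdens c v a b r) * f a b \<partial>lborel \<partial>lborel \<partial>lborel)"
  proof (rule nn_integral_cong)
    fix a
    show "(\<integral>\<^sup>+r. \<integral>\<^sup>+b. ennreal (gdens c v a b r) * f a b \<partial>lborel \<partial>lborel)
      = (\<integral>\<^sup>+b. \<integral>\<^sup>+r. ennreal (gdens c v a b r) * f a b \<partial>lborel \<partial>lborel)"
    proof (rule lborel_pair.Fubini')
      show "(\<lambda>(b, r). ennreal (gdens c v a b r) * f a b) \<in> borel_measurable (lborel \<Otimes>\<^sub>M lborel)"
        unfolding gdens_def split_beta' by measurable
    qed
  qed
  also have "\<dots> = (\<integral>\<^sup>+a. \<integral>\<^sup>+b. f a b * (\<integral>\<^sup>+r. ennreal (gdens c v a b r) \<partial>lborel) \<partial>lborel \<partial>lborel)"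
    unfolding gdens_def by (intro nn_integral_cong, subst nn_integral_multc) (auto simp: mult.commute)
  finally show ?thesis .
qed

lemma exp_neg_le_cube: "exp (- y) \<le> 27 / y ^ 3" if "0 < y" for y :: real
proof -
  have "y / 3 \<le> exp (y / 3)" using exp_ge_add_one_self[of "y / 3"] by linarith
  then have "(y / 3) ^ 3 \<le> exp (y / 3) ^ 3" using that by (intro power_mono) auto
  also have "\<dots> = exp y" by (simp flip: exp_of_nat_mult)
  finally have "y ^ 3 / 27 \<le> exp y" by (simp add: power_divide)
  then show ?thesis using that by (simp add: exp_minus field_simps)
qed

lemma dyadic_shell_le:
  fixes s t :: real
  assumes "0 < s" "t \<le> 2 ^ J * s"
  obtains "t \<le> s" | j where "j < J" "2 ^ j * s < t" "t \<le> 2 ^ (Suc j) * s"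
proof (cases "t \<le> s")
  case False
  then have "s < t" by simp
  from dyadic_shell[OF assms(1) this assms(2)] show thesis using that(2) by metis
qed (use that in blast)

text \<open>The decay 64^(-i), from the sixth power of t / s, has to beat 2^(i D) for exponents up
  to 5. The constant is 216 * 64: 27 / (x^2 / 2)^3 = 216 / x^6, and the shell is named by its outer
  radius.\<close>

lemma gaussian_le_shells6:
  fixes s t :: real
  assumes s: "0 < s" and t: "0 \<le> t" "t \<le> 2 ^ J * s"
  shows "exp (- t\<^sup>2 / (2 * s\<^sup>2)) \<le> (\<Sum>i\<le>J. 13824 * (1/64) ^ i * (if t \<le> 2 ^ i * s then 1 else 0))"
proof -
  have ge: "(13824 :: real) * (1/64) ^ i \<le> (\<Sum>i\<le>J. 13824 * (1/64) ^ i * (if t \<le> 2 ^ i * s then 1 else 0))"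
    if "i \<le> J" "t \<le> 2 ^ i * s" for i
    using that member_le_sum[of i "{..J}" "\<lambda>i. 13824 * (1/64) ^ i * (if t \<le> 2 ^ i * s then 1 else 0 :: real)"] by auto
  show ?thesis
  proof (rule dyadic_shell_le[OF s t(2)])
    assume "t \<le> s"
    have "exp (- t\<^sup>2 / (2 * s\<^sup>2)) \<le> 1" by simp
    also have "\<dots> \<le> 13824 * (1/64) ^ 0" by simp
    also have "\<dots> \<le> (\<Sum>i\<le>J. 13824 * (1/64) ^ i * (if t \<le> 2 ^ i * s then 1 else 0))"
      by (rule ge) (use \<open>t \<le> s\<close> in auto)
    finally show ?thesis .
  next
    fix j assume j: "j < J" "2 ^ j * s < t" "t \<le> 2 ^ (Suc j) * s"
    define x where "x = t / s"
    have x: "2 ^ j < x" using j s by (simp add: x_def field_simps)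
    then have x0: "0 < x" by (meson less_trans zero_less_numeral zero_less_power)
    have "exp (- t\<^sup>2 / (2 * s\<^sup>2)) = exp (- (x\<^sup>2 / 2))" by (simp add: x_def power_divide)
    also have "\<dots> \<le> 27 / (x\<^sup>2 / 2) ^ 3" using x0 by (intro exp_neg_le_cube) auto
    also have "\<dots> = 216 / x ^ 6" by (simp add: power_divide flip: power_mult)
    also have "\<dots> \<le> 216 / (2 ^ j) ^ 6" using x x0 by (intro divide_left_mono power_mono) auto
    also have "\<dots> = 13824 * (1/64) ^ Suc j"
    proof -
      have "((2::real) ^ j) ^ 6 = 64 ^ j"
        using power_mult[of "2::real" 6 j] power_mult[of "2::real" j 6] by (simp add: mult.commute)
      then show ?thesis by (simp add: power_one_over)
    qed
    also have "\<dots> \<le> (\<Sum>i\<le>J. 13824 * (1/64) ^ i * (if t \<le> 2 ^ i * s then 1 else 0))" by (rule ge) (use j in auto)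
    finally show ?thesis .
  qed
qed

text \<open>Here quadratic decay is enough, because it competes with 2^(i d) for d \<le> 1. The
  constant is 4 * 4, again with a shift from inner to outer radius.\<close>

lemma gaussian_le_shells2:
  fixes x :: real
  assumes "\<bar>x\<bar> \<le> 2 ^ J"
  shows "exp (- x\<^sup>2 / 4) \<le> (\<Sum>i\<le>J. 16 * (1/4) ^ i * (if \<bar>x\<bar> \<le> 2 ^ i then 1 else 0))"
proof -
  have ge: "(16 :: real) * (1/4) ^ i \<le> (\<Sum>i\<le>J. 16 * (1/4) ^ i * (if \<bar>x\<bar> \<le> 2 ^ i then 1 else 0))"
    if "i \<le> J" "\<bar>x\<bar> \<le> 2 ^ i" for i
    using that member_le_sum[of i "{..J}" "\<lambda>i. 16 * (1/4) ^ i * (if \<bar>x\<bar> \<le> 2 ^ i then 1 else 0 :: real)"] by auto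
  show ?thesis
  proof (rule dyadic_shell_le[of 1 "\<bar>x\<bar>" J])
    assume "\<bar>x\<bar> \<le> 1"
    have "exp (- x\<^sup>2 / 4) \<le> 1" by simp
    also have "\<dots> \<le> 16 * (1/4) ^ 0" by simp
    also have "\<dots> \<le> (\<Sum>i\<le>J. 16 * (1/4) ^ i * (if \<bar>x\<bar> \<le> 2 ^ i then 1 else 0))"
      by (rule ge) (use \<open>\<bar>x\<bar> \<le> 1\<close> in auto)
    finally show ?thesis .
  next
    fix j assume j: "j < J" "2 ^ j * 1 < \<bar>x\<bar>" "\<bar>x\<bar> \<le> 2 ^ (Suc j) * 1"
    have x0: "x \<noteq> 0" using j by auto
    have "x\<^sup>2 / 4 \<le> exp (x\<^sup>2 / 4)" using exp_ge_add_one_self[of "x\<^sup>2 / 4"] by linarith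
    then have "exp (- x\<^sup>2 / 4) \<le> 4 / x\<^sup>2" using x0 by (simp add: exp_minus field_simps)
    also have "\<dots> = 4 / \<bar>x\<bar>\<^sup>2" by simp
    also have "\<dots> \<le> 4 / (2 ^ j)\<^sup>2" using j x0 by (intro divide_left_mono power_mono) auto
    also have "\<dots> = 16 * (1/4) ^ Suc j"
    proof -
      have "((2::real) ^ j)\<^sup>2 = 4 ^ j"
        using power_mult[of "2::real" 2 j] power_mult[of "2::real" j 2] by (simp add: mult.commute)
      then show ?thesis by (simp add: power_one_over)
    qed
    also have "\<dots> \<le> (\<Sum>i\<le>J. 16 * (1/4) ^ i * (if \<bar>x\<bar> \<le> 2 ^ i then 1 else 0))" by (rule ge) (use j in auto)
    finally show ?thesis .
  qed (use assms in auto)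
qed

text \<open>The last two squares on the right are X, the squared distance of (a, b) from the point u
  * (\<theta>, 1 - \<theta>); it splits into a part along the line, centred at \<open>u0\<close>,
  and a part across it. One half of X pays for these two terms, the other half together with s^2 u^2
  for the isotropic term.\<close>

lemma gdens_exponent:
  fixes a b \<theta> s u :: real
  assumes \<theta>: "0 \<le> \<theta>" "\<theta> \<le> 1" and s: "0 \<le> s" "s \<le> 1"
  defines "u0 \<equiv> (a * \<theta> + b * (1 - \<theta>)) / (\<theta>\<^sup>2 + (1 - \<theta>)\<^sup>2)"
  shows "s\<^sup>2 * (a\<^sup>2 + b\<^sup>2) / 4 + ((1 - \<theta>) * a - \<theta> * b)\<^sup>2 / 2 + (u - u0)\<^sup>2 / 4
    \<le> s\<^sup>2 * u\<^sup>2 + (a - u * \<theta>)\<^sup>2 + (b - u * (1 - \<theta>))\<^sup>2"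
proof -
  define E where "E = \<theta>\<^sup>2 + (1 - \<theta>)\<^sup>2"
  define X where "X = (a - u * \<theta>)\<^sup>2 + (b - u * (1 - \<theta>))\<^sup>2"
  define w where "w = (1 - \<theta>) * a - \<theta> * b"
  have E1: "E \<le> 1"
  proof -
    have "E = 1 - 2 * (\<theta> * (1 - \<theta>))" by (simp add: E_def power2_eq_square algebra_simps)
    moreover have "0 \<le> \<theta> * (1 - \<theta>)" using \<theta> by simp
    ultimately show ?thesis by linarith
  qed
  have E2: "1/2 \<le> E"
  proof -
    have "E = 1/2 + 2 * (\<theta> - 1/2)\<^sup>2" by (simp add: E_def power2_eq_square algebra_simps)
    then show ?thesis by simp
  qed
  have XE: "X * E = (E * (u - u0))\<^sup>2 + w\<^sup>2"
  proof -
    have e: "E * (u - u0) = E * u - (a * \<theta> + b * (1 - \<theta>))" using E2 by (simp add: u0_def E_def[symmetric] right_diff_distrib)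
    show ?thesis unfolding e unfolding X_def w_def E_def by (simp add: power2_eq_square algebra_simps)
  qed
  have X0: "0 \<le> X" by (simp add: X_def)
  have "(E * (u - u0))\<^sup>2 + w\<^sup>2 \<le> X" using E1 X0 XE mult_left_le[of E X] by simp
  then have Xw: "w\<^sup>2 \<le> X" by (smt (verit) zero_le_power2)
  have "1/2 * (u - u0)\<^sup>2 + w\<^sup>2 \<le> X"
  proof -
    have "E * (E * (u - u0)\<^sup>2 + w\<^sup>2) \<le> E * X"
    proof -
      have "E * w\<^sup>2 \<le> 1 * w\<^sup>2" using E1 by (intro mult_right_mono) auto
      then show ?thesis using XE by (simp add: power_mult_distrib power2_eq_square algebra_simps)
    qed
    then have "E * (u - u0)\<^sup>2 + w\<^sup>2 \<le> X" using E2 by simp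
    moreover have "1/2 * (u - u0)\<^sup>2 \<le> E * (u - u0)\<^sup>2" using E2 by (intro mult_right_mono) auto
    ultimately show ?thesis by linarith
  qed
  moreover have "s\<^sup>2 * (a\<^sup>2 + b\<^sup>2) / 4 \<le> s\<^sup>2 * u\<^sup>2 + X / 2"
  proof -
    have "a\<^sup>2 \<le> 2 * (u * \<theta>)\<^sup>2 + 2 * (a - u * \<theta>)\<^sup>2"
      using zero_le_power2[of "a - 2 * (u * \<theta>)"] by (simp add: power2_eq_square algebra_simps)
    moreover have "b\<^sup>2 \<le> 2 * (u * (1 - \<theta>))\<^sup>2 + 2 * (b - u * (1 - \<theta>))\<^sup>2"
      using zero_le_power2[of "b - 2 * (u * (1 - \<theta>))"] by (simp add: power2_eq_square algebra_simps)
    moreover have "(u * \<theta>)\<^sup>2 + (u * (1 - \<theta>))\<^sup>2 = u\<^sup>2 * E" by (simp add: E_def power_mult_distrib distrib_left)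
    moreover have "u\<^sup>2 * E \<le> u\<^sup>2" using E1 by (simp add: mult_left_le)
    moreover have "A + A' \<le> 2 * U + (2 * x + 2 * y)"
      if "A \<le> 2 * p + 2 * x" "A' \<le> 2 * q + 2 * y" "p + q = V" "V \<le> U" for A A' p q x y U V :: real
      using that by linarith
    ultimately have ab: "a\<^sup>2 + b\<^sup>2 \<le> 2 * u\<^sup>2 + 2 * X" unfolding X_def distrib_left by blast
    have "s\<^sup>2 * (a\<^sup>2 + b\<^sup>2) \<le> s\<^sup>2 * (2 * u\<^sup>2 + 2 * X)" by (intro mult_left_mono ab) simp
    moreover have "s\<^sup>2 * X \<le> 1 * X" using s X0 by (intro mult_right_mono power_le_one) auto
    moreover have "0 \<le> s\<^sup>2 * u\<^sup>2" by simp
    moreover have "s\<^sup>2 * (2 * u\<^sup>2 + 2 * X) = 2 * (s\<^sup>2 * u\<^sup>2) + 2 * (s\<^sup>2 * X)" by (simp add: distrib_left)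
    ultimately show ?thesis by linarith
  qed
  ultimately have "s\<^sup>2 * (a\<^sup>2 + b\<^sup>2) / 4 + w\<^sup>2 / 2 + (u - u0)\<^sup>2 / 4 \<le> s\<^sup>2 * u\<^sup>2 + X" by linarith
  then show ?thesis unfolding X_def w_def by (simp only: add.assoc)
qed

lemma std_normal_density_le: "std_normal_density x \<le> exp (- x\<^sup>2 / 2)"
proof -
  have "1 \<le> sqrt (2 * pi)" using pi_ge_two by (intro real_le_rsqrt) simp
  then have "1 / sqrt (2 * pi) \<le> 1" by simp
  then have "1 / sqrt (2 * pi) * exp (- x\<^sup>2 / 2) \<le> 1 * exp (- x\<^sup>2 / 2)" by (intro mult_right_mono) auto
  then show ?thesis by (simp add: std_normal_density_def)
qed

lemma nn_integral_gaussian_bump: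
  assumes s: "0 < s"
  shows "(\<integral>\<^sup>+r. ennreal (exp (- (r / s - u)\<^sup>2 / 8)) \<partial>lborel) \<le> ennreal (6 * s)"
proof -
  have eq: "exp (- (r / s - u)\<^sup>2 / 8) = (2 * s * sqrt (2 * pi)) * normal_density (s * u) (2 * s) r" for r
  proof -
    have "sqrt (2 * pi * (2 * s)\<^sup>2) = 2 * s * sqrt (2 * pi)"
      unfolding real_sqrt_mult[of "2 * pi"] real_sqrt_abs using s by simp
    moreover have "(r - s * u)\<^sup>2 / (2 * (2 * s)\<^sup>2) = (r / s - u)\<^sup>2 / 8"
      using s by (simp add: power2_eq_square field_simps)
    ultimately show ?thesis using s by (simp add: normal_density_def)
  qed
  have "(\<integral>\<^sup>+r. ennreal (normal_density (s * u) (2 * s) r) \<partial>lborel) = 1"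
    using s by (subst nn_integral_eq_integral) (auto simp: normal_density_nonneg)
  then have "(\<integral>\<^sup>+r. ennreal (exp (- (r / s - u)\<^sup>2 / 8)) \<partial>lborel) = ennreal (2 * s * sqrt (2 * pi))"
    unfolding eq using s by (simp add: ennreal_mult normal_density_nonneg nn_integral_cmult)
  also have "\<dots> \<le> ennreal (6 * s)"
  proof (rule ennreal_leI)
    have "sqrt (2 * pi) \<le> 3" using pi_less_4 by (intro real_le_lsqrt) auto
    then show "2 * s * sqrt (2 * pi) \<le> 6 * s" using s by simp
  qed
  finally show ?thesis .
qed

text \<open>The test Gaussian of a strip of width s is dual to a Gaussian of length about 1/s along
  the direction (\<theta>, 1 - \<theta>) and of width about 1 across. The prefactor \<open>s\<close>
  normalises it and is the source of the bound linear in the width.\<close>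

lemma nn_integral_gdens_le:
  fixes a b \<theta> s :: real
  assumes \<theta>: "0 \<le> \<theta>" "\<theta> \<le> 1" and s: "0 < s" "s \<le> 1"
  shows "(\<integral>\<^sup>+r. ennreal (gdens 1 (\<theta> / s, (1 - \<theta>) / s) a b r) \<partial>lborel)
    \<le> ennreal (6 * s * (exp (- s\<^sup>2 * (a\<^sup>2 + b\<^sup>2) / 8) * exp (- ((1 - \<theta>) * a - \<theta> * b)\<^sup>2 / 4)))"
proof -
  define u0 where "u0 = (a * \<theta> + b * (1 - \<theta>)) / (\<theta>\<^sup>2 + (1 - \<theta>)\<^sup>2)"
  define c where "c = exp (- s\<^sup>2 * (a\<^sup>2 + b\<^sup>2) / 8) * exp (- ((1 - \<theta>) * a - \<theta> * b)\<^sup>2 / 4)"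
  have c: "0 \<le> c" by (simp add: c_def)
  have pw: "gdens 1 (\<theta> / s, (1 - \<theta>) / s) a b r \<le> c * exp (- (r / s - u0)\<^sup>2 / 8)" for r
  proof -
    define u where "u = r / s"
    have r: "r = s * u" using s by (simp add: u_def)
    have "gdens 1 (\<theta> / s, (1 - \<theta>) / s) a b r
      \<le> exp (- (s * u)\<^sup>2 / 2) * exp (- (a - u * \<theta>)\<^sup>2 / 2) * exp (- (b - u * (1 - \<theta>))\<^sup>2 / 2)"
    proof -
      have e: "r * (\<theta> / s) = u * \<theta>" "r * ((1 - \<theta>) / s) = u * (1 - \<theta>)" by (simp_all add: u_def)
      show ?thesis unfolding gdens_def fst_conv snd_conv e r[symmetric] div_by_1
        by (intro mult_mono std_normal_density_le mult_nonneg_nonneg) auto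
    qed
    also have "\<dots> = exp (- (s\<^sup>2 * u\<^sup>2 + (a - u * \<theta>)\<^sup>2 + (b - u * (1 - \<theta>))\<^sup>2) / 2)"
      by (simp add: power_mult_distrib add_divide_distrib diff_divide_distrib flip: exp_add)
    also have "\<dots> \<le> exp (- (s\<^sup>2 * (a\<^sup>2 + b\<^sup>2) / 4 + ((1 - \<theta>) * a - \<theta> * b)\<^sup>2 / 2 + (u - u0)\<^sup>2 / 4) / 2)"
      using gdens_exponent[of \<theta> s a b u] \<theta> s unfolding u0_def by simp
    also have "\<dots> = c * exp (- (u - u0)\<^sup>2 / 8)"
      by (simp add: c_def add_divide_distrib diff_divide_distrib flip: exp_add)
    finally show ?thesis by (simp add: u_def)
  qed
  have "(\<integral>\<^sup>+r. ennreal (gdens 1 (\<theta> / s, (1 - \<theta>) / s) a b r) \<partial>lborel)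
    \<le> (\<integral>\<^sup>+r. ennreal c * ennreal (exp (- (r / s - u0)\<^sup>2 / 8)) \<partial>lborel)"
    using pw c by (intro nn_integral_mono) (simp add: ennreal_leI flip: ennreal_mult)
  also have "\<dots> = ennreal c * (\<integral>\<^sup>+r. ennreal (exp (- (r / s - u0)\<^sup>2 / 8)) \<partial>lborel)"
    by (rule nn_integral_cmult) measurable
  also have "\<dots> \<le> ennreal c * ennreal (6 * s)" by (intro mult_left_mono nn_integral_gaussian_bump s) auto
  also have "\<dots> = ennreal (6 * s * c)" using c s by (simp add: mult.commute flip: ennreal_mult)
  finally show ?thesis by (simp add: c_def)
qed

lemma nn_integral_gdens_isotropic:
  assumes c: "0 < c"
  shows "(\<integral>\<^sup>+r. ennreal (gdens c (0, 0) a b r) \<partial>lborel) = ennreal (exp (- (a\<^sup>2 + b\<^sup>2) / (2 * c\<^sup>2)) / (2 * pi * c\<^sup>2))"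
proof -
  define k where "k = exp (- (a\<^sup>2 + b\<^sup>2) / (2 * c\<^sup>2)) / (2 * pi * c\<^sup>2)"
  have n: "std_normal_density (x / c) / c = exp (- x\<^sup>2 / (2 * c\<^sup>2)) / (sqrt (2 * pi) * c)" for x
    by (simp add: std_normal_density_def power_divide)
  have e: "exp (- (a\<^sup>2 + b\<^sup>2) / (2 * c\<^sup>2)) = exp (- a\<^sup>2 / (2 * c\<^sup>2)) * exp (- b\<^sup>2 / (2 * c\<^sup>2))"
    unfolding exp_add[symmetric] by (simp add: add_divide_distrib diff_divide_distrib)
  have q: "2 * pi * c\<^sup>2 = (sqrt (2 * pi) * c) * (sqrt (2 * pi) * c)"
  proof -
    define S where "S = sqrt (2 * pi)"
    have "2 * pi = S * S" by (simp add: S_def flip: real_sqrt_mult)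
    then show ?thesis unfolding S_def[symmetric] by (simp add: power2_eq_square)
  qed
  have arr: "x * (u / w) * (v / w) = u * v / (w * w) * x" for x u v w :: real by simp
  have "gdens c (0, 0) a b r = k * std_normal_density r" for r
    unfolding gdens_def k_def fst_conv snd_conv mult_zero_right diff_zero n e q by (rule arr)
  then have "(\<integral>\<^sup>+r. ennreal (gdens c (0, 0) a b r) \<partial>lborel) = (\<integral>\<^sup>+r. ennreal k * ennreal (std_normal_density r) \<partial>lborel)"
    by (intro nn_integral_cong) (simp add: k_def flip: ennreal_mult)
  also have "\<dots> = ennreal k * (\<integral>\<^sup>+r. ennreal (std_normal_density r) \<partial>lborel)"
    by (rule nn_integral_cmult) measurable
  also have "(\<integral>\<^sup>+r. ennreal (std_normal_density r) \<partial>lborel) = 1"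
    by (subst nn_integral_eq_integral) auto
  finally show ?thesis unfolding k_def mult_1_right .
qed

lemma vec_nth_measurable [measurable]: "(\<lambda>x::real^2. x $ i) \<in> borel_measurable borel"
  by (intro borel_measurable_continuous_onI continuous_intros)

section \<open>The Fourier estimate for averaged strips\<close>

context self_affine_measure
begin

interpretation \<nu>: prob_space \<nu> by (rule prob_\<nu>)
interpretation P: pair_prob_space \<nu> \<nu> ..

declare sets_\<nu> [measurable_cong] sets_P [measurable_cong]

definition "phase a b z = a * (fst z $ 1 - snd z $ 1) + b * (fst z $ 2 - snd z $ 2)"
  for a b :: real and z :: "(real^2) \<times> (real^2)"

lemma phase_measurable [measurable]:
  "(\<lambda>(w, z). phase (fst w) (snd w) z) \<in> borel_measurable ((borel \<Otimes>\<^sub>M borel) \<Otimes>\<^sub>M P)"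
  "phase a b \<in> borel_measurable P"
  unfolding phase_def[abs_def] split_beta' by measurable

text \<open>The squared modulus of the Fourier transform of the measure at the frequency (a, b),
  written as an integral over pairs.\<close>

definition "Q a b = (\<integral>z. cos (phase a b z) \<partial>P)"

lemma Q_measurable: "(\<lambda>(a, b). Q a b) \<in> borel_measurable (borel \<Otimes>\<^sub>M borel)"
proof -
  have "(\<lambda>w. \<integral>z. cos (phase (fst w) (snd w) z) \<partial>P) \<in> borel_measurable (borel \<Otimes>\<^sub>M borel)"
  proof (rule P.borel_measurable_lebesgue_integral)
    show "(\<lambda>(w, z). cos (phase (fst w) (snd w) z)) \<in> borel_measurable ((borel \<Otimes>\<^sub>M borel) \<Otimes>\<^sub>M P)"
      using measurable_compose[OF phase_measurable(1) borel_measurable_cos] by (simp add: split_beta')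
  qed
  then show ?thesis by (simp add: Q_def split_beta')
qed

lemma Q_le_1: "\<bar>Q a b\<bar> \<le> 1"
proof -
  have "norm (\<integral>z. cos (phase a b z) \<partial>P) \<le> (\<integral>z. norm (cos (phase a b z)) \<partial>P)" by (rule integral_norm_bound)
  also have "\<dots> \<le> (\<integral>z. 1 \<partial>P)"
    by (intro integral_mono P.integrable_const_bound[where B = 1]) auto
  also have "\<dots> = 1" using P.prob_space by simp
  finally show ?thesis by (simp add: Q_def)
qed

text \<open>A sum of two squares, after expanding the cosine of a difference. Nonnegativity is what
  allows the densities integrated against \<open>Q\<close> to be replaced by larger ones.\<close>

lemma Q_nonneg: "0 \<le> Q a b"
proof -
  define c where "c x = cos (a * x$1 + b * x$2)" for x :: "real^2"
  define s where "s x = sin (a * x$1 + b * x$2)" for x :: "real^2"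
  have [measurable]: "c \<in> borel_measurable \<nu>" "s \<in> borel_measurable \<nu>"
    unfolding c_def[abs_def] s_def[abs_def] by measurable
  have bd: "\<bar>c x\<bar> \<le> 1" "\<bar>s x\<bar> \<le> 1" for x by (simp_all add: c_def s_def)
  have int: "integrable \<nu> c" "integrable \<nu> s"
    by (rule \<nu>.integrable_const_bound[where B = 1]; simp add: bd)+
  have eq: "cos (phase a b (x, y)) = c x * c y + s x * s y" for x y
  proof -
    have "phase a b (x, y) = (a * x$1 + b * x$2) - (a * y$1 + b * y$2)" by (simp add: phase_def algebra_simps)
    then show ?thesis by (simp add: c_def s_def cos_diff)
  qed
  have "Q a b = (\<integral>x. \<integral>y. cos (phase a b (x, y)) \<partial>\<nu> \<partial>\<nu>)"
    unfolding Q_def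
  proof (subst P.integral_fst)
    show "integrable P (\<lambda>(x, y). cos (phase a b (x, y)))"
      by (rule P.integrable_const_bound[where B = 1]) auto
  qed (simp add: split_beta')
  also have "\<dots> = (\<integral>x. c x * (\<integral>y. c y \<partial>\<nu>) + s x * (\<integral>y. s y \<partial>\<nu>) \<partial>\<nu>)"
    unfolding eq using int by simp
  also have "\<dots> = (\<integral>x. c x \<partial>\<nu>) * (\<integral>y. c y \<partial>\<nu>) + (\<integral>x. s x \<partial>\<nu>) * (\<integral>y. s y \<partial>\<nu>)"
    using int by simp
  also have "0 \<le> \<dots>" by simp
  finally show ?thesis .
qed

definition "gaussian_energy c v = (\<integral>z. exp (- (c\<^sup>2 * (dist (fst z) (snd z))\<^sup>2 + (phase (fst v) (snd v) z)\<^sup>2) / 2) \<partial>P)"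

text \<open>Exchange of the Gaussian average with the integral over pairs: the averaged cosine is
  the Gaussian test function. This plays the part of Plancherel's formula.\<close>

lemma nn_integral_Q_gpt:
  "(\<integral>\<^sup>+\<omega>. ennreal (Q (fst (gpt c v \<omega>)) (snd (gpt c v \<omega>))) \<partial>GG) = ennreal (gaussian_energy c v)"
proof -
  interpret G: prob_space std_normal_distribution by (rule prob_space_std_normal)
  interpret G2: pair_prob_space std_normal_distribution std_normal_distribution ..
  interpret G3: pair_prob_space std_normal_distribution "std_normal_distribution \<Otimes>\<^sub>M std_normal_distribution" ..
  interpret GP: pair_prob_space GG P ..
  define f where "f \<omega> z = cos (phase (fst (gpt c v \<omega>)) (snd (gpt c v \<omega>)) z)" for \<omega> z
  have f_meas: "(\<lambda>(\<omega>, z). f \<omega> z) \<in> borel_measurable (GG \<Otimes>\<^sub>M P)"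
  proof -
    have "(\<lambda>x. (gpt c v (fst x), snd x)) \<in> GG \<Otimes>\<^sub>M P \<rightarrow>\<^sub>M (borel \<Otimes>\<^sub>M borel) \<Otimes>\<^sub>M P"
      by measurable
    from measurable_compose[OF this measurable_compose[OF phase_measurable(1) borel_measurable_cos]]
    show ?thesis by (simp add: f_def[abs_def] split_beta')
  qed
  have Q_gpt: "(\<lambda>\<omega>. Q (fst (gpt c v \<omega>)) (snd (gpt c v \<omega>))) \<in> borel_measurable GG"
    using measurable_compose[OF gpt_measurable Q_measurable] by (simp add: split_beta')
  have "(\<integral>\<^sup>+\<omega>. ennreal (Q (fst (gpt c v \<omega>)) (snd (gpt c v \<omega>))) \<partial>GG)
      = ennreal (\<integral>\<omega>. Q (fst (gpt c v \<omega>)) (snd (gpt c v \<omega>)) \<partial>GG)"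
  proof (rule nn_integral_eq_integral)
    show "integrable GG (\<lambda>\<omega>. Q (fst (gpt c v \<omega>)) (snd (gpt c v \<omega>)))"
      by (rule G3.P.integrable_const_bound[where B = 1]) (use Q_le_1 Q_gpt in auto)
  qed (simp add: Q_nonneg)
  also have "(\<integral>\<omega>. Q (fst (gpt c v \<omega>)) (snd (gpt c v \<omega>)) \<partial>GG) = (\<integral>\<omega>. \<integral>z. f \<omega> z \<partial>P \<partial>GG)"
    by (simp add: Q_def f_def)
  also have "\<dots> = (\<integral>z. \<integral>\<omega>. f \<omega> z \<partial>GG \<partial>P)"
  proof (rule GP.Fubini_integral[symmetric])
    show "integrable (GG \<Otimes>\<^sub>M P) (\<lambda>(\<omega>, z). f \<omega> z)"
      by (rule GP.P.integrable_const_bound[where B = 1]) (use f_meas in \<open>auto simp: f_def\<close>)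
  qed
  also have "\<dots> = gaussian_energy c v"
    unfolding gaussian_energy_def
  proof (rule Bochner_Integration.integral_cong[OF refl])
    fix z :: "(real^2) \<times> (real^2)"
    have d: "(dist (fst z) (snd z))\<^sup>2 = (fst z $ 1 - snd z $ 1)\<^sup>2 + (fst z $ 2 - snd z $ 2)\<^sup>2"
      unfolding dist_norm norm_vec2_sq by simp
    have "(\<integral>\<omega>. f \<omega> z \<partial>GG) = (\<integral>\<omega>. cos ((fst z $ 1 - snd z $ 1) * fst (gpt c v \<omega>) + (fst z $ 2 - snd z $ 2) * snd (gpt c v \<omega>)) \<partial>GG)"
      by (simp add: f_def phase_def mult.commute)
    also have "\<dots> = exp (- (c\<^sup>2 * (dist (fst z) (snd z))\<^sup>2 + (phase (fst v) (snd v) z)\<^sup>2) / 2)"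
      unfolding integral_cos_gpt d by (simp add: phase_def mult.commute)
    finally show "(\<integral>\<omega>. f \<omega> z \<partial>GG) = exp (- (c\<^sup>2 * (dist (fst z) (snd z))\<^sup>2 + (phase (fst v) (snd v) z)\<^sup>2) / 2)" .
  qed
  finally show ?thesis .
qed

lemma gaussian_energy_density:
  assumes c: "0 < c"
  shows "ennreal (gaussian_energy c v) = (\<integral>\<^sup>+a. \<integral>\<^sup>+b. ennreal (Q a b) * (\<integral>\<^sup>+r. ennreal (gdens c v a b r) \<partial>lborel) \<partial>lborel \<partial>lborel)"
proof -
  have "(\<lambda>(a, b). ennreal (Q a b)) \<in> borel_measurable (borel \<Otimes>\<^sub>M borel)"
    using measurable_compose[OF Q_measurable measurable_ennreal] by (simp add: split_beta')
  from nn_integral_gpt[OF this c] show ?thesis unfolding nn_integral_Q_gpt .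
qed

text \<open>The test function is a smoothed indicator of pairs at distance at most 1 / c. The shell
  weights 64^(-i) meet 2^(i D) \<le> 32^i and leave a geometric series of sum at most 2, hence the
  constant 2 * 13824.\<close>

lemma gaussian_energy_isotropic_le:
  assumes C: "0 \<le> C" "\<And>r. 0 < r \<Longrightarrow> \<phi> r \<le> C * r powr D" and D: "0 \<le> D" "D \<le> 5" and c: "0 < c"
  shows "gaussian_energy c (0, 0) \<le> 27648 * C * (1 / c) powr D"
proof -
  define \<sigma> where "\<sigma> = 1 / c"
  have \<sigma>: "0 < \<sigma>" using c by (simp add: \<sigma>_def)
  obtain J where "Rb / \<sigma> < 2 ^ J" using real_arch_pow[of 2 "Rb / \<sigma>"] by auto
  then have J: "Rb \<le> 2 ^ J * \<sigma>" using \<sigma> by (simp add: field_simps)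
  have int: "integrable P (indicat_real S)" "(\<integral>z. indicat_real S z \<partial>P) = measure P S" if "S \<in> sets (borel \<Otimes>\<^sub>M borel)" for S
    using that by (simp_all add: sets_P P.emeasure_eq_measure)
  note int_p = int[OF pairs_within_measurable]
  have "gaussian_energy c (0, 0) = (\<integral>z. exp (- (dist (fst z) (snd z))\<^sup>2 / (2 * \<sigma>\<^sup>2)) \<partial>P)"
    unfolding gaussian_energy_def by (simp add: phase_def \<sigma>_def power_divide mult.commute)
  also have "\<dots> \<le> (\<integral>z. (\<Sum>i\<le>J. 13824 * (1/64) ^ i * indicat_real (pairs_within (2 ^ i * \<sigma>)) z) \<partial>P)"
  proof (rule integral_mono_AE)
    show "integrable P (\<lambda>z. exp (- (dist (fst z) (snd z))\<^sup>2 / (2 * \<sigma>\<^sup>2)))"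
      by (rule P.integrable_const_bound[where B = 1]) auto
    show "integrable P (\<lambda>z. \<Sum>i\<le>J. 13824 * (1/64) ^ i * indicat_real (pairs_within (2 ^ i * \<sigma>)) z)"
      by (intro Bochner_Integration.integrable_sum integrable_mult_right int_p)
    show "AE z in P. exp (- (dist (fst z) (snd z))\<^sup>2 / (2 * \<sigma>\<^sup>2)) \<le> (\<Sum>i\<le>J. 13824 * (1/64) ^ i * indicat_real (pairs_within (2 ^ i * \<sigma>)) z)"
      using AE_KK
    proof eventually_elim
      case (elim z)
      have "dist (fst z) (snd z) \<le> 2 ^ J * \<sigma>" using Rb(2)[of "fst z" "snd z"] elim J by linarith
      from gaussian_le_shells6[OF \<sigma> zero_le_dist this]
      have "exp (- (dist (fst z) (snd z))\<^sup>2 / (2 * \<sigma>\<^sup>2)) \<le> (\<Sum>i\<le>J. 13824 * (1/64) ^ i * (if dist (fst z) (snd z) \<le> 2 ^ i * \<sigma> then 1 else 0))" .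
      also have "\<dots> = (\<Sum>i\<le>J. 13824 * (1/64) ^ i * indicat_real (pairs_within (2 ^ i * \<sigma>)) z)"
        by (intro sum.cong refl) (simp add: pairs_within_def)
      finally show ?case .
    qed
  qed
  also have "\<dots> = (\<Sum>i\<le>J. 13824 * (1/64) ^ i * \<phi> (2 ^ i * \<sigma>))"
    by (simp only: Bochner_Integration.integral_sum integral_mult_right_zero integrable_mult_right int_p \<phi>_def)
  also have "\<dots> \<le> (\<Sum>i\<le>J. 13824 * C * \<sigma> powr D * (1/2) ^ i)"
  proof (rule sum_mono)
    fix i
    have "(2 powr D) ^ i \<le> 32 ^ i"
    proof (rule power_mono)
      have "2 powr D \<le> 2 powr 5" using D by (intro powr_mono) auto
      also have "\<dots> = (32::real)" using powr_realpow[of 2 5] by simp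
      finally show "2 powr D \<le> (32::real)" .
    qed simp
    moreover have "(2 ^ i * \<sigma>) powr D = (2 powr D) ^ i * \<sigma> powr D"
      using \<sigma> by (simp add: powr_mult powr_powr mult.commute flip: powr_realpow)
    ultimately have le: "(2 ^ i * \<sigma>) powr D \<le> 32 ^ i * \<sigma> powr D" by (simp add: mult_right_mono)
    have "\<phi> (2 ^ i * \<sigma>) \<le> C * (2 ^ i * \<sigma>) powr D" using \<sigma> by (intro C) auto
    also have "\<dots> \<le> C * (32 ^ i * \<sigma> powr D)" using C(1) le by (intro mult_left_mono)
    finally have "13824 * (1/64) ^ i * \<phi> (2 ^ i * \<sigma>) \<le> 13824 * (1/64) ^ i * (C * (32 ^ i * \<sigma> powr D))"
      by (intro mult_left_mono) auto
    also have "\<dots> = 13824 * C * \<sigma> powr D * ((1/64) * 32) ^ i" unfolding power_mult_distrib by (simp only: mult_ac)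
    also have "(1/64) * 32 = (1/2 :: real)" by simp
    finally show "13824 * (1/64) ^ i * \<phi> (2 ^ i * \<sigma>) \<le> 13824 * C * \<sigma> powr D * (1/2) ^ i" .
  qed
  also have "\<dots> = 13824 * C * \<sigma> powr D * (\<Sum>i\<le>J. (1/2) ^ i)" by (simp add: sum_distrib_left)
  also have "\<dots> \<le> 13824 * C * \<sigma> powr D * 2"
  proof (rule mult_left_mono)
    have "(\<Sum>i\<le>J. (1/2) ^ i) \<le> (\<Sum>i. (1/2) ^ i :: real)" by (intro sum_le_suminf summable_geometric) auto
    also have "\<dots> = 2" using suminf_geometric[of "1/2 :: real"] by simp
    finally show "(\<Sum>i\<le>J. (1/2) ^ i) \<le> (2::real)" .
  qed (use C in auto)
  finally show ?thesis by (simp add: \<sigma>_def)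
qed

text \<open>A summand is large only if (\<theta>, 1 - \<theta>) is nearly parallel to the frequency
  (a, b). For a frequency of length at least 1/m such directions lie in an interval of length of
  order \<open>m\<close>, to which the Frostman count applies.\<close>

lemma directional_gaussian_sum:
  assumes d1: "d \<le> 1" and m: "\<kappa> ^ k \<le> m" "1 \<le> m * sqrt (a\<^sup>2 + b\<^sup>2)"
  shows "(\<Sum>w\<in>words I k. exp (- ((1 - \<theta> w) * a - \<theta> w * b)\<^sup>2 / 4)) \<le> 32 * M ^ k * (8 / \<kappa>) powr d * m powr d"
proof -
  define N where "N = sqrt (a\<^sup>2 + b\<^sup>2)"
  have m0: "0 < m" using m(1) \<kappa>(1) by (meson less_le_trans zero_less_power)
  have N0: "0 < N" using m(2) m0 unfolding N_def[symmetric] by (smt (verit) mult_nonneg_nonpos)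
  have Nab: "N \<le> \<bar>- b\<bar> + \<bar>a\<bar>" unfolding N_def
    by (rule order_trans[OF sqrt_sum_squares_le_sum_abs]) simp
  define g where "g w = (1 - \<theta> w) * a - \<theta> w * b" for w
  have gw: "g w = \<theta> w * (- b) + (1 - \<theta> w) * a" for w by (simp add: g_def algebra_simps)
  have mem: "\<theta> w \<in> {0..1}" if "w \<in> words I k" for w using that by (auto simp only: words_def intro!: \<theta>_mem)
  obtain J where J: "\<bar>a\<bar> + \<bar>b\<bar> < 2 ^ J" using real_arch_pow[of 2 "\<bar>a\<bar> + \<bar>b\<bar>"] by auto
  have gJ: "\<bar>g w\<bar> \<le> 2 ^ J" if "w \<in> words I k" for w
  proof -
    have "\<bar>(1 - \<theta> w) * a\<bar> \<le> \<bar>a\<bar>" "\<bar>\<theta> w * b\<bar> \<le> \<bar>b\<bar>"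
      using mem[OF that] by (auto simp: abs_mult intro!: mult_left_le_one_le)
    then show ?thesis using J unfolding g_def by linarith
  qed
  have cnt: "real (card {w\<in>words I k. \<bar>g w\<bar> \<le> 2 ^ i}) \<le> M ^ k * ((8 / \<kappa>) powr d * m powr d * 2 ^ i)" for i
  proof -
    have "real (card {w\<in>words I k. \<bar>g w\<bar> \<le> 2 ^ i}) \<le> M ^ k * ((8 * 2 ^ i * m) / \<kappa>) powr d"
    proof (rule frostman_count)
      fix w w' assume w: "w \<in> {w\<in>words I k. \<bar>g w\<bar> \<le> 2 ^ i}" "w' \<in> {w\<in>words I k. \<bar>g w\<bar> \<le> 2 ^ i}"
      have "\<bar>\<theta> w - \<theta> w'\<bar> * N \<le> 8 * 2 ^ i"
        using w mem[of w] mem[of w'] Nab N0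
        by (intro strip_direction_diff[where u = "- b" and v = a]) (auto simp: gw)
      also have "\<dots> \<le> 8 * 2 ^ i * (m * N)" using m(2) by (simp add: N_def)
      finally have "\<bar>\<theta> w - \<theta> w'\<bar> * N \<le> (8 * 2 ^ i * m) * N" by (simp add: mult.assoc)
      then show "\<bar>\<theta> w - \<theta> w'\<bar> \<le> 8 * 2 ^ i * m" using N0 by simp
    next
      have "1 * m \<le> (8 * 2 ^ i) * m" using m0 by (intro mult_right_mono) (auto intro: order_trans[OF one_le_power[of 2 i]])
      then show "\<kappa> ^ k \<le> 8 * 2 ^ i * m" using m(1) by simp
    qed auto
    also have "((8 * 2 ^ i * m) / \<kappa>) powr d = (8 / \<kappa>) powr d * m powr d * (2 ^ i) powr d"
      using m0 \<kappa> by (simp add: mult_ac flip: powr_mult)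
    also have "\<dots> \<le> (8 / \<kappa>) powr d * m powr d * 2 ^ i"
    proof (rule mult_left_mono)
      have "(2 ^ i) powr d \<le> (2 ^ i) powr (1::real)" using d1 by (intro powr_mono) auto
      then show "(2 ^ i) powr d \<le> (2 ^ i :: real)" by simp
    qed simp
    finally show ?thesis by (simp add: mult_left_mono)
  qed
  have "(\<Sum>w\<in>words I k. exp (- (g w)\<^sup>2 / 4)) \<le> (\<Sum>w\<in>words I k. \<Sum>i\<le>J. 16 * (1/4) ^ i * (if \<bar>g w\<bar> \<le> 2 ^ i then 1 else 0))"
    by (intro sum_mono gaussian_le_shells2 gJ)
  also have "\<dots> = (\<Sum>i\<le>J. 16 * (1/4) ^ i * (\<Sum>w\<in>words I k. if \<bar>g w\<bar> \<le> 2 ^ i then 1 else 0))"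
    by (subst sum.swap) (simp add: sum_distrib_left)
  also have "\<dots> = (\<Sum>i\<le>J. 16 * (1/4) ^ i * real (card {w\<in>words I k. \<bar>g w\<bar> \<le> 2 ^ i}))"
    using finite_words[OF I(1)] by (simp add: sum.inter_filter[symmetric])
  also have "\<dots> \<le> (\<Sum>i\<le>J. 16 * M ^ k * ((8 / \<kappa>) powr d * m powr d) * (1/2) ^ i)"
  proof (rule sum_mono)
    fix i
    have "16 * (1/4) ^ i * real (card {w\<in>words I k. \<bar>g w\<bar> \<le> 2 ^ i}) \<le> 16 * (1/4) ^ i * (M ^ k * ((8 / \<kappa>) powr d * m powr d * 2 ^ i))"
      by (intro mult_left_mono cnt) auto
    also have "\<dots> = 16 * M ^ k * ((8 / \<kappa>) powr d * m powr d) * ((1/4) * 2) ^ i" unfolding power_mult_distrib by (simp only: mult_ac)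
    also have "(1/4) * 2 = (1/2 :: real)" by simp
    finally show "16 * (1/4) ^ i * real (card {w\<in>words I k. \<bar>g w\<bar> \<le> 2 ^ i}) \<le> 16 * M ^ k * ((8 / \<kappa>) powr d * m powr d) * (1/2) ^ i" .
  qed
  also have "\<dots> = 16 * M ^ k * ((8 / \<kappa>) powr d * m powr d) * (\<Sum>i\<le>J. (1/2) ^ i)" by (simp add: sum_distrib_left)
  also have "\<dots> \<le> 16 * M ^ k * ((8 / \<kappa>) powr d * m powr d) * 2"
  proof (rule mult_left_mono)
    have "(\<Sum>i\<le>J. (1/2) ^ i) \<le> (\<Sum>i. (1/2) ^ i :: real)" by (intro sum_le_suminf summable_geometric) auto
    also have "\<dots> = 2" using suminf_geometric[of "1/2 :: real"] by simp
    finally show "(\<Sum>i\<le>J. (1/2) ^ i) \<le> (2::real)" .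
  qed simp
  finally show ?thesis by (simp add: g_def)
qed

end

lemma dyadic_multiple_near_1:
  fixes s :: real
  assumes "0 < s" "s \<le> 1"
  obtains J :: nat where "1 \<le> 2 ^ J * s" "2 ^ J * s \<le> 2"
proof (cases "s = 1")
  case True
  then show thesis using that[of 0] by simp
next
  case False
  obtain m where "1 / s < 2 ^ m" using real_arch_pow[of 2 "1 / s"] by auto
  then have "1 \<le> 2 ^ m * s" using assms by (simp add: field_simps)
  then obtain j where "2 ^ j * s < 1" "1 \<le> 2 ^ Suc j * s"
    using dyadic_shell[OF assms(1), of 1 m] False assms by (metis order_le_imp_less_or_eq)
  then show thesis using that[of "Suc j"] by simp
qed

context self_affine_measure
begin

interpretation \<nu>: prob_space \<nu> by (rule prob_\<nu>)
interpretation P: pair_prob_space \<nu> \<nu> ..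

declare sets_\<nu> [measurable_cong] sets_P [measurable_cong]

definition "Lam f = (\<integral>\<^sup>+a. \<integral>\<^sup>+b. ennreal (Q a b) * ennreal (f a b) \<partial>lborel \<partial>lborel)"

lemma Q_measurable':
  assumes "g \<in> borel_measurable N" "h \<in> borel_measurable N"
  shows "(\<lambda>x. ennreal (Q (g x) (h x))) \<in> borel_measurable N"
  using measurable_compose[OF measurable_compose[OF measurable_Pair[OF assms] Q_measurable] measurable_ennreal] by simp

lemma Lam_mono: "(\<And>a b. f a b \<le> g a b) \<Longrightarrow> Lam f \<le> Lam g"
  unfolding Lam_def by (intro nn_integral_mono mult_left_mono ennreal_leI) auto

lemma Lam_integrand_measurable:
  assumes f: "(\<lambda>x. f (fst x) (snd x)) \<in> borel_measurable (borel \<Otimes>\<^sub>M borel)"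
  shows "(\<lambda>b. ennreal (Q a b) * ennreal (f a b)) \<in> borel_measurable lborel"
    and "(\<lambda>a. \<integral>\<^sup>+b. ennreal (Q a b) * ennreal (f a b) \<partial>lborel) \<in> borel_measurable lborel"
proof -
  have "(\<lambda>b. f (fst (a, b)) (snd (a, b))) \<in> borel_measurable borel"
    by (rule measurable_compose[OF _ f]) measurable
  then have [measurable]: "f a \<in> borel_measurable borel" by simp
  have [measurable]: "(\<lambda>b. ennreal (Q a b)) \<in> borel_measurable borel" by (rule Q_measurable') simp_all
  show "(\<lambda>b. ennreal (Q a b) * ennreal (f a b)) \<in> borel_measurable lborel" by measurable
  note f[measurable]
  have [measurable]: "(\<lambda>x. ennreal (Q (fst x) (snd x))) \<in> borel_measurable (borel \<Otimes>\<^sub>M borel)"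
    by (rule Q_measurable') simp_all
  have "(\<lambda>(a, b). ennreal (Q a b) * ennreal (f a b)) \<in> borel_measurable (borel \<Otimes>\<^sub>M lborel)"
    unfolding split_beta' by measurable
  from lborel.borel_measurable_nn_integral[OF this]
  show "(\<lambda>a. \<integral>\<^sup>+b. ennreal (Q a b) * ennreal (f a b) \<partial>lborel) \<in> borel_measurable lborel" by simp
qed

lemma Lam_sum:
  assumes "finite S" "\<And>i a b. i \<in> S \<Longrightarrow> 0 \<le> f i a b"
    and f: "\<And>i. i \<in> S \<Longrightarrow> (\<lambda>x. f i (fst x) (snd x)) \<in> borel_measurable (borel \<Otimes>\<^sub>M borel)"
  shows "Lam (\<lambda>a b. \<Sum>i\<in>S. f i a b) = (\<Sum>i\<in>S. Lam (f i))"
proof -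
  have "Lam (\<lambda>a b. \<Sum>i\<in>S. f i a b) = (\<integral>\<^sup>+a. \<integral>\<^sup>+b. (\<Sum>i\<in>S. ennreal (Q a b) * ennreal (f i a b)) \<partial>lborel \<partial>lborel)"
    unfolding Lam_def
    by (intro nn_integral_cong) (subst sum_ennreal[symmetric], rule assms(2), assumption, rule sum_distrib_left)
  also have "\<dots> = (\<integral>\<^sup>+a. (\<Sum>i\<in>S. \<integral>\<^sup>+b. ennreal (Q a b) * ennreal (f i a b) \<partial>lborel) \<partial>lborel)"
    by (intro nn_integral_cong nn_integral_sum Lam_integrand_measurable f)
  also have "\<dots> = (\<Sum>i\<in>S. Lam (f i))"
    unfolding Lam_def by (intro nn_integral_sum Lam_integrand_measurable f)
  finally show ?thesis .
qed

lemma Lam_cmult: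
  assumes k: "0 \<le> k" "\<And>a b. 0 \<le> f a b" and f: "(\<lambda>x. f (fst x) (snd x)) \<in> borel_measurable (borel \<Otimes>\<^sub>M borel)"
  shows "Lam (\<lambda>a b. k * f a b) = ennreal k * Lam f"
proof -
  have "ennreal k * Lam f = (\<integral>\<^sup>+a. ennreal k * (\<integral>\<^sup>+b. ennreal (Q a b) * ennreal (f a b) \<partial>lborel) \<partial>lborel)"
    unfolding Lam_def by (rule nn_integral_cmult[symmetric]) (rule Lam_integrand_measurable[OF f])
  also have "\<dots> = (\<integral>\<^sup>+a. \<integral>\<^sup>+b. ennreal k * (ennreal (Q a b) * ennreal (f a b)) \<partial>lborel \<partial>lborel)"
    by (intro nn_integral_cong nn_integral_cmult[symmetric] Lam_integrand_measurable[OF f])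
  also have "\<dots> = Lam (\<lambda>a b. k * f a b)"
    unfolding Lam_def using k by (intro nn_integral_cong) (simp add: ennreal_mult mult_ac)
  finally show ?thesis ..
qed

lemma Lam_isotropic:
  assumes c: "0 < c"
  shows "Lam (\<lambda>a b. exp (- (a\<^sup>2 + b\<^sup>2) / (2 * c\<^sup>2))) = ennreal (2 * pi * c\<^sup>2 * gaussian_energy c (0, 0))"
proof -
  let ?e = "\<lambda>a b. exp (- (a\<^sup>2 + b\<^sup>2) / (2 * c\<^sup>2))"
  define k where "k = 2 * pi * c\<^sup>2"
  have k: "0 < k" using c by (simp add: k_def)
  have "ennreal (gaussian_energy c (0, 0)) = Lam (\<lambda>a b. ?e a b / k)"
    unfolding gaussian_energy_density[OF c] nn_integral_gdens_isotropic[OF c] Lam_def k_def ..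
  then have "ennreal k * ennreal (gaussian_energy c (0, 0)) = Lam (\<lambda>a b. k * (?e a b / k))"
    using k by (subst Lam_cmult) auto
  then show ?thesis using k by (simp add: ennreal_mult'' flip: k_def ennreal_mult')
qed

text \<open>On the strip the phase is at most 1 and distances are at most \<open>Rb\<close>, so the
  test function is bounded below by the inverse of the prefactor.\<close>

lemma strips_le_gaussian_energies:
  assumes s: "0 < s"
  shows "\<psi> k s \<le> exp (1/2 + Rb\<^sup>2 / 2) * (\<Sum>w\<in>words I k. gaussian_energy 1 (\<theta> w / s, (1 - \<theta> w) / s))"
proof -
  define E where "E = exp (1/2 + Rb\<^sup>2 / 2)"
  have "measure P (strip (\<theta> w) s) \<le> E * gaussian_energy 1 (\<theta> w / s, (1 - \<theta> w) / s)" for w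
  proof -
    let ?g = "\<lambda>z. exp (- (1\<^sup>2 * (dist (fst z) (snd z))\<^sup>2 + (phase (fst (\<theta> w / s, (1 - \<theta> w) / s)) (snd (\<theta> w / s, (1 - \<theta> w) / s)) z)\<^sup>2) / 2)"
    have S: "strip (\<theta> w) s \<in> sets P" by (simp add: sets_P)
    have "measure P (strip (\<theta> w) s) = (\<integral>z. indicat_real (strip (\<theta> w) s) z \<partial>P)"
      using S by simp
    also have "\<dots> \<le> (\<integral>z. E * ?g z \<partial>P)"
    proof (rule integral_mono_AE)
      show "integrable P (indicat_real (strip (\<theta> w) s))" using S by (simp add: P.emeasure_eq_measure)
      show "integrable P (\<lambda>z. E * ?g z)"
        by (intro integrable_mult_right P.integrable_const_bound[where B = 1]) auto
      show "AE z in P. indicat_real (strip (\<theta> w) s) z \<le> E * ?g z"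
        using AE_KK
      proof eventually_elim
        case (elim z)
        show ?case
        proof (cases "z \<in> strip (\<theta> w) s")
          case True
          have ph: "phase (\<theta> w / s) ((1 - \<theta> w) / s) z = (\<theta> w * (fst z $ 1 - snd z $ 1) + (1 - \<theta> w) * (fst z $ 2 - snd z $ 2)) / s"
            by (simp add: phase_def add_divide_distrib)
          have "\<bar>phase (\<theta> w / s) ((1 - \<theta> w) / s) z\<bar> \<le> 1"
            unfolding ph using True s by (simp add: strip_def divide_le_eq)
          then have "(phase (\<theta> w / s) ((1 - \<theta> w) / s) z)\<^sup>2 \<le> 1" by (simp add: abs_square_le_1)
          moreover have "(dist (fst z) (snd z))\<^sup>2 \<le> Rb\<^sup>2" using Rb(2) elim by (intro power_mono) auto
          ultimately have "0 \<le> (1/2 + Rb\<^sup>2 / 2) + (- (1\<^sup>2 * (dist (fst z) (snd z))\<^sup>2 + (phase (fst (\<theta> w / s, (1 - \<theta> w) / s)) (snd (\<theta> w / s, (1 - \<theta> w) / s)) z)\<^sup>2) / 2)"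
            by (simp add: diff_divide_distrib)
          then have "1 \<le> E * ?g z" unfolding E_def exp_add[symmetric] by simp
          then show ?thesis using True by simp
        qed (simp add: E_def)
      qed
    qed
    also have "\<dots> = E * gaussian_energy 1 (\<theta> w / s, (1 - \<theta> w) / s)"
      unfolding gaussian_energy_def by (rule integral_mult_right_zero)
    finally show ?thesis .
  qed
  then have "\<psi> k s \<le> (\<Sum>w\<in>words I k. E * gaussian_energy 1 (\<theta> w / s, (1 - \<theta> w) / s))"
    unfolding \<psi>_def by (intro sum_mono)
  then show ?thesis by (simp add: E_def sum_distrib_left)
qed

lemma directional_density_bound:
  assumes d1: "d \<le> 1" and s: "\<kappa> ^ k \<le> s" "0 < s" and J: "1 \<le> 2 ^ J * s"
  shows "exp (- s\<^sup>2 * (a\<^sup>2 + b\<^sup>2) / 8) * (\<Sum>w\<in>words I k. exp (- ((1 - \<theta> w) * a - \<theta> w * b)\<^sup>2 / 4))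
    \<le> (128 * (8 / \<kappa>) powr d * M ^ k) * (\<Sum>i\<le>J. (2 ^ i * s) powr d * exp (- (2 ^ i * s)\<^sup>2 * (a\<^sup>2 + b\<^sup>2) / 8))"
proof -
  define N where "N = sqrt (a\<^sup>2 + b\<^sup>2)"
  have N: "0 \<le> N" "N\<^sup>2 = a\<^sup>2 + b\<^sup>2" by (simp_all add: N_def)
  define c where "c = (8 / \<kappa>) powr d"
  have c: "1 \<le> c" unfolding c_def using \<kappa> d by (intro ge_one_powr_ge_zero) (auto simp: le_divide_eq)
  define S where "S = (\<Sum>w\<in>words I k. exp (- ((1 - \<theta> w) * a - \<theta> w * b)\<^sup>2 / 4))"
  have S0: "0 \<le> S" by (simp add: S_def sum_nonneg)
  define t where "t i = (2 ^ i * s) powr d * exp (- (2 ^ i * s)\<^sup>2 * N\<^sup>2 / 8)" for i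
  have t0: "0 \<le> t i" for i by (simp add: t_def)
  have S_le: "S \<le> 32 * M ^ k * c * m powr d" if "s \<le> m" "1 \<le> m * N" for m
    unfolding S_def c_def using that s by (intro directional_gaussian_sum d1) (auto simp: N_def)
  have S_le': "S \<le> M ^ k"
  proof -
    have "S \<le> (\<Sum>w\<in>words I k. 1)" unfolding S_def by (intro sum_mono) simp
    then show ?thesis by (simp add: card_words[OF I(1)])
  qed
  have one: "t i \<le> (\<Sum>i\<le>J. t i)" if "i \<le> J" for i using that t0 by (intro member_le_sum) auto
  have e8: "exp (- x\<^sup>2 * N\<^sup>2 / 8) \<ge> 1/2" if "0 \<le> x" "x * N \<le> 1" for x
  proof -
    have "(x * N)\<^sup>2 \<le> 1" using that N by (intro power_le_one) auto
    then have "1 / 2 \<le> 1 + (- (x\<^sup>2 * N\<^sup>2) / 8)" by (simp add: power_mult_distrib mult.commute)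
    also have "\<dots> \<le> exp (- (x\<^sup>2 * N\<^sup>2) / 8)" by (rule exp_ge_add_one_self)
    finally show ?thesis by simp
  qed
  have e1: "exp (- s\<^sup>2 * N\<^sup>2 / 8) \<le> 1" by simp
  have main: "\<exists>i\<le>J. exp (- s\<^sup>2 * N\<^sup>2 / 8) * S \<le> (128 * c * M ^ k) * t i"
  proof (cases "1 \<le> s * N")
    case True
    have "exp (- s\<^sup>2 * N\<^sup>2 / 8) * S \<le> exp (- s\<^sup>2 * N\<^sup>2 / 8) * (32 * M ^ k * c * s powr d)"
      using S_le[OF order_refl True] by (intro mult_left_mono) auto
    also have "\<dots> = (32 * c * M ^ k) * t 0" by (simp add: t_def)
    also have "\<dots> \<le> (128 * c * M ^ k) * t 0" using c t0 by (intro mult_right_mono) auto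
    finally show ?thesis by blast
  next
    case False
    show ?thesis
    proof (cases "1 \<le> 2 ^ J * s * N")
      case True
      have sN: "0 < s * N" using True s N by (cases "N = 0") auto
      have "1 \<le> 2 ^ J * (s * N)" using True by (simp add: mult.assoc)
      then obtain i where i: "i < J" "2 ^ i * (s * N) < 1" "1 \<le> 2 ^ Suc i * (s * N)"
        using dyadic_shell[OF sN, of 1 J] False by (metis not_le)
      have s1: "1 * s \<le> 2 ^ Suc i * s" using s by (intro mult_right_mono one_le_power) auto
      have "exp (- s\<^sup>2 * N\<^sup>2 / 8) * S \<le> 1 * (32 * M ^ k * c * (2 ^ Suc i * s) powr d)"
        using i s1 S0 e1 by (intro mult_mono S_le) (auto simp: mult.assoc)
      also have "(2 ^ Suc i * s) powr d = 2 powr d * (2 ^ i * s) powr d"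
        using s by (simp add: mult.assoc flip: powr_mult)
      also have "1 * (32 * M ^ k * c * (2 powr d * (2 ^ i * s) powr d)) \<le> 1 * (32 * M ^ k * c * (2 * (2 ^ i * s) powr d))"
      proof -
        have "2 powr d \<le> 2 powr 1" using d1 by (intro powr_mono) auto
        then show ?thesis using c by (intro mult_left_mono mult_right_mono) auto
      qed
      also have "\<dots> = (128 * c * M ^ k) * ((2 ^ i * s) powr d * (1/2))" by simp
      also have "\<dots> \<le> (128 * c * M ^ k) * t i"
        unfolding t_def using i(2) c s by (intro mult_left_mono e8) (auto simp: mult.assoc)
      finally show ?thesis using i(1) by (intro exI[of _ i]) simp
    next
      case False
      have "exp (- s\<^sup>2 * N\<^sup>2 / 8) * S \<le> 1 * M ^ k" using e1 S_le' S0 by (intro mult_mono) auto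
      also have "\<dots> \<le> (64 * c) * M ^ k" using c M_ge_1 by (intro mult_right_mono) auto
      also have "\<dots> = (128 * c * M ^ k) * (1 * (1/2))" by simp
      also have "\<dots> \<le> (128 * c * M ^ k) * t J"
        unfolding t_def using False c s J d by (intro mult_left_mono mult_mono e8 ge_one_powr_ge_zero) (auto simp: mult.assoc)
      finally show ?thesis by blast
    qed
  qed
  then obtain i where i: "i \<le> J" "exp (- s\<^sup>2 * N\<^sup>2 / 8) * S \<le> (128 * c * M ^ k) * t i" by blast
  have "(128 * c * M ^ k) * t i \<le> (128 * c * M ^ k) * (\<Sum>i\<le>J. t i)" using c one[OF i(1)] by (intro mult_left_mono) auto
  then have "exp (- s\<^sup>2 * N\<^sup>2 / 8) * S \<le> (128 * c * M ^ k) * (\<Sum>i\<le>J. t i)" using i(2) by linarith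
  then show ?thesis unfolding S_def c_def t_def N(2) .
qed

text \<open>Summed over the directions \<open>\<theta> w\<close>, the Gaussian densities are dominated by a mixture of
  isotropic ones, by the Frostman condition for the directions; the isotropic energies are controlled
  by the correlations of \<open>\<nu>\<close>. The resulting geometric series converges because \<open>d + D > 2\<close>.\<close>

lemma gaussian_energies_le:
  assumes d1: "d \<le> 1" and C: "0 \<le> C" "\<And>r. 0 < r \<Longrightarrow> \<phi> r \<le> C * r powr D" and D: "0 \<le> D" "D \<le> 5"
    and dD: "2 < d + D"
  shows "\<exists>C'\<ge>0. \<forall>k s. \<kappa> ^ k \<le> s \<longrightarrow> s \<le> 1 \<longrightarrow>
    (\<Sum>w\<in>words I k. gaussian_energy 1 (\<theta> w / s, (1 - \<theta> w) / s)) \<le> M ^ k * (C' * s)"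
proof -
  define \<gamma> where "\<gamma> = d + D - 2"
  have \<gamma>: "0 < \<gamma>" using dD by (simp add: \<gamma>_def)
  define b0 where "b0 = 2 powr (- \<gamma>)"
  have b0: "0 < b0" "b0 < 1" using \<gamma> by (auto simp: b0_def powr_less_one)
  define K1 where "K1 = 128 * (8 / \<kappa>) powr d"
  define K2 where "K2 = 2 * pi * 4 * (27648 * C)"
  define C' where "C' = 6 * K1 * (K2 * (2 powr \<gamma> * (1 / (1 - b0))))"
  have K: "0 \<le> K1" "0 \<le> K2" using C by (auto simp: K1_def K2_def)
  have C': "0 \<le> C'" unfolding C'_def using K b0 by (intro mult_nonneg_nonneg) auto
  have "(\<Sum>w\<in>words I k. gaussian_energy 1 (\<theta> w / s, (1 - \<theta> w) / s)) \<le> M ^ k * (C' * s)"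
    if s: "\<kappa> ^ k \<le> s" "s \<le> 1" for k s
  proof -
    have s0: "0 < s" using s(1) \<kappa>(1) by (meson less_le_trans zero_less_power)
    obtain J where J: "1 \<le> 2 ^ J * s" "2 ^ J * s \<le> 2" using dyadic_multiple_near_1[OF s0 s(2)] .
    define t where "t i = 2 ^ i * s" for i :: nat
    have t0: "0 < t i" for i using s0 by (simp add: t_def)
    define h where "h w a b = 6 * s * (exp (- s\<^sup>2 * (a\<^sup>2 + b\<^sup>2) / 8) * exp (- ((1 - \<theta> w) * a - \<theta> w * b)\<^sup>2 / 4))" for w a b
    have h0: "0 \<le> h w a b" for w a b using s0 by (simp add: h_def)
    have hm: "(\<lambda>x. h w (fst x) (snd x)) \<in> borel_measurable (borel \<Otimes>\<^sub>M borel)" for w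
      unfolding h_def by measurable
    have ge0: "0 \<le> gaussian_energy c v" for c v by (simp add: gaussian_energy_def)
    have "(\<Sum>w\<in>words I k. ennreal (gaussian_energy 1 (\<theta> w / s, (1 - \<theta> w) / s))) \<le> (\<Sum>w\<in>words I k. Lam (h w))"
    proof (rule sum_mono)
      fix w assume "w \<in> words I k"
      then have "\<theta> w \<in> {0..1}" by (auto simp only: words_def intro!: \<theta>_mem)
      then have "0 \<le> \<theta> w" "\<theta> w \<le> 1" by auto
      then show "ennreal (gaussian_energy 1 (\<theta> w / s, (1 - \<theta> w) / s)) \<le> Lam (h w)"
        unfolding gaussian_energy_density[OF zero_less_one] Lam_def h_def
        by (intro nn_integral_mono mult_left_mono nn_integral_gdens_le s0 s(2)) auto
    qed
    also have "\<dots> = Lam (\<lambda>a b. \<Sum>w\<in>words I k. h w a b)"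
      by (rule Lam_sum[symmetric]) (use finite_words[OF I(1)] h0 hm in auto)
    \<comment> \<open>The sum over all directions is dominated by isotropic Gaussians of width 2 / t
      i with weights \<open>t i powr d\<close>.\<close>
    also have "\<dots> \<le> Lam (\<lambda>a b. 6 * s * K1 * M ^ k * (\<Sum>i\<le>J. t i powr d * exp (- (a\<^sup>2 + b\<^sup>2) / (2 * (2 / t i)\<^sup>2))))"
    proof (rule Lam_mono)
      fix a b
      have e: "exp (- (t i)\<^sup>2 * (a\<^sup>2 + b\<^sup>2) / 8) = exp (- (a\<^sup>2 + b\<^sup>2) / (2 * (2 / t i)\<^sup>2))" for i
        using t0[of i] by (simp add: power_divide field_simps)
      have "(\<Sum>w\<in>words I k. h w a b)
        = 6 * s * (exp (- s\<^sup>2 * (a\<^sup>2 + b\<^sup>2) / 8) * (\<Sum>w\<in>words I k. exp (- ((1 - \<theta> w) * a - \<theta> w * b)\<^sup>2 / 4)))"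
        by (simp add: h_def sum_distrib_left)
      also have "\<dots> \<le> 6 * s * ((128 * (8 / \<kappa>) powr d * M ^ k) * (\<Sum>i\<le>J. t i powr d * exp (- (t i)\<^sup>2 * (a\<^sup>2 + b\<^sup>2) / 8)))"
        unfolding t_def using s0 by (intro mult_left_mono directional_density_bound d1 s(1) s0 J(1)) auto
      also have "\<dots> = 6 * s * K1 * M ^ k * (\<Sum>i\<le>J. t i powr d * exp (- (a\<^sup>2 + b\<^sup>2) / (2 * (2 / t i)\<^sup>2)))"
        unfolding e K1_def by (simp only: mult.assoc)
      finally show "(\<Sum>w\<in>words I k. h w a b) \<le> 6 * s * K1 * M ^ k * (\<Sum>i\<le>J. t i powr d * exp (- (a\<^sup>2 + b\<^sup>2) / (2 * (2 / t i)\<^sup>2)))" .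
    qed
    also have "\<dots> = ennreal (6 * s * K1 * M ^ k) * Lam (\<lambda>a b. \<Sum>i\<le>J. t i powr d * exp (- (a\<^sup>2 + b\<^sup>2) / (2 * (2 / t i)\<^sup>2)))"
      by (rule Lam_cmult) (use K s0 in \<open>auto intro: sum_nonneg\<close>)
    also have "Lam (\<lambda>a b. \<Sum>i\<le>J. t i powr d * exp (- (a\<^sup>2 + b\<^sup>2) / (2 * (2 / t i)\<^sup>2)))
      = (\<Sum>i\<le>J. Lam (\<lambda>a b. t i powr d * exp (- (a\<^sup>2 + b\<^sup>2) / (2 * (2 / t i)\<^sup>2))))"
      by (rule Lam_sum) auto
    also have "\<dots> = (\<Sum>i\<le>J. ennreal (t i powr d * (2 * pi * (2 / t i)\<^sup>2 * gaussian_energy (2 / t i) (0, 0))))"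
    proof (rule sum.cong[OF refl])
      fix i
      have "Lam (\<lambda>a b. t i powr d * exp (- (a\<^sup>2 + b\<^sup>2) / (2 * (2 / t i)\<^sup>2)))
        = ennreal (t i powr d) * Lam (\<lambda>a b. exp (- (a\<^sup>2 + b\<^sup>2) / (2 * (2 / t i)\<^sup>2)))"
        by (rule Lam_cmult) auto
      also have "\<dots> = ennreal (t i powr d) * ennreal (2 * pi * (2 / t i)\<^sup>2 * gaussian_energy (2 / t i) (0, 0))"
        using t0 by (subst Lam_isotropic) auto
      finally show "Lam (\<lambda>a b. t i powr d * exp (- (a\<^sup>2 + b\<^sup>2) / (2 * (2 / t i)\<^sup>2)))
        = ennreal (t i powr d * (2 * pi * (2 / t i)\<^sup>2 * gaussian_energy (2 / t i) (0, 0)))"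
        using ge0 by (simp add: ennreal_mult)
    qed
    also have "\<dots> = ennreal (\<Sum>i\<le>J. t i powr d * (2 * pi * (2 / t i)\<^sup>2 * gaussian_energy (2 / t i) (0, 0)))"
      using ge0 by (intro sum_ennreal) auto
    also have "\<dots> \<le> ennreal (K2 * (2 powr \<gamma> * (1 / (1 - b0))))"
    proof (rule ennreal_leI)
      have "(\<Sum>i\<le>J. t i powr d * (2 * pi * (2 / t i)\<^sup>2 * gaussian_energy (2 / t i) (0, 0))) \<le> (\<Sum>i\<le>J. K2 * (2 powr \<gamma> * b0 ^ (J - i)))"
      proof (rule sum_mono)
        fix i assume i: "i \<in> {..J}"
        have "gaussian_energy (2 / t i) (0, 0) \<le> 27648 * C * (1 / (2 / t i)) powr D"
          using t0 by (intro gaussian_energy_isotropic_le C D) auto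
        also have "\<dots> \<le> 27648 * C * t i powr D"
          using C(1) D t0[of i] by (intro mult_left_mono powr_mono2) auto
        finally have "t i powr d * (2 * pi * (2 / t i)\<^sup>2 * gaussian_energy (2 / t i) (0, 0))
          \<le> t i powr d * (2 * pi * (2 / t i)\<^sup>2 * (27648 * C * t i powr D))"
          by (intro mult_left_mono) auto
        also have "\<dots> = K2 * (t i powr d * t i powr D / (t i)\<^sup>2)"
          by (simp add: K2_def power_divide)
        also have "t i powr d * t i powr D / (t i)\<^sup>2 = t i powr \<gamma>"
        proof -
          have "(t i)\<^sup>2 = t i powr 2" using t0[of i] by (simp add: powr_numeral)
          then show ?thesis by (simp add: \<gamma>_def powr_diff powr_add)
        qed
        \<comment> \<open>\<open>J\<close> was chosen so that the largest scale \<open>t J\<close>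
          lies between 1 and 2. With \<gamma> = d + D - 2 > 0 the terms decrease geometrically from
          there downwards, so the bound is uniform in \<open>s\<close>.\<close>
        also have "t i powr \<gamma> \<le> 2 powr \<gamma> * b0 ^ (J - i)"
        proof -
          have "2 ^ J = 2 ^ i * (2::real) ^ (J - i)" using i by (simp flip: power_add)
          then have "t i = 2 ^ J * s / 2 ^ (J - i)" by (simp add: t_def)
          also have "\<dots> \<le> 2 / 2 ^ (J - i)" using J(2) by (intro divide_right_mono) auto
          finally have "t i powr \<gamma> \<le> (2 / 2 ^ (J - i)) powr \<gamma>" using t0[of i] \<gamma> by (intro powr_mono2) auto
          also have "\<dots> = 2 powr \<gamma> * b0 ^ (J - i)"
            by (simp add: b0_def powr_divide powr_minus powr_powr power_inverse field_simps flip: powr_realpow)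
          finally show ?thesis .
        qed
        finally show "t i powr d * (2 * pi * (2 / t i)\<^sup>2 * gaussian_energy (2 / t i) (0, 0)) \<le> K2 * (2 powr \<gamma> * b0 ^ (J - i))"
          using K by (simp add: mult_left_mono)
      qed
      also have "\<dots> = K2 * (2 powr \<gamma> * (\<Sum>i\<le>J. b0 ^ (J - i)))" by (simp add: sum_distrib_left)
      also have "(\<Sum>i\<le>J. b0 ^ (J - i)) = (\<Sum>i\<le>J. b0 ^ i)"
        by (rule sum.reindex_bij_witness[of _ "\<lambda>i. J - i" "\<lambda>i. J - i"]) auto
      also have "K2 * (2 powr \<gamma> * (\<Sum>i\<le>J. b0 ^ i)) \<le> K2 * (2 powr \<gamma> * (1 / (1 - b0)))"
      proof (intro mult_left_mono)
        have "(\<Sum>i\<le>J. b0 ^ i) \<le> (\<Sum>i. b0 ^ i)" using b0 by (intro sum_le_suminf summable_geometric) auto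
        also have "\<dots> = 1 / (1 - b0)" using b0 by (intro suminf_geometric) auto
        finally show "(\<Sum>i\<le>J. b0 ^ i) \<le> 1 / (1 - b0)" .
      qed (use K in auto)
      finally show "(\<Sum>i\<le>J. t i powr d * (2 * pi * (2 / t i)\<^sup>2 * gaussian_energy (2 / t i) (0, 0))) \<le> K2 * (2 powr \<gamma> * (1 / (1 - b0)))" .
    qed
    finally have "(\<Sum>w\<in>words I k. ennreal (gaussian_energy 1 (\<theta> w / s, (1 - \<theta> w) / s)))
      \<le> ennreal (6 * s * K1 * M ^ k) * ennreal (K2 * (2 powr \<gamma> * (1 / (1 - b0))))"
      by (simp add: mult_left_mono)
    also have "\<dots> = ennreal (M ^ k * (C' * s))"
      unfolding C'_def using K s0 by (subst ennreal_mult'[symmetric]) (auto simp: mult_ac)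
    finally have "ennreal (\<Sum>w\<in>words I k. gaussian_energy 1 (\<theta> w / s, (1 - \<theta> w) / s)) \<le> ennreal (M ^ k * (C' * s))"
      using ge0 by (simp add: sum_ennreal)
    then show ?thesis using C' s0 by (subst (asm) ennreal_le_iff) auto
  qed
  then show ?thesis using C' by blast
qed

lemma correlation_fourier_step:
  assumes d1: "d \<le> 1" and C: "0 \<le> C" "\<And>r. 0 < r \<Longrightarrow> \<phi> r \<le> C * r powr D" and D: "0 \<le> D" "D \<le> 5"
    and dD: "2 < d + D" and \<rho>1: "\<rho> \<le> 1" and D2: "0 \<le> D2" and rel: "\<rho> \<le> M * q powr D2"
  shows "\<exists>C\<ge>0. \<forall>r>0. \<phi> r \<le> C * r powr D2"
proof -
  obtain C' where C': "0 \<le> C'" "\<And>k s. \<kappa> ^ k \<le> s \<Longrightarrow> s \<le> 1 \<Longrightarrow>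
    (\<Sum>w\<in>words I k. gaussian_energy 1 (\<theta> w / s, (1 - \<theta> w) / s)) \<le> M ^ k * (C' * s)"
    using gaussian_energies_le[OF d1 C D dD] by blast
  define E where "E = exp (1/2 + Rb\<^sup>2 / 2)"
  have "\<psi> k (\<rho> ^ k) \<le> M ^ k * (E * C' * (\<rho> ^ k) powr 1)" for k
  proof -
    have r0: "0 < \<rho> ^ k" using \<rho> by simp
    have "\<psi> k (\<rho> ^ k) \<le> E * (\<Sum>w\<in>words I k. gaussian_energy 1 (\<theta> w / \<rho> ^ k, (1 - \<theta> w) / \<rho> ^ k))"
      unfolding E_def by (rule strips_le_gaussian_energies[OF r0])
    also have "\<dots> \<le> E * (M ^ k * (C' * \<rho> ^ k))"
      using \<rho> \<kappa> \<rho>1 by (intro mult_left_mono C'(2) power_mono power_le_one) (auto simp: E_def)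
    finally show ?thesis using r0 by (simp add: mult_ac)
  qed
  then show ?thesis
    using C' rel \<rho> by (intro correlation_from_strips[where C = "E * C'" and \<tau> = 1] D2) (auto simp: E_def)
qed

end

section \<open>The upper bound for the box dimension\<close>

text \<open>Test the product on the preimage under \<open>B\<close> of a vector on which
  \<open>A\<close> attains its norm.\<close>

lemma sv1_mult_ge:
  assumes "det B \<noteq> 0"
  shows "sv1 A * sv2 B \<le> sv1 (A ** B)"
proof -
  obtain v where v: "v \<noteq> 0" "norm (A *v v) = sv1 A * norm v"
    using singular_vector[OF sv_in_singular_values(1)] .
  obtain B' where B': "B ** B' = mat 1"
    using assms unfolding invertible_det_nz[symmetric] invertible_def by blast
  define u where "u = B' *v v"
  have Bu: "B *v u = v" by (simp add: u_def matrix_vector_mul_assoc B')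
  then have u: "0 < norm u" using v(1) by auto
  have "(sv1 A * sv2 B) * norm u = sv1 A * (sv2 B * norm u)" by simp
  also have "\<dots> \<le> sv1 A * norm v" using norm_ge_sv2[of B u] Bu by (intro mult_left_mono sv1_nonneg) simp
  also have "\<dots> = norm ((A ** B) *v u)" using v(2) Bu by (simp flip: matrix_vector_mul_assoc)
  also have "\<dots> \<le> sv1 (A ** B) * norm u" by (rule norm_le_sv1)
  finally show ?thesis using u by simp
qed

lemma card_int_interval_le:
  fixes x :: real
  assumes "0 \<le> x"
  shows "real (card {\<lfloor>- x\<rfloor>..\<lfloor>x\<rfloor>}) \<le> 2 * x + 2"
proof -
  have "real (card {\<lfloor>- x\<rfloor>..\<lfloor>x\<rfloor>}) = real_of_int (\<lfloor>x\<rfloor> + 1 - \<lfloor>- x\<rfloor>)"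
    using floor_mono[of "- x" x] assms by simp
  also have "\<dots> \<le> 2 * x + 2" by (simp; linarith)
  finally show ?thesis .
qed

text \<open>Cut \<open>K\<close> into slabs of width \<delta> / sv1 along the unit vector u
  orthogonal to a singular vector for \<open>sv2\<close>. On a slab the image varies by at most
  \<delta> through u, and by at most 2 * R * sv2 in the other direction.\<close>

lemma affine_image_cover:
  fixes K :: "(real^2) set"
  assumes F: "\<And>x y. F x - F y = A *v (x - y)" and A: "0 < sv1 A" "sv2 A \<le> \<delta>" and \<delta>: "0 < \<delta>"
    and K: "\<And>x. x \<in> K \<Longrightarrow> norm x \<le> R" and R: "0 \<le> R"
  shows "\<exists>C. finite C \<and> F ` K \<subseteq> \<Union>C \<and> (\<forall>U\<in>C. bounded U \<and> diameter U \<le> (1 + 2 * R) * \<delta>)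
    \<and> real (card C) \<le> 2 * R * sv1 A / \<delta> + 2"
proof -
  obtain v0 where v0: "v0 \<noteq> 0" "norm (A *v v0) = sv2 A * norm v0"
    using singular_vector[OF sv_in_singular_values(2)] .
  define v where "v = (1 / norm v0) *\<^sub>R v0"
  have v: "norm v = 1" "norm (A *v v) = sv2 A"
    using v0 by (simp_all add: v_def matrix_vector_mult_scaleR)
  define u :: "real^2" where "u = vector [- v$2, v$1]"
  have u_nth: "u $ 1 = - v$2" "u $ 2 = v$1" by (simp_all add: u_def)
  have v1: "(v$1)\<^sup>2 + (v$2)\<^sup>2 = 1" using norm_vec2_sq[of v] v by simp
  have u1: "norm u = 1" using norm_vec2_sq[of u] v1 norm_ge_zero[of u] by (simp add: u_nth power2_eq_1_iff add.commute)
  have decomp: "z = (z \<bullet> u) *\<^sub>R u + (z \<bullet> v) *\<^sub>R v" for z :: "real^2"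
  proof -
    have "z$1 * 1 = (z \<bullet> u) * u$1 + (z \<bullet> v) * v$1" "z$2 * 1 = (z \<bullet> u) * u$2 + (z \<bullet> v) * v$2"
      unfolding v1[symmetric] by (simp_all add: inner_vec_def UNIV_2 u_nth power2_eq_square algebra_simps)
    then show ?thesis by (simp add: vec2_eq_iff)
  qed
  have comp: "\<bar>z \<bullet> u\<bar> \<le> norm z" "\<bar>z \<bullet> v\<bar> \<le> norm z" for z :: "real^2"
    using Cauchy_Schwarz_ineq2[of z u] Cauchy_Schwarz_ineq2[of z v] u1 v(1) by simp_all
  define g where "g z = \<lfloor>(z \<bullet> u) * (sv1 A / \<delta>)\<rfloor>" for z
  define J where "J = {\<lfloor>- (R * sv1 A / \<delta>)\<rfloor>..\<lfloor>R * sv1 A / \<delta>\<rfloor>}"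
  define U where "U j = F ` {z\<in>K. g z = j}" for j
  have gJ: "g z \<in> J" if "z \<in> K" for z
  proof -
    have "\<bar>z \<bullet> u\<bar> * (sv1 A / \<delta>) \<le> R * (sv1 A / \<delta>)"
      using comp(1)[of z] K[OF that] A \<delta> by (intro mult_right_mono) auto
    then have "\<bar>(z \<bullet> u) * (sv1 A / \<delta>)\<bar> \<le> R * sv1 A / \<delta>" using A \<delta> by (simp add: abs_mult)
    then show ?thesis by (auto simp only: g_def J_def atLeastAtMost_iff intro!: floor_mono)
  qed
  have dist_le: "dist x y \<le> (1 + 2 * R) * \<delta>" if xy: "x \<in> U j" "y \<in> U j" for x y j
  proof -
    obtain z z' where z: "z \<in> K" "z' \<in> K" "g z = j" "g z' = j" "x = F z" "y = F z'"
      using xy by (auto simp: U_def)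
    define h where "h = z - z'"
    have "\<bar>(z \<bullet> u) * (sv1 A / \<delta>) - (z' \<bullet> u) * (sv1 A / \<delta>)\<bar> \<le> 1"
      using z(3,4) unfolding g_def by linarith
    then have "\<bar>(h \<bullet> u) * (sv1 A / \<delta>)\<bar> \<le> 1" unfolding h_def inner_diff_left left_diff_distrib .
    then have hu: "\<bar>h \<bullet> u\<bar> * sv1 A \<le> \<delta>" using A(1) \<delta> by (simp add: abs_mult field_simps)
    have "norm h \<le> R + R" unfolding h_def using K[OF z(1)] K[OF z(2)] norm_triangle_ineq4[of z z'] by linarith
    then have hv: "\<bar>h \<bullet> v\<bar> \<le> 2 * R" using comp(2)[of h] by linarith
    have "dist x y = norm (A *v h)" unfolding z(5,6) dist_norm F h_def ..
    also have "A *v h = (h \<bullet> u) *\<^sub>R (A *v u) + (h \<bullet> v) *\<^sub>R (A *v v)"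
      by (subst decomp[of h]) (simp add: matrix_vector_right_distrib matrix_vector_mult_scaleR)
    also have "norm \<dots> \<le> \<bar>h \<bullet> u\<bar> * norm (A *v u) + \<bar>h \<bullet> v\<bar> * norm (A *v v)"
      by (rule order_trans[OF norm_triangle_ineq]) simp
    also have "\<dots> \<le> \<bar>h \<bullet> u\<bar> * sv1 A + (2 * R) * \<delta>"
      using norm_le_sv1[of A u] u1 v A hv R by (intro add_mono mult_mono) (auto simp: sv2_nonneg)
    also have "\<dots> \<le> (1 + 2 * R) * \<delta>" using hu by (simp add: algebra_simps)
    finally show ?thesis .
  qed
  have "bounded (U j)" for j
  proof (cases "U j = {}")
    case False
    then obtain x where "x \<in> U j" by blast
    then show ?thesis using dist_le unfolding bounded_def by blast
  qed simp
  moreover have "diameter (U j) \<le> (1 + 2 * R) * \<delta>" for j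
    by (rule diameter_le_dist) (use R \<delta> dist_le in auto)
  moreover have "F ` K \<subseteq> \<Union>(U ` J)" using gJ by (auto simp: U_def)
  moreover have "real (card (U ` J)) \<le> 2 * R * sv1 A / \<delta> + 2"
  proof -
    have "real (card (U ` J)) \<le> real (card J)" unfolding of_nat_le_iff J_def by (rule card_image_le) simp
    also have "\<dots> \<le> 2 * (R * sv1 A / \<delta>) + 2" unfolding J_def using A \<delta> R by (intro card_int_interval_le) auto
    finally show ?thesis by simp
  qed
  moreover have "finite (U ` J)" by (simp add: J_def)
  ultimately show ?thesis by blast
qed

context
  fixes A :: "real^2^2^'n::finite" and t :: "real^2^'n"
  assumes nonsing: "\<And>i. det (A $ i) \<noteq> 0" and contr: "\<And>i. sv1 (A $ i) < 1"
begin

lemma attractor_word_cover: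
  assumes "x \<in> attractor (affine_ifs A t)"
  shows "\<exists>w. length w = n \<and> x \<in> word_map A t w ` attractor (affine_ifs A t)"
  using assms
proof (induction n arbitrary: x)
  case 0
  then show ?case by (intro exI[of _ "[]"]) simp
next
  case (Suc n)
  obtain i y where y: "y \<in> attractor (affine_ifs A t)" "x = affine_ifs A t i y"
    using Suc.prems attractor_props(3)[OF nonsing contr] by blast
  obtain w z where "length w = n" "z \<in> attractor (affine_ifs A t)" "y = word_map A t w z"
    using Suc.IH[OF y(1)] by blast
  then show ?case using y(2) by (intro exI[of _ "i # w"]) auto
qed

text \<open>The function \<open>g\<close> abstracts over the singular value used to stop: the larger
  one below dimension 1, the smaller one otherwise. The stopped words may simply be counted among
  all words, since the series of the sums converges.\<close>

lemma upper_box_dim_attractor_stopping: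
  fixes g :: "'n list \<Rightarrow> real"
  assumes s: "0 \<le> s" "summable (svsum A s)" and l: "0 < l" "l < 1" and c0: "0 < c0" and C0: "0 \<le> C0"
    and g_upper: "\<And>w. g w \<le> l ^ length w" and g_step: "\<And>w i. b * g w \<le> g (w @ [i])" and b: "0 < b"
    and g0: "1 \<le> g []"
    and cover: "\<And>w \<delta>. 0 < \<delta> \<Longrightarrow> \<delta> < 1 \<Longrightarrow> g w \<le> \<delta> \<Longrightarrow> b * \<delta> \<le> g w \<Longrightarrow>
      \<exists>C. finite C \<and> word_map A t w ` attractor (affine_ifs A t) \<subseteq> \<Union>C \<and>
        (\<forall>U\<in>C. bounded U \<and> diameter U \<le> c0 * \<delta>) \<and> real (card C) \<le> C0 * \<delta> powr (- s) * svf s (word_product A w)"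
  shows "upper_box_dim (attractor (affine_ifs A t)) \<le> ereal s"
proof -
  define K where "K = attractor (affine_ifs A t)"
  note K = attractor_props[OF nonsing contr, of t, folded K_def]
  define \<Sigma> where "\<Sigma> = (\<Sum>n. svsum A s n)"
  have svs: "0 \<le> svsum A s n" for n using svsum_pos[OF nonsing contr, of s n] by simp
  have \<Sigma>: "0 \<le> \<Sigma>" unfolding \<Sigma>_def by (rule suminf_nonneg[OF s(2) svs])
  have count: "real (covering_number (c0 * \<delta>) K) \<le> (C0 * \<Sigma>) * \<delta> powr (- s)" if \<delta>: "0 < \<delta>" "\<delta> < 1" for \<delta>
  proof -
    obtain n where n: "l ^ n < \<delta>" using real_arch_pow_inv[OF \<delta>(1) l(2)] by blast
    define T where "T = {w. length w \<le> n \<and> g w \<le> \<delta> \<and> b * \<delta> \<le> g w}"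
    have finT: "finite T"
      by (rule finite_subset[OF _ finite_lists_length_le[of UNIV n]]) (auto simp: T_def)
    have KT: "\<exists>w\<in>T. x \<in> word_map A t w ` K" if x: "x \<in> K" for x
    proof -
      obtain w z where w: "length w = n" "z \<in> K" "x = word_map A t w z"
        using attractor_word_cover[of x n] x by (auto simp: K_def)
      \<comment> \<open>The shortest prefix at which \<open>g\<close> has dropped to \<delta>. It is
        nonempty by \<open>g0\<close>, and by \<open>g_step\<close> the last letter cannot have
        pushed \<open>g\<close> below b * \<delta>.\<close>
      define k where "k = (LEAST k. g (take k w) \<le> \<delta>)"
      have ex: "g (take n w) \<le> \<delta>" using g_upper[of w] n w(1) by simp
      have k1: "g (take k w) \<le> \<delta>" and k2: "k \<le> n" unfolding k_def
        by (rule LeastI[of "\<lambda>k. g (take k w) \<le> \<delta>", OF ex], rule Least_le[of "\<lambda>k. g (take k w) \<le> \<delta>", OF ex])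
      have "k \<noteq> 0" using k1 g0 \<delta> by (intro notI) simp
      then obtain j where j: "k = Suc j" by (cases k) auto
      have "\<not> g (take j w) \<le> \<delta>" unfolding k_def using not_less_Least[of j "\<lambda>k. g (take k w) \<le> \<delta>"] j k_def by simp
      then have "b * \<delta> \<le> b * g (take j w)" using b by simp
      also have "\<dots> \<le> g (take j w @ [w ! j])" by (rule g_step)
      also have "take j w @ [w ! j] = take k w" using j k2 w(1) by (simp add: take_Suc_conv_app_nth)
      finally have "take k w \<in> T" using k1 k2 w(1) by (simp add: T_def)
      moreover have "x = word_map A t (take k w) (word_map A t (drop k w) z)"
        unfolding w(3) by (simp flip: word_map_append)
      moreover have "word_map A t (drop k w) z \<in> K"
        using w(2) unfolding K_def by (rule word_map_attractor[OF nonsing contr])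
      ultimately show ?thesis by blast
    qed
    have "\<forall>w\<in>T. \<exists>C. finite C \<and> word_map A t w ` K \<subseteq> \<Union>C \<and> (\<forall>U\<in>C. bounded U \<and> diameter U \<le> c0 * \<delta>)
        \<and> real (card C) \<le> C0 * \<delta> powr (- s) * svf s (word_product A w)"
      unfolding K_def T_def using cover[OF \<delta>] by blast
    then obtain C where C: "\<And>w. w \<in> T \<Longrightarrow> finite (C w)" "\<And>w. w \<in> T \<Longrightarrow> word_map A t w ` K \<subseteq> \<Union>(C w)"
      "\<And>w U. w \<in> T \<Longrightarrow> U \<in> C w \<Longrightarrow> bounded U \<and> diameter U \<le> c0 * \<delta>"
      "\<And>w. w \<in> T \<Longrightarrow> real (card (C w)) \<le> C0 * \<delta> powr (- s) * svf s (word_product A w)"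
      by metis
    have "real (covering_number (c0 * \<delta>) K) \<le> real (card (\<Union>(C ` T)))"
      unfolding of_nat_le_iff
    proof (rule covering_number_le)
      show "finite (\<Union>(C ` T))" using finT C(1) by blast
      show "K \<subseteq> \<Union>(\<Union>(C ` T))"
      proof
        fix x assume "x \<in> K"
        then obtain w where "w \<in> T" "x \<in> word_map A t w ` K" using KT by blast
        then show "x \<in> \<Union>(\<Union>(C ` T))" using C(2)[of w] by blast
      qed
      show "bounded U \<and> diameter U \<le> c0 * \<delta>" if "U \<in> \<Union>(C ` T)" for U
        using that C(3) by blast
    qed
    also have "\<dots> \<le> (\<Sum>w\<in>T. real (card (C w)))"
      using card_UN_le[OF finT, of C] by (metis of_nat_mono of_nat_sum)
    also have "\<dots> \<le> (\<Sum>w\<in>T. C0 * \<delta> powr (- s) * svf s (word_product A w))"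
      by (intro sum_mono C(4))
    also have "\<dots> = C0 * \<delta> powr (- s) * (\<Sum>w\<in>T. svf s (word_product A w))" by (simp add: sum_distrib_left)
    also have "\<dots> \<le> C0 * \<delta> powr (- s) * \<Sigma>"
    proof (intro mult_left_mono)
      have "(\<Sum>w\<in>T. svf s (word_product A w)) \<le> (\<Sum>w\<in>(\<Union>k\<in>{..n}. words UNIV k). svf s (word_product A w))"
        by (intro sum_mono2) (auto simp: T_def words_UNIV finite_words[unfolded words_UNIV] less_imp_le svf_pos det_word_product nonsing
            intro: finite_words[of UNIV, unfolded words_UNIV, simplified])
      also have "\<dots> = (\<Sum>k\<le>n. svsum A s k)"
        unfolding svsum_def by (intro sum.UNION_disjoint) (auto simp: words_UNIV intro: finite_words[of UNIV, unfolded words_UNIV, simplified])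
      also have "\<dots> \<le> \<Sigma>" unfolding \<Sigma>_def using svs by (intro sum_le_suminf s(2)) auto
      finally show "(\<Sum>w\<in>T. svf s (word_product A w)) \<le> \<Sigma>" .
    qed (use C0 in auto)
    finally show ?thesis by (simp add: mult_ac)
  qed
  have "upper_box_dim K \<le> ereal s"
  proof (rule upper_box_dim_le[OF K(2,1)])
    define C' where "C' = C0 * \<Sigma> * c0 powr s + 1"
    show "0 < C'" unfolding C'_def using C0 \<Sigma> c0 by (intro add_nonneg_pos mult_nonneg_nonneg) auto
    show "0 < c0" by (rule c0)
    fix \<delta> assume \<delta>: "0 < \<delta>" "\<delta> < c0"
    have "real (covering_number (c0 * (\<delta> / c0)) K) \<le> (C0 * \<Sigma>) * (\<delta> / c0) powr (- s)"
      using \<delta> c0 by (intro count) auto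
    also have "\<dots> = (C0 * \<Sigma> * c0 powr s) * \<delta> powr (- s)"
      using \<delta> c0 by (simp add: powr_divide powr_minus field_simps)
    also have "\<dots> \<le> C' * \<delta> powr (- s)" unfolding C'_def by (intro mult_right_mono) auto
    finally show "real (covering_number \<delta> K) \<le> C' * \<delta> powr (- s)" using c0 by simp
  qed
  then show ?thesis unfolding K_def .
qed

lemma upper_box_dim_attractor_le:
  assumes N: "CARD('n) \<ge> 2"
  shows "upper_box_dim (attractor (affine_ifs A t)) \<le> ereal (affinity_dim A)"
proof (rule ereal_le_epsilon2)
  fix e :: real assume e: "0 < e"
  define K where "K = attractor (affine_ifs A t)"
  note K = attractor_props[OF nonsing contr, of t, folded K_def]
  obtain R where R: "\<And>x. x \<in> K \<Longrightarrow> norm x \<le> R" "0 < R"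
    using compact_imp_bounded[OF K(2)] unfolding bounded_pos by blast
  obtain l where l: "0 < l" "l < 1" "\<And>w. sv1 (word_product A w) \<le> l ^ length w" using sv1_uniform[OF nonsing contr] by blast
  obtain b where b: "0 < b" "b < 1" "\<And>w. b ^ length w \<le> sv2 (word_product A w)" using sv2_uniform[OF nonsing contr] by blast
  have b1: "b \<le> sv2 (A $ i)" for i using b(3)[of "[i]"] by simp
  have det: "det (word_product A w) \<noteq> 0" for w by (rule det_word_product) (rule nonsing)
  have s0: "0 < affinity_dim A" by (rule affinity_dim_props(1)[OF nonsing contr N])
  have dec: "summable (svsum A s)" if "affinity_dim A < s" for s
    using svsum_decay[OF nonsing contr N that] by (simp add: eta_contract_eq)
  have snoc: "word_product A (w @ [i]) = word_product A w ** A $ i" for w i by (simp add: word_product_append)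
  show "upper_box_dim (attractor (affine_ifs A t)) \<le> ereal (affinity_dim A) + ereal e"
  proof (cases "affinity_dim A < 1")
    case True
    \<comment> \<open>Capped at 1, so that the singular value function is still a pure power of
      \<open>sv1\<close> and one set per stopped word suffices.\<close>
    define s where "s = min 1 (affinity_dim A + e)"
    have s: "0 < s" "s \<le> 1" "affinity_dim A < s" "s \<le> affinity_dim A + e" using s0 True e by (auto simp: s_def)
    have "upper_box_dim (attractor (affine_ifs A t)) \<le> ereal s"
    proof (rule upper_box_dim_attractor_stopping[where g = "\<lambda>w. sv1 (word_product A w)" and b = b and l = l
          and ?c0.0 = "2 * R" and ?C0.0 = "b powr (- s)"])
      show "b * sv1 (word_product A w) \<le> sv1 (word_product A (w @ [i]))" for w i
      proof -
        have "b * sv1 (word_product A w) \<le> sv1 (word_product A w) * sv2 (A $ i)"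
          unfolding mult.commute[of b] by (intro mult_left_mono b1 sv1_nonneg)
        also have "\<dots> \<le> sv1 (word_product A (w @ [i]))" unfolding snoc by (intro sv1_mult_ge nonsing)
        finally show ?thesis .
      qed
      fix w \<delta> assume \<delta>: "0 < \<delta>" "sv1 (word_product A w) \<le> \<delta>" "b * \<delta> \<le> sv1 (word_product A w)"
      have d: "dist x y \<le> 2 * R * \<delta>" if "x \<in> word_map A t w ` K" "y \<in> word_map A t w ` K" for x y
      proof -
        obtain x' y' where xy: "x' \<in> K" "y' \<in> K" "x = word_map A t w x'" "y = word_map A t w y'" using \<open>x \<in> _\<close> \<open>y \<in> _\<close> by blast
        have "norm (x' - y') \<le> 2 * R" using R(1)[OF xy(1)] R(1)[OF xy(2)] norm_triangle_ineq4[of x' y'] by linarith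
        then have "sv1 (word_product A w) * norm (x' - y') \<le> \<delta> * (2 * R)" using \<delta> by (intro mult_mono) auto
        then show ?thesis
          using norm_le_sv1[of "word_product A w" "x' - y'"] unfolding xy(3,4) dist_word_map by (simp add: mult_ac)
      qed
      show "\<exists>C. finite C \<and> word_map A t w ` attractor (affine_ifs A t) \<subseteq> \<Union> C \<and>
          (\<forall>U\<in>C. bounded U \<and> diameter U \<le> 2 * R * \<delta>) \<and>
          real (card C) \<le> b powr - s * \<delta> powr - s * svf s (word_product A w)"
      proof (intro exI[of _ "{word_map A t w ` attractor (affine_ifs A t)}"] conjI ballI)
        fix U assume "U \<in> {word_map A t w ` attractor (affine_ifs A t)}"
        then have U: "U = word_map A t w ` K" by (simp add: K_def)
        obtain z where "z \<in> U" using U K(1) by blast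
        then show "bounded U" using d unfolding bounded_def U by blast
        show "diameter U \<le> 2 * R * \<delta>" by (rule diameter_le_dist) (use R \<delta> d U in auto)
      next
        have "(b * \<delta>) powr s \<le> svf s (word_product A w)"
          unfolding svf_def using s \<delta> b by (auto intro!: powr_mono2)
        then show "real (card {word_map A t w ` attractor (affine_ifs A t)}) \<le> b powr - s * \<delta> powr - s * svf s (word_product A w)"
          using b \<delta> by (simp add: powr_mult powr_minus field_simps)
      qed auto
    qed (use s dec l b R in \<open>auto simp: sv_mat1\<close>)
    also have "\<dots> \<le> ereal (affinity_dim A) + ereal e" using s by simp
    finally show ?thesis .
  next
    case False
    define s where "s = affinity_dim A + e"
    have s: "1 < s" "affinity_dim A < s" using False e by (auto simp: s_def)
    \<comment> \<open>The number of slabs needs the middle form of the singular value function.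
      Above 2 the actual function is even larger, because exponent is moved from \<open>sv2\<close>
      to \<open>sv1\<close>.\<close>
    have svf_ge: "sv1 (word_product A w) * sv2 (word_product A w) powr (s - 1) \<le> svf s (word_product A w)" for w
    proof (cases "s \<le> 2")
      case False
      let ?a = "sv1 (word_product A w)" and ?c = "sv2 (word_product A w)"
      have pos: "0 < ?a" "0 < ?c" using sv1_pos sv2_pos det by blast+
      have "?a * ?c powr (s - 1) = ?a * (?c powr (s / 2) * ?c powr (s / 2 - 1))" by (simp flip: powr_add)
      also have "\<dots> \<le> ?a * (?c powr (s / 2) * ?a powr (s / 2 - 1))"
        using False pos sv2_le_sv1 by (intro mult_left_mono powr_mono2) auto
      also have "\<dots> = ?c powr (s / 2) * (?a powr 1 * ?a powr (s / 2 - 1))" using pos by simp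
      also have "?a powr 1 * ?a powr (s / 2 - 1) = ?a powr (s / 2)" unfolding powr_add[symmetric] by simp
      finally show ?thesis using s False pos by (simp add: svf_def powr_mult mult.commute)
    qed (use s in \<open>simp add: svf_def\<close>)
    have "upper_box_dim (attractor (affine_ifs A t)) \<le> ereal s"
    proof (rule upper_box_dim_attractor_stopping[where g = "\<lambda>w. sv2 (word_product A w)" and b = b and l = l
          and ?c0.0 = "1 + 2 * R" and ?C0.0 = "(2 * R + 2 / b) * b powr (1 - s)"])
      show "sv2 (word_product A w) \<le> l ^ length w" for w
        using sv2_le_sv1[of "word_product A w"] l(3)[of w] by linarith
      show "b * sv2 (word_product A w) \<le> sv2 (word_product A (w @ [i]))" for w i
      proof -
        have "b * sv2 (word_product A w) \<le> sv2 (word_product A w) * sv2 (A $ i)"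
          unfolding mult.commute[of b] by (intro mult_left_mono b1 sv2_nonneg)
        also have "\<dots> \<le> sv2 (word_product A (w @ [i]))" unfolding snoc by (rule sv2_mult)
        finally show ?thesis .
      qed
      fix w \<delta> assume \<delta>: "0 < \<delta>" "sv2 (word_product A w) \<le> \<delta>" "b * \<delta> \<le> sv2 (word_product A w)"
      let ?a = "sv1 (word_product A w)" and ?c = "sv2 (word_product A w)"
      have a: "0 < ?a" using sv1_pos det by blast
      obtain C where C: "finite C" "word_map A t w ` K \<subseteq> \<Union>C" "\<forall>U\<in>C. bounded U \<and> diameter U \<le> (1 + 2 * R) * \<delta>"
        "real (card C) \<le> 2 * R * ?a / \<delta> + 2"
        using affine_image_cover[OF word_map_diff a \<delta>(2,1) R(1)] R(2) by (metis less_imp_le)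
      \<comment> \<open>Stopping gives sv1 \<ge> sv2 \<ge> b * \<delta>, so the additive 2 in the
        number of slabs is absorbed by the main term.\<close>
      have "2 \<le> 2 / b * ?a / \<delta>"
        using \<delta> b sv2_le_sv1[of "word_product A w"] by (simp add: field_simps)
      then have "real (card C) \<le> (2 * R + 2 / b) * (?a / \<delta>)" using C(4) by (simp add: algebra_simps)
      also have "\<dots> \<le> (2 * R + 2 / b) * (b powr (1 - s) * \<delta> powr (- s) * svf s (word_product A w))"
      proof (intro mult_left_mono)
        have "?a * (b * \<delta>) powr (s - 1) \<le> ?a * ?c powr (s - 1)"
          using a b \<delta> s by (intro mult_left_mono powr_mono2) auto
        then have "?a * (b * \<delta>) powr (s - 1) \<le> svf s (word_product A w)" using svf_ge[of w] by linarith
        then have "?a / \<delta> * ((b * \<delta>) powr (s - 1) * (b powr (1 - s) * \<delta> powr (1 - s)))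
          \<le> svf s (word_product A w) / \<delta> * (b powr (1 - s) * \<delta> powr (1 - s))"
          using \<delta> by (subst mult.assoc[symmetric], intro mult_right_mono) (auto simp: divide_right_mono)
        also have "(b * \<delta>) powr (s - 1) * (b powr (1 - s) * \<delta> powr (1 - s)) = 1"
          using b \<delta> by (simp add: powr_mult flip: powr_mult powr_add)
        also have "svf s (word_product A w) / \<delta> * (b powr (1 - s) * \<delta> powr (1 - s))
          = b powr (1 - s) * \<delta> powr (- s) * svf s (word_product A w)"
          using \<delta> powr_diff[of \<delta> "1 - s" 1] by simp
        finally show "?a / \<delta> \<le> b powr (1 - s) * \<delta> powr (- s) * svf s (word_product A w)" by simp
      qed (use R b in auto)
      finally show "\<exists>C. finite C \<and> word_map A t w ` attractor (affine_ifs A t) \<subseteq> \<Union> C \<and>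
          (\<forall>U\<in>C. bounded U \<and> diameter U \<le> (1 + 2 * R) * \<delta>) \<and>
          real (card C) \<le> (2 * R + 2 / b) * b powr (1 - s) * \<delta> powr - s * svf s (word_product A w)"
        using C(1-3) unfolding K_def by (intro exI[of _ C] conjI) (auto simp: mult_ac)
    qed (use s dec l b R in \<open>auto simp: sv_mat1\<close>)
    then show ?thesis by (simp add: s_def)
  qed
qed

end

section \<open>Word classes and the lower bound\<close>

lemma set_M_props:
  assumes "A \<in> set_M"
  shows "A \<in> psgn" "det A \<noteq> 0" "\<bar>det A\<bar> < 1/2 * (min_row_sum A)\<^sup>2" "sv1 A < 1"
proof -
  show psgn: "A \<in> psgn" and "det A \<noteq> 0" and "sv1 A < 1"
    using assms by (auto simp: set_M_def psgn_def op_norm_eq_sv1)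
  have "\<bar>det A\<bar> / (min_row_sum A)\<^sup>2 < 1 / 2" using assms by (simp add: set_M_def)
  then show "\<bar>det A\<bar> < 1/2 * (min_row_sum A)\<^sup>2" using min_row_sum_pos[OF psgn] by (simp add: divide_less_eq)
qed

text \<open>The norm of the inverse is 1 / sv2, so the defining inequality of \<open>set_N\<close>
  compares the square of the larger singular value with the smaller one. In this form it passes to
  products.\<close>

lemma set_N_sv2_ge:
  assumes "A \<in> set_N"
  shows "(sv1 A)\<^sup>2 \<le> sv2 A"
proof (rule sv2_ge_if)
  fix z :: "real^2"
  have A: "A \<in> set_M" and le: "sv1 (matrix_inv A) * (sv1 A)\<^sup>2 \<le> 1"
    using assms by (auto simp: set_N_def op_norm_eq_sv1)
  have "invertible A" using set_M_props(2)[OF A] by (simp add: invertible_det_nz)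
  then have "matrix_inv A ** A = mat 1"
    unfolding invertible_def matrix_inv_def by (rule someI2_ex) blast
  then have "z = matrix_inv A *v (A *v z)" by (simp add: matrix_vector_mul_assoc)
  then have "norm z \<le> sv1 (matrix_inv A) * norm (A *v z)" using norm_le_sv1[of "matrix_inv A" "A *v z"] by simp
  then have "(sv1 A)\<^sup>2 * norm z \<le> (sv1 A)\<^sup>2 * (sv1 (matrix_inv A) * norm (A *v z))" by (intro mult_left_mono) auto
  also have "\<dots> = (sv1 (matrix_inv A) * (sv1 A)\<^sup>2) * norm (A *v z)" by simp
  also have "\<dots> \<le> 1 * norm (A *v z)" using le by (intro mult_right_mono) auto
  finally show "(sv1 A)\<^sup>2 * norm z \<le> norm (A *v z)" by simp
qed

lemma sv2_ge_sv1_square_word: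
  assumes "\<And>i. (sv1 (A $ i))\<^sup>2 \<le> sv2 (A $ i)"
  shows "(sv1 (word_product A w))\<^sup>2 \<le> sv2 (word_product A w)"
proof (induction w)
  case (Cons i w)
  have "(sv1 (word_product A (i # w)))\<^sup>2 \<le> (sv1 (A $ i) * sv1 (word_product A w))\<^sup>2"
    by (intro power_mono) (simp_all add: sv1_mult sv1_nonneg)
  also have "\<dots> \<le> sv2 (A $ i) * sv2 (word_product A w)"
    unfolding power_mult_distrib by (intro mult_mono assms Cons.IH) (auto simp: sv2_nonneg)
  also have "\<dots> \<le> sv2 (word_product A (i # w))" by (simp add: sv2_mult)
  finally show ?case .
qed (simp add: sv_mat1)

text \<open>The first letter mixes both rows of the remaining product with weights bounded below, so
  each row sum of the whole controls the sum of all entries, hence the norm. This excludes products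
  with one short row.\<close>

lemma word_product_min_row_sum_ge_sv1:
  fixes A :: "real^2^2^'n::finite"
  assumes psgn: "\<And>i. A $ i \<in> psgn" and contr: "\<And>i. sv1 (A $ i) < 1"
  obtains c where "0 < c" "\<And>w. w \<noteq> [] \<Longrightarrow> c * sv1 (word_product A w) \<le> min_row_sum (word_product A w)"
proof -
  define S where "S = range (\<lambda>(i, j, k). \<bar>A $ i $ j $ k\<bar>)"
  have S: "finite S" "S \<noteq> {}" by (auto simp: S_def)
  define c where "c = Min S"
  have "x > 0" if "x \<in> S" for x using that psgn_nonzero[OF psgn] by (auto simp: S_def)
  then have c0: "0 < c" unfolding c_def using S by simp
  have c: "c \<le> \<bar>A $ i $ j $ k\<bar>" for i j k unfolding c_def S_def by (intro Min_le image_eqI[of _ _ "(i, j, k)"]) auto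
  have "c * sv1 (word_product A w) \<le> min_row_sum (word_product A w)" if ne: "w \<noteq> []" for w
  proof -
    obtain i u where w: "w = i # u" using ne by (cases w) auto
    show ?thesis
    proof (cases "u = []")
      case True
      have "c * sv1 (A $ i) \<le> c * 1" using contr[of i] c0 by (intro mult_left_mono) auto
      also have "c * 1 \<le> min_row_sum (A $ i)"
        using c[of i 1 1] c[of i 2 1] by (auto simp: min_row_sum_def intro: add_increasing2)
      finally show ?thesis by (simp add: w True)
    next
      case False
      let ?B = "word_product A u"
      have B: "?B \<in> psgn" using word_product_psgn[OF psgn False] .
      have "sv1 (A $ i ** ?B) \<le> sv1 (A $ i) * sv1 ?B" by (rule sv1_mult)
      also have "\<dots> \<le> 1 * sv1 ?B" using contr[of i] by (intro mult_right_mono sv1_nonneg) auto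
      also have "\<dots> \<le> rsum ?B 1 + rsum ?B 2" using sv1_le_row_sums[of ?B] by (simp add: rsum_def)
      finally have "c * sv1 (A $ i ** ?B) \<le> c * (rsum ?B 1 + rsum ?B 2)" using c0 by (intro mult_left_mono) auto
      also have "\<dots> \<le> rsum (A $ i ** ?B) k" for k
        unfolding rsum_mult[OF psgn B] distrib_left
        using rsum_pos[OF B] by (intro add_mono mult_right_mono c) (auto intro: less_imp_le)
      finally have "c * sv1 (A $ i ** ?B) \<le> rsum (A $ i ** ?B) k" for k .
      then show ?thesis by (simp add: w min_row_sum_rsum)
    qed
  qed
  then show thesis using that c0 by blast
qed

text \<open>The determinant is multiplicative and the minimal row sum supermultiplicative; so the
  ratio that bounds the contraction of directions is submultiplicative.\<close>

lemma word_product_det_le: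
  fixes A :: "real^2^2^'n::finite"
  assumes psgn: "\<And>i. A $ i \<in> psgn" and c: "\<And>i. \<bar>det (A $ i)\<bar> \<le> c * (min_row_sum (A $ i))\<^sup>2" and c0: "0 \<le> c"
  shows "w \<noteq> [] \<Longrightarrow> \<bar>det (word_product A w)\<bar> \<le> c ^ length w * (min_row_sum (word_product A w))\<^sup>2"
proof (induction w)
  case (Cons i w)
  show ?case
  proof (cases "w = []")
    case True
    then show ?thesis using c[of i] by simp
  next
    case False
    let ?B = "word_product A w"
    have B: "?B \<in> psgn" using word_product_psgn[OF psgn False] .
    have "\<bar>det (A $ i ** ?B)\<bar> = \<bar>det (A $ i)\<bar> * \<bar>det ?B\<bar>" by (simp add: det_mul abs_mult)
    also have "\<dots> \<le> (c * (min_row_sum (A $ i))\<^sup>2) * (c ^ length w * (min_row_sum ?B)\<^sup>2)"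
      using c Cons.IH[OF False] c0 by (intro mult_mono) auto
    also have "\<dots> = c ^ length (i # w) * (min_row_sum (A $ i) * min_row_sum ?B)\<^sup>2" by (simp add: power_mult_distrib)
    also have "\<dots> \<le> c ^ length (i # w) * (min_row_sum (A $ i ** ?B))\<^sup>2"
      using c0 min_row_sum_pos[OF psgn] min_row_sum_pos[OF B]
      by (intro mult_left_mono power_mono min_row_sum_mult psgn B) (auto intro: less_imp_le)
    finally show ?thesis by simp
  qed
qed simp

lemma concat_words_nonempty:
  assumes "w \<in> words \<Gamma> m" "0 < m" "\<And>\<gamma>. \<gamma> \<in> \<Gamma> \<Longrightarrow> length \<gamma> = n" "0 < n"
  shows "concat w \<noteq> []"
proof -
  obtain \<gamma> v where "w = \<gamma> # v" "\<gamma> \<in> \<Gamma>" using assms(1,2) by (cases w) (auto simp: words_def)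
  then show ?thesis using assms(3)[of \<gamma>] assms(4) by auto
qed

lemma words_concat_inj:
  assumes "w \<in> words \<Gamma> m" "w' \<in> words \<Gamma> m" "\<And>\<gamma>. \<gamma> \<in> \<Gamma> \<Longrightarrow> length \<gamma> = n" "concat w = concat w'"
  shows "w = w'"
proof (rule concat_injective[OF assms(4)])
  show "length w = length w'" using assms(1,2) by (simp add: words_def)
  show "\<forall>(x, y)\<in>set (zip w w'). length x = length y"
  proof clarify
    fix x y assume "(x, y) \<in> set (zip w w')"
    then have "x \<in> \<Gamma>" "y \<in> \<Gamma>" using assms(1,2) by (auto simp: words_def dest: set_zip_leftD set_zip_rightD)
    then show "length x = length y" using assms(3) by simp
  qed
qed

lemma concat_words_length:
  assumes "w \<in> words \<Gamma> m" "\<And>\<gamma>. \<gamma> \<in> \<Gamma> \<Longrightarrow> length \<gamma> = n"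
  shows "length (concat w) = n * m"
  using assms(1)
proof (induction m arbitrary: w)
  case (Suc m)
  then obtain \<gamma> v where v: "w = \<gamma> # v" "\<gamma> \<in> \<Gamma>" "v \<in> words \<Gamma> m" by (cases w) (auto simp: words_def)
  then show ?case using Suc.IH[OF v(3)] assms(2)[OF v(2)] by simp
qed (simp add: words_def)

lemma word_product_concat_bounds:
  fixes A :: "real^2^2^'n::finite" and \<Gamma> :: "'n list set"
  assumes psgn: "\<And>i. A $ i \<in> psgn" and \<Gamma>: "\<And>\<gamma>. \<gamma> \<in> \<Gamma> \<Longrightarrow> length \<gamma> = n" "0 < n" and w: "w \<in> words \<Gamma> m"
  shows min_row_sum_concat: "0 \<le> p \<Longrightarrow> (\<And>\<gamma>. \<gamma> \<in> \<Gamma> \<Longrightarrow> p \<le> min_row_sum (word_product A \<gamma>)) \<Longrightarrow> p ^ m \<le> min_row_sum (word_product A (concat w))"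
    and sv2_concat: "0 \<le> q \<Longrightarrow> (\<And>\<gamma>. \<gamma> \<in> \<Gamma> \<Longrightarrow> q \<le> sv2 (word_product A \<gamma>)) \<Longrightarrow> q ^ m \<le> sv2 (word_product A (concat w))"
    and gm_concat_lower: "0 \<le> \<kappa> \<Longrightarrow> (\<And>\<gamma>. \<gamma> \<in> \<Gamma> \<Longrightarrow> \<kappa> * (max_row_sum (word_product A \<gamma>))\<^sup>2 \<le> \<bar>det (word_product A \<gamma>)\<bar>) \<Longrightarrow>
      x \<in> {0..1} \<Longrightarrow> y \<in> {0..1} \<Longrightarrow> \<kappa> ^ m * \<bar>x - y\<bar> \<le> \<bar>gm (word_product A (concat w)) x - gm (word_product A (concat w)) y\<bar>"
    and gm_concat_upper: "(\<And>\<gamma>. \<gamma> \<in> \<Gamma> \<Longrightarrow> \<bar>det (word_product A \<gamma>)\<bar> \<le> \<zeta> * (min_row_sum (word_product A \<gamma>))\<^sup>2) \<Longrightarrow> 0 \<le> \<zeta> \<Longrightarrow>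
      x \<in> {0..1} \<Longrightarrow> y \<in> {0..1} \<Longrightarrow> \<bar>gm (word_product A (concat w)) x - gm (word_product A (concat w)) y\<bar> \<le> \<zeta> ^ m * \<bar>x - y\<bar>"
proof -
  have G: "word_product A \<gamma> \<in> psgn" if "\<gamma> \<in> \<Gamma>" for \<gamma>
    using \<Gamma>(1)[OF that] \<Gamma>(2) by (intro word_product_psgn psgn) auto
  have cons: thesis
    if "w \<in> words \<Gamma> (Suc m)" "\<And>\<gamma> v. w = \<gamma> # v \<Longrightarrow> \<gamma> \<in> \<Gamma> \<Longrightarrow> v \<in> words \<Gamma> m \<Longrightarrow> concat w = \<gamma> @ concat v \<Longrightarrow> thesis"
    for w m thesis
    using that(1) by (cases w) (auto simp: words_def intro!: that(2))
  have mat1: "min_row_sum (mat 1) = 1" by (simp add: min_row_sum_def mat_def)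
  show "p ^ m \<le> min_row_sum (word_product A (concat w))"
    if p: "0 \<le> p" "\<And>\<gamma>. \<gamma> \<in> \<Gamma> \<Longrightarrow> p \<le> min_row_sum (word_product A \<gamma>)"
    using w
  proof (induction m arbitrary: w)
    case (Suc m)
    obtain \<gamma> v where v: "\<gamma> \<in> \<Gamma>" "v \<in> words \<Gamma> m" "concat w = \<gamma> @ concat v"
      by (rule cons[OF Suc.prems]) blast
    have IH: "p ^ m \<le> min_row_sum (word_product A (concat v))" by (rule Suc.IH[OF v(2)])
    show ?case
    proof (cases "concat v = []")
      case True
      have "p * p ^ m \<le> min_row_sum (word_product A \<gamma>) * 1"
        using p(1) p(2)[OF v(1)] IH True mat1 by (intro mult_mono) (auto intro: order_trans)
      then show ?thesis using v(3) True by simp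
    next
      case False
      have "p * p ^ m \<le> min_row_sum (word_product A \<gamma>) * min_row_sum (word_product A (concat v))"
        using p(1) p(2)[OF v(1)] IH by (intro mult_mono) (auto intro: order_trans)
      also have "\<dots> \<le> min_row_sum (word_product A \<gamma> ** word_product A (concat v))"
        by (intro min_row_sum_mult G v(1) word_product_psgn psgn False)
      finally show ?thesis by (simp add: v(3) word_product_append)
    qed
  qed (simp add: mat1)
  show "q ^ m \<le> sv2 (word_product A (concat w))"
    if q: "0 \<le> q" "\<And>\<gamma>. \<gamma> \<in> \<Gamma> \<Longrightarrow> q \<le> sv2 (word_product A \<gamma>)"
    using w
  proof (induction m arbitrary: w)
    case (Suc m)
    obtain \<gamma> v where v: "\<gamma> \<in> \<Gamma>" "v \<in> words \<Gamma> m" "concat w = \<gamma> @ concat v"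
      by (rule cons[OF Suc.prems]) blast
    have "q * q ^ m \<le> sv2 (word_product A \<gamma>) * sv2 (word_product A (concat v))"
      using q(1) q(2)[OF v(1)] Suc.IH[OF v(2)] by (intro mult_mono) (auto simp: sv2_nonneg)
    also have "\<dots> \<le> sv2 (word_product A \<gamma> ** word_product A (concat v))" by (rule sv2_mult)
    finally show ?case by (simp add: v(3) word_product_append)
  qed (simp add: sv_mat1)
  have gm_split: "gm (word_product A (\<gamma> @ u)) z = gm (word_product A u) (gm (word_product A \<gamma>) z)"
    if "\<gamma> \<in> \<Gamma>" "z \<in> {0..1}" for \<gamma> u z
  proof (cases "u = []")
    case False
    then show ?thesis using that unfolding word_product_append
      by (intro gm_mult G word_product_psgn psgn) auto
  qed (simp add: gm_mat1)
  have gm_in: "gm (word_product A \<gamma>) z \<in> {0..1}" if "\<gamma> \<in> \<Gamma>" "z \<in> {0..1}" for \<gamma> z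
    using gm_mem[OF G[OF that(1)], of z] that(2) by simp
  show "\<kappa> ^ m * \<bar>x - y\<bar> \<le> \<bar>gm (word_product A (concat w)) x - gm (word_product A (concat w)) y\<bar>"
    if \<kappa>: "0 \<le> \<kappa>" "\<And>\<gamma>. \<gamma> \<in> \<Gamma> \<Longrightarrow> \<kappa> * (max_row_sum (word_product A \<gamma>))\<^sup>2 \<le> \<bar>det (word_product A \<gamma>)\<bar>"
      and xy: "x \<in> {0..1}" "y \<in> {0..1}"
    using w xy
  proof (induction m arbitrary: w x y)
    case (Suc m)
    obtain \<gamma> v where v: "\<gamma> \<in> \<Gamma>" "v \<in> words \<Gamma> m" "concat w = \<gamma> @ concat v"
      by (rule cons[OF Suc.prems(1)]) blast
    let ?x = "gm (word_product A \<gamma>) x" and ?y = "gm (word_product A \<gamma>) y"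
    have "\<kappa> \<le> \<bar>det (word_product A \<gamma>)\<bar> / (max_row_sum (word_product A \<gamma>))\<^sup>2"
      using \<kappa>(2)[OF v(1)] max_row_sum_pos[OF G[OF v(1)]] by (simp add: le_divide_eq)
    then have "\<kappa> * \<bar>x - y\<bar> \<le> \<bar>det (word_product A \<gamma>)\<bar> / (max_row_sum (word_product A \<gamma>))\<^sup>2 * \<bar>x - y\<bar>"
      by (intro mult_right_mono) auto
    also have "\<dots> \<le> \<bar>?x - ?y\<bar>" using Suc.prems by (intro gm_lower G v(1)) auto
    finally have "\<kappa> ^ m * (\<kappa> * \<bar>x - y\<bar>) \<le> \<kappa> ^ m * \<bar>?x - ?y\<bar>" using \<kappa>(1) by (intro mult_left_mono) auto
    also have "\<dots> \<le> \<bar>gm (word_product A (concat v)) ?x - gm (word_product A (concat v)) ?y\<bar>"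
      using Suc.prems v by (intro Suc.IH gm_in)
    finally show ?case using Suc.prems v by (simp add: gm_split mult_ac)
  qed (simp add: gm_mat1)
  show "\<bar>gm (word_product A (concat w)) x - gm (word_product A (concat w)) y\<bar> \<le> \<zeta> ^ m * \<bar>x - y\<bar>"
    if \<zeta>: "\<And>\<gamma>. \<gamma> \<in> \<Gamma> \<Longrightarrow> \<bar>det (word_product A \<gamma>)\<bar> \<le> \<zeta> * (min_row_sum (word_product A \<gamma>))\<^sup>2" "0 \<le> \<zeta>"
      and xy: "x \<in> {0..1}" "y \<in> {0..1}"
    using w xy
  proof (induction m arbitrary: w x y)
    case (Suc m)
    obtain \<gamma> v where v: "\<gamma> \<in> \<Gamma>" "v \<in> words \<Gamma> m" "concat w = \<gamma> @ concat v"
      by (rule cons[OF Suc.prems(1)]) blast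
    let ?x = "gm (word_product A \<gamma>) x" and ?y = "gm (word_product A \<gamma>) y"
    have z: "\<bar>det (word_product A \<gamma>)\<bar> / (min_row_sum (word_product A \<gamma>))\<^sup>2 \<le> \<zeta>"
      using \<zeta>(1)[OF v(1)] min_row_sum_pos[OF G[OF v(1)]] by (simp add: divide_le_eq)
    have "\<bar>gm (word_product A (concat v)) ?x - gm (word_product A (concat v)) ?y\<bar> \<le> \<zeta> ^ m * \<bar>?x - ?y\<bar>"
      using Suc.prems v by (intro Suc.IH gm_in)
    also have "\<bar>?x - ?y\<bar> \<le> \<bar>det (word_product A \<gamma>)\<bar> / (min_row_sum (word_product A \<gamma>))\<^sup>2 * \<bar>x - y\<bar>"
      using Suc.prems by (intro gm_upper G v(1)) auto
    also have "\<dots> \<le> \<zeta> * \<bar>x - y\<bar>" using z by (intro mult_right_mono) auto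
    finally have "\<bar>gm (word_product A (concat v)) ?x - gm (word_product A (concat v)) ?y\<bar> \<le> \<zeta> ^ m * (\<zeta> * \<bar>x - y\<bar>)"
      using \<zeta>(2) by (simp add: mult_left_mono)
    then show ?case using Suc.prems v by (simp add: gm_split mult_ac)
  qed (simp add: gm_mat1)
qed

section \<open>Self-affine measures on subsystems of words\<close>

context
  fixes A :: "real^2^2^'n::finite" and t :: "real^2^'n"
  assumes nonsing: "\<And>i. det (A $ i) \<noteq> 0" and contr: "\<And>i. sv1 (A $ i) < 1"
begin

lemma word_separation:
  assumes "strong_separation (affine_ifs A t)"
  shows "\<exists>e>0. \<forall>u v. length u = L \<longrightarrow> length v = L \<longrightarrow> u \<noteq> v \<longrightarrow>
    (\<forall>x\<in>attractor (affine_ifs A t). \<forall>y\<in>attractor (affine_ifs A t). e \<le> dist (word_map A t u x) (word_map A t v y))"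
proof -
  obtain e where e: "0 < e" "\<And>i j x y. x \<in> attractor (affine_ifs A t) \<Longrightarrow> y \<in> attractor (affine_ifs A t) \<Longrightarrow> i \<noteq> j \<Longrightarrow>
      e \<le> dist (affine_ifs A t i x) (affine_ifs A t j y)"
    using strong_separation_dist[OF nonsing contr assms] by blast
  obtain b where b: "0 < b" "b < 1" "\<And>w. b ^ length w \<le> sv2 (word_product A w)" using sv2_uniform[OF nonsing contr] by blast
  have "e * b ^ L \<le> dist (word_map A t u x) (word_map A t v y)"
    if "length u = L" "length v = L" "u \<noteq> v" and xy: "x \<in> attractor (affine_ifs A t)" "y \<in> attractor (affine_ifs A t)" for u v x y
    using that(1-3)
  proof (induction L arbitrary: u v)
    case (Suc L)
    obtain i u' where u: "u = i # u'" "length u' = L" using Suc.prems(1) by (cases u) auto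
    obtain j v' where v: "v = j # v'" "length v' = L" using Suc.prems(2) by (cases v) auto
    let ?x = "word_map A t u' x" and ?y = "word_map A t v' y"
    show ?case
    proof (cases "i = j")
      case False
      have "e * b ^ Suc L \<le> e * 1" using e(1) b by (intro mult_left_mono power_le_one) auto
      also have "e * 1 \<le> dist (affine_ifs A t i ?x) (affine_ifs A t j ?y)"
        using xy False e(2)[of ?x ?y i j] word_map_attractor[OF nonsing contr] by simp
      finally show ?thesis by (simp add: u v)
    next
      case True
      then have "u' \<noteq> v'" using Suc.prems(3) u v by simp
      then have IH: "e * b ^ L \<le> dist ?x ?y" by (intro Suc.IH u(2) v(2))
      have "b * (e * b ^ L) \<le> sv2 (A $ i) * norm (?x - ?y)"
        using IH b(3)[of "[i]"] b e by (intro mult_mono) (auto simp: dist_norm sv2_nonneg)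
      also have "\<dots> \<le> norm (A $ i *v (?x - ?y))" by (rule norm_ge_sv2)
      also have "\<dots> = dist (affine_ifs A t i ?x) (affine_ifs A t i ?y)" by (simp add: dist_norm affine_ifs_diff)
      finally show ?thesis by (simp add: u v True mult_ac)
    qed
  qed simp
  then show ?thesis using e(1) b(1) by (intro exI[of _ "e * b ^ L"]) auto
qed

text \<open>\<open>slack\<close> is the Frostman condition per level of \<Gamma>. The spare factor
  \<omega> ^ m \<ge> 4 pays for the two factors 2: half of the words are discarded, and the others
  may have twice the average number of neighbours.\<close>

lemma self_affine_measure_from_words:
  assumes ssc: "strong_separation (affine_ifs A t)" and psgn: "\<And>i. A $ i \<in> psgn"
    and \<Gamma>: "finite \<Gamma>" "\<Gamma> \<noteq> {}" "\<And>\<gamma>. \<gamma> \<in> \<Gamma> \<Longrightarrow> length \<gamma> = n" "0 < n"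
    and \<kappa>: "0 < \<kappa>" "\<kappa> < 1" "\<kappa> < \<zeta>" "\<kappa> \<le> q / p"
    and p: "0 < p" "p < 1" "\<And>\<gamma>. \<gamma> \<in> \<Gamma> \<Longrightarrow> p \<le> min_row_sum (word_product A \<gamma>)"
    and q: "0 < q" "q < 1" "\<And>\<gamma>. \<gamma> \<in> \<Gamma> \<Longrightarrow> q \<le> sv2 (word_product A \<gamma>)"
    and lower: "\<And>\<gamma>. \<gamma> \<in> \<Gamma> \<Longrightarrow> \<kappa> * (max_row_sum (word_product A \<gamma>))\<^sup>2 \<le> \<bar>det (word_product A \<gamma>)\<bar>"
    and upper: "\<And>\<gamma>. \<gamma> \<in> \<Gamma> \<Longrightarrow> \<bar>det (word_product A \<gamma>)\<bar> \<le> \<zeta> * (min_row_sum (word_product A \<gamma>))\<^sup>2"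
    and ev: "eventually (\<lambda>m. real (card {(w, w'). w \<in> words \<Gamma> m \<and> w' \<in> words \<Gamma> m \<and>
          \<bar>row1_dir (word_product A (concat w)) - row1_dir (word_product A (concat w'))\<bar> \<le> 3 * \<zeta> ^ m})
        \<le> real (card \<Gamma>) ^ m * ((max 1 (real (card \<Gamma>) * \<kappa>)) ^ m * (\<zeta> / \<kappa>) ^ (2 * m))) sequentially"
    and d: "0 < d" and \<omega>: "1 < \<omega>"
    and slack: "max 1 (real (card \<Gamma>) * \<kappa>) * (\<zeta> / \<kappa>)\<^sup>2 * \<omega> \<le> real (card \<Gamma>) * \<kappa> powr d"
  shows "\<exists>m (\<Gamma>' :: 'n list list set) \<nu> e0. 0 < m \<and> 4 \<le> \<omega> ^ m \<and> real (card \<Gamma>) ^ m \<le> 2 * real (card \<Gamma>') \<and>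
    self_affine_measure \<Gamma>' (\<lambda>w. word_product A (concat w)) (\<lambda>w. word_map A t (concat w))
      (attractor (affine_ifs A t)) (p ^ m) (q ^ m) e0 \<nu> (\<kappa> ^ m) d"
proof -
  define K where "K = attractor (affine_ifs A t)"
  note K = attractor_props[OF nonsing contr, of t, folded K_def]
  define X where "X = max 1 (real (card \<Gamma>) * \<kappa>)"
  have X: "1 \<le> X" by (simp add: X_def)
  have card0: "0 < real (card \<Gamma>)" using \<Gamma>(1,2) by (simp add: card_gt_0_iff)
  obtain m1 where "4 < \<omega> ^ m1" using real_arch_pow[OF \<omega>] by blast
  have "eventually (\<lambda>m. 4 \<le> \<omega> ^ m) sequentially"
    unfolding eventually_sequentially
  proof (intro exI[of _ m1] allI impI)
    fix m assume "m1 \<le> m"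
    then have "\<omega> ^ m1 \<le> \<omega> ^ m" using \<omega> by (intro power_increasing) auto
    then show "4 \<le> \<omega> ^ m" using \<open>4 < \<omega> ^ m1\<close> by linarith
  qed
  then have "eventually (\<lambda>m. 0 < m \<and> 4 \<le> \<omega> ^ m \<and> real (card {(w, w'). w \<in> words \<Gamma> m \<and> w' \<in> words \<Gamma> m \<and>
          \<bar>row1_dir (word_product A (concat w)) - row1_dir (word_product A (concat w'))\<bar> \<le> 3 * \<zeta> ^ m})
        \<le> real (card \<Gamma>) ^ m * ((max 1 (real (card \<Gamma>) * \<kappa>)) ^ m * (\<zeta> / \<kappa>) ^ (2 * m))) sequentially"
    using ev eventually_gt_at_top[of 0] by eventually_elim blast
  from eventually_happens'[OF sequentially_bot this]
  obtain m where m: "0 < m" "4 \<le> \<omega> ^ m" "real (card {(w, w'). w \<in> words \<Gamma> m \<and> w' \<in> words \<Gamma> m \<and>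
          \<bar>row1_dir (word_product A (concat w)) - row1_dir (word_product A (concat w'))\<bar> \<le> 3 * \<zeta> ^ m})
        \<le> real (card \<Gamma>) ^ m * (X ^ m * (\<zeta> / \<kappa>) ^ (2 * m))"
    unfolding X_def by blast
  define Y where "Y = X ^ m * (\<zeta> / \<kappa>) ^ (2 * m)"
  have Y: "0 < Y" unfolding Y_def using X \<kappa> by (intro mult_pos_pos zero_less_power divide_pos_pos) auto
  have cardW: "card (words \<Gamma> m) = card \<Gamma> ^ m" by (rule card_words[OF \<Gamma>(1)])
  define f where "f w = row1_dir (word_product A (concat w))" for w
  have "real (card {(w, w'). w \<in> words \<Gamma> m \<and> w' \<in> words \<Gamma> m \<and> \<bar>f w - f w'\<bar> \<le> 3 * \<zeta> ^ m}) \<le> real (card (words \<Gamma> m)) * Y"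
    using m(3) by (simp add: f_def cardW Y_def)
  then obtain \<Gamma>' where \<Gamma>': "\<Gamma>' \<subseteq> words \<Gamma> m" "real (card (words \<Gamma> m)) / 2 \<le> real (card \<Gamma>')"
    "\<And>w. w \<in> \<Gamma>' \<Longrightarrow> real (card {w'\<in>\<Gamma>'. \<bar>f w - f w'\<bar> \<le> 3 * \<zeta> ^ m}) \<le> 2 * Y"
    using half_with_few_neighbours[OF finite_words[OF \<Gamma>(1)] Y] by blast
  have card': "real (card \<Gamma>) ^ m \<le> 2 * real (card \<Gamma>')" using \<Gamma>'(2) cardW by simp
  have fin': "finite \<Gamma>'" using \<Gamma>'(1) finite_words[OF \<Gamma>(1)] by (rule finite_subset)
  have "0 < real (card \<Gamma>')" using card' zero_less_power[OF card0, of m] by linarith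
  then have ne': "\<Gamma>' \<noteq> {}" by auto
  have W: "w \<in> words \<Gamma> m" if "w \<in> \<Gamma>'" for w using that \<Gamma>'(1) by blast
  have nonempty: "concat w \<noteq> []" if "w \<in> \<Gamma>'" for w
    by (rule concat_words_nonempty[OF W[OF that] m(1) \<Gamma>(3,4)])
  have B_psgn: "word_product A (concat w) \<in> psgn" if "w \<in> \<Gamma>'" for w
    using nonempty[OF that] by (intro word_product_psgn psgn)
  obtain l where l: "0 < l" "l < 1" "\<And>w. sv1 (word_product A w) \<le> l ^ length w" using sv1_uniform[OF nonsing contr] by blast
  obtain e0 where e0: "0 < e0" "\<And>u v x y. length u = n * m \<Longrightarrow> length v = n * m \<Longrightarrow> u \<noteq> v \<Longrightarrow> x \<in> K \<Longrightarrow> y \<in> K \<Longrightarrow>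
      e0 \<le> dist (word_map A t u x) (word_map A t v y)"
    using word_separation[OF ssc, of "n * m"] unfolding K_def by blast
  interpret affine_system \<Gamma>' "\<lambda>w. word_product A (concat w)" "\<lambda>w. word_map A t (concat w)" K "p ^ m" "q ^ m" e0
  proof
    show "word_map A t (concat w) x \<in> K" if "x \<in> K" for w x
      using that unfolding K_def by (rule word_map_attractor[OF nonsing contr])
    show "sv1 (word_product A (concat w)) < 1" if "w \<in> \<Gamma>'" for w
    proof -
      have "l ^ length (concat w) < 1" using nonempty[OF that] l by (simp only: length_greater_0_conv[symmetric] power_less_one_iff)
      then show ?thesis using l(3)[of "concat w"] by linarith
    qed
    show "e0 \<le> dist (word_map A t (concat i) x) (word_map A t (concat j) y)"
      if ij: "i \<in> \<Gamma>'" "j \<in> \<Gamma>'" and xy: "x \<in> K" "y \<in> K" and ne: "i \<noteq> j" for i j x y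
    proof (rule e0(2)[OF _ _ _ xy])
      show "length (concat i) = n * m" "length (concat j) = n * m"
        by (intro concat_words_length[of _ \<Gamma>] W ij \<Gamma>(3); assumption)+
      show "concat i \<noteq> concat j" using words_concat_inj[OF W[OF ij(1)] W[OF ij(2)] \<Gamma>(3)] ne by blast
    qed
    show "p ^ m \<le> min_row_sum (word_product A (concat w))" if "w \<in> \<Gamma>'" for w
      using p(1) by (intro min_row_sum_concat[OF psgn \<Gamma>(3,4) W[OF that] _ p(3)]) auto
    show "q ^ m \<le> sv2 (word_product A (concat w))" if "w \<in> \<Gamma>'" for w
      using q(1) by (intro sv2_concat[OF psgn \<Gamma>(3,4) W[OF that] _ q(3)]) auto
    show "p ^ m < 1" "q ^ m < 1" using p q m(1) by (simp_all add: power_less_one_iff)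
  qed (use fin' ne' K B_psgn p q e0(1) in \<open>auto simp: word_map_diff\<close>)
  obtain \<nu> where \<nu>: "prob_space \<nu>" "sets \<nu> = sets borel" "emeasure \<nu> K = 1"
    "\<And>g. g \<in> borel_measurable borel \<Longrightarrow> (\<integral>\<^sup>+x. g x \<partial>\<nu>) = (\<Sum>w\<in>\<Gamma>'. \<integral>\<^sup>+x. g (word_map A t (concat w) x) \<partial>\<nu>) / ennreal (real (card \<Gamma>'))"
    using invariant_measure_exists by blast
  have "self_affine_measure \<Gamma>' (\<lambda>w. word_product A (concat w)) (\<lambda>w. word_map A t (concat w)) K (p ^ m) (q ^ m) e0 \<nu> (\<kappa> ^ m) d"
  proof (intro self_affine_measure.intro affine_system_axioms self_affine_measure_axioms.intro)
    show "prob_space \<nu>" "sets \<nu> = sets borel" "emeasure \<nu> K = 1" "0 < d" by (rule \<nu>(1) \<nu>(2) \<nu>(3) d)+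
    show "\<And>g. g \<in> borel_measurable borel \<Longrightarrow>
      (\<integral>\<^sup>+x. g x \<partial>\<nu>) = (\<Sum>w\<in>\<Gamma>'. \<integral>\<^sup>+x. g (word_map A t (concat w) x) \<partial>\<nu>) / ennreal (real (card \<Gamma>'))"
      by (rule \<nu>(4))
    show "\<kappa> ^ m < 1" "0 < \<kappa> ^ m" using \<kappa> m(1) by (simp_all add: power_less_one_iff)
    show "\<kappa> ^ m \<le> q ^ m / p ^ m" using power_mono[OF \<kappa>(4), of m] \<kappa>(1) by (simp add: power_divide)
    show "\<kappa> ^ m * \<bar>x - y\<bar> \<le> \<bar>gm (word_product A (concat i)) x - gm (word_product A (concat i)) y\<bar>"
      if "i \<in> \<Gamma>'" "x \<in> {0..1}" "y \<in> {0..1}" for i x y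
      using \<kappa>(1) that(2,3) by (intro gm_concat_lower[OF psgn \<Gamma>(3,4) W[OF that(1)] _ lower]) auto
    show "real (card S) \<le> real (card \<Gamma>') * (\<kappa> ^ m) powr d"
      if S: "S \<subseteq> \<Gamma>'" and cl: "\<And>i j. i \<in> S \<Longrightarrow> j \<in> S \<Longrightarrow>
        \<exists>x\<in>{0..1}. \<exists>y\<in>{0..1}. \<bar>gm (word_product A (concat i)) x - gm (word_product A (concat j)) y\<bar> \<le> \<kappa> ^ m" for S
    proof (cases "S = {}")
      case False
      then obtain w where w: "w \<in> S" by blast
      have up: "\<bar>gm (word_product A (concat v)) x - f v\<bar> \<le> \<zeta> ^ m" if "v \<in> S" "x \<in> {0..1}" for v x
      proof -
        have v: "v \<in> words \<Gamma> m" using that(1) S W by blast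
        have "\<bar>gm (word_product A (concat v)) x - gm (word_product A (concat v)) 1\<bar> \<le> \<zeta> ^ m * \<bar>x - 1\<bar>"
          using \<kappa> that(2) by (intro gm_concat_upper[OF psgn \<Gamma>(3,4) v upper]) auto
        also have "\<dots> \<le> \<zeta> ^ m * 1" using that(2) \<kappa> by (intro mult_left_mono) auto
        finally show ?thesis by (simp add: f_def row1_dir_def)
      qed
      have \<kappa>\<zeta>: "\<kappa> ^ m \<le> \<zeta> ^ m" using \<kappa> by (intro power_mono) auto
      have "S \<subseteq> {w'\<in>\<Gamma>'. \<bar>f w - f w'\<bar> \<le> 3 * \<zeta> ^ m}"
      proof
        fix v assume v: "v \<in> S"
        obtain x y where xy: "x \<in> {0..1}" "y \<in> {0..1}"
          "\<bar>gm (word_product A (concat w)) x - gm (word_product A (concat v)) y\<bar> \<le> \<kappa> ^ m"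
          using cl[OF w v] by blast
        \<comment> \<open>Moving either argument to the base point 1 costs
          \<open>\<zeta> ^ m\<close>, and the clustering itself at most
          \<open>\<kappa> ^ m \<le> \<zeta> ^ m\<close>: this is the 3 in the count of close
          pairs.\<close>
        have "\<bar>f w - f v\<bar> \<le> 3 * \<zeta> ^ m"
          using up[OF w xy(1)] up[OF v xy(2)] xy(3) \<kappa>\<zeta> by linarith
        then show "v \<in> {w'\<in>\<Gamma>'. \<bar>f w - f w'\<bar> \<le> 3 * \<zeta> ^ m}" using v S by blast
      qed
      then have "card S \<le> card {w'\<in>\<Gamma>'. \<bar>f w - f w'\<bar> \<le> 3 * \<zeta> ^ m}" using fin' by (intro card_mono) auto
      then have "real (card S) \<le> 2 * Y" using \<Gamma>'(3)[of w] w S by fastforce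
      also have "4 * Y \<le> real (card \<Gamma>) ^ m * (\<kappa> ^ m) powr d"
      proof -
        have "4 * Y \<le> \<omega> ^ m * Y" using m(2) Y by (intro mult_right_mono) auto
        also have "\<dots> = (X * (\<zeta> / \<kappa>)\<^sup>2 * \<omega>) ^ m" unfolding Y_def power_mult_distrib power_mult by (simp only: mult_ac)
        also have "\<dots> \<le> (real (card \<Gamma>) * \<kappa> powr d) ^ m"
          using slack X \<omega> unfolding X_def[symmetric] by (intro power_mono mult_nonneg_nonneg) auto
        also have "\<dots> = real (card \<Gamma>) ^ m * (\<kappa> ^ m) powr d"
          unfolding power_mult_distrib using \<kappa>(1)
          by (simp add: powr_realpow[symmetric] powr_powr mult.commute)
        finally show ?thesis .
      qed
      then have "2 * Y \<le> (real (card \<Gamma>) ^ m / 2) * (\<kappa> ^ m) powr d" by simp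
      also have "\<dots> \<le> real (card \<Gamma>') * (\<kappa> ^ m) powr d" using card' by (intro mult_right_mono) auto
      finally show ?thesis .
    qed simp
  qed
  then show ?thesis using m card' unfolding K_def by blast
qed

end

section \<open>The choice of the word class\<close>

lemma pigeonhole_sum:
  fixes h :: "'a \<Rightarrow> real"
  assumes "finite S" "finite T" "g ` S \<subseteq> T" and less: "real (card T) < sum h S"
  shows "\<exists>y\<in>T. 1 < sum h {x\<in>S. g x = y}"
proof (rule ccontr)
  assume neg: "\<not> ?thesis"
  have "sum h S = (\<Sum>y\<in>T. sum h {x\<in>S. g x = y})" by (rule sum.group[OF assms(1-3), symmetric])
  also have "\<dots> \<le> (\<Sum>y\<in>T. 1)" by (intro sum_mono) (use neg in \<open>meson not_le\<close>)
  finally show False using less by simp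
qed

lemma log_shell:
  assumes "0 < x" "x \<le> 1" "0 < H"
  shows "exp (- (real (nat \<lfloor>- ln x / H\<rfloor>) * H) - H) < x" "x \<le> exp (- (real (nat \<lfloor>- ln x / H\<rfloor>) * H))"
proof -
  define i where "i = nat \<lfloor>- ln x / H\<rfloor>"
  have "0 \<le> - ln x / H" using assms by (auto simp: divide_nonpos_pos)
  then have i: "real i = of_int \<lfloor>- ln x / H\<rfloor>" by (simp add: i_def)
  have "real i \<le> - ln x / H" "- ln x / H < real i + 1" unfolding i by linarith+
  then have "real i * H \<le> - ln x" "- ln x < real i * H + H" using assms(3) by (simp_all add: field_simps)
  then have "ln x \<le> - (real i * H)" "- (real i * H) - H < ln x" by linarith+
  then show "exp (- (real i * H) - H) < x" "x \<le> exp (- (real i * H))"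
    using assms(1) by (metis exp_less_mono exp_ln, metis exp_le_cancel_iff exp_ln)
qed

context
  fixes A :: "real^2^2^'n::finite"
  assumes nonsing: "\<And>i. det (A $ i) \<noteq> 0" and contr: "\<And>i. sv1 (A $ i) < 1"
begin

text \<open>Logarithms of singular values of words of length \<open>n\<close> range over an interval
  of length proportional to \<open>n\<close>. Cut into pieces of length \<eta> * n, it yields a
  number of classes independent of \<open>n\<close>, whereas the total of the singular value
  function grows exponentially below the affinity dimension.\<close>

lemma dense_word_class:
  assumes N: "CARD('n) \<ge> 2" and s: "0 \<le> s" "s < affinity_dim A" and \<eta>: "0 < \<eta>"
  shows "eventually (\<lambda>n. \<exists>\<Gamma> U V. \<Gamma> \<subseteq> words UNIV n \<and> \<Gamma> \<noteq> {} \<and>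
    (\<forall>w\<in>\<Gamma>. exp (- U - \<eta> * real n) < sv1 (word_product A w) \<and> sv1 (word_product A w) \<le> exp (- U) \<and>
      exp (- V - \<eta> * real n) < sv2 (word_product A w) \<and> sv2 (word_product A w) \<le> exp (- V)) \<and>
    exp (expo1 s * U + expo2 s * V) \<le> real (card \<Gamma>)) sequentially"
proof -
  obtain \<eta>0 where \<eta>0: "\<eta>0 > 0" "eventually (\<lambda>n. exp (\<eta>0 * real n) \<le> svsum A s n) sequentially"
    using svsum_growth[OF nonsing contr N s] by blast
  obtain b where b: "0 < b" "b < 1" "\<And>w. b ^ length w \<le> sv2 (word_product A w)" using sv2_uniform[OF nonsing contr] by blast
  obtain l where l: "0 < l" "l < 1" "\<And>w. sv1 (word_product A w) \<le> l ^ length w" using sv1_uniform[OF nonsing contr] by blast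
  define J where "J = nat \<lfloor>- ln b / \<eta>\<rfloor>"
  define T where "T = {..J} \<times> {..J}"
  have "filterlim (\<lambda>n. exp (\<eta>0 * real n)) at_top sequentially"
    using \<eta>0(1) by (intro filterlim_compose[OF exp_at_top] filterlim_tendsto_pos_mult_at_top[OF tendsto_const] filterlim_real_sequentially)
  then have "eventually (\<lambda>n. real (card T) < exp (\<eta>0 * real n)) sequentially"
    by (simp only: filterlim_at_top_dense)
  then show ?thesis
    using \<eta>0(2) eventually_gt_at_top[of 0]
  proof eventually_elim
    case (elim n)
    define H where "H = \<eta> * real n"
    have H: "0 < H" using \<eta> elim by (simp add: H_def)
    define ix where "ix x = nat \<lfloor>- ln x / H\<rfloor>" for x :: real
    define f where "f w = (ix (sv1 (word_product A w)), ix (sv2 (word_product A w)))" for w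
    have det: "det (word_product A w) \<noteq> 0" for w by (rule det_word_product) (rule nonsing)
    have pos: "0 < sv1 (word_product A w)" "0 < sv2 (word_product A w)" for w using det sv1_pos sv2_pos by auto
    have le1: "sv1 (word_product A w) \<le> 1" "sv2 (word_product A w) \<le> 1" for w
    proof -
      have "l ^ length w \<le> 1" using l by (intro power_le_one) auto
      then show "sv1 (word_product A w) \<le> 1" using l(3)[of w] by linarith
      then show "sv2 (word_product A w) \<le> 1" using sv2_le_sv1[of "word_product A w"] by linarith
    qed
    have ix_le: "ix x \<le> J" if "b ^ n \<le> x" for x
    proof -
      have bn: "0 < b ^ n" using b by simp
      have "ln (b ^ n) \<le> ln x" using that bn by (subst ln_le_cancel_iff) auto
      then have "real n * ln b \<le> ln x" using b by (simp add: ln_realpow)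
      then have "- ln x / H \<le> - (real n * ln b) / H" using H by (intro divide_right_mono) auto
      also have "\<dots> = - ln b / \<eta>" using elim by (simp add: H_def)
      finally show ?thesis unfolding ix_def J_def by (intro nat_mono floor_mono)
    qed
    have "f w \<in> T" if "w \<in> words UNIV n" for w
    proof -
      have "b ^ n \<le> sv2 (word_product A w)" using that b(3)[of w] by (simp add: words_UNIV)
      then show ?thesis using ix_le sv2_le_sv1[of "word_product A w"] unfolding f_def T_def by (simp add: order_trans)
    qed
    then have fT: "f ` words UNIV n \<subseteq> T" by blast
    have "real (card T) < (\<Sum>w\<in>words UNIV n. svf s (word_product A w))"
      using elim unfolding svsum_def by linarith
    then obtain y where y: "1 < (\<Sum>w\<in>{w\<in>words UNIV n. f w = y}. svf s (word_product A w))"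
      using pigeonhole_sum[OF finite_words _ fT, of "\<lambda>w. svf s (word_product A w)"] by (auto simp: T_def)
    define \<Gamma> where "\<Gamma> = {w\<in>words UNIV n. f w = y}"
    define U where "U = real (fst y) * H"
    define V where "V = real (snd y) * H"
    have sv: "exp (- U - H) < sv1 (word_product A w)" "sv1 (word_product A w) \<le> exp (- U)"
      "exp (- V - H) < sv2 (word_product A w)" "sv2 (word_product A w) \<le> exp (- V)" if "w \<in> \<Gamma>" for w
    proof -
      have "fst y = ix (sv1 (word_product A w))" "snd y = ix (sv2 (word_product A w))"
        using that by (auto simp: \<Gamma>_def f_def)
      then show "exp (- U - H) < sv1 (word_product A w)" "sv1 (word_product A w) \<le> exp (- U)"
        "exp (- V - H) < sv2 (word_product A w)" "sv2 (word_product A w) \<le> exp (- V)"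
        unfolding U_def V_def ix_def using log_shell[OF pos(1) le1(1) H] log_shell[OF pos(2) le1(2) H] by simp_all
    qed
    have "1 \<le> (\<Sum>w\<in>\<Gamma>. svf s (word_product A w))" using y unfolding \<Gamma>_def by simp
    also have "\<dots> \<le> (\<Sum>w\<in>\<Gamma>. exp (- (expo1 s * U + expo2 s * V)))"
    proof (rule sum_mono)
      fix w assume w: "w \<in> \<Gamma>"
      have "svf s (word_product A w) \<le> exp (- U) powr expo1 s * exp (- V) powr expo2 s"
        unfolding svf_eq[OF det] using sv[OF w] pos expo_nonneg(1)[OF s(1)] expo_nonneg(2)[of s]
        by (intro mult_mono powr_mono2) (auto intro: less_imp_le)
      also have "\<dots> = exp (- (expo1 s * U + expo2 s * V))" by (simp add: powr_def flip: exp_add)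
      finally show "svf s (word_product A w) \<le> exp (- (expo1 s * U + expo2 s * V))" .
    qed
    also have "\<dots> = real (card \<Gamma>) / exp (expo1 s * U + expo2 s * V)"
      by (simp only: sum_constant exp_minus divide_inverse)
    finally have "1 \<le> real (card \<Gamma>) / exp (expo1 s * U + expo2 s * V)" .
    then have "exp (expo1 s * U + expo2 s * V) \<le> real (card \<Gamma>)" by (simp add: le_divide_eq)
    moreover have "\<Gamma> \<noteq> {}" using y unfolding \<Gamma>_def[symmetric] by auto
    moreover have "\<Gamma> \<subseteq> words UNIV n" by (auto simp: \<Gamma>_def)
    moreover have "\<forall>w\<in>\<Gamma>. exp (- U - H) < sv1 (word_product A w) \<and> sv1 (word_product A w) \<le> exp (- U) \<and>
      exp (- V - H) < sv2 (word_product A w) \<and> sv2 (word_product A w) \<le> exp (- V)"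
      by (intro ballI conjI sv)
    ultimately show ?case
      unfolding H_def by - (rule exI[of _ \<Gamma>], rule exI[of _ U], rule exI[of _ V], intro conjI)
  qed
qed

lemma good_word_class:
  assumes N: "CARD('n) \<ge> 2" and s: "0 \<le> s" "s < affinity_dim A"
    and psgn: "\<And>i. A $ i \<in> psgn" and dom: "\<And>i. \<bar>det (A $ i)\<bar> \<le> 1/2 * (min_row_sum (A $ i))\<^sup>2"
    and \<epsilon>: "0 < \<epsilon>" "\<epsilon> \<le> 1"
  shows "\<exists>n \<Gamma> U V H. 0 < n \<and> \<Gamma> \<subseteq> words UNIV n \<and> \<Gamma> \<noteq> {} \<and>
    (\<forall>w\<in>\<Gamma>. exp (- U - H) < sv1 (word_product A w) \<and> sv1 (word_product A w) \<le> exp (- U) \<and>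
      exp (- V - H) < sv2 (word_product A w) \<and> sv2 (word_product A w) \<le> exp (- V) \<and>
      exp (- U - 2 * H) \<le> min_row_sum (word_product A w)) \<and>
    exp (expo1 s * U + expo2 s * V) \<le> real (card \<Gamma>) \<and> 4 \<le> exp H \<and> 50 * H \<le> \<epsilon> * U \<and> 50 * H \<le> \<epsilon> * (V - U)"
proof -
  obtain c where c: "0 < c" "\<And>w. w \<noteq> [] \<Longrightarrow> c * sv1 (word_product A w) \<le> min_row_sum (word_product A w)"
    using word_product_min_row_sum_ge_sv1[OF psgn contr] by blast
  obtain l where l: "0 < l" "l < 1" "\<And>w. sv1 (word_product A w) \<le> l ^ length w" using sv1_uniform[OF nonsing contr] by blast
  \<comment> \<open>The first entry is a rate for the decay of \<open>sv1\<close> and bounds U from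
    below. The second is the rate at which the directions contract, as |det| is at most 2^(-n) times
    the squared row sum, and bounds V - U.\<close>
  define u0 where "u0 = min (- ln l) (ln 2)"
  have u0: "0 < u0" using l by (simp add: u0_def)
  \<comment> \<open>Gives \<epsilon> * u0 * n = 60 * H. As U \<ge> u0 * n - H and V - U \<ge> u0 * n
    - 2 * H with \<epsilon> \<le> 1, at least 58 * H is left for the required 50 * H.\<close>
  define \<eta> where "\<eta> = \<epsilon> * u0 / 60"
  have \<eta>: "0 < \<eta>" using \<epsilon> u0 by (simp add: \<eta>_def)
  have "filterlim (\<lambda>n. exp (\<eta> * real n)) at_top sequentially"
    using \<eta> by (intro filterlim_compose[OF exp_at_top] filterlim_tendsto_pos_mult_at_top[OF tendsto_const] filterlim_real_sequentially)
  \<comment> \<open>Multiplicative constants are hidden in \<open>exp H\<close>: the 4 for later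
    factors 2, and 1 / c for the passage from norm to row sum.\<close>
  then have "eventually (\<lambda>n. max 4 (1 / c) < exp (\<eta> * real n)) sequentially"
    by (simp only: filterlim_at_top_dense)
  then have "eventually (\<lambda>n. max 4 (1 / c) < exp (\<eta> * real n) \<and> 0 < n \<and> (\<exists>\<Gamma> U V. \<Gamma> \<subseteq> words UNIV n \<and> \<Gamma> \<noteq> {} \<and>
    (\<forall>w\<in>\<Gamma>. exp (- U - \<eta> * real n) < sv1 (word_product A w) \<and> sv1 (word_product A w) \<le> exp (- U) \<and>
      exp (- V - \<eta> * real n) < sv2 (word_product A w) \<and> sv2 (word_product A w) \<le> exp (- V)) \<and>
    exp (expo1 s * U + expo2 s * V) \<le> real (card \<Gamma>))) sequentially"
    using eventually_gt_at_top[of 0] dense_word_class[OF N s \<eta>] by eventually_elim blast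
  from eventually_happens'[OF sequentially_bot this]
  obtain n \<Gamma> U V where n: "max 4 (1 / c) < exp (\<eta> * real n)" "0 < n" and \<Gamma>: "\<Gamma> \<subseteq> words UNIV n" "\<Gamma> \<noteq> {}"
    and sv: "\<And>w. w \<in> \<Gamma> \<Longrightarrow> exp (- U - \<eta> * real n) < sv1 (word_product A w)" "\<And>w. w \<in> \<Gamma> \<Longrightarrow> sv1 (word_product A w) \<le> exp (- U)"
      "\<And>w. w \<in> \<Gamma> \<Longrightarrow> exp (- V - \<eta> * real n) < sv2 (word_product A w)" "\<And>w. w \<in> \<Gamma> \<Longrightarrow> sv2 (word_product A w) \<le> exp (- V)"
    and card: "exp (expo1 s * U + expo2 s * V) \<le> real (card \<Gamma>)" by blast
  define H where "H = \<eta> * real n"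
  have H: "0 < H" "4 < exp H" "1 / c < exp H" using \<eta> n by (auto simp: H_def)
  have len: "length w = n" if "w \<in> \<Gamma>" for w using that \<Gamma>(1) by (auto simp: words_UNIV)
  have ne: "w \<noteq> []" if "w \<in> \<Gamma>" for w using len[OF that] n(2) by auto
  have row: "exp (- U - 2 * H) \<le> min_row_sum (word_product A w)" if "w \<in> \<Gamma>" for w
  proof -
    have "exp (- U - 2 * H) = exp (- U - H) * exp (- H)" by (simp flip: exp_add)
    also have "\<dots> \<le> sv1 (word_product A w) * c"
    proof (rule mult_mono)
      show "exp (- U - H) \<le> sv1 (word_product A w)" using sv(1)[OF that] by (simp add: H_def)
      show "exp (- H) \<le> c" using H(3) c(1) by (simp add: exp_minus field_simps)
    qed (auto simp: sv1_nonneg)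
    also have "\<dots> \<le> min_row_sum (word_product A w)" using c(2)[OF ne[OF that]] by (simp add: mult.commute)
    finally show ?thesis .
  qed
  obtain w where w: "w \<in> \<Gamma>" using \<Gamma>(2) by blast
  have nu0: "\<epsilon> * (u0 * real n) = 60 * H" by (simp add: H_def \<eta>_def)
  have \<epsilon>H: "\<epsilon> * H \<le> H" using \<epsilon> H by simp
  have "exp (- U - H) < exp (- (u0 * real n))"
  proof -
    have "exp (- U - H) < l ^ n" using sv(1)[OF w] l(3)[of w] len[OF w] by (simp add: H_def)
    also have "l ^ n = exp (real n * ln l)" using l by (simp add: exp_of_nat_mult)
    also have "\<dots> \<le> exp (- (u0 * real n))"
    proof -
      have "real n * u0 \<le> real n * (- ln l)" by (intro mult_left_mono) (auto simp: u0_def)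
      then show ?thesis by (simp add: mult.commute)
    qed
    finally show ?thesis .
  qed
  then have "u0 * real n - H \<le> U" by simp
  then have "\<epsilon> * (u0 * real n - H) \<le> \<epsilon> * U" using \<epsilon> by (intro mult_left_mono) auto
  then have U: "50 * H \<le> \<epsilon> * U" using nu0 \<epsilon>H H(1) unfolding right_diff_distrib by linarith
  have "exp (- V - H) < exp (H - u0 * real n - U)"
  proof -
    let ?W = "word_product A w"
    have W: "?W \<in> psgn" by (rule word_product_psgn[OF psgn ne[OF w]])
    have s1: "0 < sv1 ?W" using sv1_pos det_word_product[OF nonsing] by blast
    have "min_row_sum ?W \<le> 2 * sv1 ?W"
      using row_sum_le_sv1[of ?W 1] min_row_sum_le[of ?W 1] by (simp add: rsum_def)
    then have "(min_row_sum ?W)\<^sup>2 \<le> (2 * sv1 ?W)\<^sup>2" using min_row_sum_pos[OF W] by (intro power_mono) auto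
    then have "(1/2) ^ n * (min_row_sum ?W)\<^sup>2 \<le> (1/2) ^ n * (2 * sv1 ?W)\<^sup>2" by (intro mult_left_mono) auto
    then have "sv1 ?W * sv2 ?W \<le> (1/2) ^ n * (2 * sv1 ?W)\<^sup>2"
      using word_product_det_le[OF psgn dom _ ne[OF w]] unfolding sv_prod len[OF w] by linarith
    then have "sv1 ?W * sv2 ?W \<le> sv1 ?W * (4 * (1/2) ^ n * sv1 ?W)" by (simp add: power2_eq_square mult_ac)
    then have "sv2 ?W \<le> 4 * (1/2) ^ n * sv1 ?W" using s1 by simp
    also have "\<dots> \<le> exp H * exp (- (u0 * real n)) * exp (- U)"
    proof (intro mult_mono)
      have "(1/2 :: real) ^ n = exp (real n * ln (1/2))" by (subst exp_of_nat_mult) simp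
      also have "\<dots> \<le> exp (- (u0 * real n))"
      proof -
        have "real n * u0 \<le> real n * ln 2" by (intro mult_left_mono) (auto simp: u0_def)
        then show ?thesis by (simp add: ln_div mult.commute)
      qed
      finally show "(1/2 :: real) ^ n \<le> exp (- (u0 * real n))" .
    qed (use H sv(2)[OF w] s1 in auto)
    also have "\<dots> = exp (H - u0 * real n - U)" by (simp flip: exp_add)
    finally show ?thesis using sv(3)[OF w] unfolding H_def by linarith
  qed
  then have "u0 * real n - 2 * H \<le> V - U" by simp
  then have "\<epsilon> * (u0 * real n - 2 * H) \<le> \<epsilon> * (V - U)" using \<epsilon> by (intro mult_left_mono) auto
  then have "50 * H \<le> \<epsilon> * (V - U)" using nu0 \<epsilon>H H(1) unfolding right_diff_distrib by linarith
  moreover have "\<forall>w\<in>\<Gamma>. exp (- U - H) < sv1 (word_product A w) \<and> sv1 (word_product A w) \<le> exp (- U) \<and>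
      exp (- V - H) < sv2 (word_product A w) \<and> sv2 (word_product A w) \<le> exp (- V) \<and>
      exp (- U - 2 * H) \<le> min_row_sum (word_product A w)"
    unfolding H_def by (intro ballI conjI sv row[unfolded H_def])
  moreover note n(2) \<Gamma> card less_imp_le[OF H(2)] U
  ultimately show ?thesis
    by - (rule exI[of _ n], rule exI[of _ \<Gamma>], rule exI[of _ U], rule exI[of _ V], rule exI[of _ H], intro conjI)
qed

end

section \<open>The attainable exponents\<close>

definition correlation_decay :: "(real^2) set \<Rightarrow> real \<Rightarrow> bool" where
  "correlation_decay K D \<longleftrightarrow> (\<exists>\<nu> C. borel_prob_on K \<nu> \<and>
    (\<forall>r. 0 < r \<longrightarrow> r \<le> 1 \<longrightarrow> measure (\<nu> \<Otimes>\<^sub>M \<nu>) (pairs_within r) \<le> C * r powr D))"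

lemma correlation_decay_mono:
  assumes "correlation_decay K D" "D' \<le> D"
  shows "correlation_decay K D'"
proof -
  obtain \<nu> C where \<nu>: "borel_prob_on K \<nu>"
    and C: "\<And>r. 0 < r \<Longrightarrow> r \<le> 1 \<Longrightarrow> measure (\<nu> \<Otimes>\<^sub>M \<nu>) (pairs_within r) \<le> C * r powr D"
    using assms(1) unfolding correlation_decay_def by blast
  have "measure (\<nu> \<Otimes>\<^sub>M \<nu>) (pairs_within r) \<le> max 0 C * r powr D'" if r: "0 < r" "r \<le> 1" for r
  proof -
    have "C * r powr D \<le> max 0 C * r powr D'"
      using r assms(2) by (intro mult_mono powr_mono') auto
    then show ?thesis using C[OF r] by linarith
  qed
  then show ?thesis using \<nu> unfolding correlation_decay_def by blast
qed

lemma correlation_decayI: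
  assumes m: "self_affine_measure I B F K p q e0 \<nu> \<kappa> d" and r: "\<exists>C\<ge>0. \<forall>r>0. self_affine_measure.\<phi> \<nu> r \<le> C * r powr D"
  shows "correlation_decay K D"
proof -
  interpret self_affine_measure I B F K p q e0 \<nu> \<kappa> d by (rule m)
  show ?thesis
    unfolding correlation_decay_def borel_prob_on_def
    using r prob_\<nu> sets_\<nu> \<nu>_K unfolding \<phi>_def by blast
qed

lemma exp_power_powr: "(exp a ^ m) powr D = exp (real m * (D * a))"
  by (simp add: powr_def exp_of_nat_mult[symmetric] mult_ac)

text \<open>One factor \<open>exp H ^ m\<close> pays for the loss of half the words and still leaves
  a factor 2, which makes strict inequalities available.\<close>

lemma exp_power_half:
  fixes c :: real
  assumes "exp E ^ m \<le> 2 * c" "4 \<le> exp H ^ m" "X + H \<le> E"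
  shows "2 * exp (real m * X) \<le> c"
proof -
  have "4 * exp (real m * X) \<le> exp H ^ m * exp (real m * X)" using assms(2) by (intro mult_right_mono) auto
  also have "\<dots> = exp (real m * (X + H))" by (simp add: distrib_left exp_add exp_of_nat_mult)
  also have "\<dots> \<le> exp (real m * E)" using assms(3) by (simp add: mult_left_mono)
  also have "\<dots> = exp E ^ m" by (simp add: exp_of_nat_mult)
  finally show ?thesis using assms(1) by linarith
qed

lemma contracting_tuples_props:
  assumes "A \<in> contracting_tuples"
  shows "A $ i \<in> psgn" "det (A $ i) \<noteq> 0" "\<bar>det (A $ i)\<bar> \<le> 1/2 * (min_row_sum (A $ i))\<^sup>2"
  using assms by (auto simp: contracting_tuples_def intro: less_imp_le)

context self_affine_measure
begin

context
  fixes U V H E :: real and m :: nat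
  assumes params: "p = exp (- U - 2 * H) ^ m" "q = exp (- V - H) ^ m" "exp E ^ m \<le> 2 * M" "4 \<le> exp H ^ m"
begin

lemma rho_exp: "\<rho> = exp (U - V + H) ^ m"
proof -
  have "\<rho> = q / p" by (rule \<rho>_def)
  also have "\<dots> = (exp (- V - H) / exp (- U - 2 * H)) ^ m" unfolding params(1,2) power_divide ..
  also have "exp (- V - H) / exp (- U - 2 * H) = exp (U - V + H)" by (simp flip: exp_diff)
  finally show ?thesis .
qed

text \<open>All parameters are m-th powers up to that factor, so after taking logarithms
  \<open>m\<close> drops out and the condition becomes a linear inequality between U, H and
  E.\<close>

lemma bootstrap_exp:
  assumes "0 \<le> D" "D < d" "D * (U + 2 * H) + H \<le> E"
  shows "\<exists>C\<ge>0. \<forall>r>0. \<phi> r \<le> C * r powr D"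
proof (rule correlation_bootstrap[OF assms(1,2)])
  have "2 * exp (real m * (D * (U + 2 * H))) \<le> M" by (rule exp_power_half[OF params(3,4) assms(3)])
  then have "2 * exp (real m * (D * (U + 2 * H))) * exp (real m * (D * (- U - 2 * H))) \<le> M * p powr D"
    unfolding params(1) exp_power_powr by (intro mult_right_mono) auto
  then show "1 < M * p powr D" by (simp add: algebra_simps flip: exp_add)
qed

lemma relation_exp:
  assumes "D * (U - V + H) + D1 * (V + H) + H \<le> E"
  shows "\<rho> powr D \<le> M * q powr D1"
proof -
  have "2 * exp (real m * (D * (U - V + H) + D1 * (V + H))) \<le> M" by (rule exp_power_half[OF params(3,4) assms])
  then have "exp (real m * (D * (U - V + H) + D1 * (V + H))) \<le> M"
    using exp_gt_zero[of "real m * (D * (U - V + H) + D1 * (V + H))"] by linarith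
  then have "exp (real m * (D * (U - V + H) + D1 * (V + H))) * exp (real m * (D1 * (- V - H))) \<le> M * q powr D1"
    unfolding params(2) exp_power_powr by (intro mult_right_mono) auto
  then show ?thesis unfolding rho_exp exp_power_powr by (simp add: algebra_simps flip: exp_add)
qed

end

end

context
  fixes A :: "real^2^2^'n::finite" and t :: "real^2^'n"
  assumes A: "A \<in> contracting_tuples" and contr: "\<And>i. sv1 (A $ i) < 1"
    and N: "CARD('n) \<ge> 2" and ssc: "strong_separation (affine_ifs A t)"
    and trans: "\<And>\<Gamma> n (\<kappa>::real) (\<zeta>::real). finite \<Gamma> \<Longrightarrow> \<Gamma> \<noteq> {} \<Longrightarrow> 0 < n \<Longrightarrow> (\<forall>\<gamma>\<in>\<Gamma>. length \<gamma> = n) \<Longrightarrow>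
      \<kappa> \<in> \<rat> \<Longrightarrow> \<zeta> \<in> \<rat> \<Longrightarrow> 0 < \<kappa> \<Longrightarrow> \<kappa> < \<zeta> \<Longrightarrow>
      (\<forall>\<gamma>\<in>\<Gamma>. \<kappa> * (max_row_sum (word_product A \<gamma>))\<^sup>2 < \<bar>det (word_product A \<gamma>)\<bar>) \<Longrightarrow>
      eventually (\<lambda>m. real (card {(w, w'). w \<in> words \<Gamma> m \<and> w' \<in> words \<Gamma> m \<and>
          \<bar>row1_dir (word_product A (concat w)) - row1_dir (word_product A (concat w'))\<bar> \<le> 3 * \<zeta> ^ m})
        \<le> real (card \<Gamma>) ^ m * ((max 1 (real (card \<Gamma>) * \<kappa>)) ^ m * (\<zeta> / \<kappa>) ^ (2 * m))) sequentially"
begin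

lemmas psgn = contracting_tuples_props(1)[OF A] and nonsing = contracting_tuples_props(2)[OF A] and dom = contracting_tuples_props(3)[OF A]

lemma word_class_measure:
  assumes \<Gamma>: "\<Gamma> \<subseteq> words UNIV n" "\<Gamma> \<noteq> {}" "0 < n"
    and sv: "\<And>w. w \<in> \<Gamma> \<Longrightarrow> exp (- U - H) < sv1 (word_product A w)" "\<And>w. w \<in> \<Gamma> \<Longrightarrow> sv1 (word_product A w) \<le> exp (- U)"
      "\<And>w. w \<in> \<Gamma> \<Longrightarrow> exp (- V - H) < sv2 (word_product A w)" "\<And>w. w \<in> \<Gamma> \<Longrightarrow> sv2 (word_product A w) \<le> exp (- V)"
    and row: "\<And>w. w \<in> \<Gamma> \<Longrightarrow> exp (- U - 2 * H) \<le> min_row_sum (word_product A w)"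
    and card: "exp E \<le> real (card \<Gamma>)" and H: "0 < H" "4 \<le> exp H" and U: "0 < U" "U \<le> V"
    and d: "0 < d" "d \<le> 1" and slack1: "19 * H + d * (V - U + 4 * H) \<le> E" and slack2: "19 * H \<le> (1 - d) * (V - U)"
  shows "\<exists>m (\<Gamma>' :: 'n list list set) \<nu> e0 \<kappa>. 0 < m \<and> 4 \<le> exp H ^ m \<and> exp E ^ m \<le> 2 * real (card \<Gamma>') \<and>
    self_affine_measure \<Gamma>' (\<lambda>w. word_product A (concat w)) (\<lambda>w. word_map A t (concat w))
      (attractor (affine_ifs A t)) (exp (- U - 2 * H) ^ m) (exp (- V - H) ^ m) e0 \<nu> \<kappa> d"
proof -
  define g where "g = V - U"
  have g: "0 \<le> g" using U by (simp add: g_def)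
  \<comment> \<open>\<open>\<kappa>\<close> has to stay below |det| / max_row_sum^2, which is at
    least exp (- g - 3 * H), and \<open>\<zeta>\<close> above |det| / min_row_sum^2, which is at
    most exp (- g + 4 * H). Intervals of length H contain rationals and keep the ratio under
    control.\<close>
  obtain k :: rat where k: "exp (- g - 4 * H) < of_rat k" "of_rat k < exp (- g - 3 * H)"
    using of_rat_dense[of "exp (- g - 4 * H)" "exp (- g - 3 * H)"] H(1) by auto
  obtain z :: rat where z: "exp (- g + 4 * H) < of_rat z" "of_rat z < exp (- g + 5 * H)"
    using of_rat_dense[of "exp (- g + 4 * H)" "exp (- g + 5 * H)"] H(1) by auto
  define \<kappa> :: real where "\<kappa> = of_rat k"
  define \<zeta> :: real where "\<zeta> = of_rat z"
  note \<kappa> = k[folded \<kappa>_def] and \<zeta> = z[folded \<zeta>_def]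
  have \<kappa>0: "0 < \<kappa>" using \<kappa>(1) exp_gt_zero less_trans by blast
  have \<zeta>0: "0 < \<zeta>" using \<zeta>(1) exp_gt_zero less_trans by blast
  have "exp (- g - 3 * H) \<le> exp 0" "exp (- g - 3 * H) \<le> exp (- g + 4 * H)" "exp (- g - 3 * H) \<le> exp (- g + H)"
    unfolding exp_le_cancel_iff using H(1) g by linarith+
  then have \<kappa>1: "\<kappa> < 1" "\<kappa> < \<zeta>" "\<kappa> \<le> exp (- g + H)" using \<kappa>(2) \<zeta>(1) unfolding exp_zero by linarith+
  have fin: "finite \<Gamma>" using \<Gamma>(1) by (rule finite_subset) (simp add: finite_words)
  have len: "length \<gamma> = n" if "\<gamma> \<in> \<Gamma>" for \<gamma> using that \<Gamma>(1) by (auto simp: words_UNIV)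
  have ne: "\<gamma> \<noteq> []" if "\<gamma> \<in> \<Gamma>" for \<gamma> using len[OF that] \<Gamma>(3) by auto
  have W: "word_product A \<gamma> \<in> psgn" if "\<gamma> \<in> \<Gamma>" for \<gamma> by (rule word_product_psgn[OF psgn ne[OF that]])
  have lower: "\<kappa> * (max_row_sum (word_product A \<gamma>))\<^sup>2 < \<bar>det (word_product A \<gamma>)\<bar>" if "\<gamma> \<in> \<Gamma>" for \<gamma>
  proof -
    let ?W = "word_product A \<gamma>"
    have "max_row_sum ?W \<le> 2 * sv1 ?W"
      using row_sum_le_sv1[of ?W] by (simp add: max_row_sum_def rsum_def)
    then have "max_row_sum ?W \<le> 2 * exp (- U)" using sv(2)[OF that] by linarith
    then have "(max_row_sum ?W)\<^sup>2 \<le> (2 * exp (- U))\<^sup>2" using max_row_sum_pos[OF W[OF that]] by (intro power_mono) auto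
    also have "\<dots> = 4 * exp (- 2 * U)" by (simp add: power_mult_distrib exp_double[symmetric])
    also have "\<dots> \<le> exp H * exp (- 2 * U)" using H(2) by (intro mult_right_mono) auto
    finally have "\<kappa> * (max_row_sum ?W)\<^sup>2 \<le> \<kappa> * (exp H * exp (- 2 * U))" using \<kappa>0 by (intro mult_left_mono) auto
    also have "\<dots> < exp (- g - 3 * H) * (exp H * exp (- 2 * U))" using \<kappa>(2) by simp
    also have "\<dots> = exp (- U - H) * exp (- V - H)" by (simp add: g_def flip: exp_add)
    also have "\<dots> \<le> sv1 ?W * sv2 ?W" using sv[OF that] by (intro mult_mono) (auto simp: sv1_nonneg)
    finally show ?thesis by (simp add: sv_prod)
  qed
  have upper: "\<bar>det (word_product A \<gamma>)\<bar> \<le> \<zeta> * (min_row_sum (word_product A \<gamma>))\<^sup>2" if "\<gamma> \<in> \<Gamma>" for \<gamma>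
  proof -
    let ?W = "word_product A \<gamma>"
    have "\<bar>det ?W\<bar> \<le> exp (- U) * exp (- V)"
      unfolding sv_prod[symmetric] using sv[OF that] by (intro mult_mono) (auto simp: sv2_nonneg)
    also have "\<dots> = exp (- g + 4 * H) * (exp (- U - 2 * H))\<^sup>2" by (simp add: g_def power2_eq_square flip: exp_add)
    also have "\<dots> \<le> \<zeta> * (min_row_sum ?W)\<^sup>2" using \<zeta> \<zeta>0 row[OF that] by (intro mult_mono power_mono) auto
    finally show ?thesis .
  qed
  have c0: "0 < real (card \<Gamma>)" using card exp_gt_zero[of E] by linarith
  have slack: "max 1 (real (card \<Gamma>) * \<kappa>) * (\<zeta> / \<kappa>)\<^sup>2 * exp H \<le> real (card \<Gamma>) * \<kappa> powr d"
  proof -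
    \<comment> \<open>The origin of 19: the ratio costs 9 * H, its square 18 * H, and \<omega> = exp
      H one more H.\<close>
    have "\<zeta> / \<kappa> \<le> exp (- g + 5 * H) / exp (- g - 4 * H)"
      using \<kappa>(1) \<zeta>(2) \<kappa>0 \<zeta>0 by (intro frac_le) auto
    also have "\<dots> = exp (9 * H)" by (simp flip: exp_diff)
    finally have "(\<zeta> / \<kappa>)\<^sup>2 \<le> exp (9 * H) ^ 2" using \<kappa>0 \<zeta>0 by (intro power_mono) auto
    then have "(\<zeta> / \<kappa>)\<^sup>2 * exp H \<le> exp (9 * H) ^ 2 * exp H" by (intro mult_right_mono) auto
    also have "\<dots> = exp (19 * H)" by (simp add: power2_eq_square flip: exp_add)
    finally have R: "(\<zeta> / \<kappa>)\<^sup>2 * exp H \<le> exp (19 * H)" .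
    \<comment> \<open>The two entries of the maximum are treated separately: \<open>slack1\<close>
      provides enough words for the exponent d, \<open>slack2\<close> keeps d below 1 by a
      sufficient margin.\<close>
    have "exp (19 * H) \<le> real (card \<Gamma>) * \<kappa> powr d"
    proof -
      have "exp (19 * H) \<le> exp (E + d * (- g - 4 * H))" using slack1 by (simp add: g_def algebra_simps)
      also have "\<dots> = exp E * exp (- g - 4 * H) powr d" by (simp add: exp_add powr_def)
      also have "\<dots> \<le> real (card \<Gamma>) * \<kappa> powr d" using card \<kappa>(1) d by (intro mult_mono powr_mono2) auto
      finally show ?thesis .
    qed
    moreover have "\<kappa> * exp (19 * H) \<le> \<kappa> powr d"
    proof -
      have "\<kappa> powr (1 - d) \<le> exp (- g - 3 * H) powr (1 - d)" using \<kappa>(2) \<kappa>0 d by (intro powr_mono2) auto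
      also have "\<dots> = exp ((1 - d) * (- g - 3 * H))" by (simp add: powr_def)
      also have "\<dots> \<le> exp (- 19 * H)"
      proof -
        have "0 \<le> (1 - d) * (3 * H)" using d H by simp
        moreover have "(1 - d) * (- g - 3 * H) = - ((1 - d) * g) - (1 - d) * (3 * H)" by (simp add: algebra_simps)
        ultimately have "(1 - d) * (- g - 3 * H) \<le> - 19 * H" using slack2[folded g_def] by linarith
        then show ?thesis by simp
      qed
      finally have "\<kappa> powr d * (\<kappa> powr (1 - d) * exp (19 * H)) \<le> \<kappa> powr d * (exp (- 19 * H) * exp (19 * H))"
        by (intro mult_left_mono mult_right_mono) auto
      moreover have "\<kappa> powr d * \<kappa> powr (1 - d) = \<kappa>" using \<kappa>0 by (simp flip: powr_add)
      ultimately show ?thesis by (simp add: mult.assoc[symmetric] flip: exp_add)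
    qed
    then have "real (card \<Gamma>) * \<kappa> * exp (19 * H) \<le> real (card \<Gamma>) * \<kappa> powr d" using c0 by (simp add: mult.assoc)
    ultimately have "max 1 (real (card \<Gamma>) * \<kappa>) * exp (19 * H) \<le> real (card \<Gamma>) * \<kappa> powr d"
      by (simp add: max_def)
    moreover have "max 1 (real (card \<Gamma>) * \<kappa>) * ((\<zeta> / \<kappa>)\<^sup>2 * exp H) \<le> max 1 (real (card \<Gamma>) * \<kappa>) * exp (19 * H)"
      by (intro mult_left_mono R) auto
    ultimately show ?thesis by (simp add: mult.assoc)
  qed
  have ex: "\<exists>m (\<Gamma>' :: 'n list list set) \<nu> e0. 0 < m \<and> 4 \<le> exp H ^ m \<and> real (card \<Gamma>) ^ m \<le> 2 * real (card \<Gamma>') \<and>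
    self_affine_measure \<Gamma>' (\<lambda>w. word_product A (concat w)) (\<lambda>w. word_map A t (concat w))
      (attractor (affine_ifs A t)) (exp (- U - 2 * H) ^ m) (exp (- V - H) ^ m) e0 \<nu> (\<kappa> ^ m) d"
  proof (rule self_affine_measure_from_words[OF nonsing contr ssc psgn fin \<Gamma>(2) len \<Gamma>(3) \<kappa>0 \<kappa>1(1,2) _ _ _ row _ _ less_imp_le[OF sv(3)]
      less_imp_le[OF lower] upper _ d(1) _ slack])
    show "\<kappa> \<le> exp (- V - H) / exp (- U - 2 * H)" using \<kappa>1(3) by (simp add: g_def algebra_simps flip: exp_diff)
    show "eventually (\<lambda>m. real (card {(w, w'). w \<in> words \<Gamma> m \<and> w' \<in> words \<Gamma> m \<and>
          \<bar>row1_dir (word_product A (concat w)) - row1_dir (word_product A (concat w'))\<bar> \<le> 3 * \<zeta> ^ m})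
        \<le> real (card \<Gamma>) ^ m * ((max 1 (real (card \<Gamma>) * \<kappa>)) ^ m * (\<zeta> / \<kappa>) ^ (2 * m))) sequentially"
      using len lower by (intro trans[OF fin \<Gamma>(2,3) _ _ _ \<kappa>0 \<kappa>1(2)] ballI) (auto simp: \<kappa>_def \<zeta>_def)
  qed (use U H in auto)
  from ex obtain m :: nat and \<Gamma>' :: "'n list list set" and \<nu> e0 where m: "0 < m" "4 \<le> exp H ^ m" "real (card \<Gamma>) ^ m \<le> 2 * real (card \<Gamma>')"
    "self_affine_measure \<Gamma>' (\<lambda>w. word_product A (concat w)) (\<lambda>w. word_map A t (concat w))
      (attractor (affine_ifs A t)) (exp (- U - 2 * H) ^ m) (exp (- V - H) ^ m) e0 \<nu> (\<kappa> ^ m) d"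
    by blast
  have "exp E ^ m \<le> real (card \<Gamma>) ^ m" using card by (intro power_mono) auto
  then have "exp E ^ m \<le> 2 * real (card \<Gamma>')" using m(3) by linarith
  then show ?thesis using m by blast
qed


text \<open>Here \<open>exp (- U)\<close> and \<open>exp (- V)\<close> are the singular values of the matrices in the chosen class,
  up to factors \<open>exp H\<close> that are negligible compared with powers of these values and of their quotient.\<close>

lemma word_class_cases:
  assumes s: "0 \<le> s" "s < affinity_dim A" and \<epsilon>: "0 < \<epsilon>" "\<epsilon> \<le> 1" and d: "0 < d" "d \<le> 1 - \<epsilon>"
    and main: "\<And>U V H. 0 < H \<Longrightarrow> 50 * H \<le> \<epsilon> * U \<Longrightarrow> 50 * H \<le> \<epsilon> * (V - U) \<Longrightarrow> 50 * H \<le> U \<Longrightarrow> 50 * H \<le> V - U \<Longrightarrow>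
      (\<forall>i. (sv1 (A $ i))\<^sup>2 \<le> sv2 (A $ i)) \<longrightarrow> V \<le> 2 * U + 2 * H \<Longrightarrow>
      19 * H + d * (V - U + 4 * H) \<le> expo1 s * U + expo2 s * V"
    and result: "\<And>U V H (I :: 'n list list set) p q e0 \<nu> \<kappa> m.
      0 < H \<Longrightarrow> 50 * H \<le> \<epsilon> * U \<Longrightarrow> 50 * H \<le> \<epsilon> * (V - U) \<Longrightarrow> 50 * H \<le> U \<Longrightarrow> 50 * H \<le> V - U \<Longrightarrow>
      (\<forall>i. (sv1 (A $ i))\<^sup>2 \<le> sv2 (A $ i)) \<longrightarrow> V \<le> 2 * U + 2 * H \<Longrightarrow>
      self_affine_measure I (\<lambda>w. word_product A (concat w)) (\<lambda>w. word_map A t (concat w)) (attractor (affine_ifs A t)) p q e0 \<nu> \<kappa> d \<Longrightarrow>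
      p = exp (- U - 2 * H) ^ m \<Longrightarrow> q = exp (- V - H) ^ m \<Longrightarrow> exp (expo1 s * U + expo2 s * V) ^ m \<le> 2 * real (card I) \<Longrightarrow> 4 \<le> exp H ^ m \<Longrightarrow>
      \<exists>C\<ge>0. \<forall>r>0. self_affine_measure.\<phi> \<nu> r \<le> C * r powr D"
  shows "correlation_decay (attractor (affine_ifs A t)) D"
proof -
  obtain n \<Gamma> U V H where \<Gamma>: "0 < n" "\<Gamma> \<subseteq> words UNIV n" "\<Gamma> \<noteq> {}"
    and sv: "\<forall>w\<in>\<Gamma>. exp (- U - H) < sv1 (word_product A w) \<and> sv1 (word_product A w) \<le> exp (- U) \<and>
      exp (- V - H) < sv2 (word_product A w) \<and> sv2 (word_product A w) \<le> exp (- V) \<and>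
      exp (- U - 2 * H) \<le> min_row_sum (word_product A w)"
    and card: "exp (expo1 s * U + expo2 s * V) \<le> real (card \<Gamma>)"
    and H: "4 \<le> exp H" "50 * H \<le> \<epsilon> * U" "50 * H \<le> \<epsilon> * (V - U)"
    using good_word_class[OF nonsing contr N s psgn dom \<epsilon>] by blast
  have "exp 0 < exp H" unfolding exp_zero using H(1) by linarith
  then have H0: "0 < H" unfolding exp_less_cancel_iff .
  have pos: "0 < U" "0 < V - U" using H(2,3) H0 \<epsilon>(1) zero_less_mult_pos[of \<epsilon> U] zero_less_mult_pos[of \<epsilon> "V - U"] by linarith+
  have "\<epsilon> * U \<le> U" "\<epsilon> * (V - U) \<le> V - U" using pos \<epsilon> by (simp_all add: mult_left_le_one_le)
  then have U: "50 * H \<le> U" "50 * H \<le> V - U" using H(2,3) by (meson order_trans)+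
  have VU: "(\<forall>i. (sv1 (A $ i))\<^sup>2 \<le> sv2 (A $ i)) \<longrightarrow> V \<le> 2 * U + 2 * H"
  proof
    assume N: "\<forall>i. (sv1 (A $ i))\<^sup>2 \<le> sv2 (A $ i)"
    obtain w where w: "w \<in> \<Gamma>" using \<Gamma>(3) by blast
    have "(exp (- U - H))\<^sup>2 < (sv1 (word_product A w))\<^sup>2" using sv w by (intro power_strict_mono) auto
    also have "\<dots> \<le> sv2 (word_product A w)" using N by (intro sv2_ge_sv1_square_word) auto
    also have "\<dots> \<le> exp (- V)" using sv w by blast
    finally have "exp (2 * (- U - H)) < exp (- V)" by (simp only: exp_double)
    then show "V \<le> 2 * U + 2 * H" by simp
  qed
  have slack2: "19 * H \<le> (1 - d) * (V - U)"
  proof -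
    have "\<epsilon> * (V - U) \<le> (1 - d) * (V - U)" using d pos by (intro mult_right_mono) auto
    then show ?thesis using H(3) H0 by linarith
  qed
  have slack1: "19 * H + d * (V - U + 4 * H) \<le> expo1 s * U + expo2 s * V"
    by (rule main[OF H0 H(2,3) U VU])
  have UV: "U \<le> V" and d1: "d \<le> 1" using pos d \<epsilon> by auto
  obtain m and \<Gamma>' :: "'n list list set" and \<nu> e0 \<kappa> where m: "4 \<le> exp H ^ m" "exp (expo1 s * U + expo2 s * V) ^ m \<le> 2 * real (card \<Gamma>')"
    "self_affine_measure \<Gamma>' (\<lambda>w. word_product A (concat w)) (\<lambda>w. word_map A t (concat w))
      (attractor (affine_ifs A t)) (exp (- U - 2 * H) ^ m) (exp (- V - H) ^ m) e0 \<nu> \<kappa> d"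
    using word_class_measure[OF \<Gamma>(2,3,1) _ _ _ _ _ card H0 H(1) pos(1) UV d(1) d1 slack1 slack2] sv by blast
  show ?thesis
    by (rule correlation_decayI[OF m(3) result[OF H0 H(2,3) U VU m(3) refl refl m(2,1)]])
qed

text \<open>From V \<le> 2 * U, up to H, the number of words exp (s * U) is about at least exp (s *
  (V - U)), so directions of exponent close to s exist. Bootstrapping alone then reaches every
  exponent below s.\<close>

lemma correlation_decay_small:
  assumes s: "s < affinity_dim A" "s \<le> 1" and \<epsilon>: "0 < \<epsilon>" "2 * \<epsilon> \<le> s" and N: "\<And>i. (sv1 (A $ i))\<^sup>2 \<le> sv2 (A $ i)"
  shows "correlation_decay (attractor (affine_ifs A t)) (s - 2 * \<epsilon>)"
proof (rule word_class_cases[where s = s and \<epsilon> = \<epsilon> and d = "s - \<epsilon>"])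
  fix U V H :: real
  assume H: "0 < H" "50 * H \<le> \<epsilon> * U" "50 * H \<le> \<epsilon> * (V - U)" "50 * H \<le> U" "50 * H \<le> V - U"
    and VU: "(\<forall>i. (sv1 (A $ i))\<^sup>2 \<le> sv2 (A $ i)) \<longrightarrow> V \<le> 2 * U + 2 * H"
  have ex: "expo1 s = s" "expo2 s = 0" using s by (simp_all add: expo1_def expo2_def)
  have "(s - \<epsilon>) * (V - U + 4 * H) \<le> (s - \<epsilon>) * (U + 6 * H)" using VU N \<epsilon> by (intro mult_left_mono) auto
  moreover have sH: "(s - \<epsilon>) * H \<le> 1 * H" "(s - 2 * \<epsilon>) * H \<le> 1 * H" using s \<epsilon> H(1) by (intro mult_right_mono; simp)+
  ultimately show "19 * H + (s - \<epsilon>) * (V - U + 4 * H) \<le> expo1 s * U + expo2 s * V"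
    unfolding ex using H by (simp add: algebra_simps)
  fix I :: "'n list list set" and p q e0 \<nu> \<kappa> m
  assume sam: "self_affine_measure I (\<lambda>w. word_product A (concat w)) (\<lambda>w. word_map A t (concat w)) (attractor (affine_ifs A t)) p q e0 \<nu> \<kappa> (s - \<epsilon>)"
    and params: "p = exp (- U - 2 * H) ^ m" "q = exp (- V - H) ^ m" "exp (expo1 s * U + expo2 s * V) ^ m \<le> 2 * real (card I)" "4 \<le> exp H ^ m"
  interpret self_affine_measure I "\<lambda>w. word_product A (concat w)" "\<lambda>w. word_map A t (concat w)" "attractor (affine_ifs A t)" p q e0 \<nu> \<kappa> "s - \<epsilon>"
    by (rule sam)
  show "\<exists>C\<ge>0. \<forall>r>0. \<phi> r \<le> C * r powr (s - 2 * \<epsilon>)"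
  proof (rule bootstrap_exp[OF params])
    show "(s - 2 * \<epsilon>) * (U + 2 * H) + H \<le> expo1 s * U + expo2 s * V"
      unfolding ex using sH H by (simp add: algebra_simps)
  qed (use \<epsilon> in auto)
qed (use s \<epsilon> in auto)

text \<open>Directions have exponent at most 1, so bootstrapping stops near 1. In the Kaufman step
  with D near 1 the terms add up to (V - U) + U + (s - 1) * V = s * V, which is exponent s at scale
  exp (- V).\<close>

lemma correlation_decay_middle:
  assumes s: "s < affinity_dim A" "1 < s" "s \<le> 2" and \<epsilon>: "0 < \<epsilon>" "4 * \<epsilon> \<le> s" "2 * \<epsilon> \<le> 1" and N: "\<And>i. (sv1 (A $ i))\<^sup>2 \<le> sv2 (A $ i)"
  shows "correlation_decay (attractor (affine_ifs A t)) (s - 4 * \<epsilon>)"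
proof (rule word_class_cases[where s = s and \<epsilon> = \<epsilon> and d = "1 - \<epsilon>"])
  fix U V H :: real
  assume H: "0 < H" "50 * H \<le> \<epsilon> * U" "50 * H \<le> \<epsilon> * (V - U)" "50 * H \<le> U" "50 * H \<le> V - U"
    and VU: "(\<forall>i. (sv1 (A $ i))\<^sup>2 \<le> sv2 (A $ i)) \<longrightarrow> V \<le> 2 * U + 2 * H"
  have ex: "expo1 s = 1" "expo2 s = s - 1" using s by (simp_all add: expo1_def expo2_def)
  have "(1 - \<epsilon>) * (V - U + 4 * H) \<le> (1 - \<epsilon>) * (U + 6 * H)" using VU N \<epsilon> by (intro mult_left_mono) auto
  moreover have sV: "0 \<le> (s - 1) * V" using s H by (intro mult_nonneg_nonneg) auto
  moreover have \<epsilon>H: "0 \<le> \<epsilon> * H" "s * H \<le> 2 * H" using \<epsilon> H(1) s by auto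
  moreover have "(1 - \<epsilon>) * (U + 6 * H) = U + 6 * H - \<epsilon> * U - 6 * (\<epsilon> * H)" by (simp add: algebra_simps)
  ultimately show "19 * H + (1 - \<epsilon>) * (V - U + 4 * H) \<le> expo1 s * U + expo2 s * V"
    unfolding ex using H by linarith
  fix I :: "'n list list set" and p q e0 \<nu> \<kappa> m
  assume sam: "self_affine_measure I (\<lambda>w. word_product A (concat w)) (\<lambda>w. word_map A t (concat w)) (attractor (affine_ifs A t)) p q e0 \<nu> \<kappa> (1 - \<epsilon>)"
    and params: "p = exp (- U - 2 * H) ^ m" "q = exp (- V - H) ^ m" "exp (expo1 s * U + expo2 s * V) ^ m \<le> 2 * real (card I)" "4 \<le> exp H ^ m"
  interpret self_affine_measure I "\<lambda>w. word_product A (concat w)" "\<lambda>w. word_map A t (concat w)" "attractor (affine_ifs A t)" p q e0 \<nu> \<kappa> "1 - \<epsilon>"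
    by (rule sam)
  have "\<exists>C\<ge>0. \<forall>r>0. \<phi> r \<le> C * r powr (1 - 2 * \<epsilon>)"
  proof (rule bootstrap_exp[OF params])
    have "(1 - 2 * \<epsilon>) * (U + 2 * H) + H = U + 3 * H - 2 * (\<epsilon> * U) - 4 * (\<epsilon> * H)" by (simp add: algebra_simps)
    then show "(1 - 2 * \<epsilon>) * (U + 2 * H) + H \<le> expo1 s * U + expo2 s * V"
      unfolding ex using \<epsilon>H sV H by linarith
  qed (use \<epsilon> in auto)
  then obtain C where C: "0 \<le> C" "\<And>r. 0 < r \<Longrightarrow> \<phi> r \<le> C * r powr (1 - 2 * \<epsilon>)" by blast
  show "\<exists>C\<ge>0. \<forall>r>0. \<phi> r \<le> C * r powr (s - 4 * \<epsilon>)"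
  proof (rule correlation_kaufman_step[OF _ _ C])
    show "\<rho> powr (1 - 2 * \<epsilon>) \<le> M * q powr (s - 4 * \<epsilon>)"
    proof (rule relation_exp[OF params])
      have "(1 - 2 * \<epsilon>) * (U - V + H) + (s - 4 * \<epsilon>) * (V + H) + H
        = U + (s - 1) * V + (2 * H + s * H) - 6 * (\<epsilon> * H) - 2 * (\<epsilon> * U) - 2 * (\<epsilon> * V)" by (simp add: algebra_simps)
      moreover have "\<epsilon> * V = \<epsilon> * U + \<epsilon> * (V - U)" by (simp add: algebra_simps)
      ultimately show "(1 - 2 * \<epsilon>) * (U - V + H) + (s - 4 * \<epsilon>) * (V + H) + H \<le> expo1 s * U + expo2 s * V"
        unfolding ex using \<epsilon>H H by linarith
    qed
  qed (use s \<epsilon> in auto)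
qed (use s \<epsilon> in auto)

text \<open>Nothing relates U to V here, and d near s - 1 is what the inequality d * (V - U) \<le> U
  + (s - 1) * V always permits. The exponents pass through 2/3 and s - 1/3 to s, up to
  \<epsilon>.\<close>

lemma correlation_decay_large:
  assumes s: "s < affinity_dim A" "5/3 + \<epsilon> < s" "s \<le> 2" and \<epsilon>: "0 < \<epsilon>" "\<epsilon> \<le> 1"
  shows "correlation_decay (attractor (affine_ifs A t)) (s - \<epsilon>)"
proof (rule word_class_cases[where s = s and \<epsilon> = \<epsilon> and d = "s - 1 - \<epsilon>"])
  fix U V H :: real
  assume H: "0 < H" "50 * H \<le> \<epsilon> * U" "50 * H \<le> \<epsilon> * (V - U)" "50 * H \<le> U" "50 * H \<le> V - U"
    and VU: "(\<forall>i. (sv1 (A $ i))\<^sup>2 \<le> sv2 (A $ i)) \<longrightarrow> V \<le> 2 * U + 2 * H"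
  have ex: "expo1 s = 1" "expo2 s = s - 1" using s \<epsilon> by (simp_all add: expo1_def expo2_def)
  have sV: "0 \<le> (s - 1) * V" "0 \<le> (s - 1) * U" using s H \<epsilon> by (intro mult_nonneg_nonneg; simp)+
  have \<epsilon>H: "0 \<le> \<epsilon> * H" "s * H \<le> 2 * H" using \<epsilon> H(1) s by auto
  have \<epsilon>V: "\<epsilon> * V = \<epsilon> * U + \<epsilon> * (V - U)" by (simp add: algebra_simps)
  have "19 * H + (s - 1 - \<epsilon>) * (V - U + 4 * H)
    = (s - 1) * V - (s - 1) * U + 15 * H + 4 * (s * H) - 4 * (\<epsilon> * H) - \<epsilon> * (V - U)" by (simp add: algebra_simps)
  then show "19 * H + (s - 1 - \<epsilon>) * (V - U + 4 * H) \<le> expo1 s * U + expo2 s * V"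
    unfolding ex using H sV \<epsilon>H by linarith
  fix I :: "'n list list set" and p q e0 \<nu> \<kappa> m
  assume sam: "self_affine_measure I (\<lambda>w. word_product A (concat w)) (\<lambda>w. word_map A t (concat w)) (attractor (affine_ifs A t)) p q e0 \<nu> \<kappa> (s - 1 - \<epsilon>)"
    and params: "p = exp (- U - 2 * H) ^ m" "q = exp (- V - H) ^ m" "exp (expo1 s * U + expo2 s * V) ^ m \<le> 2 * real (card I)" "4 \<le> exp H ^ m"
  interpret self_affine_measure I "\<lambda>w. word_product A (concat w)" "\<lambda>w. word_map A t (concat w)" "attractor (affine_ifs A t)" p q e0 \<nu> \<kappa> "s - 1 - \<epsilon>"
    by (rule sam)
  \<comment> \<open>The bootstrap needs 2/3 < d = s - 1 - \<epsilon>, which is the assumption s >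
    5/3 + \<epsilon>.\<close>
  have "\<exists>C\<ge>0. \<forall>r>0. \<phi> r \<le> C * r powr (2/3)"
  proof (rule bootstrap_exp[OF params])
    show "2/3 * (U + 2 * H) + H \<le> expo1 s * U + expo2 s * V"
      unfolding ex distrib_left using sV H by linarith
  qed (use s in auto)
  then obtain C where C: "0 \<le> C" "\<And>r. 0 < r \<Longrightarrow> \<phi> r \<le> C * r powr (2/3)" by blast
  have "\<exists>C\<ge>0. \<forall>r>0. \<phi> r \<le> C * r powr (s - 1/3 - \<epsilon>)"
  proof (rule correlation_kaufman_step[OF _ _ C])
    show "\<rho> powr (2/3) \<le> M * q powr (s - 1/3 - \<epsilon>)"
    proof (rule relation_exp[OF params])
      have "0 \<le> \<epsilon> * V" using \<epsilon> H by simp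
      then show "2/3 * (U - V + H) + (s - 1/3 - \<epsilon>) * (V + H) + H \<le> expo1 s * U + expo2 s * V"
        unfolding ex ring_distribs using \<epsilon>H H by linarith
    qed
  qed (use s \<epsilon> in auto)
  then obtain C' where C': "0 \<le> C'" "\<And>r. 0 < r \<Longrightarrow> \<phi> r \<le> C' * r powr (s - 1/3 - \<epsilon>)" by blast
  \<comment> \<open>With D = s - 1/3 - \<epsilon> the condition d + D > 2 reads 2 * s - 4/3 - 2 *
    \<epsilon> > 2, the same bound on s once more.\<close>
  show "\<exists>C\<ge>0. \<forall>r>0. \<phi> r \<le> C * r powr (s - \<epsilon>)"
  proof (rule correlation_fourier_step[OF _ C'])
    have "\<rho> powr 1 \<le> M * q powr (s - \<epsilon>)"
    proof (rule relation_exp[OF params])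
      have "1 * (U - V + H) + (s - \<epsilon>) * (V + H) + H = U + (s - 1) * V + 2 * H + s * H - \<epsilon> * H - \<epsilon> * V"
        by (simp add: algebra_simps)
      then show "1 * (U - V + H) + (s - \<epsilon>) * (V + H) + H \<le> expo1 s * U + expo2 s * V"
        unfolding ex using \<epsilon>H H \<epsilon>V by linarith
    qed
    moreover have "0 < \<rho>" unfolding rho_exp[OF params] by simp
    ultimately show "\<rho> \<le> M * q powr (s - \<epsilon>)" by simp
    have "exp (U - V + H) \<le> 1" using H by simp
    then show "\<rho> \<le> 1" unfolding rho_exp[OF params] by (intro power_le_one) auto
  qed (use s \<epsilon> in auto)
qed (use s \<epsilon> in auto)

lemma attractor_dimensions:
  assumes "(\<forall>i. (sv1 (A $ i))\<^sup>2 \<le> sv2 (A $ i)) \<or> 5/3 < affinity_dim A"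
  shows "\<exists>\<nu>. borel_prob_on (attractor (affine_ifs A t)) \<nu> \<and>
    hausdorff_dim_measure \<nu> = hausdorff_dim (attractor (affine_ifs A t)) \<and>
    hausdorff_dim (attractor (affine_ifs A t)) = ereal (affinity_dim A) \<and>
    has_box_dim (attractor (affine_ifs A t)) (ereal (affinity_dim A))"
proof (rule dimensions_coincide)
  let ?K = "attractor (affine_ifs A t)"
  let ?a = "affinity_dim A"
  show "compact ?K" "?K \<noteq> {}" using attractor_props[OF nonsing contr] by blast+
  show a0: "0 < ?a" by (rule affinity_dim_props(1)[OF nonsing contr N])
  show "upper_box_dim ?K \<le> ereal ?a" by (rule upper_box_dim_attractor_le[OF nonsing contr N])
  have a2: "?a \<le> 2" by (rule affinity_dim_le_2[OF nonsing contr ssc N])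
  fix \<tau> :: real assume \<tau>: "0 < \<tau>" "\<tau> < ?a"
  have "correlation_decay ?K \<tau>"
    using assms
  proof
    assume sv: "\<forall>i. (sv1 (A $ i))\<^sup>2 \<le> sv2 (A $ i)"
    show ?thesis
    proof (cases "?a \<le> 1")
      case True
      \<comment> \<open>The midpoint of \<tau> and the dimension serves as s, and \<epsilon> is such
        that the loss leads back to \<tau> exactly.\<close>
      have "correlation_decay ?K ((\<tau> + ?a) / 2 - 2 * ((?a - \<tau>) / 4))"
        using sv \<tau> True by (intro correlation_decay_small) (auto simp: field_simps)
      then show ?thesis by (rule correlation_decay_mono) (simp add: field_simps)
    next
      case False
      define u where "u = max \<tau> 1"
      have u: "1 \<le> u" "\<tau> \<le> u" "u < ?a" using \<tau> False by (auto simp: u_def)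
      have "correlation_decay ?K ((u + ?a) / 2 - 4 * ((?a - u) / 8))"
        using sv u a2 by (intro correlation_decay_middle) (auto simp: field_simps)
      then show ?thesis by (rule correlation_decay_mono) (use u in \<open>simp add: field_simps\<close>)
    qed
  next
    assume "5/3 < ?a"
    define u where "u = max \<tau> (5/3)"
    have u: "5/3 \<le> u" "\<tau> \<le> u" "u < ?a" using \<tau> \<open>5/3 < ?a\<close> by (auto simp: u_def)
    \<comment> \<open>With \<epsilon> a quarter of the distance from u to the dimension, the
      midpoint stays above 5/3 + \<epsilon> and the exponent obtained is still at least u.\<close>
    have "correlation_decay ?K ((u + ?a) / 2 - (?a - u) / 4)"
      using u a2 by (intro correlation_decay_large) (auto simp: field_simps)
    then show ?thesis by (rule correlation_decay_mono) (use u in \<open>simp add: field_simps\<close>)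
  qed
  then show "\<exists>\<nu> C. borel_prob_on ?K \<nu> \<and>
      (\<forall>r. 0 < r \<longrightarrow> r \<le> 1 \<longrightarrow> measure (\<nu> \<Otimes>\<^sub>M \<nu>) (pairs_within r) \<le> C * r powr \<tau>)"
    unfolding correlation_decay_def .
qed

end

theorem theorem1p1:
  assumes "CARD('n::finite) \<ge> 2"
  shows "AE A :: real^2^2^'n in lebesgue.
    A \<in> tuples set_N \<union> set_O \<longrightarrow>
    (\<forall>t :: real^2^'n. strong_separation (affine_ifs A t) \<longrightarrow>
      (\<exists>\<nu>. borel_prob_on (attractor (affine_ifs A t)) \<nu> \<and>
        hausdorff_dim_measure \<nu> = hausdorff_dim (attractor (affine_ifs A t)) \<and>
        hausdorff_dim (attractor (affine_ifs A t)) = ereal (affinity_dim A) \<and>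
        has_box_dim (attractor (affine_ifs A t)) (ereal (affinity_dim A))))"
  \<comment> \<open>The null set is fixed here, before the translations are introduced; the rest
    holds for each tuple outside it.\<close>
  using transversality_ae
proof eventually_elim
  case (elim A)
  show ?case
  proof (intro impI allI)
    fix t :: "real^2^'n"
    assume A: "A \<in> tuples set_N \<union> set_O" and ssc: "strong_separation (affine_ifs A t)"
    have M: "A $ i \<in> set_M" for i using A by (auto simp: tuples_def set_N_def set_O_def)
    have A': "A \<in> contracting_tuples" using set_M_props[OF M] by (simp add: contracting_tuples_def)
    have or: "(\<forall>i. (sv1 (A $ i))\<^sup>2 \<le> sv2 (A $ i)) \<or> 5/3 < affinity_dim A"
      using A set_N_sv2_ge by (auto simp: tuples_def set_O_def)
    note tr = elim[rule_format, OF A']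
    show "\<exists>\<nu>. borel_prob_on (attractor (affine_ifs A t)) \<nu> \<and>
        hausdorff_dim_measure \<nu> = hausdorff_dim (attractor (affine_ifs A t)) \<and>
        hausdorff_dim (attractor (affine_ifs A t)) = ereal (affinity_dim A) \<and>
        has_box_dim (attractor (affine_ifs A t)) (ereal (affinity_dim A))"
      by (rule attractor_dimensions[OF A' set_M_props(4)[OF M] assms ssc _ or]) (rule tr; blast)
  qed
qed

end
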